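(* Let $d\in\{1,2\}$, $\beta\in(0,2]$, and let the random walk $(S_n)$, the scenery $(\xi_y)_{y\in\mathbb Z^d}$, the random walk in random scenery $(Z_n)$ and the constant $A$ be as described in the context. Assume that $\xi_0$ takes its values in $\mathbb Z$, and let $d_0\ge1$ be the integer such that $\{u\in\mathbb R: |\varphi_\xi(u)|=1\}=\frac{2\pi}{d_0}\mathbb Z$, where $\varphi_\xi$ is the characteristic function of $\xi_0$. For $n\ge 2$ let $b_n:=n^{1/\beta}(\log(n))^{(\beta-1)/\beta}$. Let $C(\cdot)$ be the density function of $\tilde Y_1:=\left(\frac{\Gamma(\beta+1)}{(\pi A)^{\beta-1}}\right)^{1/\beta}Y(1)$, where $Y(1)$ has distribution $\mathcal S_\beta$. Then, for every $x\in\mathbb R$: $\bullet$ if $\mathbb P\left(n\xi_0-\lfloor b_nx\rfloor\notin d_0\mathbb Z\right)=1$, then $\mathbb P\left(Z_n=\lfloor b_nx\rfloor\right)=0$; $\bullet$ if $\mathbb P\left(n\xi_0-\lfloor b_nx\rfloor\in d_0\mathbb Z\right)=1$, then $$\mathbb P\left(Z_n=\lfloor b_nx\rfloor\right)=d_0\frac{C(x)}{n^{1/\beta}(\log(n))^{(\beta-1)/\beta}}+o\left(n^{-1/\beta}(\log(n))^{-(\beta-1)/\beta}\right)$$ as $n\to\infty$, uniformly in $x\in\mathbb R$.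
   Context: Let $X=(X_k)_{k\ge1}$ be i.i.d. random variables with values in $\mathbb Z^d$ and $\xi=(\xi_y)_{y\in\mathbb Z^d}$ be i.i.d. real random variables, the two sequences being independent. Set $S_0:=0$, $S_n:=\sum_{i=1}^n X_i$, and $Z_0:=0$, $Z_n:=\sum_{k=0}^{n-1}\xi_{S_k}$ for $n\ge1$. Assumptions on the random walk: either (a) $d=2$ and $X_1$ is centered, square integrable with invertible variance matrix $\Sigma$, and then $A:=2\sqrt{\det\Sigma}$; or (b) $d=1$ and $(S_n/n)_n$ converges in distribution to a random variable with characteristic function $t\mapsto\exp(-a|t|)$ with $a>0$, and then $A:=a$. Assumptions on the scenery: $\xi_0$ belongs to the normal domain of attraction of a strictly stable distribution $\mathcal S_\beta$ of index $\beta\in(0,2]$, i.e. $n^{-1/\beta}$ times the sum of $n$ i.i.d. copies of $\xi_0$ converges in distribution to $\mathcal S_\beta$, where $\mathcal S_\beta$ has characteristic function $\phi(u)=e^{-|u|^\beta(A_1+iA_2\,\mathrm{sgn}(u))}$ with $0<A_1<\infty$ and $|A_1^{-1}A_2|\le|\tan(\pi\beta/2)|$ (no restriction on $A_2\in\mathbb R$ when $\beta=1$). When $\beta=1$ it is further assumed that $\sup_{t>0}\left|\mathbb E[\xi_0\mathbf 1_{\{|\xi_0|\le t\}}]\right|<+\infty$. In the second item, uniformity in $x$ is meant over those $x$ (depending on $n$) for which the stated condition holds.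
   Formalization: For β≠1 it is also assumed that no proper subgroup of Z^d carries the law of X_1; otherwise the claim fails (for d=2, doubling every step leaves the law of Z_n unchanged but multiplies A by 4). C(·) is taken to be the continuous version of the density. *)

theory Defs
  imports "HOL-Probability.Probability"
begin

definition iid_family ::
    "'w measure \<Rightarrow> 'b measure \<Rightarrow> 'i set \<Rightarrow> ('i \<Rightarrow> 'w \<Rightarrow> 'b) \<Rightarrow> bool" where
  "iid_family M N I V \<longleftrightarrow>
     prob_space.indep_vars M (\<lambda>_. N) V I \<and>
     (\<forall>i\<in>I. \<forall>j\<in>I. distr M N (V i) = distr M N (V j))"

definition walk :: "(nat \<Rightarrow> 'w \<Rightarrow> int ^ 'd) \<Rightarrow> nat \<Rightarrow> 'w \<Rightarrow> int ^ 'd" where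
  "walk X n \<omega> = (\<Sum>i=1..n. X i \<omega>)"

definition rwrs ::
    "(nat \<Rightarrow> 'w \<Rightarrow> int ^ 'd) \<Rightarrow> (int ^ 'd \<Rightarrow> 'w \<Rightarrow> real) \<Rightarrow> nat \<Rightarrow> 'w \<Rightarrow> real" where
  "rwrs X \<xi> n \<omega> = (\<Sum>k<n. \<xi> (walk X k \<omega>) \<omega>)"

text \<open>
  The increments are indexed by the positive integers; \<open>X 0\<close> is never used.
  The last conjunct is the independence of
  the two whole sequences, stated through the sigma-algebras they generate because \<open>indep_var\<close>
  needs both variables to have the same type.
\<close>

definition walk_and_scenery ::
    "'w measure \<Rightarrow> (nat \<Rightarrow> 'w \<Rightarrow> int ^ 'd) \<Rightarrow> (int ^ 'd \<Rightarrow> 'w \<Rightarrow> real) \<Rightarrow> bool" where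
  "walk_and_scenery M X \<xi> \<longleftrightarrow>
     prob_space M \<and>
     iid_family M (count_space UNIV) {1..} X \<and>
     iid_family M borel UNIV \<xi> \<and>
     prob_space.indep_set M
       (sets (vimage_algebra (space M)
          (\<lambda>\<omega>. \<lambda>k\<in>{1..}. X k \<omega>) (\<Pi>\<^sub>M k\<in>{1..}. count_space UNIV)))
       (sets (vimage_algebra (space M)
          (\<lambda>\<omega> y. \<xi> y \<omega>) (\<Pi>\<^sub>M y\<in>UNIV. borel)))"

definition covariance_matrix :: "'w measure \<Rightarrow> ('w \<Rightarrow> int ^ 'd) \<Rightarrow> real ^ 'd ^ 'd" where
  "covariance_matrix M V = (\<chi> i j.
     (\<integral>\<omega>. (of_int (V \<omega> $ i) - (\<integral>\<omega>'. of_int (V \<omega>' $ i) \<partial>M)) *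
          (of_int (V \<omega> $ j) - (\<integral>\<omega>'. of_int (V \<omega>' $ j) \<partial>M)) \<partial>M))"

definition planar_walk_assumption ::
    "'w measure \<Rightarrow> (nat \<Rightarrow> 'w \<Rightarrow> int ^ 'd) \<Rightarrow> real \<Rightarrow> bool" where
  "planar_walk_assumption M X A \<longleftrightarrow>
     CARD('d) = 2 \<and>
     (\<forall>i. integrable M (\<lambda>\<omega>. (of_int (X 1 \<omega> $ i) :: real)\<^sup>2)) \<and>
     (\<forall>i. (\<integral>\<omega>. (of_int (X 1 \<omega> $ i) :: real) \<partial>M) = 0) \<and>
     invertible (covariance_matrix M (X 1)) \<and>
     A = 2 * sqrt (det (covariance_matrix M (X 1)))"

text \<open>
  As \<open>CARD('d) = 1\<close>, the index \<open>i\<close> below ranges over the unique coordinate.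
\<close>

definition cauchy_walk_assumption ::
    "'w measure \<Rightarrow> (nat \<Rightarrow> 'w \<Rightarrow> int ^ 'd) \<Rightarrow> real \<Rightarrow> bool" where
  "cauchy_walk_assumption M X a \<longleftrightarrow>
     CARD('d) = 1 \<and> a > 0 \<and>
     (\<exists>L. real_distribution L \<and>
          (\<forall>t. char L t = complex_of_real (exp (- a * \<bar>t\<bar>))) \<and>
          (\<forall>i. weak_conv_m
                 (\<lambda>n. distr M borel (\<lambda>\<omega>. of_int (walk X n \<omega> $ i) / real n)) L))"

text \<open>
  No proper subgroup of the lattice carries the law of \<open>V\<close>.  Periodic walks such as the simple
  random walk are allowed: no condition is put on the differences of the increments.
\<close>

definition generates_lattice :: "'w measure \<Rightarrow> ('w \<Rightarrow> int ^ 'd) \<Rightarrow> bool" where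
  "generates_lattice M V \<longleftrightarrow>
     (\<forall>H. 0 \<in> H \<and> (\<forall>u\<in>H. \<forall>v\<in>H. u - v \<in> H) \<and> (AE \<omega> in M. V \<omega> \<in> H) \<longrightarrow> H = UNIV)"

text \<open>
  The case \<open>\<beta> = 1\<close> is split off because \<open>tan (pi / 2) = 0\<close> here,
  whereas mathematically the bound is then void.
\<close>

definition strictly_stable_law :: "real \<Rightarrow> real \<Rightarrow> real \<Rightarrow> real measure \<Rightarrow> bool" where
  "strictly_stable_law \<beta> A1 A2 N \<longleftrightarrow>
     0 < \<beta> \<and> \<beta> \<le> 2 \<and> 0 < A1 \<and>
     (\<beta> \<noteq> 1 \<longrightarrow> \<bar>A2 / A1\<bar> \<le> \<bar>tan (pi * \<beta> / 2)\<bar>) \<and>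
     real_distribution N \<and>
     (\<forall>u. char N u =
        exp (- (complex_of_real (\<bar>u\<bar> powr \<beta>) *
                (complex_of_real A1 + \<i> * complex_of_real A2 * complex_of_real (sgn u)))))"

text \<open>
  The product measure carries \<open>n\<close> independent copies of a variable with law \<open>\<mu>\<close>.
\<close>

definition normal_domain_of_attraction ::
    "real \<Rightarrow> real measure \<Rightarrow> real measure \<Rightarrow> bool" where
  "normal_domain_of_attraction \<beta> \<mu> N \<longleftrightarrow>
     weak_conv_m
       (\<lambda>n. distr (\<Pi>\<^sub>M k\<in>{..<n}. \<mu>) borel
              (\<lambda>x. real n powr (- 1 / \<beta>) * (\<Sum>k<n. x k))) N"

definition bounded_truncated_means :: "'w measure \<Rightarrow> ('w \<Rightarrow> real) \<Rightarrow> bool" where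
  "bounded_truncated_means M V \<longleftrightarrow>
     bdd_above ((\<lambda>t. \<bar>\<integral>\<omega>. V \<omega> * indicator {\<omega>. \<bar>V \<omega>\<bar> \<le> t} \<omega> \<partial>M\<bar>) ` {0<..})"

definition rwrs_scale :: "real \<Rightarrow> nat \<Rightarrow> real" where
  "rwrs_scale \<beta> n = real n powr (1 / \<beta>) * ln (real n) powr ((\<beta> - 1) / \<beta>)"

definition multiples :: "nat \<Rightarrow> real set" where
  "multiples d = range (\<lambda>k::int. real d * of_int k)"

end

theory Submission
  imports Defs "HOL-Real_Asymp.Real_Asymp"
begin

text \<open>
 Given the path of the walk, \<open>Z\<close> is a sum of independent variables, one for each visited site, so
 the characteristic function of \<open>Z\<close> is the mean of \<open>\<Prod>y. \<phi> (t * N y)\<close>, where \<open>N y\<close> is the number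
 of visits to \<open>y\<close> and \<open>\<phi>\<close> belongs to the scenery, and Fourier inversion over one period of \<open>\<bar>\<phi>\<bar>\<close>
 gives the probabilities. Rescaled by \<open>b\<close>, the product is close to \<open>exp (- psi u * V / b powr \<beta>)\<close>
 with \<open>V = (\<Sum>y. N y powr \<beta>)\<close>. The walk being critical, the Green function grows like
 \<open>ln n / (pi * A)\<close>; hence \<open>V / b powr \<beta>\<close> has mean tending to \<open>Gamma (\<beta> + 1) / (pi * A) powr (\<beta> - 1)\<close>, and it
 concentrates because \<open>V\<close> is almost additive over short blocks of the path.

 For \<open>\<bar>t\<bar> \<le> n powr (- 1 / 4)\<close> domination comes from \<open>exp (- c * \<bar>u\<bar> powr \<beta> * W powr \<beta>) \<le> const / (u * W)\<^sup>2\<close> and from the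
 boundedness of the mean of \<open>1 / W\<^sup>2\<close>, where \<open>W = V powr (1 / \<beta>) / b\<close>. For larger \<open>t\<close>, exchanging two distinct
 consecutive increments changes the number of visits to one site by one, and
 \<open>\<phi> (t * k)\<close> and \<open>\<phi> (t * (k + 1))\<close> cannot both have modulus near one; many independent
 exchanges make the mean smaller than every power of \<open>n\<close>.
\<close>

text \<open>Origin of the constant: with lam = 1 / (pi * A), the probability \<open>esc\<close> of
  not returning within n steps is about 1 / (lam * ln n). By time reversal the path discovers about
  n * esc sites, and a discovered site is visited about 1 / esc times an exponential variable. So V
  is about n * esc * Gamma (\<beta> + 1) * esc powr (- \<beta>), which is the limit constant times b
  powr \<beta>. Periodic walks are allowed, so return probabilities at single times need not
  converge. The argument relies instead on their sum, the Green function, and on an upper bound of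
  order 1 / k, which both survive periodicity. The exponent 1 / 4 balances two demands. Visit counts
  stay below every positive power of n, so below the threshold all t * N y lie within half a period
  of |\<phi>|. Above it, \<beta> \<le> 2 makes each exchange gain at least a multiple of n powr (-
  1/2), and n powr (3/4) independent exchanges give exp (- c * n powr (1/4)). The inverse moment of
  W comes from interpolating the identity that the counts sum to n between V and either the range
  (\<beta> > 1) or a higher power sum (\<beta> < 1).\<close>

abbreviation (input) LIMSEQ_ascii :: "(nat => 'a::topological_space) => 'a => bool" ("((_)/ ----> (_))" [60, 60] 60) where
 "X ----> L \<equiv> X \<longlonglongrightarrow> L"

abbreviation (input) mean :: "'a pmf => ('a => 'b::{banach, second_countable_topology}) => 'b" where
  "mean P \<equiv> measure_pmf.expectation P"

abbreviation (input) wmean :: "nat => 'a pmf => ('a list => 'b::{banach, second_countable_topology}) => 'b" where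
  "wmean n p \<equiv> mean (replicate_pmf n p)"

abbreviation (input) wprob :: "nat => 'a pmf => 'a list set => real" where
  "wprob n p \<equiv> measure_pmf.prob (replicate_pmf n p)"

abbreviation (input) nlog :: "real => nat => real" where
  "nlog q n \<equiv> real n * ln (real n) powr (q - 1)"

section \<open>Paths and their visit counts\<close>

text \<open>The endpoint is left out: n increments give the n positions at times 0, ..., n - 1,
  exactly those over which \<open>rwrs\<close> sums. Working with finite words turns the Markov
  property into splitting by \<open>take\<close> and \<open>drop\<close>, and time reversal into
  \<open>rev\<close>.\<close>

fun sites :: "'a::ab_group_add list => 'a list" where
 "sites [] = []"
| "sites (x # xs) = 0 # map ((+) x) (sites xs)"

definition cnt :: "'a::ab_group_add list => 'a => nat" where
 "cnt xs y = count_list (sites xs) y"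

lemma length_sites [simp]: "length (sites xs) = length xs"
 by (induction xs) auto

lemma sites_eq_Nil_iff [simp]: "sites xs = [] \<longleftrightarrow> xs = []"
 by (cases xs) auto

lemma sites_append: "sites (xs @ ys) = sites xs @ map ((+) (sum_list xs)) (sites ys)"
 by (induction xs) (auto simp: o_def add.assoc)

lemma sites_nth: "k < length xs ==> sites xs ! k = sum_list (take k xs)"
proof (induction xs arbitrary: k)
 case (Cons x xs)
 then show ?case by (cases k) auto
qed simp

lemma count_list_map_add: "count_list (map ((+) a) xs) y = count_list xs (y - a :: 'a::ab_group_add)"
 by (induction xs) (auto simp: algebra_simps)

lemma cnt_Nil [simp]: "cnt [] y = 0"
 by (simp add: cnt_def)

lemma cnt_Cons: "cnt (x # xs) y = (if y = 0 then 1 else 0) + cnt xs (y - x)"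
 by (auto simp: cnt_def count_list_map_add)

lemma cnt_append: "cnt (xs @ ys) y = cnt xs y + cnt ys (y - sum_list xs)"
 by (simp add: cnt_def sites_append count_list_append count_list_map_add)

lemma cnt_le_length: "cnt xs y <= length xs"
 unfolding cnt_def by (metis count_le_length length_sites)

lemma cnt_eq_0_iff: "cnt xs y = 0 \<longleftrightarrow> y \<notin> set (sites xs)"
 by (simp add: cnt_def count_list_0_iff)

lemma cnt_pos_iff: "cnt xs y > 0 \<longleftrightarrow> y \<in> set (sites xs)"
 using cnt_eq_0_iff[of xs y] by auto

lemma sum_cnt: "(\<Sum>y\<in>set (sites xs). cnt xs y) = length xs"
 unfolding cnt_def by (simp add: sum_count_set)

lemma cnt_alt: "cnt xs y = card {k. k < length xs \<and> sum_list (take k xs) = y}"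
 unfolding cnt_def count_list_eq_length_filter length_filter_conv_card
 by (intro arg_cong[where f=card]) (auto simp: sites_nth)

definition Vsum :: "(nat => real) => 'a::ab_group_add list => real" where
 "Vsum f xs = (\<Sum>y\<in>set (sites xs). f (cnt xs y))"

text \<open>Times 1 to \<open>length xs\<close> are tested, so the endpoint, which
  \<open>sites\<close> omits, counts as a possible return.\<close>

definition avoids :: "'a::ab_group_add list => bool" where
 "avoids xs \<longleftrightarrow> (\<forall>k\<in>{1..length xs}. sum_list (take k xs) \<noteq> 0)"

lemma avoids_Nil [simp]: "avoids []"
 by (simp add: avoids_def)

definition fresh :: "'a::ab_group_add list => bool" where
 "fresh xs \<longleftrightarrow> sum_list xs \<notin> set (sites xs)"

text \<open>Time reversal: the partial sums of \<open>rev xs\<close> are the differences between the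
  endpoint and the earlier positions. Reversal preserves the law of an i.i.d. word, so discovering a
  new site at time k is as likely as not returning to 0 within k steps.\<close>

lemma fresh_iff_avoids_rev: "fresh xs \<longleftrightarrow> avoids (rev xs)"
proof -
 have eq: "sum_list (take k (rev xs)) = sum_list xs - sum_list (take (length xs - k) xs)"
  if "k <= length xs" for k
 proof -
  have "sum_list xs = sum_list (take (length xs - k) xs) + sum_list (drop (length xs - k) xs)"
   by (metis append_take_drop_id sum_list_append)
  moreover have "sum_list (take k (rev xs)) = sum_list (drop (length xs - k) xs)"
   by (simp add: take_rev sum_list_rev)
  ultimately show ?thesis by simp
 qed
 have "fresh xs \<longleftrightarrow> (\<forall>k<length xs. sum_list (take k xs) \<noteq> sum_list xs)"
  unfolding fresh_def by (force simp: in_set_conv_nth sites_nth)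
 also have "... \<longleftrightarrow> (\<forall>k\<in>{1..length xs}. sum_list (take (length xs - k) xs) \<noteq> sum_list xs)"
 proof safe
  fix k assume *: "\<forall>k\<in>{1..length xs}. sum_list (take (length xs - k) xs) \<noteq> sum_list xs"
   "k < length xs" "sum_list (take k xs) = sum_list xs"
  have "length xs - k \<in> {1..length xs}" "length xs - (length xs - k) = k" using *(2) by auto
  with *(1,3) show False by metis
 qed auto
 also have "... \<longleftrightarrow> avoids (rev xs)"
  unfolding avoids_def by (intro ball_cong) (auto simp: eq)
 finally show ?thesis .
qed

text \<open>Every visited site is charged to the time k of its first visit; no visit precedes k, so
  all its visits are seen by the path after k, recentred at that site. The two factors depend on
  disjoint sets of increments, which makes the expectation computable.\<close>

lemma Vsum_first_visit:
 "Vsum f xs = (\<Sum>k<length xs. (if fresh (take k xs) then 1 else 0) * f (cnt (drop k xs) 0))"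
proof -
 define K where "K = {k. k < length xs \<and> fresh (take k xs)}"
 define S where "S k = sum_list (take k xs)" for k
 have fr: "fresh (take k xs) \<longleftrightarrow> (\<forall>i<k. S i \<noteq> S k)" if "k < length xs" for k
  using that unfolding fresh_def S_def by (force simp: in_set_conv_nth sites_nth min_def)
 have inj: "inj_on S K"
  unfolding K_def inj_on_def using fr by (metis (mono_tags, lifting) linorder_neqE_nat mem_Collect_eq)
 have im: "S ` K = set (sites xs)"
 proof (rule antisym)
  show "S ` K \<subseteq> set (sites xs)"
   unfolding K_def S_def by (force simp: in_set_conv_nth sites_nth)
  show "set (sites xs) \<subseteq> S ` K"
  proof
   fix y assume "y \<in> set (sites xs)"
   then have ex: "\<exists>k. k < length xs \<and> S k = y"
    unfolding S_def by (force simp: in_set_conv_nth sites_nth)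
   define k where "k = (LEAST k. k < length xs \<and> S k = y)"
   have k: "k < length xs" "S k = y" using LeastI_ex[OF ex] by (auto simp: k_def)
   have "S i \<noteq> S k" if "i < k" for i
    using not_less_Least[of i "%k. k < length xs \<and> S k = y"] that k by (auto simp: k_def)
   then show "y \<in> S ` K" using k fr by (auto simp: K_def)
  qed
 qed
 have "Vsum f xs = (\<Sum>k\<in>K. f (cnt xs (S k)))"
  unfolding Vsum_def im[symmetric] by (simp add: sum.reindex[OF inj])
 also have "... = (\<Sum>k\<in>K. f (cnt (drop k xs) 0))"
 proof (intro sum.cong refl)
  fix k assume k: "k \<in> K"
  have "cnt xs (S k) = cnt (take k xs) (S k) + cnt (drop k xs) (S k - sum_list (take k xs))"
   by (metis append_take_drop_id cnt_append)
  moreover have "cnt (take k xs) (S k) = 0"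
   using k by (simp add: K_def fresh_def cnt_eq_0_iff S_def)
  ultimately show "f (cnt xs (S k)) = f (cnt (drop k xs) 0)" by (simp add: S_def)
 qed
 also have "... = (\<Sum>k<length xs. (if fresh (take k xs) then 1 else 0) * f (cnt (drop k xs) 0))"
  unfolding K_def by (intro sum.mono_neutral_cong_left) auto
 finally show ?thesis .
qed

definition returns_at :: "'a::ab_group_add list => bool" where
 "returns_at xs \<longleftrightarrow> xs \<noteq> [] \<and> avoids (butlast xs) \<and> sum_list xs = 0"

lemma returns_at_take: "0 < k ==> k <= length xs ==>
  returns_at (take k xs) \<longleftrightarrow> sum_list (take k xs) = 0 \<and> (\<forall>i\<in>{1..<k}. sum_list (take i xs) \<noteq> 0)"
 unfolding returns_at_def avoids_def by (auto simp: butlast_take min_def)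

text \<open>The first return time is unique, so the indicators over k are disjoint and add up to the
  indicator of their union.\<close>

lemma first_return:
 assumes "length xs = m"
 shows "(\<Sum>k\<in>{1..m}. if returns_at (take k xs) \<and> P k then 1 else 0 :: real) =
  (if \<exists>k\<in>{1..m}. returns_at (take k xs) \<and> P k then 1 else 0)"
proof (cases "\<exists>k\<in>{1..m}. returns_at (take k xs) \<and> P k")
 case True
 then obtain k where k: "k \<in> {1..m}" "returns_at (take k xs)" "P k" by auto
 have uniq: "i = k" if "i \<in> {1..m}" "returns_at (take i xs)" for i
  using that k(1,2) assms by (auto simp: returns_at_take) (metis atLeastLessThan_iff linorder_neqE_nat)
 have "(\<Sum>i\<in>{1..m}. if returns_at (take i xs) \<and> P i then 1 else 0 :: real) = (\<Sum>i\<in>{1..m}. if i = k then 1 else 0)"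
  using k uniq by (intro sum.cong refl if_cong) metis+
 also have "... = 1" using k(1) by simp
 finally show ?thesis using True by (simp only: if_True)
next
 case False
 have "(\<Sum>k\<in>{1..m}. if returns_at (take k xs) \<and> P k then 1 else 0 :: real) = (\<Sum>k\<in>{1..m}. 0)"
  by (intro sum.cong refl if_not_P) (use False in blast)
 then show ?thesis using False by (simp only: if_False sum.neutral_const)
qed

lemma not_avoids_iff: "\<not> avoids xs \<longleftrightarrow> (\<exists>k\<in>{1..length xs}. returns_at (take k xs))"
proof
 assume "\<not> avoids xs"
 then have ex: "\<exists>k. k \<in> {1..length xs} \<and> sum_list (take k xs) = 0" by (auto simp: avoids_def)
 define k where "k = (LEAST k. k \<in> {1..length xs} \<and> sum_list (take k xs) = 0)"
 have k: "k \<in> {1..length xs}" "sum_list (take k xs) = 0" using LeastI_ex[OF ex] by (auto simp: k_def)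
 have "sum_list (take i xs) \<noteq> 0" if "i \<in> {1..<k}" for i
  using not_less_Least[of i "%k. k \<in> {1..length xs} \<and> sum_list (take k xs) = 0"] that k
  by (auto simp: k_def)
 then have "returns_at (take k xs)" using k by (subst returns_at_take) auto
 then show "\<exists>k\<in>{1..length xs}. returns_at (take k xs)" using k by blast
next
 assume "\<exists>k\<in>{1..length xs}. returns_at (take k xs)"
 then obtain k where "k \<in> {1..length xs}" "returns_at (take k xs)" by blast
 then show "\<not> avoids xs" by (auto simp: avoids_def returns_at_def)
qed

text \<open>Cut at the first return: the first excursion contains only the visit at time 0, its
  endpoint being counted as the starting site of the remainder. Exactly one visit is removed from
  the count.\<close>

lemma cnt_ge_decomp:
 assumes "length xs = m"
 shows "Suc (Suc j) <= cnt xs 0 \<longleftrightarrow>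
  (\<exists>k\<in>{1..m}. returns_at (take k xs) \<and> Suc j <= cnt (drop k xs) 0)"
proof -
 define S where "S k = sum_list (take k xs)" for k
 have cd: "cnt xs 0 = 1 + cnt (drop k xs) 0" if k: "k \<in> {1..m}" "returns_at (take k xs)" for k
 proof -
  have "cnt xs 0 = cnt (take k xs) 0 + cnt (drop k xs) (0 - sum_list (take k xs))"
   by (metis append_take_drop_id cnt_append)
  moreover have "sum_list (take k xs) = 0" using k by (simp add: returns_at_def)
  moreover have "{i. i < length (take k xs) \<and> sum_list (take i (take k xs)) = 0} = {0}"
  proof (rule set_eqI)
   fix i
   have "sum_list (take i xs) \<noteq> 0" if "0 < i" "i < k"
    using k that assms by (auto simp: returns_at_take)
   then show "i \<in> {i. i < length (take k xs) \<and> sum_list (take i (take k xs)) = 0} \<longleftrightarrow> i \<in> {0}"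
    using k assms by (cases "i = 0") (auto simp: min_def)
  qed
  then have "cnt (take k xs) 0 = 1" unfolding cnt_alt by simp
  ultimately show ?thesis by simp
 qed
 show ?thesis
 proof
  assume L: "Suc (Suc j) <= cnt xs 0"
  have "\<not> avoids xs"
  proof
   assume "avoids xs"
   then have "{k. k < length xs \<and> sum_list (take k xs) = 0} \<subseteq> {0}"
    by (force simp: avoids_def Suc_le_eq)
   from card_mono[OF _ this] have "cnt xs 0 <= 1" by (simp add: cnt_alt)
   with L show False by simp
  qed
  then obtain k where k: "k \<in> {1..m}" "returns_at (take k xs)"
   using assms by (auto simp: not_avoids_iff)
  then show "\<exists>k\<in>{1..m}. returns_at (take k xs) \<and> Suc j <= cnt (drop k xs) 0"
   using L cd[OF k] by (intro bexI[of _ k]) auto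
 next
  assume "\<exists>k\<in>{1..m}. returns_at (take k xs) \<and> Suc j <= cnt (drop k xs) 0"
  then show "Suc (Suc j) <= cnt xs 0" using cd by auto
 qed
qed

text \<open>Exactly one k, the last time up to n at which the walk sits at 0, gives a nonzero term;
  k = 0 is always a candidate.\<close>

lemma last_exit:
 assumes "length xs = n"
 shows "(\<Sum>k\<le>n. (if sum_list (take k xs) = 0 then 1 else 0) * (if avoids (drop k xs) then 1 else 0)) = (1::real)"
proof -
 define S where "S k = sum_list (take k xs)" for k
 define k where "k = Max {k. k <= n \<and> S k = 0}"
 have fin: "finite {k. k <= n \<and> S k = 0}" by simp
 have ne: "{k. k <= n \<and> S k = 0} \<noteq> {}" by (auto simp: S_def intro!: exI[of _ 0])
 have k: "k <= n" "S k = 0" using Max_in[OF fin ne] by (auto simp: k_def)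
 have mx: "i <= k" if "i <= n" "S i = 0" for i using Max_ge[OF fin] that by (auto simp: k_def)
 have dr: "sum_list (take i (drop l xs)) = S (l + i) - S l" for l i
  by (simp add: S_def take_add)
 have av: "avoids (drop l xs) \<longleftrightarrow> (\<forall>i. l < i \<and> i <= n --> S i \<noteq> 0)" if "S l = 0" "l <= n" for l
 proof -
  have "avoids (drop l xs) \<longleftrightarrow> (\<forall>i\<in>{1..n-l}. S (l + i) \<noteq> 0)"
   unfolding avoids_def dr using that assms by simp
  also have "... \<longleftrightarrow> (\<forall>i. l < i \<and> i <= n --> S i \<noteq> 0)"
  proof safe
   fix i assume *: "\<forall>i\<in>{1..n - l}. S (l + i) \<noteq> 0" "l < i" "i <= n" "S i = 0"
   then have "i - l \<in> {1..n-l}" "l + (i - l) = i" by auto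
   with * show False by metis
  qed (use that in auto)
  finally show ?thesis .
 qed
 have "(\<Sum>i\<le>n. (if S i = 0 then 1 else 0) * (if avoids (drop i xs) then 1 else 0)) = (\<Sum>i\<in>{k}. 1::real)"
 proof (intro sum.mono_neutral_cong_right)
  show "\<forall>i\<in>{..n} - {k}. (if S i = 0 then 1 else 0) * (if avoids (drop i xs) then 1 else 0) = (0::real)"
   using k mx av by (auto) (metis le_neq_implies_less)
  show "(if S i = 0 then 1 else 0) * (if avoids (drop i xs) then 1 else 0) = (1::real)" if "i \<in> {k}" for i
   using that k mx av[of k] by (auto) (metis leD)
 qed (use k in auto)
 then show ?thesis by (simp add: S_def)
qed

section \<open>Escape probabilities\<close>

lemma integrable_pmf_bounded:
 fixes F :: "'a => 'b::{banach, second_countable_topology}"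
 assumes "\<And>x. x \<in> set_pmf P ==> norm (F x) <= c"
 shows "integrable (measure_pmf P) F"
 by (rule measure_pmf.integrable_const_bound[where B=c]) (use assms in \<open>auto simp: AE_measure_pmf_iff\<close>)

lemma expectation_pmf_mono:
 fixes F G :: "'a => real"
 assumes "integrable (measure_pmf P) F" "integrable (measure_pmf P) G" "\<And>x. x \<in> set_pmf P ==> F x <= G x"
 shows "mean P F <= mean P G"
 by (rule integral_mono_AE) (use assms in \<open>auto simp: AE_measure_pmf_iff\<close>)

lemma expectation_pmf_cong:
 assumes "\<And>x. x \<in> set_pmf P ==> F x = G x"
 shows "mean P F = mean P (G :: _ => real)"
 by (rule integral_cong_AE) (use assms in \<open>auto simp: AE_measure_pmf_iff\<close>)

lemma expectation_pair_pmf_nonneg: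
 fixes f :: "'a \<times> 'b => real"
 assumes b: "\<And>x y. x \<in> set_pmf P ==> y \<in> set_pmf Q ==> 0 <= f (x, y) \<and> f (x, y) <= c"
 shows "mean (pair_pmf P Q) f =
  mean P (%x. mean Q (%y. f (x, y)))"
proof -
 have inner: "(\<integral>\<^sup>+y. ennreal (f (x, y)) \<partial>Q) = ennreal (mean Q (%y. f (x, y)))"
  if "x \<in> set_pmf P" for x
  by (rule nn_integral_eq_integral)
    (use b that in \<open>auto intro!: integrable_pmf_bounded[where c=c] simp: AE_measure_pmf_iff\<close>)
 have ne: "set_pmf Q \<noteq> {}" "set_pmf P \<noteq> {}" by (rule set_pmf_not_empty)+
 then have c0: "c \<ge> 0" using b by (meson ex_in_conv order_trans)
 have le: "mean Q (%y. f (x, y)) <= c" "mean Q (%y. f (x, y)) \<ge> 0"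
  if x: "x \<in> set_pmf P" for x
 proof -
  have i: "integrable Q (%y. f (x, y))"
   by (rule integrable_pmf_bounded[where c=c]) (use b x in auto)
  show "mean Q (%y. f (x, y)) \<ge> 0"
   by (rule integral_nonneg_AE) (use b x in \<open>auto simp: AE_measure_pmf_iff\<close>)
  have "mean Q (%y. f (x, y)) <= mean Q (%y. c)"
   by (rule expectation_pmf_mono) (use i b x in auto)
  then show "mean Q (%y. f (x, y)) <= c" by simp
 qed
 have "ennreal (mean (pair_pmf P Q) f) = (\<integral>\<^sup>+z. ennreal (f z) \<partial>pair_pmf P Q)"
  by (rule nn_integral_eq_integral[symmetric])
    (use b in \<open>auto intro!: integrable_pmf_bounded[where c=c] simp: AE_measure_pmf_iff\<close>)
 also have "... = (\<integral>\<^sup>+x. \<integral>\<^sup>+y. ennreal (f (x, y)) \<partial>Q \<partial>P)"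
  by (rule nn_integral_pair_pmf')
 also have "... = (\<integral>\<^sup>+x. ennreal (mean Q (%y. f (x, y))) \<partial>P)"
  by (rule nn_integral_cong_AE) (use inner in \<open>auto simp: AE_measure_pmf_iff\<close>)
 also have "... = ennreal (mean P (%x. mean Q (%y. f (x, y))))"
  by (rule nn_integral_eq_integral)
    (use le in \<open>auto intro!: integrable_pmf_bounded[where c=c] simp: AE_measure_pmf_iff\<close>)
 finally show ?thesis
  by (subst (asm) ennreal_inj) (use b le in \<open>auto intro!: integral_nonneg_AE simp: AE_measure_pmf_iff\<close>)
qed

text \<open>Reduced to the nonnegative case by adding the bound \<open>c\<close> to the
  integrand.\<close>

lemma expectation_pair_pmf:
 fixes f :: "'a \<times> 'b => real"
 assumes b: "\<And>x y. x \<in> set_pmf P ==> y \<in> set_pmf Q ==> \<bar>f (x, y)\<bar> <= c"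
 shows "mean (pair_pmf P Q) f =
  mean P (%x. mean Q (%y. f (x, y)))"
proof -
 have "mean (pair_pmf P Q) (%z. f z + c) =
  mean P (%x. mean Q (%y. f (x, y) + c))"
  by (rule expectation_pair_pmf_nonneg[where c="2 * c"]) (use b in fastforce)
 moreover have "mean (pair_pmf P Q) (%z. f z + c) = mean (pair_pmf P Q) f + c"
  by (subst Bochner_Integration.integral_add)
    (use b in \<open>auto intro!: integrable_pmf_bounded[where c=c]\<close>)
 moreover have "mean P (%x. mean Q (%y. f (x, y) + c)) =
  mean P (%x. mean Q (%y. f (x, y)) + c)"
  by (rule expectation_pmf_cong, subst Bochner_Integration.integral_add)
    (use b in \<open>auto intro!: integrable_pmf_bounded[where c=c]\<close>)
 moreover have "mean P (%x. mean Q (%y. f (x, y)) + c) =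
  mean P (%x. mean Q (%y. f (x, y))) + c"
 proof (subst Bochner_Integration.integral_add)
  show "integrable P (%x. mean Q (%y. f (x, y)))"
  proof (rule integrable_pmf_bounded[where c=c])
   fix x assume x: "x \<in> set_pmf P"
   have "norm (mean Q (%y. f (x, y))) <= mean Q (%y. norm (f (x, y)))"
    by (rule integral_norm_bound)
   also have "... <= mean Q (%y. c)"
    by (rule expectation_pmf_mono) (use b x in \<open>auto intro!: integrable_pmf_bounded[where c=c]\<close>)
   finally show "norm (mean Q (%y. f (x, y))) <= c" by simp
  qed
 qed auto
 ultimately show ?thesis by simp
qed

lemma replicate_pmf_append:
 "replicate_pmf (m + n) p = map_pmf (%(xs, ys). xs @ ys) (pair_pmf (replicate_pmf m p) (replicate_pmf n p))"
 by (simp add: replicate_pmf_distrib pair_pmf_def map_bind_pmf)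

lemma length_replicate_pmf: "xs \<in> set_pmf (replicate_pmf n p) ==> length xs = n"
 by (simp add: set_replicate_pmf)

lemma expectation_replicate_append:
 fixes F :: "'a list => real"
 assumes "\<And>xs. length xs = m + n ==> \<bar>F xs\<bar> <= c"
 shows "wmean (m + n) p F =
  wmean m p (%xs. wmean n p (%ys. F (xs @ ys)))"
 unfolding replicate_pmf_append integral_map_pmf
 by (subst expectation_pair_pmf[where c=c]) (use assms in \<open>auto dest!: length_replicate_pmf\<close>)

text \<open>Independence of the increments before and after time k, in the form used by the path
  decompositions below.\<close>

lemma expectation_replicate_split:
 fixes A B :: "'a list => real"
 assumes "\<And>xs. length xs = k ==> \<bar>A xs\<bar> <= c" "\<And>xs. length xs = n - k ==> \<bar>B xs\<bar> <= d" "k <= n"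
 shows "wmean n p (%xs. A (take k xs) * B (drop k xs)) =
  wmean k p A * wmean (n - k) p B"
proof -
 have n: "n = k + (n - k)" using assms(3) by simp
 have c: "c \<ge> 0" using assms(1)[of "replicate k undefined"] by fastforce
 have "wmean n p (%xs. A (take k xs) * B (drop k xs)) =
  wmean k p (%xs. wmean (n - k) p
    (%ys. A (take k (xs @ ys)) * B (drop k (xs @ ys))))"
  by (subst n, rule expectation_replicate_append[where c="c * d"])
    (use assms c in \<open>auto simp: abs_mult intro!: mult_mono\<close>)
 also have "... = wmean k p (%xs. A xs * wmean (n - k) p B)"
  by (rule expectation_pmf_cong) (simp add: length_replicate_pmf)
 finally show ?thesis by simp
qed

lemma map_rev_replicate_pmf: "map_pmf rev (replicate_pmf n p) = replicate_pmf n p"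
proof (induction n)
 case (Suc n)
 have "map_pmf rev (replicate_pmf (Suc n) p) =
   do {x \<leftarrow> p; xs \<leftarrow> map_pmf rev (replicate_pmf n p); return_pmf (xs @ [x])}"
  by (simp add: map_bind_pmf bind_map_pmf map_pmf_def[symmetric] pmf.map_comp o_def)
 also have "... = do {xs \<leftarrow> replicate_pmf n p; x \<leftarrow> p; return_pmf (xs @ [x])}"
  by (subst bind_commute_pmf) (simp add: Suc.IH)
 also have "... = replicate_pmf (n + 1) p"
  unfolding replicate_pmf_distrib by (simp only: replicate_pmf_1 bind_map_pmf)
 finally show ?case by simp
qed simp

definition esc :: "'a::ab_group_add pmf => nat => real" where
 "esc p n = wprob n p {xs. avoids xs}"

definition ret :: "'a::ab_group_add pmf => nat => real" where
 "ret p n = wprob n p {xs. returns_at xs}"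

definition at0 :: "'a::ab_group_add pmf => nat => real" where
 "at0 p n = wprob n p {xs. sum_list xs = 0}"

definition vis :: "'a::ab_group_add pmf => nat => nat => real" where
 "vis p n j = wprob n p {xs. j <= cnt xs 0}"

lemma prob_eq_expectation:
 "measure_pmf.prob P {x. Q x} = mean P (%x. if Q x then 1 else 0)"
proof -
 have "(%x. if Q x then 1 else 0 :: real) = indicator {x. Q x}" by (auto simp: indicator_def)
 then show ?thesis by simp
qed

lemma esc_range: "0 <= esc p n" "esc p n <= 1"
 by (auto simp: esc_def)

lemma at0_range: "0 <= at0 p n" "at0 p n <= 1"
 by (auto simp: at0_def)

lemma ret_nonneg: "0 <= ret p n"
 by (auto simp: ret_def)

lemma vis_range: "0 <= vis p n j" "vis p n j <= 1"
 by (auto simp: vis_def)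

text \<open>Mean of the last-exit decomposition: a renewal identity tying return probabilities to
  escape probabilities. Both inequalities between \<open>esc\<close> and \<open>green\<close> are
  drawn from it.\<close>

lemma last_exit_prob: "(\<Sum>k\<le>n. at0 p k * esc p (n - k)) = 1"
proof -
 have "(\<Sum>k\<le>n. at0 p k * esc p (n - k)) =
  (\<Sum>k\<le>n. wmean n p (%xs. (if sum_list (take k xs) = 0 then 1 else 0) * (if avoids (drop k xs) then 1 else 0)))"
  unfolding at0_def esc_def prob_eq_expectation
  by (intro sum.cong refl expectation_replicate_split[symmetric, where c=1 and d=1]) auto
 also have "... = wmean n p (%xs. \<Sum>k\<le>n. (if sum_list (take k xs) = 0 then 1 else 0) * (if avoids (drop k xs) then 1 else 0))"
  by (rule Bochner_Integration.integral_sum[symmetric]) (auto intro!: integrable_pmf_bounded[where c=1])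
 also have "... = wmean n p (%xs. 1)"
  by (intro expectation_pmf_cong last_exit) (simp add: length_replicate_pmf)
 finally show ?thesis by simp
qed

lemma prob_fresh: "wprob n p {xs. fresh xs} = esc p n"
 by (subst map_rev_replicate_pmf[symmetric]) (simp add: esc_def fresh_iff_avoids_rev vimage_def)

text \<open>First visits factor off: \<open>esc p k\<close> is the probability of discovering a site
  at time k, by reversal, and the remaining n - k steps start afresh from that site.\<close>

lemma expectation_Vsum:
 assumes "\<And>j. 0 <= f j"
 shows "wmean n p (Vsum f) =
  (\<Sum>k<n. esc p k * wmean (n - k) p (%xs. f (cnt xs 0)))"
proof -
 define C where "C = (\<Sum>j\<le>n. f j)"
 have C: "f (cnt xs 0) <= C" if "length xs <= n" for xs :: "'a list"
  unfolding C_def by (rule member_le_sum) (use assms cnt_le_length[of xs 0] that in auto)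
 have Cn: "C \<ge> 0" unfolding C_def by (intro sum_nonneg) (use assms in auto)
 have "wmean n p (Vsum f) =
   wmean n p (%xs. \<Sum>k<n. (if fresh (take k xs) then 1 else 0) * f (cnt (drop k xs) 0))"
  by (rule expectation_pmf_cong) (auto simp: Vsum_first_visit length_replicate_pmf)
 also have "... = (\<Sum>k<n. wmean n p (%xs. (if fresh (take k xs) then 1 else 0) * f (cnt (drop k xs) 0)))"
  by (rule Bochner_Integration.integral_sum)
    (use assms C Cn in \<open>auto intro!: integrable_pmf_bounded[where c=C] dest!: length_replicate_pmf\<close>)
 also have "... = (\<Sum>k<n. esc p k * wmean (n - k) p (%xs. f (cnt xs 0)))"
 proof (intro sum.cong refl)
  fix k assume "k \<in> {..<n}"
  then show "wmean n p (%xs. (if fresh (take k xs) then 1 else 0) * f (cnt (drop k xs) 0)) =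
   esc p k * wmean (n - k) p (%xs. f (cnt xs 0))"
   unfolding prob_fresh[symmetric] prob_eq_expectation
   by (intro expectation_replicate_split[where c=1 and d=C]) (use C assms in auto)
 qed
 finally show ?thesis .
qed

lemma sum_ret: "(\<Sum>k\<in>{1..m}. ret p k) = 1 - esc p m"
proof -
 have "(\<Sum>k\<in>{1..m}. ret p k) =
  (\<Sum>k\<in>{1..m}. wmean m p (%xs. (if returns_at (take k xs) then 1 else 0) * (%_. 1) (drop k xs)))"
  unfolding ret_def prob_eq_expectation
  by (intro sum.cong refl, subst expectation_replicate_split[where c=1 and d=1]) auto
 also have "... = wmean m p (%xs. \<Sum>k\<in>{1..m}. if returns_at (take k xs) then 1 else 0)"
  by (subst Bochner_Integration.integral_sum) (auto intro!: integrable_pmf_bounded[where c=1])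
 also have "... = wmean m p (%xs. 1 - (if avoids xs then 1 else 0))"
 proof (rule expectation_pmf_cong)
  fix xs assume "xs \<in> set_pmf (replicate_pmf m p)"
  then have l: "length xs = m" by (rule length_replicate_pmf)
  show "(\<Sum>k\<in>{1..m}. if returns_at (take k xs) then 1 else 0) = 1 - (if avoids xs then 1 else 0 :: real)"
   using first_return[OF l, of "%_. True"] not_avoids_iff[of xs] unfolding l simp_thms
   by (simp only: split: if_split) auto
 qed
 also have "... = 1 - esc p m"
  unfolding esc_def prob_eq_expectation
  by (subst Bochner_Integration.integral_diff) (auto intro!: integrable_pmf_bounded[where c=1])
 finally show ?thesis .
qed

text \<open>Markov property at the first return time k, which uses up one visit.\<close>

lemma vis_Suc_Suc: "vis p m (Suc (Suc j)) = (\<Sum>k\<in>{1..m}. ret p k * vis p (m - k) (Suc j))"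
proof -
 have "(\<Sum>k\<in>{1..m}. ret p k * vis p (m - k) (Suc j)) =
  (\<Sum>k\<in>{1..m}. wmean m p (%xs. (if returns_at (take k xs) then 1 else 0) * (if Suc j <= cnt (drop k xs) 0 then 1 else 0)))"
  unfolding ret_def vis_def prob_eq_expectation
  by (intro sum.cong refl, subst expectation_replicate_split[where c=1 and d=1]) auto
 also have "... = wmean m p (%xs. \<Sum>k\<in>{1..m}. if returns_at (take k xs) \<and> Suc j <= cnt (drop k xs) 0 then 1 else 0)"
  by (subst Bochner_Integration.integral_sum)
    (auto intro!: integrable_pmf_bounded[where c=1] sum.cong expectation_pmf_cong)
 also have "... = vis p m (Suc (Suc j))"
  unfolding vis_def prob_eq_expectation
 proof (rule expectation_pmf_cong)
  fix xs assume "xs \<in> set_pmf (replicate_pmf m p)"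
  then have l: "length xs = m" by (rule length_replicate_pmf)
  show "(\<Sum>k\<in>{1..m}. if returns_at (take k xs) \<and> Suc j <= cnt (drop k xs) 0 then 1 else 0) =
     (if Suc (Suc j) <= cnt xs 0 then 1 else 0 :: real)"
   unfolding first_return[OF l, of "%k. Suc j <= cnt (drop k xs) 0"] cnt_ge_decomp[OF l] by (rule refl)
 qed
 finally show ?thesis ..
qed

lemma prob_replicate_append_mono:
 assumes "\<And>xs ys. A xs ==> B (xs @ ys)"
 shows "wprob m p {xs. A xs} <= wprob (m + n) p {xs. B xs}"
proof -
 have "wprob m p {xs. A xs} = measure_pmf.prob (pair_pmf (replicate_pmf m p) (replicate_pmf n p)) {z. A (fst z)}"
  by (subst (1) map_fst_pair_pmf[of _ "replicate_pmf n p", symmetric]) (simp add: vimage_def)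
 also have "... <= measure_pmf.prob (pair_pmf (replicate_pmf m p) (replicate_pmf n p)) {z. B (fst z @ snd z)}"
  by (rule measure_pmf.finite_measure_mono) (use assms in auto)
 also have "... = wprob (m + n) p {xs. B xs}"
  by (simp add: replicate_pmf_append vimage_def case_prod_unfold)
 finally show ?thesis .
qed

lemma vis_mono: "m <= n ==> vis p m j <= vis p n j"
 unfolding vis_def using prob_replicate_append_mono[of "%xs. j <= cnt xs 0" "%xs. j <= cnt xs 0" m p "n - m"]
 by (simp add: cnt_append)

lemma esc_antimono: "m <= n ==> esc p n <= esc p m"
proof -
 assume mn: "m <= n"
 have "(\<Sum>k\<in>{1..m}. ret p k) <= (\<Sum>k\<in>{1..n}. ret p k)"
  using mn by (intro sum_mono2) (auto simp: ret_nonneg)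
 then show ?thesis unfolding sum_ret by simp
qed

lemma vis_1: "m > 0 ==> vis p m (Suc 0) = 1"
proof -
 assume "m > 0"
 have "vis p m (Suc 0) = wmean m p (%xs. 1)"
  unfolding vis_def prob_eq_expectation
 proof (rule expectation_pmf_cong)
  fix xs assume "xs \<in> set_pmf (replicate_pmf m p)"
  then have "length xs = m" by (rule length_replicate_pmf)
  then show "(if Suc 0 <= cnt xs 0 then 1 else 0) = (1::real)"
   using \<open>m > 0\<close> by (cases xs) (auto simp: cnt_Cons)
 qed
 then show ?thesis by simp
qed

text \<open>Granting the full time m again after each return only enlarges the probability, which
  gives a geometric tail.\<close>

lemma vis_upper: "vis p m (Suc j) <= (1 - esc p m) ^ j"
proof (induction j)
 case (Suc j)
 have "vis p m (Suc (Suc j)) <= (\<Sum>k\<in>{1..m}. ret p k * vis p m (Suc j))"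
  unfolding vis_Suc_Suc by (intro sum_mono mult_left_mono vis_mono ret_nonneg) auto
 also have "... = (1 - esc p m) * vis p m (Suc j)"
  by (simp add: sum_distrib_right[symmetric] sum_ret[symmetric] del: sum_ret)
 also have "... <= (1 - esc p m) * (1 - esc p m) ^ j"
  by (intro mult_left_mono Suc.IH) (simp add: esc_range)
 finally show ?case by simp
qed (simp add: vis_range)

text \<open>Each of the j returns is required within s steps, so at most j * s steps are used; the
  strict inequality leaves one more step, without which the last return would be an endpoint and not
  a counted site.\<close>

lemma vis_lower: "j * s < m ==> (1 - esc p s) ^ j <= vis p m (Suc j)"
proof (induction j arbitrary: m)
 case (Suc j)
 have "(1 - esc p s) * (1 - esc p s) ^ j <= (1 - esc p s) * vis p (m - s) (Suc j)"
  by (intro mult_left_mono Suc.IH) (use Suc.prems esc_range[of p s] in auto)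
 also have "... = (\<Sum>k\<in>{1..s}. ret p k * vis p (m - s) (Suc j))"
  by (simp add: sum_distrib_right[symmetric] sum_ret[symmetric] del: sum_ret)
 also have "... <= (\<Sum>k\<in>{1..s}. ret p k * vis p (m - k) (Suc j))"
  by (intro sum_mono mult_left_mono vis_mono ret_nonneg) auto
 also have "... <= (\<Sum>k\<in>{1..m}. ret p k * vis p (m - k) (Suc j))"
  using Suc.prems by (intro sum_mono2) (auto simp: ret_nonneg vis_range)
 finally show ?case by (simp add: vis_Suc_Suc)
qed (simp add: vis_1)

section \<open>Truncated Green function and its relation to the escape probability\<close>

definition green :: "'a::ab_group_add pmf => nat => real" where
 "green p n = (\<Sum>k\<le>n. at0 p k)"

lemma green_ge_1: "green p n \<ge> 1"
proof -
 have "at0 p 0 = 1" by (simp add: at0_def indicator_def)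
 moreover have "at0 p 0 <= green p n" unfolding green_def
  by (rule member_le_sum) (auto simp: at0_range)
 ultimately show ?thesis by simp
qed

lemma esc_green_le_1: "esc p n * green p n <= 1"
proof -
 have "esc p n * green p n = (\<Sum>k\<le>n. at0 p k * esc p n)"
  by (simp add: green_def sum_distrib_left mult.commute)
 also have "... <= (\<Sum>k\<le>n. at0 p k * esc p (n - k))"
  by (intro sum_mono mult_left_mono esc_antimono at0_range) auto
 finally show ?thesis by (simp add: last_exit_prob)
qed

text \<open>The decay 1 / k is that of recurrent walks in the critical dimension; it makes
  \<open>green\<close> grow at most logarithmically. As an upper bound it tolerates return
  probabilities that vanish along some times.\<close>

locale critical_walk =
 fixes p :: "'a::ab_group_add pmf" and C0 :: real
 assumes at0_le: "\<And>k. k \<ge> 1 ==> at0 p k <= C0 / real k"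
begin

lemma C0_nonneg: "C0 \<ge> 0"
 using at0_le[of 1] at0_range(1)[of p 1] by auto

lemma green_le: "n \<ge> 1 ==> green p n <= 1 + C0 * (1 + ln (real n))"
proof (induction n rule: dec_induct)
 case base
 have "green p 1 = at0 p 0 + at0 p 1" by (simp add: green_def)
 then show ?case using at0_le[of 1] at0_range(2)[of p 0] by simp
next
 case (step n)
 have "green p (Suc n) = green p n + at0 p (Suc n)" by (simp add: green_def)
 moreover have "at0 p (Suc n) <= C0 * (1 / real (Suc n))" using at0_le[of "Suc n"] by simp
 moreover have "1 / real (Suc n) <= ln (real (Suc n)) - ln (real n)"
 proof -
  have "ln (real n / real (Suc n)) <= real n / real (Suc n) - 1"
   by (rule ln_le_minus_one) (use step in auto)
  also have "... = - (1 / real (Suc n))" by (simp add: field_simps)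
  finally show ?thesis using step by (simp add: ln_div)
 qed
 then have "C0 * (1 / real (Suc n)) <= C0 * (ln (real (Suc n)) - ln (real n))"
  by (intro mult_left_mono C0_nonneg)
 ultimately show ?case using step.IH by (simp add: algebra_simps)
qed

text \<open>Last exit over the longer horizon m + n. Exits up to time m leave at least n steps to
  escape; the exit times after m are n in number and have probability at most C0 / m each.\<close>

lemma esc_green_ge: "m \<ge> 1 ==> 1 - C0 * real n / real m <= esc p n * green p m"
proof -
 assume m: "m \<ge> 1"
 have "1 = (\<Sum>k\<le>m + n. at0 p k * esc p (m + n - k))" by (rule last_exit_prob[symmetric])
 also have "... = (\<Sum>k\<le>m. at0 p k * esc p (m + n - k)) + (\<Sum>k\<in>{m<..m+n}. at0 p k * esc p (m + n - k))"
  by (subst sum.union_disjoint[symmetric]) (auto intro!: sum.cong)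
 also have "(\<Sum>k\<le>m. at0 p k * esc p (m + n - k)) <= (\<Sum>k\<le>m. at0 p k * esc p n)"
  by (intro sum_mono mult_left_mono esc_antimono at0_range) auto
 also have "... = esc p n * green p m"
  by (simp add: green_def sum_distrib_left mult.commute)
 also have "(\<Sum>k\<in>{m<..m+n}. at0 p k * esc p (m + n - k)) <= (\<Sum>k\<in>{m<..m+n}. C0 / real m)"
 proof (intro sum_mono)
  fix k assume k: "k \<in> {m<..m+n}"
  have "at0 p k * esc p (m + n - k) <= at0 p k * 1"
   by (intro mult_left_mono esc_range at0_range)
  also have "... <= C0 / real k" using at0_le[of k] k by simp
  also have "... <= C0 / real m" using k m C0_nonneg by (intro divide_left_mono) auto
  finally show "at0 p k * esc p (m + n - k) <= C0 / real m" .
 qed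
 also have "... = C0 * real n / real m" by simp
 finally show ?thesis by simp
qed

lemma esc_pos: "esc p n > 0"
proof -
 define m where "m = nat \<lceil>2 * C0 * real n\<rceil> + 1"
 have "C0 * real n / real m <= 1 / 2"
 proof -
  have "2 * C0 * real n <= real m" unfolding m_def by linarith
  then show ?thesis by (simp add: m_def divide_le_eq algebra_simps)
 qed
 moreover have "1 <= m" by (simp add: m_def)
 ultimately have "esc p n * green p m > 0" using esc_green_ge[of m n] by linarith
 then show ?thesis using esc_range(1)[of p n] by (metis less_eq_real_def mult_zero_left order_less_irrefl)
qed

lemma esc_lower: obtains c where "c > 0" "\<And>n. n \<ge> 2 ==> c / ln (real n) <= esc p n"
proof -
 \<comment> \<open>With horizon m = K * n the error C0 * n / m of \<open>esc_green_ge\<close> is at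
   most 1/2.\<close>
 define K where "K = nat \<lceil>2 * C0\<rceil> + 1"
 \<comment> \<open>Collects the constants of 1 + C0 * (1 + ln (K * n)); dividing by
   \<open>ln 2\<close> absorbs them into a multiple of ln n for n at least 2.\<close>
 define D where "D = 1 / ln 2 + C0 / ln 2 + C0 * ln (real K) / ln 2 + C0"
 have l2: "ln 2 > (0::real)" by simp
 have D: "D > 0" unfolding D_def using C0_nonneg l2
  by (intro add_pos_nonneg divide_pos_pos mult_nonneg_nonneg divide_nonneg_nonneg) (auto simp: K_def)
 show ?thesis
 proof (rule that[of "1 / (2 * D)"])
  fix n :: nat assume n: "n \<ge> 2"
  have ln: "ln (real n) \<ge> ln 2" using n by simp
  have "real K \<ge> 2 * C0" unfolding K_def by linarith
  moreover have "real K > 0" by (simp add: K_def)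
  ultimately have "C0 * real n / real (K * n) <= 1 / 2"
   using n by (simp add: field_simps)
  then have 1: "1 / 2 <= esc p n * green p (K * n)"
   using esc_green_ge[of "K * n" n] n by (simp add: K_def)
  have "green p (K * n) <= 1 + C0 * (1 + ln (real (K * n)))"
   by (rule green_le) (use n in \<open>auto simp: K_def\<close>)
  also have "ln (real (K * n)) = ln (real K) + ln (real n)"
   using n \<open>real K > 0\<close> unfolding of_nat_mult by (subst ln_mult) auto
  also have "1 + C0 * (1 + (ln (real K) + ln (real n))) <= D * ln (real n)"
  proof -
   have *: "x <= x / ln 2 * ln (real n)" if "x \<ge> 0" for x
    using mult_left_mono[OF ln that] l2 by (simp add: field_simps)
   have "C0 * ln (real K) <= C0 * ln (real K) / ln 2 * ln (real n)"
    by (rule *) (use C0_nonneg in \<open>auto simp: K_def\<close>)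
   moreover have "0 <= C0 * ln (real n)" using C0_nonneg ln l2 by (intro mult_nonneg_nonneg) linarith+
   moreover have "D * ln (real n) = 1 / ln 2 * ln (real n) + C0 / ln 2 * ln (real n)
     + C0 * ln (real K) / ln 2 * ln (real n) + C0 * ln (real n)"
    by (simp add: D_def algebra_simps)
   ultimately show ?thesis using *[OF zero_le_one] *[OF C0_nonneg] C0_nonneg ln
    by (simp only: distrib_left mult_1_right)
  qed
  finally have "esc p n * green p (K * n) <= esc p n * (D * ln (real n))"
   by (intro mult_left_mono esc_range)
  with 1 have "1 / 2 <= esc p n * (D * ln (real n))" by linarith
  moreover have "D * ln (real n) > 0" using D n by simp
  ultimately show "1 / (2 * D) / ln (real n) <= esc p n"
   by (simp add: field_simps)
 qed (use D in simp)
qed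

end

section \<open>Layer-cake formula for power moments\<close>

lemma powr_eq_nn_integral:
 assumes "q > 0" "(a::real) \<ge> 0"
 shows "ennreal (a powr q) = (\<integral>\<^sup>+y. ennreal (q * y powr (q - 1)) * indicator {0<..<a} y \<partial>lborel)"
proof -
 have "((%y. y powr (q - 1)) has_integral (a powr (q - 1 + 1) / (q - 1 + 1))) {0..a}"
  by (rule has_integral_powr_from_0) (use assms in auto)
 then have "((%y. q * y powr (q - 1)) has_integral (q * (a powr q / q))) {0..a}"
  by (intro has_integral_mult_right) simp
 then have "((%y. q * y powr (q - 1)) has_integral a powr q) {0..a}"
  using assms by simp
 then have "(\<integral>\<^sup>+y. ennreal (indicator {0..a} y * (q * y powr (q - 1))) \<partial>lborel) = ennreal (a powr q)"
  by (intro nn_integral_has_integral_lebesgue) (use assms in auto)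
 moreover have "(\<integral>\<^sup>+y. ennreal (indicator {0..a} y * (q * y powr (q - 1))) \<partial>lborel) =
   (\<integral>\<^sup>+y. ennreal (q * y powr (q - 1)) * indicator {0<..<a} y \<partial>lborel)"
  by (intro nn_integral_cong_AE) (use AE_lborel_singleton[of 0] AE_lborel_singleton[of a] in eventually_elim, auto simp: indicator_def)
 ultimately show ?thesis by simp
qed

text \<open>Since N is integer valued, y < \<gamma> * N means that N exceeds the integer part of y /
  \<gamma>. The scale \<gamma> will be the escape probability, for which the tail becomes
  exponential.\<close>

lemma moment_layer_cake:
 fixes N :: "'x => nat"
 assumes "q > 0" "\<gamma> > 0" "\<And>x. x \<in> set_pmf P ==> N x <= b"
 shows "ennreal (\<gamma> powr q * mean P (%x. real (N x) powr q)) =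
  (\<integral>\<^sup>+y. ennreal (indicator {0<..} y * (q * y powr (q - 1) * measure_pmf.prob P {x. Suc (nat \<lfloor>y / \<gamma>\<rfloor>) <= N x})) \<partial>lborel)"
proof -
 have "ennreal (\<gamma> powr q * mean P (%x. real (N x) powr q)) =
   ennreal (mean P (%x. (\<gamma> * real (N x)) powr q))"
  using assms by (simp add: powr_mult)
 also have "... = (\<integral>\<^sup>+x. ennreal ((\<gamma> * real (N x)) powr q) \<partial>P)"
  by (rule nn_integral_eq_integral[symmetric])
    (use assms in \<open>auto intro!: integrable_pmf_bounded[where c="(\<gamma> * real b) powr q"] powr_mono2\<close>)
 also have "... = (\<integral>\<^sup>+x. (\<integral>\<^sup>+y. ennreal (q * y powr (q - 1)) * indicator {0<..<\<gamma> * real (N x)} y \<partial>lborel) \<partial>P)"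
  using assms by (subst powr_eq_nn_integral) auto
 also have "... = (\<integral>\<^sup>+x. (\<integral>\<^sup>+y. ennreal (q * y powr (q - 1)) * (if 0 < y \<and> y < \<gamma> * real (N x) then 1 else 0) \<partial>lborel) \<partial>P)"
  by (intro nn_integral_cong) (auto simp: indicator_def)
 also have "... = (\<integral>\<^sup>+y. (\<integral>\<^sup>+x. ennreal (q * y powr (q - 1)) * (if 0 < y \<and> y < \<gamma> * real (N x) then 1 else 0) \<partial>P) \<partial>lborel)"
 proof -
  interpret pair_sigma_finite "measure_pmf P" lborel ..
  have [measurable]: "(%z. real (N (fst z))) \<in> borel_measurable (measure_pmf P \<Otimes>\<^sub>M lborel)"
   by (rule measurable_compose[OF measurable_fst]) simp
  have "(%z. ennreal (q * snd z powr (q - 1)) * (if 0 < snd z \<and> snd z < \<gamma> * real (N (fst z)) then 1 else 0)) \<in> borel_measurable (measure_pmf P \<Otimes>\<^sub>M lborel)"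
   by measurable
  then have "(%(x, y). ennreal (q * y powr (q - 1)) * (if 0 < y \<and> y < \<gamma> * real (N x) then 1 else 0)) \<in> borel_measurable (measure_pmf P \<Otimes>\<^sub>M lborel)"
   by (simp add: case_prod_unfold)
  from Fubini'[OF this] show ?thesis by simp
 qed
 also have "... = (\<integral>\<^sup>+y. ennreal (indicator {0<..} y * (q * y powr (q - 1) * measure_pmf.prob P {x. Suc (nat \<lfloor>y / \<gamma>\<rfloor>) <= N x})) \<partial>lborel)"
 proof (intro nn_integral_cong)
  fix y :: real
  have eq: "(0 < y \<and> y < \<gamma> * real k) \<longleftrightarrow> (0 < y \<and> Suc (nat \<lfloor>y / \<gamma>\<rfloor>) <= k)" for k
  proof -
   have "y < \<gamma> * real k \<longleftrightarrow> y / \<gamma> < real k" using assms(2) by (simp add: field_simps)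
   moreover have "0 < y ==> y / \<gamma> < real k \<longleftrightarrow> Suc (nat \<lfloor>y / \<gamma>\<rfloor>) <= k"
    using assms(2) by (subst Suc_le_eq, subst nat_less_iff) (auto simp: floor_less_iff)
   ultimately show ?thesis by auto
  qed
  have "(\<integral>\<^sup>+x. ennreal (q * y powr (q - 1)) * (if 0 < y \<and> y < \<gamma> * real (N x) then 1 else 0) \<partial>P) =
   ennreal (q * y powr (q - 1)) * (\<integral>\<^sup>+x. indicator {x. 0 < y \<and> Suc (nat \<lfloor>y / \<gamma>\<rfloor>) <= N x} x \<partial>P)"
   unfolding eq by (subst nn_integral_cmult[symmetric]) (auto intro!: nn_integral_cong simp: indicator_def)
  also have "... = ennreal (q * y powr (q - 1)) * ennreal (measure_pmf.prob P {x. 0 < y \<and> Suc (nat \<lfloor>y / \<gamma>\<rfloor>) <= N x})"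
   by (subst nn_integral_indicator) (auto simp: measure_pmf.emeasure_eq_measure)
  also have "... = ennreal (indicator {0<..} y * (q * y powr (q - 1) * measure_pmf.prob P {x. Suc (nat \<lfloor>y / \<gamma>\<rfloor>) <= N x}))"
   using assms(1) by (auto simp: ennreal_mult'' indicator_def)
  finally show "(\<integral>\<^sup>+x. ennreal (q * y powr (q - 1)) * (if 0 < y \<and> y < \<gamma> * real (N x) then 1 else 0) \<partial>P) = ..." .
 qed
 finally show ?thesis .
qed

lemma Gamma_nn_integral:
 assumes "q > 0"
 shows "(\<integral>\<^sup>+y. ennreal (indicator {0<..} y * (q * y powr (q - 1) * exp (- y))) \<partial>lborel) = ennreal (Gamma (q + 1))"
proof -
 have "((%t. q * (t powr (q - 1) / exp t)) has_integral q * Gamma q) {0..}"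
  by (intro has_integral_mult_right Gamma_integral_real assms)
 then have "(\<integral>\<^sup>+y. ennreal (indicator {0..} y * (q * (y powr (q - 1) / exp y))) \<partial>lborel) = ennreal (q * Gamma q)"
  by (intro nn_integral_has_integral_lebesgue) (use assms in auto)
 moreover have "(\<integral>\<^sup>+y. ennreal (indicator {0..} y * (q * (y powr (q - 1) / exp y))) \<partial>lborel) =
   (\<integral>\<^sup>+y. ennreal (indicator {0<..} y * (q * y powr (q - 1) * exp (- y))) \<partial>lborel)"
  by (intro nn_integral_cong_AE) (use AE_lborel_singleton[of 0] in eventually_elim, auto simp: indicator_def exp_minus divide_inverse mult.assoc)
 moreover have "q * Gamma q = Gamma (q + 1)"
  using assms by (subst Gamma_plus1) (auto elim!: nonpos_Ints_cases)
 ultimately show ?thesis by simp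
qed

section \<open>Moments of the visit counts\<close>

definition visit_moment :: "'a::ab_group_add pmf => real => nat => real" where
 "visit_moment p q n = wmean n p (%xs. real (cnt xs 0) powr q)"

lemma visit_moment_nonneg: "visit_moment p q n \<ge> 0"
 unfolding visit_moment_def by (rule Bochner_Integration.integral_nonneg) auto

lemma visit_moment_layer:
 assumes "q > 0" "\<gamma> > 0"
 shows "ennreal (\<gamma> powr q * visit_moment p q n) =
  (\<integral>\<^sup>+y. ennreal (indicator {0<..} y * (q * y powr (q - 1) * vis p n (Suc (nat \<lfloor>y / \<gamma>\<rfloor>)))) \<partial>lborel)"
 unfolding visit_moment_def vis_def
 by (rule moment_layer_cake[where b=n]) (use assms cnt_le_length length_replicate_pmf in fastforce)+

lemma visit_moment_mono: "q > 0 ==> m <= n ==> visit_moment p q m <= visit_moment p q n"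
proof -
 assume b: "q > 0" and mn: "m <= n"
 have "ennreal (1 powr q * visit_moment p q m) <= ennreal (1 powr q * visit_moment p q n)"
  unfolding visit_moment_layer[OF b zero_less_one]
  by (intro nn_integral_mono ennreal_leI mult_left_mono vis_mono mn) (use b in auto)
 then show ?thesis by (simp add: visit_moment_nonneg)
qed

context critical_walk begin

text \<open>The geometric tail in the rescaled variable, uniformly in n: the majorant for dominated
  convergence. The factor \<open>exp 1\<close> pays for rounding y / esc down, as esc is at most
  1.\<close>

lemma vis_exp_bound:
 assumes "y \<ge> 0"
 shows "vis p n (Suc (nat \<lfloor>y / esc p n\<rfloor>)) <= exp 1 * exp (- y)"
proof -
 define j where "j = nat \<lfloor>y / esc p n\<rfloor>"
 have j: "real j \<ge> y / esc p n - 1" unfolding j_def by linarith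
 have "vis p n (Suc j) <= (1 - esc p n) ^ j" by (rule vis_upper)
 also have "... <= (exp (- esc p n)) ^ j"
  using esc_range[of p n] exp_ge_add_one_self[of "- esc p n"] by (intro power_mono) auto
 also have "... = exp (- (esc p n * real j))" by (simp add: exp_of_nat_mult[symmetric] mult.commute)
 also have "... <= exp (1 - y)"
 proof -
  have "esc p n * real j \<ge> esc p n * (y / esc p n - 1)"
   using j esc_pos[of n] by (intro mult_left_mono) auto
  also have "esc p n * (y / esc p n - 1) = y - esc p n" using esc_pos[of n] by (simp add: field_simps)
  finally show ?thesis using esc_range[of p n] by simp
 qed
 finally show ?thesis by (simp add: j_def exp_diff exp_minus divide_inverse)
qed

lemma visit_moment_le:
 assumes b: "q > 0"
 shows "visit_moment p q n <= exp 1 * Gamma (q + 1) * esc p n powr (- q)"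
proof -
 have "ennreal (esc p n powr q * visit_moment p q n) \<le>
   (\<integral>\<^sup>+y. ennreal (exp 1) * ennreal (indicator {0<..} y * (q * y powr (q - 1) * exp (- y))) \<partial>lborel)"
  unfolding visit_moment_layer[OF b esc_pos]
 proof (intro nn_integral_mono)
  fix y :: real
  have "indicator {0<..} y * (q * y powr (q - 1) * vis p n (Suc (nat \<lfloor>y / esc p n\<rfloor>))) \<le>
   indicator {0<..} y * (q * y powr (q - 1) * (exp 1 * exp (- y)))"
   using vis_exp_bound[of y n] b by (auto simp: indicator_def intro!: mult_left_mono)
  also have "... = exp 1 * (indicator {0<..} y * (q * y powr (q - 1) * exp (- y)))" by simp
  finally show "ennreal (indicator {0<..} y * (q * y powr (q - 1) * vis p n (Suc (nat \<lfloor>y / esc p n\<rfloor>))))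
   <= ennreal (exp 1) * ennreal (indicator {0<..} y * (q * y powr (q - 1) * exp (- y)))"
   by (subst ennreal_mult[symmetric]) (use b in \<open>auto intro!: ennreal_leI\<close>)
 qed
 also have "... = ennreal (exp 1 * Gamma (q + 1))"
  using b Gamma_nn_integral[OF b] by (subst nn_integral_cmult) (auto simp: ennreal_mult)
 finally have "esc p n powr q * visit_moment p q n <= exp 1 * Gamma (q + 1)"
  using b by (subst (asm) ennreal_le_iff) (auto intro!: Gamma_real_nonneg)
 then show ?thesis using esc_pos[of n] by (simp add: powr_minus field_simps)
qed

text \<open>No lattice assumption is used here, so the power of the logarithm is not sharp.\<close>
lemma expectation_Vsum_crude:
 assumes b: "q > 0"
 obtains C where "C > 0" "\<And>n. n \<ge> 2 ==>
  wmean n p (Vsum (%j. real j powr q)) <= C * real n * ln (real n) powr q"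
proof -
 obtain c where c: "c > 0" "\<And>n. n \<ge> 2 ==> c / ln (real n) <= esc p n" using esc_lower by blast
 show ?thesis
 proof (rule that[of "exp 1 * Gamma (q + 1) * c powr (- q)"])
  fix n :: nat assume n: "n \<ge> 2"
  have "wmean n p (Vsum (%j. real j powr q)) =
   (\<Sum>k<n. esc p k * visit_moment p q (n - k))"
   unfolding visit_moment_def by (rule expectation_Vsum) auto
  also have "... <= (\<Sum>k<n. 1 * visit_moment p q n)"
   by (intro sum_mono mult_mono visit_moment_mono esc_range visit_moment_nonneg b) auto
  also have "... = real n * visit_moment p q n" by simp
  also have "... <= real n * (exp 1 * Gamma (q + 1) * esc p n powr (- q))"
   by (intro mult_left_mono visit_moment_le b) auto
  also have "... <= real n * (exp 1 * Gamma (q + 1) * (c / ln (real n)) powr (- q))"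
   using c n b by (intro mult_left_mono powr_mono2') (auto intro!: Gamma_real_nonneg mult_nonneg_nonneg)
  also have "(c / ln (real n)) powr (- q) = c powr (- q) * ln (real n) powr q"
   using c n by (simp add: powr_divide powr_minus field_simps)
  finally show "wmean n p (Vsum (%j. real j powr q)) \<le>
   exp 1 * Gamma (q + 1) * c powr (- q) * real n * ln (real n) powr q" by (simp add: mult_ac)
 qed (use c b in \<open>auto intro!: mult_pos_pos Gamma_real_pos\<close>)
qed

end

locale log_green_walk = critical_walk +
 fixes lam :: real
 assumes lam_pos: "lam > 0"
  and green_asymp: "(%n. green p n / ln (real n)) ----> lam"
begin

lemma esc_asymp: "(%n. esc p n * ln (real n)) ----> 1 / lam"
proof -
 \<comment> \<open>The horizon exceeds n by a logarithmic factor: n / m tends to 0, so the error in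
   \<open>esc_green_ge\<close> vanishes, while ln m remains equivalent to ln n.\<close>
 define m where "m n = n * nat \<lceil>ln (real n)\<rceil>" for n
 have up: "esc p n * ln (real n) <= 1 / (green p n / ln (real n))" if "n \<ge> 2" for n
  using esc_green_le_1[of p n] green_ge_1[of p n] that by (simp add: field_simps)
 have upev: "\<forall>\<^sub>F n in sequentially. esc p n * ln (real n) <= 1 / (green p n / ln (real n))"
  using eventually_ge_at_top[of 2] by eventually_elim (rule up)
 have uplim: "(%n. 1 / (green p n / ln (real n))) ----> 1 / lam"
  by (intro tendsto_intros green_asymp) (use lam_pos in auto)
 have m_top: "filterlim m sequentially sequentially"
 proof (rule filterlim_at_top_mono[OF filterlim_ident])
  show "\<forall>\<^sub>F n in sequentially. n <= m n"
   using eventually_ge_at_top[of 3]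
  proof eventually_elim
   case (elim n)
   then have "ln (real n) > 0" by simp
   then have "nat \<lceil>ln (real n)\<rceil> \<ge> 1" by linarith
   then show ?case by (simp add: m_def)
  qed
 qed
 have mge: "real n * ln (real n) <= real (m n)" for n
  unfolding m_def of_nat_mult by (rule mult_left_mono[OF real_nat_ceiling_ge]) simp
 have low: "(1 - C0 / ln (real n)) / (green p (m n) / ln (real (m n)) * (ln (real (m n)) / ln (real n))) <= esc p n * ln (real n)"
  if "n \<ge> 3" for n
 proof -
  have ln1: "ln (real n) > 0" using that by simp
  have "0 < real n * ln (real n)" using ln1 that by simp
  then have mp: "real (m n) > 0" using mge[of n] by linarith
  then have m1: "m n \<ge> 1" by simp
  have "C0 * real n / real (m n) <= C0 * real n / (real n * ln (real n))"
   using mge[of n] C0_nonneg ln1 that by (intro divide_left_mono) (auto intro!: mult_pos_pos mp)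
  also have "... = C0 / ln (real n)" using that by simp
  finally have "1 - C0 / ln (real n) <= esc p n * green p (m n)" using esc_green_ge[OF m1, of n] by simp
  then have "(1 - C0 / ln (real n)) * ln (real n) <= esc p n * green p (m n) * ln (real n)"
   using ln1 by (intro mult_right_mono) auto
  then have *: "(1 - C0 / ln (real n)) * ln (real n) / green p (m n) <= esc p n * ln (real n)"
   using green_ge_1[of p "m n"] by (simp add: field_simps)
  have "m n \<noteq> 1"
  proof
   assume "m n = 1"
   then show False using that by (auto simp: m_def)
  qed
  then have "ln (real (m n)) > 0" using m1 by simp
  then have "green p (m n) / ln (real (m n)) * (ln (real (m n)) / ln (real n)) = green p (m n) / ln (real n)" by simp
  then show ?thesis using * by (simp add: mult.commute)
 qed
 have lowev: "\<forall>\<^sub>F n in sequentially. (1 - C0 / ln (real n)) / (green p (m n) / ln (real (m n)) * (ln (real (m n)) / ln (real n))) <= esc p n * ln (real n)"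
  using eventually_ge_at_top[of 3] by eventually_elim (rule low)
 have 1: "(%n. green p (m n) / ln (real (m n))) ----> lam"
  by (rule filterlim_compose[OF green_asymp m_top])
 have 2: "(%n. ln (real (m n)) / ln (real n)) ----> 1"
 proof (rule tendsto_sandwich)
  show "(%n. ln (real n * ln (real n)) / ln (real n)) ----> 1" by real_asymp
  show "(%n. ln (real n * (ln (real n) + 1)) / ln (real n)) ----> 1" by real_asymp
  show "\<forall>\<^sub>F n in sequentially. ln (real n * ln (real n)) / ln (real n) <= ln (real (m n)) / ln (real n)"
   using eventually_ge_at_top[of 3]
  proof eventually_elim
   case (elim n)
   then have "ln (real n) > 0" by simp
   then show ?case using mge[of n] elim by (intro divide_right_mono ln_mono mult_pos_pos) auto
  qed
  show "\<forall>\<^sub>F n in sequentially. ln (real (m n)) / ln (real n) <= ln (real n * (ln (real n) + 1)) / ln (real n)"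
   using eventually_ge_at_top[of 3]
  proof eventually_elim
   case (elim n)
   then have l: "ln (real n) > 0" by simp
   have "0 < real n * ln (real n)" using l elim by simp
   then have "real (m n) > 0" using mge[of n] by linarith
   moreover have "real (m n) <= real n * (ln (real n) + 1)"
    unfolding m_def of_nat_mult using l by (intro mult_left_mono) linarith+
   ultimately show ?case using l by (intro divide_right_mono ln_mono) auto
  qed
 qed
 have "(%n. (1 - C0 / ln (real n)) / (green p (m n) / ln (real (m n)) * (ln (real (m n)) / ln (real n)))) ----> (1 - 0) / (lam * 1)"
 proof (intro tendsto_intros 1 2)
  show "(%n. C0 / ln (real n)) ----> 0" by real_asymp
 qed (use lam_pos in auto)
 then have lowlim: "(%n. (1 - C0 / ln (real n)) / (green p (m n) / ln (real (m n)) * (ln (real (m n)) / ln (real n)))) ----> 1 / lam"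
  by simp
 show ?thesis by (rule tendsto_sandwich[OF lowev upev lowlim uplim])
qed

text \<open>The number of visits to the start, multiplied by the escape probability, becomes
  exponential. The upper bound allows all n steps for each return, the lower bound about n / ln n of
  them, and \<open>esc\<close> is asymptotically the same at both times because it varies like 1 /
  ln.\<close>

lemma vis_asymp:
 assumes y: "y > 0"
 shows "(%n. vis p n (Suc (nat \<lfloor>y / esc p n\<rfloor>))) ----> exp (- y)"
proof -
 define j where "j n = nat \<lfloor>y / esc p n\<rfloor>" for n
 \<comment> \<open>Guarantees \<open>j n * s n < n\<close>, as \<open>vis_lower\<close>
   demands.\<close>
 define s where "s n = (n - 1) div (j n + 1)" for n
 \<comment> \<open>Eventually esc * ln n > 1 / (2 * lam), so j is at most 2 * y * lam * ln n; the
   summand 2 absorbs the 1 in j + 1 since ln n \<ge> 1/2.\<close>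
 define K where "K = 2 * y * lam + 2"
 have esc0: "esc p ----> 0"
 proof -
  have "(%n. (esc p n * ln (real n)) * (1 / ln (real n))) ----> 1 / lam * 0"
   by (intro tendsto_intros esc_asymp) real_asymp
  moreover have "\<forall>\<^sub>F n in sequentially. (esc p n * ln (real n)) * (1 / ln (real n)) = esc p n"
   using eventually_ge_at_top[of 2] by eventually_elim auto
  ultimately show ?thesis by (simp add: filterlim_cong)
 qed
 have jesc: "(%n. esc p n * real (j n)) ----> y"
 proof (rule tendsto_sandwich)
  show "(%n. y - esc p n) ----> y" using tendsto_diff[OF tendsto_const esc0, of y] by simp
  show "\<forall>\<^sub>F n in sequentially. y - esc p n <= esc p n * real (j n)"
  proof (intro always_eventually allI)
   fix n
   have "esc p n * (y / esc p n - 1) <= esc p n * real (j n)"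
    using esc_pos[of n] unfolding j_def by (intro mult_left_mono) linarith+
   then show "y - esc p n <= esc p n * real (j n)" using esc_pos[of n] by (simp add: right_diff_distrib)
  qed
  show "\<forall>\<^sub>F n in sequentially. esc p n * real (j n) <= y"
  proof (intro always_eventually allI)
   fix n
   have "real (j n) <= y / esc p n"
    using y esc_pos[of n] unfolding j_def by (intro of_nat_floor) auto
   then show "esc p n * real (j n) <= y" using esc_pos[of n] by (simp add: field_simps)
  qed
 qed simp
 have jK: "\<forall>\<^sub>F n in sequentially. real (j n) + 1 <= K * ln (real n)"
 proof -
  have "1 / lam > 1 / (2 * lam)" using lam_pos by (simp add: field_simps)
  then have "\<forall>\<^sub>F n in sequentially. esc p n * ln (real n) > 1 / (2 * lam)"
   by (rule order_tendstoD(1)[OF esc_asymp])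
  then show ?thesis using eventually_ge_at_top[of 3]
  proof eventually_elim
   case (elim n)
   have l: "ln (real n) \<ge> 1/2"
   proof -
    have "exp (1/2) <= exp (1::real)" by simp
    also have "... <= 3" by (rule exp_le)
    finally have "exp (1/2) <= real n" using elim by simp
    then show ?thesis using elim by (subst ln_ge_iff) auto
   qed
   have "y / esc p n <= 2 * y * lam * ln (real n)"
   proof -
    have "1 <= esc p n * ln (real n) * (2 * lam)"
     using elim(1) lam_pos by (simp add: field_simps)
    then have "y * 1 <= y * (esc p n * ln (real n) * (2 * lam))" using y by (intro mult_left_mono) auto
    then show ?thesis using esc_pos[of n] by (simp add: field_simps)
   qed
   moreover have "real (j n) <= y / esc p n"
    using y esc_pos[of n] unfolding j_def by (intro of_nat_floor) auto
   ultimately show ?case using l by (simp add: K_def algebra_simps)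
  qed
 qed
 have sK: "\<forall>\<^sub>F n in sequentially. (real n - 1) / (K * ln (real n)) - 1 <= real (s n)"
  using jK eventually_ge_at_top[of 3]
 proof eventually_elim
  case (elim n)
  have "(real n - 1) / (K * ln (real n)) <= (real n - 1) / (real (j n) + 1)"
   using elim by (intro divide_left_mono) auto
  also have "... = real (n - 1) / real (j n + 1)" using elim by (simp add: of_nat_diff)
  also have "... <= real (s n) + 1"
  proof -
   have "n - 1 < (s n + 1) * (j n + 1)" unfolding s_def
    by (metis add_gr_0 dividend_less_times_div mult.commute mult_Suc_right Suc_eq_plus1 add.commute zero_less_one)
   then have "real (n - 1) < real ((s n + 1) * (j n + 1))" by (simp only: of_nat_less_iff)
   then have "real (n - 1) <= (real (s n) + 1) * real (j n + 1)" by (simp add: algebra_simps)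
   then show ?thesis by (subst pos_divide_le_eq) auto
  qed
  finally show ?case by simp
 qed
 have K0: "K > 0" unfolding K_def using y lam_pos by (simp add: add_pos_pos)
 have s_top: "filterlim s sequentially sequentially"
 proof -
  have "filterlim (%n. (real n - 1) / (K * ln (real n)) - 1) at_top sequentially"
   using K0 by real_asymp
  then have "filterlim (%n. real (s n)) at_top sequentially"
   by (rule filterlim_at_top_mono) (rule sK)
  then show ?thesis by (simp add: filterlim_sequentially_iff_filterlim_real)
 qed
 have lns: "(%n. ln (real (s n)) / ln (real n)) ----> 1"
 proof (rule tendsto_sandwich)
  show "(%n. ln ((real n - 1) / (K * ln (real n)) - 1) / ln (real n)) ----> 1" using K0 by real_asymp
  show "\<forall>\<^sub>F n in sequentially. ln ((real n - 1) / (K * ln (real n)) - 1) / ln (real n) <= ln (real (s n)) / ln (real n)"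
  proof -
   have "\<forall>\<^sub>F n in sequentially. (real n - 1) / (K * ln (real n)) - 1 > 0" using K0 by real_asymp
   then show ?thesis using sK eventually_ge_at_top[of 3]
    by eventually_elim (intro divide_right_mono ln_mono, auto)
  qed
  show "\<forall>\<^sub>F n in sequentially. ln (real (s n)) / ln (real n) <= 1"
  proof -
   have "\<forall>\<^sub>F n in sequentially. s n \<ge> 1" using s_top by (simp add: filterlim_at_top)
   then show ?thesis using eventually_ge_at_top[of 3]
   proof eventually_elim
    case (elim n)
    have "s n <= n" unfolding s_def by (meson diff_le_self div_le_dividend order_trans)
    then show ?case using elim by simp
   qed
  qed
 qed simp
 have esj: "(%n. esc p (s n) * real (j n)) ----> y"
 proof -
  have "(%n. (esc p (s n) * ln (real (s n))) / (esc p n * ln (real n)) / (ln (real (s n)) / ln (real n)) * (esc p n * real (j n))) ----> (1/lam) / (1/lam) / 1 * y"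
   by (intro tendsto_intros jesc lns esc_asymp filterlim_compose[OF esc_asymp s_top]) (use lam_pos in auto)
  moreover have "\<forall>\<^sub>F n in sequentially. s n \<ge> 2" using s_top by (simp add: filterlim_at_top)
  then have "\<forall>\<^sub>F n in sequentially. (esc p (s n) * ln (real (s n))) / (esc p n * ln (real n)) / (ln (real (s n)) / ln (real n)) * (esc p n * real (j n)) = esc p (s n) * real (j n)"
   using eventually_ge_at_top[of 3] by eventually_elim (use esc_pos in \<open>auto simp: less_imp_neq[symmetric]\<close>)
  ultimately show ?thesis using lam_pos by (simp add: filterlim_cong)
 qed
 have lower_lim: "(%n. (1 - esc p (s n)) ^ j n) ----> exp (- y)"
 proof -
  have e0: "(%n. esc p (s n)) ----> 0" by (rule filterlim_compose[OF esc0 s_top])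
  have "((%x. ln (1 - x) / x) \<longlongrightarrow> -1) (at_right (0::real))" by real_asymp
  moreover have "filterlim (%n. esc p (s n)) (at_right 0) sequentially"
   using e0 esc_pos by (auto simp: filterlim_at less_imp_neq[symmetric])
  ultimately have "(%n. ln (1 - esc p (s n)) / esc p (s n)) ----> -1"
   by (rule filterlim_compose)
  then have "(%n. exp (ln (1 - esc p (s n)) / esc p (s n) * (esc p (s n) * real (j n)))) ----> exp (-1 * y)"
   by (intro tendsto_intros esj)
  moreover have "\<forall>\<^sub>F n in sequentially. esc p (s n) < 1"
   by (rule order_tendstoD(2)[OF e0]) simp
  then have "\<forall>\<^sub>F n in sequentially. exp (ln (1 - esc p (s n)) / esc p (s n) * (esc p (s n) * real (j n))) = (1 - esc p (s n)) ^ j n"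
  proof eventually_elim
   case (elim n)
   have "ln (1 - esc p (s n)) / esc p (s n) * (esc p (s n) * real (j n)) = real (j n) * ln (1 - esc p (s n))"
    using esc_pos[of "s n"] by simp
   then show ?case using elim by (simp add: exp_of_nat_mult)
  qed
  ultimately show ?thesis by (simp add: filterlim_cong)
 qed
 show ?thesis
 proof (rule tendsto_sandwich[OF _ _ lower_lim])
  have "(%n. exp (- (esc p n * real (j n)))) ----> exp (- y)"
   by (intro tendsto_intros jesc)
  then show "(%n. exp (- (esc p n * real (j n)))) ----> exp (- y)" .
  show "\<forall>\<^sub>F n in sequentially. (1 - esc p (s n)) ^ j n <= vis p n (Suc (nat \<lfloor>y / esc p n\<rfloor>))"
   using eventually_ge_at_top[of 1]
  proof eventually_elim
   case (elim n)
   have "j n * s n <= (j n + 1) * s n" by simp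
   also have "... <= n - 1" unfolding s_def by (rule times_div_less_eq_dividend)
   finally have "j n * s n < n" using elim by linarith
   then show ?case using vis_lower[of "j n" "s n" n p] by (simp add: j_def)
  qed
  show "\<forall>\<^sub>F n in sequentially. vis p n (Suc (nat \<lfloor>y / esc p n\<rfloor>)) <= exp (- (esc p n * real (j n)))"
  proof (intro always_eventually allI)
   fix n
   have "vis p n (Suc (j n)) <= (1 - esc p n) ^ j n" by (rule vis_upper)
   also have "... <= (exp (- esc p n)) ^ j n"
    using esc_range[of p n] exp_ge_add_one_self[of "- esc p n"] by (intro power_mono) auto
   also have "... = exp (- (esc p n * real (j n)))" by (simp add: exp_of_nat_mult[symmetric] mult.commute)
   finally show "vis p n (Suc (nat \<lfloor>y / esc p n\<rfloor>)) <= exp (- (esc p n * real (j n)))" by (simp add: j_def)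
  qed
 qed
qed

text \<open>Dominated convergence in the layer-cake integral with \<gamma> = esc: the tail tends to
  that of a standard exponential variable, whose q-th moment is Gamma (q + 1).\<close>

lemma visit_moment_asymp:
 assumes b: "q > 0"
 shows "(%n. esc p n powr q * visit_moment p q n) ----> Gamma (q + 1)"
proof -
 have "(%n. \<integral>\<^sup>+y. ennreal (indicator {0<..} y * (q * y powr (q - 1) * vis p n (Suc (nat \<lfloor>y / esc p n\<rfloor>)))) \<partial>lborel)
   ----> (\<integral>\<^sup>+y. ennreal (indicator {0<..} y * (q * y powr (q - 1) * exp (- y))) \<partial>lborel)"
 proof (rule nn_integral_dominated_convergence[where w="%y. ennreal (exp 1 * (indicator {0<..} y * (q * y powr (q - 1) * exp (- y))))"])
  fix n
  have [measurable]: "(%i::int. vis p n (Suc (nat i))) \<in> borel_measurable (count_space UNIV)" by simp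
  have "(%y. vis p n (Suc (nat \<lfloor>y / esc p n\<rfloor>))) \<in> borel_measurable lborel"
   by measurable
  then show "(%y. ennreal (indicator {0<..} y * (q * y powr (q - 1) * vis p n (Suc (nat \<lfloor>y / esc p n\<rfloor>))))) \<in> borel_measurable lborel"
   by measurable
  show "AE y in lborel. ennreal (indicator {0<..} y * (q * y powr (q - 1) * vis p n (Suc (nat \<lfloor>y / esc p n\<rfloor>))))
    <= ennreal (exp 1 * (indicator {0<..} y * (q * y powr (q - 1) * exp (- y))))"
  proof (intro AE_I2 ennreal_leI)
   fix y :: real
   have "indicator {0<..} y * (q * y powr (q - 1) * vis p n (Suc (nat \<lfloor>y / esc p n\<rfloor>))) \<le>
    indicator {0<..} y * (q * y powr (q - 1) * (exp 1 * exp (- y)))"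
    using vis_exp_bound[of y n] b by (auto simp: indicator_def intro!: mult_left_mono)
   then show "indicator {0<..} y * (q * y powr (q - 1) * vis p n (Suc (nat \<lfloor>y / esc p n\<rfloor>)))
    <= exp 1 * (indicator {0<..} y * (q * y powr (q - 1) * exp (- y)))" by (simp add: mult_ac)
  qed
 next
  have "(\<integral>\<^sup>+y. ennreal (exp 1 * (indicator {0<..} y * (q * y powr (q - 1) * exp (- y)))) \<partial>lborel) = ennreal (exp 1) * ennreal (Gamma (q + 1))"
   unfolding Gamma_nn_integral[OF b, symmetric]
   by (subst nn_integral_cmult[symmetric]) (use b in \<open>auto simp: ennreal_mult intro!: nn_integral_cong\<close>)
  then show "(\<integral>\<^sup>+y. ennreal (exp 1 * (indicator {0<..} y * (q * y powr (q - 1) * exp (- y)))) \<partial>lborel) < \<infinity>"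
   by (simp add: ennreal_mult_less_top)
  show "AE y in lborel. (%n. ennreal (indicator {0<..} y * (q * y powr (q - 1) * vis p n (Suc (nat \<lfloor>y / esc p n\<rfloor>)))))
    ----> ennreal (indicator {0<..} y * (q * y powr (q - 1) * exp (- y)))"
  proof (intro AE_I2)
   fix y :: real
   show "(%n. ennreal (indicator {0<..} y * (q * y powr (q - 1) * vis p n (Suc (nat \<lfloor>y / esc p n\<rfloor>)))))
    ----> ennreal (indicator {0<..} y * (q * y powr (q - 1) * exp (- y)))"
    by (cases "y > 0") (auto intro!: tendsto_intros vis_asymp)
  qed
 qed auto
 then have "(%n. ennreal (esc p n powr q * visit_moment p q n)) ----> ennreal (Gamma (q + 1))"
  unfolding Gamma_nn_integral[OF b] visit_moment_layer[OF b esc_pos] .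
 then show ?thesis
  by (subst (asm) tendsto_ennreal_iff)
    (use b in \<open>auto intro!: Gamma_real_nonneg always_eventually mult_nonneg_nonneg visit_moment_nonneg\<close>)
qed

end

context log_green_walk begin

lemma sum_esc_le:
 "(\<Sum>k<n. esc p k) <= real m + real n * esc p m"
proof -
 have "(\<Sum>k<n. esc p k) <= (\<Sum>k<n. (if k < m then 1 else 0) + esc p m)"
 proof (intro sum_mono)
  fix k
  show "esc p k <= (if k < m then 1 else 0) + esc p m"
   using esc_range[of p k] esc_range[of p m] esc_antimono[of m k p] by (cases "k < m") auto
 qed
 also have "... = (\<Sum>k<n. if k < m then 1 else 0) + real n * esc p m"
  by (simp add: sum.distrib)
 also have "(\<Sum>k<n. if k < m then 1 else 0 :: real) <= real m"
 proof -
  have "(\<Sum>k<n. if k < m then 1 else 0 :: real) = real (card ({..<n} \<inter> {..<m}))"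
   by (simp add: sum.If_cases Int_def lessThan_def)
  also have "... <= real m" using card_mono[of "{..<m}" "{..<n} \<inter> {..<m}"] by simp
  finally show ?thesis .
 qed
 finally show ?thesis by simp
qed

text \<open>Truncation at \<open>n / (ln n) ^ 6\<close> costs nothing, as \<open>ln\<close> is slowly varying.\<close>
lemma shrunk_time:
 defines "m \<equiv> %n. nat \<lfloor>real n / (ln (real n)) ^ 6\<rfloor>"
 shows "filterlim m sequentially sequentially" "(%n. ln (real (m n)) / ln (real n)) ----> 1"
  "(%n. real (m n) * ln (real n) / real n) ----> 0"
  "(%n. esc p (m n) * ln (real n)) ----> 1 / lam"
proof -
 have lb: "real n / (ln (real n)) ^ 6 - 1 <= real (m n)" for n unfolding m_def by linarith
 have ub: "real (m n) <= real n / (ln (real n)) ^ 6" for n unfolding m_def by (intro of_nat_floor) auto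
 have "filterlim (%n. real n / (ln (real n)) ^ 6 - 1) at_top sequentially" by real_asymp
 then have "filterlim (%n. real (m n)) at_top sequentially"
  by (rule filterlim_at_top_mono) (intro always_eventually allI lb)
 then show top: "filterlim m sequentially sequentially"
  by (simp add: filterlim_sequentially_iff_filterlim_real)
 have m1: "\<forall>\<^sub>F n in sequentially. m n \<ge> 2" using top by (simp add: filterlim_at_top)
 show lim: "(%n. ln (real (m n)) / ln (real n)) ----> 1"
 proof (rule tendsto_sandwich)
  show "\<forall>\<^sub>F n in sequentially. ln (real n / (ln (real n)) ^ 6 - 1) / ln (real n) <= ln (real (m n)) / ln (real n)"
  proof -
   have "\<forall>\<^sub>F n in sequentially. real n / (ln (real n)) ^ 6 - 1 > 0" by real_asymp
   then show ?thesis using m1 eventually_ge_at_top[of 3]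
    by eventually_elim (intro divide_right_mono ln_mono lb, auto)
  qed
  show "\<forall>\<^sub>F n in sequentially. ln (real (m n)) / ln (real n) <= ln (real n / (ln (real n)) ^ 6) / ln (real n)"
   using m1 eventually_ge_at_top[of 3]
   by eventually_elim (intro divide_right_mono ln_mono ub, auto)
  show "(%n. ln (real n / (ln (real n)) ^ 6 - 1) / ln (real n)) ----> 1" by real_asymp
  show "(%n. ln (real n / (ln (real n)) ^ 6) / ln (real n)) ----> 1" by real_asymp
 qed
 show "(%n. real (m n) * ln (real n) / real n) ----> 0"
 proof (rule tendsto_sandwich)
  show "\<forall>\<^sub>F n in sequentially. 0 <= real (m n) * ln (real n) / real n"
   using eventually_ge_at_top[of 3] by eventually_elim auto
  show "\<forall>\<^sub>F n in sequentially. real (m n) * ln (real n) / real n <= (real n / (ln (real n)) ^ 6) * ln (real n) / real n"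
   using eventually_ge_at_top[of 3] by eventually_elim (intro divide_right_mono mult_right_mono ub, auto)
  show "(%n. (real n / (ln (real n)) ^ 6) * ln (real n) / real n) ----> 0" by real_asymp
 qed simp
 have "(%n. esc p (m n) * ln (real (m n)) / (ln (real (m n)) / ln (real n))) ----> 1 / lam / 1"
  by (intro tendsto_intros lim filterlim_compose[OF esc_asymp top]) simp
 moreover have "\<forall>\<^sub>F n in sequentially. esc p (m n) * ln (real (m n)) / (ln (real (m n)) / ln (real n)) = esc p (m n) * ln (real n)"
  using m1 by eventually_elim auto
 ultimately show "(%n. esc p (m n) * ln (real n)) ----> 1 / lam"
  by (simp add: filterlim_cong)
qed

lemma sum_esc_asymp: "(%n. (\<Sum>k<n. esc p k) * ln (real n) / real n) ----> 1 / lam"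
proof (rule tendsto_sandwich)
 let ?m = "%n. nat \<lfloor>real n / (ln (real n)) ^ 6\<rfloor>"
 show "\<forall>\<^sub>F n in sequentially. esc p n * ln (real n) <= (\<Sum>k<n. esc p k) * ln (real n) / real n"
  using eventually_ge_at_top[of 3]
 proof eventually_elim
  case (elim n)
  have "real n * esc p n = (\<Sum>k<n. esc p n)" by simp
  also have "... <= (\<Sum>k<n. esc p k)" by (intro sum_mono esc_antimono) auto
  finally have "real n * esc p n * ln (real n) <= (\<Sum>k<n. esc p k) * ln (real n)"
   using elim by (intro mult_right_mono) auto
  then show ?case using elim by (simp add: field_simps)
 qed
 show "\<forall>\<^sub>F n in sequentially. (\<Sum>k<n. esc p k) * ln (real n) / real n \<le>
   real (?m n) * ln (real n) / real n + esc p (?m n) * ln (real n)"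
  using eventually_ge_at_top[of 3]
 proof eventually_elim
  case (elim n)
  have "(\<Sum>k<n. esc p k) * ln (real n) <= (real (?m n) + real n * esc p (?m n)) * ln (real n)"
   using elim by (intro mult_right_mono sum_esc_le) auto
  then have "(\<Sum>k<n. esc p k) * ln (real n) / real n <= (real (?m n) + real n * esc p (?m n)) * ln (real n) / real n"
   by (rule divide_right_mono) simp
  also have "... = real (?m n) * ln (real n) / real n + esc p (?m n) * ln (real n)"
   using elim by (simp add: add_divide_distrib distrib_right)
  finally show ?case .
 qed
 show "(%n. esc p n * ln (real n)) ----> 1 / lam" by (rule esc_asymp)
 show "(%n. real (?m n) * ln (real n) / real n + esc p (?m n) * ln (real n)) ----> 1 / lam"
  using tendsto_add[OF shrunk_time(3,4)] by simp
qed

lemma visit_moment_log: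
 assumes b: "q > 0"
 shows "(%n. visit_moment p q n / ln (real n) powr q) ----> Gamma (q + 1) * lam powr q"
proof -
 have "(%n. (esc p n powr q * visit_moment p q n) / (esc p n * ln (real n)) powr q) ----> Gamma (q + 1) / (1 / lam) powr q"
  by (intro tendsto_intros visit_moment_asymp b esc_asymp) (use lam_pos in auto)
 moreover have "\<forall>\<^sub>F n in sequentially. (esc p n powr q * visit_moment p q n) / (esc p n * ln (real n)) powr q = visit_moment p q n / ln (real n) powr q"
  using eventually_ge_at_top[of 3]
 proof eventually_elim
  case (elim n)
  then show ?case using esc_pos[of n] by (simp add: powr_mult)
 qed
 ultimately show ?thesis using lam_pos by (simp add: filterlim_cong powr_divide)
qed

text \<open>Number of discovered sites, about n / (lam * ln n), times the moment of the visits to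
  each, about Gamma (q + 1) * (lam * ln n) powr q. The sum is squeezed by granting every site the
  full time n, or by keeping only the sites found before n - m and granting each the time m, where m
  is about n / (ln n) ^ 6.\<close>

theorem expectation_Vsum_asymp:
 assumes b: "q > 0"
 shows "(%n. wmean n p (Vsum (%j. real j powr q)) / (nlog q n))
  ----> Gamma (q + 1) * lam powr (q - 1)"
proof -
 let ?m = "%n. nat \<lfloor>real n / (ln (real n)) ^ 6\<rfloor>"
 let ?E = "%n. wmean n p (Vsum (%j. real j powr q))"
 have E: "?E n = (\<Sum>k<n. esc p k * visit_moment p q (n - k))" for n
  unfolding visit_moment_def by (rule expectation_Vsum) auto
 have pm: "lam powr q / lam = lam powr (q - 1)" using lam_pos by (simp add: powr_diff)
 have up: "?E n / (nlog q n) \<le>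
   ((\<Sum>k<n. esc p k) * ln (real n) / real n) * (visit_moment p q n / ln (real n) powr q)" if n: "n \<ge> 3" for n
 proof -
  have "?E n <= (\<Sum>k<n. esc p k * visit_moment p q n)"
   unfolding E by (intro sum_mono mult_left_mono visit_moment_mono b esc_range) auto
  also have "... = (\<Sum>k<n. esc p k) * visit_moment p q n" by (simp add: sum_distrib_right)
  finally have "?E n / (nlog q n) <= (\<Sum>k<n. esc p k) * visit_moment p q n / (nlog q n)"
   by (intro divide_right_mono) auto
  also have "... = ((\<Sum>k<n. esc p k) * ln (real n) / real n) * (visit_moment p q n / ln (real n) powr q)"
   using n by (simp add: powr_diff)
  finally show ?thesis .
 qed
 have low: "((real n - real (?m n)) / real n) * (esc p n * ln (real n)) * (visit_moment p q (?m n) / ln (real n) powr q) \<le>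
  ?E n / (nlog q n)" if n: "n \<ge> 3" for n
 proof -
  have mn: "?m n <= n"
  proof -
   have "1 <= ln (real n)"
   proof -
    have "exp 1 <= real n" using exp_le n by linarith
    then show ?thesis using n by (subst ln_ge_iff) auto
   qed
   then have "1 <= (ln (real n)) ^ 6" by (rule one_le_power)
   then have "real n / (ln (real n)) ^ 6 <= real n" using n by (simp add: divide_le_eq mult_le_cancel_left1)
   then show ?thesis by linarith
  qed
  have "(real n - real (?m n)) * (esc p n * visit_moment p q (?m n)) = (\<Sum>k<n - ?m n. esc p n * visit_moment p q (?m n))"
   using mn by (simp add: of_nat_diff)
  also have "... <= (\<Sum>k<n - ?m n. esc p k * visit_moment p q (n - k))"
   by (intro sum_mono mult_mono visit_moment_mono b esc_antimono esc_range visit_moment_nonneg) auto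
  also have "... <= ?E n" unfolding E
   by (intro sum_mono2) (auto intro!: mult_nonneg_nonneg esc_range visit_moment_nonneg)
  finally have "(real n - real (?m n)) * (esc p n * visit_moment p q (?m n)) / (nlog q n) <= ?E n / (nlog q n)"
   by (intro divide_right_mono) auto
  also have "(real n - real (?m n)) * (esc p n * visit_moment p q (?m n)) / (nlog q n) =
   ((real n - real (?m n)) / real n) * (esc p n * ln (real n)) * (visit_moment p q (?m n) / ln (real n) powr q)"
   using n by (simp add: powr_diff)
  finally show ?thesis .
 qed
 have m1: "\<forall>\<^sub>F n in sequentially. ?m n \<ge> 2" using shrunk_time(1) by (simp add: filterlim_at_top)
 have vm: "(%n. visit_moment p q (?m n) / ln (real n) powr q) ----> Gamma (q + 1) * lam powr q"
 proof -
  have "(%n. visit_moment p q (?m n) / ln (real (?m n)) powr q * (ln (real (?m n)) / ln (real n)) powr q) ----> Gamma (q + 1) * lam powr q * 1 powr q"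
   by (intro tendsto_intros filterlim_compose[OF visit_moment_log[OF b] shrunk_time(1)] shrunk_time(2)) simp
  moreover have "\<forall>\<^sub>F n in sequentially. visit_moment p q (?m n) / ln (real (?m n)) powr q * (ln (real (?m n)) / ln (real n)) powr q = visit_moment p q (?m n) / ln (real n) powr q"
   using m1 eventually_ge_at_top[of 3]
  proof eventually_elim
   case (elim n)
   have "real (?m n) > 1" using elim(1) by linarith
   then have "ln (real (?m n)) > 0" by (rule ln_gt_zero)
   moreover have "ln (real n) > 0" using elim(2) by simp
   ultimately have "ln (real (?m n)) > 0" "ln (real n) > 0" by auto
   then show ?case by (simp add: powr_divide)
  qed
  ultimately show ?thesis by (simp add: filterlim_cong)
 qed
 have mr: "(%n. (real n - real (?m n)) / real n) ----> 1"
 proof -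
  have "(%n. 1 - (real (?m n) * ln (real n) / real n) * (1 / ln (real n))) ----> 1 - 0 * 0"
   by (intro tendsto_intros shrunk_time(3)) real_asymp
  moreover have "\<forall>\<^sub>F n in sequentially. 1 - (real (?m n) * ln (real n) / real n) * (1 / ln (real n)) = (real n - real (?m n)) / real n"
   using eventually_ge_at_top[of 3] by eventually_elim (simp add: field_simps)
  ultimately show ?thesis by (simp add: filterlim_cong)
 qed
 have upev: "\<forall>\<^sub>F n in sequentially. ?E n / (nlog q n) \<le>
   ((\<Sum>k<n. esc p k) * ln (real n) / real n) * (visit_moment p q n / ln (real n) powr q)"
  using eventually_ge_at_top[of 3] by eventually_elim (rule up)
 have lowev: "\<forall>\<^sub>F n in sequentially. ((real n - real (?m n)) / real n) * (esc p n * ln (real n)) * (visit_moment p q (?m n) / ln (real n) powr q) \<le>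
  ?E n / (nlog q n)"
  using eventually_ge_at_top[of 3] by eventually_elim (rule low)
 show ?thesis
 proof (rule tendsto_sandwich[OF lowev upev])
  have "(%n. ((real n - real (?m n)) / real n) * (esc p n * ln (real n)) * (visit_moment p q (?m n) / ln (real n) powr q)) ----> 1 * (1 / lam) * (Gamma (q + 1) * lam powr q)"
   by (intro tendsto_intros vm mr esc_asymp)
  moreover have "1 * (1 / lam) * (Gamma (q + 1) * lam powr q) = Gamma (q + 1) * lam powr (q - 1)"
   using pm[symmetric] by simp
  ultimately show "(%n. ((real n - real (?m n)) / real n) * (esc p n * ln (real n)) * (visit_moment p q (?m n) / ln (real n) powr q)) ----> Gamma (q + 1) * lam powr (q - 1)"
   by (simp only:)
  have "(%n. ((\<Sum>k<n. esc p k) * ln (real n) / real n) * (visit_moment p q n / ln (real n) powr q)) ----> (1 / lam) * (Gamma (q + 1) * lam powr q)"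
   by (intro tendsto_intros sum_esc_asymp visit_moment_log b)
  moreover have "(1 / lam) * (Gamma (q + 1) * lam powr q) = Gamma (q + 1) * lam powr (q - 1)"
   using pm[symmetric] by simp
  ultimately show "(%n. ((\<Sum>k<n. esc p k) * ln (real n) / real n) * (visit_moment p q n / ln (real n) powr q)) ----> Gamma (q + 1) * lam powr (q - 1)"
   by (simp only:)
 qed
qed

end

section \<open>Concentration of site functionals\<close>

lemma integrable_replicateI:
 fixes F :: "'a list => 'b::{banach, second_countable_topology}"
 assumes "\<And>xs. length xs = n ==> norm (F xs) <= c"
 shows "integrable (replicate_pmf n p) F"
 by (rule integrable_pmf_bounded) (blast intro: assms length_replicate_pmf)

definition range_card :: "'a::ab_group_add list => real" where
 "range_card xs = real (card (set (sites xs)))"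

lemma range_card_eq_Vsum: "range_card xs = Vsum (%j. if j = 0 then 0 else 1) xs"
proof -
 have "Vsum (%j. if j = 0 then 0 else 1) xs = (\<Sum>y\<in>set (sites xs). 1)"
  unfolding Vsum_def by (rule sum.cong[OF refl]) (metis cnt_eq_0_iff)
 then show ?thesis by (simp add: range_card_def)
qed

lemma range_card_nonneg: "0 <= range_card xs"
 by (simp add: range_card_def)

lemma range_card_le: "range_card xs <= real (length xs)"
 unfolding range_card_def using card_length[of "sites xs"] by simp

lemma range_card_append_ge: "range_card xs <= range_card (xs @ ys)"
 unfolding range_card_def by (auto simp: sites_append intro!: card_mono)

lemma Vsum_superset:
 assumes "finite U" "set (sites xs) \<subseteq> U" "f 0 = 0"
 shows "Vsum f xs = (\<Sum>y\<in>U. f (cnt xs y))"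
 unfolding Vsum_def
proof (rule sum.mono_neutral_left)
 show "\<forall>y\<in>U - set (sites xs). f (cnt xs y) = 0"
  using assms(3) cnt_eq_0_iff[of xs] by (metis DiffD2)
qed (use assms in auto)

lemma Vsum_bounds:
 assumes "\<And>j. 0 <= f j \<and> f j <= B"
 shows "0 <= Vsum f xs" "Vsum f xs <= B * range_card xs" "Vsum f xs <= B * real (length xs)"
proof -
 show "0 <= Vsum f xs" unfolding Vsum_def by (intro sum_nonneg) (use assms in auto)
 have "Vsum f xs <= (\<Sum>y\<in>set (sites xs). B)" unfolding Vsum_def by (intro sum_mono) (use assms in auto)
 then show 1: "Vsum f xs <= B * range_card xs" by (simp add: range_card_def mult.commute)
 have "B \<ge> 0" using assms[of 0] by linarith
 then show "Vsum f xs <= B * real (length xs)"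
  using 1 mult_left_mono[OF range_card_le[of xs], of B] by linarith
qed

text \<open>Only the sites common to both pieces contribute to the defect of additivity.\<close>
lemma Vsum_append_defect:
 fixes f :: "nat => real"
 assumes f0: "f 0 = 0" and f: "mono f" "\<And>j. f j <= B"
 shows "\<bar>Vsum f (xs @ ys) - Vsum f xs - Vsum f ys\<bar> <= B * (range_card xs + range_card ys - range_card (xs @ ys))"
proof -
 define s where "s = sum_list xs"
 define X where "X = set (sites xs)"
 define Y where "Y = (+) s ` set (sites ys)"
 have fn: "0 <= f j" for j using monoD[OF f(1), of 0 j] f0 by simp
 have fin: "finite X" "finite Y" by (auto simp: X_def Y_def)
 have XY: "set (sites (xs @ ys)) = X \<union> Y" by (simp add: sites_append X_def Y_def s_def)
 have Yiff: "cnt ys (y - s) = 0 \<longleftrightarrow> y \<notin> Y" for y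
  unfolding Y_def cnt_eq_0_iff by (auto simp: image_iff algebra_simps)
 have Xiff: "cnt xs y = 0 \<longleftrightarrow> y \<notin> X" for y unfolding X_def cnt_eq_0_iff ..
 have 1: "Vsum f (xs @ ys) = (\<Sum>y\<in>X \<union> Y. f (cnt xs y + cnt ys (y - s)))"
  unfolding Vsum_def XY by (simp add: cnt_append s_def)
 have 2: "Vsum f xs = (\<Sum>y\<in>X \<union> Y. f (cnt xs y))"
  by (rule Vsum_superset) (use fin f0 in \<open>auto simp: X_def\<close>)
 have "Vsum f ys = (\<Sum>y\<in>Y. f (cnt ys (y - s)))"
  unfolding Vsum_def Y_def by (subst sum.reindex) auto
 also have "... = (\<Sum>y\<in>X \<union> Y. f (cnt ys (y - s)))"
 proof (rule sum.mono_neutral_left)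
  show "\<forall>y\<in>X \<union> Y - Y. f (cnt ys (y - s)) = 0" using f0 Yiff by (metis DiffD2)
 qed (use fin in auto)
 finally have 3: "Vsum f ys = (\<Sum>y\<in>X \<union> Y. f (cnt ys (y - s)))" .
 have "\<bar>Vsum f (xs @ ys) - Vsum f xs - Vsum f ys\<bar> = \<bar>\<Sum>y\<in>X \<union> Y. f (cnt xs y + cnt ys (y - s)) - f (cnt xs y) - f (cnt ys (y - s))\<bar>"
  unfolding 1 2 3 by (simp add: sum_subtractf)
 also have "... <= (\<Sum>y\<in>X \<union> Y. if y \<in> X \<inter> Y then B else 0)"
 proof (rule order_trans[OF sum_abs], rule sum_mono)
  fix y assume y: "y \<in> X \<union> Y"
  let ?a = "cnt xs y" and ?d = "cnt ys (y - s)"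
  show "\<bar>f (?a + ?d) - f ?a - f ?d\<bar> <= (if y \<in> X \<inter> Y then B else 0)"
  proof (cases "y \<in> X \<inter> Y")
   case True
   have "f ?a <= f (?a + ?d)" "f ?d <= f (?a + ?d)" by (rule monoD[OF f(1)]; simp)+
   then show ?thesis using fn[of ?a] fn[of ?d] f(2)[of ?a] f(2)[of ?d] f(2)[of "?a + ?d"] True by auto
  next
   case False
   then have "?a = 0 \<or> ?d = 0" using Xiff Yiff by auto
   then show ?thesis using False f0 by auto
  qed
 qed
 also have "... = B * real (card (X \<inter> Y))"
 proof -
  have "(\<Sum>y\<in>X \<union> Y. if y \<in> X \<inter> Y then B else 0) = (\<Sum>y\<in>X \<inter> Y. B)"
   by (rule sum.mono_neutral_cong_right) (use fin in auto)
  then show ?thesis by (simp add: mult.commute)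
 qed
 also have "real (card (X \<inter> Y)) = range_card xs + range_card ys - range_card (xs @ ys)"
 proof -
  have "card Y = card (set (sites ys))" unfolding Y_def by (rule card_image) simp
  then show ?thesis using card_Un_Int[OF fin] unfolding range_card_def XY X_def[symmetric] by simp
 qed
 finally show ?thesis .
qed

primrec block_sum :: "('a list => real) => nat => nat => 'a list => real" where
 "block_sum F l 0 xs = 0"
| "block_sum F l (Suc M) xs = F (take l xs) + block_sum F l M (drop l xs)"

lemma block_sum_abs_le:
 assumes "\<And>xs. length xs <= l ==> \<bar>F xs\<bar> <= b"
 shows "\<bar>block_sum F l M xs\<bar> <= real M * b"
proof (induction M arbitrary: xs)
 case (Suc M)
 have "\<bar>F (take l xs)\<bar> <= b" by (rule assms) simp
 then show ?case using Suc[of "drop l xs"] by (simp add: algebra_simps)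
qed simp

lemma expectation_block_sum:
 assumes "\<And>xs. length xs <= l ==> \<bar>F xs\<bar> <= b"
 shows "wmean (M * l) p (block_sum F l M) =
  real M * wmean l p F"
proof (induction M)
 case (Suc M)
 have b: "b \<ge> 0" using assms[of "[]"] by auto
 have iF: "integrable (replicate_pmf l p) F"
  by (rule integrable_replicateI[where c=b]) (use assms in auto)
 have iB: "integrable (replicate_pmf (M * l) p) (block_sum F l M)"
  by (rule integrable_pmf_bounded[where c="real M * b"]) (use block_sum_abs_le[of l F b M, OF assms] in auto)
 have "wmean (Suc M * l) p (block_sum F l (Suc M)) =
   wmean l p (%xs. wmean (M * l) p (%ys. block_sum F l (Suc M) (xs @ ys)))"
  unfolding mult_Suc by (rule expectation_replicate_append[where c="real (Suc M) * b"])
    (use block_sum_abs_le[of l F b "Suc M", OF assms] in auto)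
 also have "... = wmean l p (%xs. F xs + wmean (M * l) p (block_sum F l M))"
  by (rule expectation_pmf_cong) (use iB in \<open>auto dest!: length_replicate_pmf\<close>)
 also have "... = real (Suc M) * wmean l p F"
  using iF by (simp add: Suc.IH algebra_simps)
 finally show ?case .
qed simp

text \<open>Blocks are independent, so variances add: the cross term with a centred block sum
  integrates to 0. Each block contributes at most the square of twice its supremum bound.\<close>

lemma variance_block_sum:
 fixes F :: "'a list => real" and p :: "'a pmf"
 assumes F: "\<And>xs. length xs <= l ==> \<bar>F xs\<bar> <= b"
 defines "\<mu> \<equiv> wmean l p F"
 shows "wmean (M * l) p (%xs. (block_sum F l M xs - real M * \<mu>)\<^sup>2) <= real M * (2 * b)\<^sup>2"
proof (induction M)
 case (Suc M)
 have b: "b \<ge> 0" using F[of "[]"] by auto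
 have mu: "\<bar>\<mu>\<bar> <= b"
 proof -
  have "norm \<mu> <= wmean l p (%x. norm (F x))"
   unfolding \<mu>_def by (rule integral_norm_bound)
  also have "... <= wmean l p (%x. b)"
   by (rule expectation_pmf_mono) (use F b in \<open>auto intro!: integrable_pmf_bounded[where c=b] dest!: length_replicate_pmf\<close>)
  finally show ?thesis by simp
 qed
 let ?v = "wmean (M * l) p (%xs. (block_sum F l M xs - real M * \<mu>)\<^sup>2)"
 have bs: "\<bar>block_sum F l K xs - real K * \<mu>\<bar> <= real K * (2 * b)" for K xs
 proof -
  have "\<bar>real K * \<mu>\<bar> <= real K * b" using mu by (simp add: abs_mult mult_left_mono)
  then show ?thesis using block_sum_abs_le[of l F b K xs, OF F] by (simp add: algebra_simps)
 qed
 have bs2: "\<bar>(block_sum F l K xs - real K * \<mu>)\<^sup>2\<bar> <= (real K * (2 * b))\<^sup>2" for K xs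
  using power_mono[OF bs[of K xs] abs_ge_zero, of 2] by simp
 have iB1: "integrable (replicate_pmf (M * l) p) (%ys. block_sum F l M ys - real M * \<mu>)"
  by (rule integrable_pmf_bounded[where c="real M * (2 * b)"]) (use bs in auto)
 have iB2: "integrable (replicate_pmf (M * l) p) (%ys. (block_sum F l M ys - real M * \<mu>)\<^sup>2)"
  by (rule integrable_pmf_bounded[where c="(real M * (2 * b))\<^sup>2"]) (use bs2 in auto)
 have iB0: "integrable (replicate_pmf (M * l) p) (block_sum F l M)"
  by (rule integrable_pmf_bounded[where c="real M * b"]) (use block_sum_abs_le[of l F b M, OF F] in auto)
 have zero: "wmean (M * l) p (%ys. block_sum F l M ys - real M * \<mu>) = 0"
  using iB0 by (simp add: expectation_block_sum[OF F] \<mu>_def)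
 have "wmean (Suc M * l) p (%xs. (block_sum F l (Suc M) xs - real (Suc M) * \<mu>)\<^sup>2) =
   wmean l p (%xs. wmean (M * l) p (%ys. (block_sum F l (Suc M) (xs @ ys) - real (Suc M) * \<mu>)\<^sup>2))"
  unfolding mult_Suc by (rule expectation_replicate_append[where c="(real (Suc M) * (2 * b))\<^sup>2"]) (rule bs2)
 also have "... = wmean l p (%xs. (F xs - \<mu>)\<^sup>2 + ?v)"
 proof (rule expectation_pmf_cong)
  fix xs assume "xs \<in> set_pmf (replicate_pmf l p)"
  then have l: "length xs = l" by (rule length_replicate_pmf)
  have "(%ys. (block_sum F l (Suc M) (xs @ ys) - real (Suc M) * \<mu>)\<^sup>2) =
    (%ys. (F xs - \<mu>)\<^sup>2 + 2 * (F xs - \<mu>) * (block_sum F l M ys - real M * \<mu>) + (block_sum F l M ys - real M * \<mu>)\<^sup>2)"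
   using l by (intro ext) (simp add: power2_eq_square algebra_simps)
  then have "wmean (M * l) p (%ys. (block_sum F l (Suc M) (xs @ ys) - real (Suc M) * \<mu>)\<^sup>2) =
   wmean (M * l) p (%ys. (F xs - \<mu>)\<^sup>2 + 2 * (F xs - \<mu>) * (block_sum F l M ys - real M * \<mu>) + (block_sum F l M ys - real M * \<mu>)\<^sup>2)"
   by simp
  also have "... = wmean (M * l) p (%ys. (F xs - \<mu>)\<^sup>2 + 2 * (F xs - \<mu>) * (block_sum F l M ys - real M * \<mu>)) + ?v"
   by (rule Bochner_Integration.integral_add[OF _ iB2]) (intro Bochner_Integration.integrable_add integrable_mult_right iB1, simp)
  also have "wmean (M * l) p (%ys. (F xs - \<mu>)\<^sup>2 + 2 * (F xs - \<mu>) * (block_sum F l M ys - real M * \<mu>)) =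
    wmean (M * l) p (%ys. (F xs - \<mu>)\<^sup>2) + wmean (M * l) p (%ys. 2 * (F xs - \<mu>) * (block_sum F l M ys - real M * \<mu>))"
   by (rule Bochner_Integration.integral_add) (simp, intro integrable_mult_right iB1)
  also have "... = (F xs - \<mu>)\<^sup>2" using zero by (simp only: integral_mult_right_zero) simp
  finally show "wmean (M * l) p (%ys. (block_sum F l (Suc M) (xs @ ys) - real (Suc M) * \<mu>)\<^sup>2) = (F xs - \<mu>)\<^sup>2 + ?v" .
 qed
 also have "... <= wmean l p (%xs. (2 * b)\<^sup>2 + ?v)"
 proof (rule expectation_pmf_mono)
  have le: "(F xs - \<mu>)\<^sup>2 <= (2 * b)\<^sup>2" if "length xs = l" for xs
  proof -
   have "\<bar>F xs - \<mu>\<bar> <= 2 * b" using F[of xs] mu that by auto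
   from power_mono[OF this, of 2] show ?thesis by simp
  qed
  show "integrable (replicate_pmf l p) (%xs. (F xs - \<mu>)\<^sup>2 + ?v)"
   by (rule Bochner_Integration.integrable_add)
     (use le in \<open>auto intro!: integrable_pmf_bounded[where c="(2*b)\<^sup>2"] dest!: length_replicate_pmf\<close>)
  show "(F xs - \<mu>)\<^sup>2 + ?v <= (2 * b)\<^sup>2 + ?v" if "xs \<in> set_pmf (replicate_pmf l p)" for xs
   using le length_replicate_pmf[OF that] by simp
 qed simp
 also have "... <= real (Suc M) * (2 * b)\<^sup>2" using Suc.IH by (simp add: algebra_simps)
 finally show ?case .
qed simp

text \<open>Induction on the blocks: the additivity defects telescope into the defect of the range,
  which is the same quantity for every admissible f and has an explicit expectation.\<close>

lemma Vsum_block_defect: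
 fixes f :: "nat => real"
 assumes f0: "f 0 = 0" and f: "mono f" "\<And>j. f j <= B" and len: "length xs = M * l"
 shows "\<bar>Vsum f xs - block_sum (Vsum f) l M xs\<bar> <= B * (block_sum range_card l M xs - range_card xs)"
 using len
proof (induction M arbitrary: xs)
 case 0
 then show ?case by (simp add: Vsum_def range_card_def)
next
 case (Suc M)
 let ?x = "take l xs" and ?y = "drop l xs"
 have "\<bar>Vsum f ?y - block_sum (Vsum f) l M ?y\<bar> <= B * (block_sum range_card l M ?y - range_card ?y)"
  by (rule Suc.IH) (use Suc.prems in auto)
 moreover have "\<bar>Vsum f (?x @ ?y) - Vsum f ?x - Vsum f ?y\<bar> <= B * (range_card ?x + range_card ?y - range_card (?x @ ?y))"
  by (rule Vsum_append_defect[OF f0 f])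
 ultimately show ?case unfolding append_take_drop_id by (simp add: algebra_simps)
qed

text \<open>From 2 * v * |F| \<le> F^2 + v^2, where v is an upper bound for the root mean
  square.\<close>

lemma expectation_abs_le_sqrt:
 assumes "integrable (measure_pmf P) (%x. (F x :: real)\<^sup>2)" "integrable (measure_pmf P) F"
  "mean P (%x. (F x)\<^sup>2) <= v\<^sup>2" "v > 0"
 shows "mean P (%x. \<bar>F x\<bar>) <= v"
proof -
 have "\<bar>F x\<bar> <= (F x)\<^sup>2 / (2 * v) + v / 2" for x
 proof -
  have "0 <= (\<bar>F x\<bar> - v)\<^sup>2" by simp
  then have "2 * v * \<bar>F x\<bar> <= (F x)\<^sup>2 + v\<^sup>2" by (simp add: power2_diff mult_ac)
  then show ?thesis using assms(4) by (simp add: field_simps power2_eq_square)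
 qed
 then have "mean P (%x. \<bar>F x\<bar>) <= mean P (%x. (F x)\<^sup>2 / (2 * v) + v / 2)"
  by (intro integral_mono) (use assms in auto)
 also have "... = mean P (%x. (F x)\<^sup>2) / (2 * v) + v / 2"
  using assms by simp
 also have "... <= v\<^sup>2 / (2 * v) + v / 2" using assms by (intro add_right_mono divide_right_mono) auto
 also have "... = v" using assms(4) by (simp add: power2_eq_square)
 finally show ?thesis .
qed

text \<open>Time k discovers a new site with probability \<open>esc p k\<close>.\<close>

lemma expectation_range_card:
 "wmean n p range_card = (\<Sum>k<n. esc p k)"
proof -
 have "wmean n p range_card = wmean n p (Vsum (%j. if j = 0 then 0 else 1))"
  by (simp add: range_card_eq_Vsum[abs_def])
 also have "... = (\<Sum>k<n. esc p k * wmean (n - k) p (%xs. if cnt xs 0 = 0 then 0 else 1))"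
  by (rule expectation_Vsum) auto
 also have "... = (\<Sum>k<n. esc p k)"
 proof (rule sum.cong[OF refl])
  fix k assume "k \<in> {..<n}"
  then have "vis p (n - k) (Suc 0) = 1" by (intro vis_1) auto
  moreover have "(%xs. if cnt xs 0 = 0 then 0 else 1 :: real) = (%xs :: 'a list. if Suc 0 <= cnt xs 0 then 1 else 0)"
   by (intro ext) auto
  ultimately have "wmean (n - k) p (%xs. if cnt xs 0 = 0 then 0 else 1 :: real) = 1"
   unfolding vis_def prob_eq_expectation by simp
  then show "esc p k * wmean (n - k) p (%xs. if cnt xs 0 = 0 then 0 else 1) = esc p k" by simp
 qed
 finally show ?thesis .
qed

text \<open>Three errors: the r left-over steps, the overlap of the ranges of the blocks, and the
  fluctuation of a sum of M independent blocks. The mean overlap is a difference of sums of escape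
  probabilities, hence small once \<open>esc\<close> varies slowly.\<close>

lemma Vsum_concentration:
 fixes f :: "nat => real" and p :: "'a::ab_group_add pmf"
 assumes f0: "f 0 = 0" and f: "mono f" "\<And>j. f j <= B" and l: "l > 0" and B: "B > 0" and M: "M > 0"
 defines "\<mu> \<equiv> wmean l p (Vsum f)"
 shows "wmean (M * l + r) p (%xs. \<bar>Vsum f xs - real M * \<mu>\<bar>) \<le>
  B * (3 * real r + (real M * (\<Sum>k<l. esc p k) - (\<Sum>k<M * l + r. esc p k)) + 2 * sqrt (real M) * real l)"
proof -
 let ?P = "replicate_pmf (M * l) p" and ?Q = "replicate_pmf (M * l + r) p"
 have fB: "0 <= f j \<and> f j <= B" for j using monoD[OF f(1), of 0 j] f0 f(2)[of j] by simp
 have Vb: "\<bar>Vsum f xs\<bar> <= B * real (length xs)" for xs :: "'a list" using Vsum_bounds[of f B xs, OF fB] by simp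
 have Vl: "\<bar>Vsum f xs\<bar> <= B * real l" if "length xs <= l" for xs :: "'a list"
  by (rule order_trans[OF Vb]) (use that B in simp)
 have Rl: "\<bar>range_card xs\<bar> <= real l" if "length xs <= l" for xs :: "'a list"
  using range_card_le[of xs] range_card_nonneg[of xs] that by simp
 have iV: "integrable (replicate_pmf n p) (Vsum f)" for n
  by (rule integrable_replicateI[where c="B * real n"]) (use Vb in auto)
 have iR: "integrable (replicate_pmf n p) range_card" for n
  by (rule integrable_replicateI[where c="real n"]) (use range_card_le in \<open>auto simp: abs_of_nonneg[OF range_card_nonneg]\<close>)
 have iBV: "integrable ?P (block_sum (Vsum f) l M)"
  by (rule integrable_pmf_bounded[where c="real M * (B * real l)"]) (use block_sum_abs_le[of l "Vsum f :: 'a list => real" "B * real l" M, OF Vl] in auto)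
 have iBR: "integrable ?P (block_sum range_card l M)"
  by (rule integrable_pmf_bounded[where c="real M * real l"]) (use block_sum_abs_le[of l "range_card :: 'a list => real" "real l" M, OF Rl] in auto)
 have part1: "mean ?P (%xs. \<bar>Vsum f xs - real M * \<mu>\<bar>) \<le>
  B * (real M * (\<Sum>k<l. esc p k) - (\<Sum>k<M * l. esc p k)) + 2 * sqrt (real M) * (B * real l)"
 proof -
  have "mean ?P (%xs. \<bar>Vsum f xs - real M * \<mu>\<bar>) \<le>
   mean ?P (%xs. B * (block_sum range_card l M xs - range_card xs) + \<bar>block_sum (Vsum f) l M xs - real M * \<mu>\<bar>)"
  proof (rule expectation_pmf_mono)
   fix xs assume "xs \<in> set_pmf ?P"
   then have "length xs = M * l" by (rule length_replicate_pmf)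
   from Vsum_block_defect[where f=f and B=B, OF f0 f this]
   show "\<bar>Vsum f xs - real M * \<mu>\<bar> <= B * (block_sum range_card l M xs - range_card xs) + \<bar>block_sum (Vsum f) l M xs - real M * \<mu>\<bar>" by linarith
  qed (use iV iR iBV iBR in \<open>auto intro!: integrable_abs\<close>)
  also have "... = B * (mean ?P (block_sum range_card l M) - mean ?P range_card) +
    mean ?P (%xs. \<bar>block_sum (Vsum f) l M xs - real M * \<mu>\<bar>)"
   using iR iBR iBV by (subst Bochner_Integration.integral_add) (auto intro!: integrable_abs)
  also have "mean ?P (block_sum range_card l M) = real M * (\<Sum>k<l. esc p k)"
   by (simp add: expectation_block_sum[OF Rl] expectation_range_card)
  also have "mean ?P range_card = (\<Sum>k<M * l. esc p k)" by (rule expectation_range_card)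
  also have "mean ?P (%xs. \<bar>block_sum (Vsum f) l M xs - real M * \<mu>\<bar>) <= 2 * sqrt (real M) * (B * real l)"
  proof (rule expectation_abs_le_sqrt)
   have "mean ?P (%xs. (block_sum (Vsum f) l M xs - real M * \<mu>)\<^sup>2) <= real M * (2 * (B * real l))\<^sup>2"
    unfolding \<mu>_def by (rule variance_block_sum[OF Vl])
   also have "... = (2 * sqrt (real M) * (B * real l))\<^sup>2" by (simp add: power_mult_distrib)
   finally show "mean ?P (%xs. (block_sum (Vsum f) l M xs - real M * \<mu>)\<^sup>2) <= (2 * sqrt (real M) * (B * real l))\<^sup>2" .
   have "\<bar>block_sum (Vsum f) l M xs - real M * \<mu>\<bar> <= real M * (B * real l) + \<bar>real M * \<mu>\<bar>" for xs :: "'a list"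
    using block_sum_abs_le[of l "Vsum f :: 'a list => real" "B * real l" M xs, OF Vl] by linarith
   from power_mono[OF this abs_ge_zero, where n=2]
   show "integrable ?P (%xs. (block_sum (Vsum f) l M xs - real M * \<mu>)\<^sup>2)"
    by (intro integrable_pmf_bounded[where c="(real M * (B * real l) + \<bar>real M * \<mu>\<bar>)\<^sup>2"]) simp
  qed (use iBV M l B in auto)
  finally show ?thesis by simp
 qed
 \<comment> \<open>Dropping the last r steps costs \<open>B * r\<close> twice: once for their own
   contribution and once for the additivity defect.\<close>
 have "mean ?Q (%xs. \<bar>Vsum f xs - real M * \<mu>\<bar>) \<le>
  mean ?Q (%xs. \<bar>Vsum f (take (M * l) xs) - real M * \<mu>\<bar> + 2 * B * real r)"
 proof (rule expectation_pmf_mono)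
  fix xs assume "xs \<in> set_pmf ?Q"
  then have len: "length xs = M * l + r" by (rule length_replicate_pmf)
  let ?x = "take (M * l) xs" and ?y = "drop (M * l) xs"
  have "\<bar>Vsum f (?x @ ?y) - Vsum f ?x - Vsum f ?y\<bar> <= B * (range_card ?x + range_card ?y - range_card (?x @ ?y))"
   by (rule Vsum_append_defect[OF f0 f])
  also have "... <= B * range_card ?y"
   using range_card_append_ge[of ?x ?y] B by (intro mult_left_mono) auto
  also have "... <= B * real r" using range_card_le[of ?y] len B by (intro mult_left_mono) auto
  finally show "\<bar>Vsum f xs - real M * \<mu>\<bar> <= \<bar>Vsum f ?x - real M * \<mu>\<bar> + 2 * B * real r"
   using Vb[of ?y] len unfolding append_take_drop_id by simp
 next
  have "\<bar>Vsum f (take (M * l) xs)\<bar> <= B * real (M * l)" for xs :: "'a list"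
   by (rule order_trans[OF Vb]) (rule mult_left_mono, simp only: of_nat_le_iff length_take min.cobounded2, use B in simp)
  then have "integrable ?Q (%xs. Vsum f (take (M * l) xs))"
   by (intro integrable_pmf_bounded[where c="B * real (M * l)"]) simp
  then show "integrable ?Q (%xs. \<bar>Vsum f (take (M * l) xs) - real M * \<mu>\<bar> + 2 * B * real r)"
   by (auto intro!: integrable_abs)
 qed (use iV in \<open>auto intro!: integrable_abs\<close>)
 also have "... = mean ?P (%xs. \<bar>Vsum f xs - real M * \<mu>\<bar> + 2 * B * real r)"
 proof -
  have "\<bar>\<bar>Vsum f xs - real M * \<mu>\<bar> + 2 * B * real r\<bar> <= B * real (M * l) + \<bar>real M * \<mu>\<bar> + 2 * B * real r" if "length xs = M * l" for xs :: "'a list"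
   using Vb[of xs] that B by simp
  then have "mean ?Q (%xs. (\<bar>Vsum f (take (M * l) xs) - real M * \<mu>\<bar> + 2 * B * real r) * (%_. 1) (drop (M * l) xs)) =
   mean ?P (%xs. \<bar>Vsum f xs - real M * \<mu>\<bar> + 2 * B * real r) * wmean (M * l + r - M * l) p (%_. 1)"
   by (intro expectation_replicate_split[where c="B * real (M * l) + \<bar>real M * \<mu>\<bar> + 2 * B * real r" and d=1]) auto
  then show ?thesis by simp
 qed
 also have "... = mean ?P (%xs. \<bar>Vsum f xs - real M * \<mu>\<bar>) + 2 * B * real r"
  using iV by simp
 also have "... <= B * (real M * (\<Sum>k<l. esc p k) - (\<Sum>k<M * l. esc p k)) + 2 * sqrt (real M) * (B * real l) + 2 * B * real r"
  using part1 by simp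
 \<comment> \<open>The third \<open>B * r\<close>: extending the sum of escape probabilities from M
   * l to M * l + r adds at most r.\<close>
 also have "... <= B * (3 * real r + (real M * (\<Sum>k<l. esc p k) - (\<Sum>k<M * l + r. esc p k)) + 2 * sqrt (real M) * real l)"
 proof -
  have "(\<Sum>k<M * l + r. esc p k) = (\<Sum>k<M * l. esc p k) + (\<Sum>k\<in>{M * l..<M * l + r}. esc p k)"
   by (metis le_add1 lessThan_atLeast0 sum.atLeastLessThan_concat zero_le)
  also have "(\<Sum>k\<in>{M * l..<M * l + r}. esc p k) <= (\<Sum>k\<in>{M * l..<M * l + r}. 1)"
   by (intro sum_mono esc_range)
  finally have "(\<Sum>k<M * l + r. esc p k) <= (\<Sum>k<M * l. esc p k) + real r" by simp
  then have "B * (\<Sum>k<M * l + r. esc p k) <= B * ((\<Sum>k<M * l. esc p k) + real r)" using B by (intro mult_left_mono) auto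
  then show ?thesis by (simp add: algebra_simps)
 qed
 finally show ?thesis .
qed

section \<open>Power sums of the visit counts: truncation and convergence in mean\<close>

abbreviation Vpow :: "real => 'a::ab_group_add list => real" where
 "Vpow q \<equiv> Vsum (%j. real j powr q)"

lemma Vpow_nonneg: "Vpow q xs \<ge> 0"
 unfolding Vsum_def by (intro sum_nonneg) auto

lemma Vpow_le:
 assumes "q \<ge> 0"
 shows "Vpow q xs <= real (length xs) powr q * real (length xs)"
proof -
 have "Vpow q xs <= (\<Sum>y\<in>set (sites xs). real (length xs) powr q)"
  unfolding Vsum_def by (intro sum_mono powr_mono2) (use assms cnt_le_length in auto)
 also have "... = real (length xs) powr q * range_card xs" by (simp add: range_card_def)
 also have "... <= real (length xs) powr q * real (length xs)"
  by (intro mult_left_mono range_card_le) auto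
 finally show ?thesis .
qed

lemma integrable_Vpow: "q \<ge> 0 ==> integrable (replicate_pmf n p) (Vpow q)"
 by (rule integrable_replicateI[where c="real n powr q * real n"])
   (use Vpow_le in \<open>auto simp: abs_of_nonneg[OF Vpow_nonneg]\<close>)

text \<open>Only counts j > T lose anything, and for them j powr q is at most j powr (q + 1) / T.
  Truncation bounds the contribution of a single site, as the block argument requires; its price is
  a moment of one higher order.\<close>

lemma Vpow_truncation:
 assumes "q > 0" "T > 0"
 shows "0 <= Vpow q xs - Vsum (%j. min (real j) T powr q) xs"
  "Vpow q xs - Vsum (%j. min (real j) T powr q) xs <= Vpow (q + 1) xs / T"
proof -
 have eq: "Vpow q xs - Vsum (%j. min (real j) T powr q) xs = Vsum (%j. real j powr q - min (real j) T powr q) xs"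
  unfolding Vsum_def by (simp add: sum_subtractf)
 show "0 <= Vpow q xs - Vsum (%j. min (real j) T powr q) xs"
  unfolding eq unfolding Vsum_def by (intro sum_nonneg) (use assms in \<open>auto intro!: powr_mono2\<close>)
 have "real j powr q - min (real j) T powr q <= real j powr (q + 1) / T" for j
 proof (cases "real j <= T")
  case False
  then have "real j powr q * T <= real j powr q * real j" by (intro mult_left_mono) auto
  also have "... = real j powr (q + 1)" using assms False by (simp add: powr_add)
  finally have "real j powr q <= real j powr (q + 1) / T" using assms by (simp add: field_simps)
  moreover have "min (real j) T powr q \<ge> 0" by simp
  ultimately show ?thesis by linarith
 qed (use assms in auto)
 then show "Vpow q xs - Vsum (%j. min (real j) T powr q) xs <= Vpow (q + 1) xs / T"
  unfolding eq unfolding Vsum_def sum_divide_distrib by (intro sum_mono)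
qed

text \<open>Concentration about any constant c implies concentration about the mean, up to a factor
  2. In the application c is M times the block mean of the truncated functional, which is never
  evaluated.\<close>

lemma abs_deviation_le:
 fixes V F :: "'a => real"
 assumes i: "integrable (measure_pmf P) V" "integrable (measure_pmf P) F"
 shows "mean P (%x. \<bar>V x - mean P V\<bar>) \<le>
  2 * (mean P (%x. \<bar>V x - F x\<bar>) + mean P (%x. \<bar>F x - c\<bar>))"
proof -
 let ?E = "mean P"
 have Vc: "?E (%x. \<bar>V x - c\<bar>) <= ?E (%x. \<bar>V x - F x\<bar>) + ?E (%x. \<bar>F x - c\<bar>)"
 proof -
  have "?E (%x. \<bar>V x - c\<bar>) <= ?E (%x. \<bar>V x - F x\<bar> + \<bar>F x - c\<bar>)"
   by (intro integral_mono) (use i in \<open>auto intro!: integrable_abs\<close>)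
  also have "... = ?E (%x. \<bar>V x - F x\<bar>) + ?E (%x. \<bar>F x - c\<bar>)"
   by (intro Bochner_Integration.integral_add) (use i in \<open>auto intro!: integrable_abs\<close>)
  finally show ?thesis .
 qed
 have "\<bar>c - ?E V\<bar> = \<bar>?E (%x. V x - c)\<bar>" using i by (simp add: abs_minus_commute)
 also have "... <= ?E (%x. \<bar>V x - c\<bar>)" by (rule integral_abs_bound)
 finally have 2: "\<bar>c - ?E V\<bar> <= ?E (%x. \<bar>V x - c\<bar>)" .
 have "?E (%x. \<bar>V x - ?E V\<bar>) <= ?E (%x. \<bar>V x - c\<bar> + \<bar>c - ?E V\<bar>)"
  by (intro integral_mono) (use i in \<open>auto intro!: integrable_abs\<close>)
 also have "... = ?E (%x. \<bar>V x - c\<bar>) + \<bar>c - ?E V\<bar>"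
  by (subst Bochner_Integration.integral_add) (use i in \<open>auto intro!: integrable_abs\<close>)
 also have "... <= ?E (%x. \<bar>V x - c\<bar>) + ?E (%x. \<bar>V x - c\<bar>)"
  by (rule add_left_mono[OF 2])
 also have "... <= (?E (%x. \<bar>V x - F x\<bar>) + ?E (%x. \<bar>F x - c\<bar>)) + (?E (%x. \<bar>V x - F x\<bar>) + ?E (%x. \<bar>F x - c\<bar>))"
  by (rule add_mono[OF Vc Vc])
 finally show ?thesis by (simp only: mult_2)
qed

context log_green_walk begin

text \<open>Truncation at T, then a cut into blocks of length l. The parameter m enters through
  \<open>sum_esc_le\<close>, which bounds the sum of \<open>esc\<close> over a block by splitting it
  at time m.\<close>

lemma Vpow_deviation:
 assumes b: "q > 0" and T: "T > 0" and l: "0 < l" "l <= n"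
 shows "wmean n p (%xs. \<bar>Vpow q xs - wmean n p (Vpow q)\<bar>) \<le>
  2 * (wmean n p (Vpow (q + 1)) / T) +
  2 * T powr q * (3 * real l + real n * real m / real l + real n * (esc p m - esc p n) + 2 * sqrt (real n * real l))"
proof -
 define M where "M = n div l"
 define r where "r = n mod l"
 have n: "n = M * l + r" by (simp add: M_def r_def)
 have M: "M > 0" unfolding M_def using l by (simp add: div_greater_zero_iff)
 have Ml: "real M * real l <= real n" using n by (metis le_add1 of_nat_le_iff of_nat_mult)
 define f where "f j = min (real j) T powr q" for j
 let ?E = "wmean n p"
 let ?c = "real M * wmean l p (Vsum f)"
 have fB: "0 <= f j \<and> f j <= T powr q" for j
  unfolding f_def using T b by (auto intro!: powr_mono2)
 have iF: "integrable (replicate_pmf n p) (Vsum f)"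
  by (rule integrable_replicateI[where c="T powr q * real n"])
    (use Vsum_bounds[of f "T powr q", OF fB] in \<open>auto simp: abs_if not_less[symmetric]\<close>)
 have "?E (%xs. \<bar>Vpow q xs - ?E (Vpow q)\<bar>) <= 2 * (?E (%x. \<bar>Vpow q x - Vsum f x\<bar>) + ?E (%x. \<bar>Vsum f x - ?c\<bar>))"
  by (rule abs_deviation_le[OF integrable_Vpow iF]) (use b in simp)
 also have "?E (%x. \<bar>Vpow q x - Vsum f x\<bar>) <= ?E (%x. Vpow (q + 1) x / T)"
 proof (rule integral_mono)
  show "\<bar>Vpow q x - Vsum f x\<bar> <= Vpow (q + 1) x / T" for x :: "'a list"
   unfolding f_def[abs_def] by (metis abs_of_nonneg Vpow_truncation b T)
 qed (use iF b integrable_Vpow[of _ n p] in \<open>auto intro!: integrable_abs\<close>)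
 also have "?E (%x. Vpow (q + 1) x / T) = ?E (Vpow (q + 1)) / T" by simp
 also have "?E (%x. \<bar>Vsum f x - ?c\<bar>) <= T powr q * (3 * real r + (real M * (\<Sum>k<l. esc p k) - (\<Sum>k<n. esc p k)) + 2 * sqrt (real M) * real l)"
  unfolding n by (rule Vsum_concentration)
    (use fB l M T b in \<open>auto simp: mono_def f_def intro!: powr_mono2\<close>)
 also have "... <= T powr q * (3 * real l + real n * real m / real l + real n * (esc p m - esc p n) + 2 * sqrt (real n * real l))"
 proof (rule mult_left_mono)
  have "real r <= real l" using l by (simp add: r_def less_imp_le)
  moreover have "real M * (\<Sum>k<l. esc p k) <= real n * real m / real l + real n * esc p m"
  proof -
   have "real M * (\<Sum>k<l. esc p k) <= real M * (real m + real l * esc p m)"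
    by (intro mult_left_mono sum_esc_le) auto
   also have "... = (real M * real l) * (real m / real l) + (real M * real l) * esc p m"
    using l by (simp add: algebra_simps)
   also have "... <= real n * (real m / real l) + real n * esc p m"
    by (intro add_mono mult_right_mono Ml) (auto simp: esc_range)
   finally show ?thesis by simp
  qed
  moreover have "real n * esc p n <= (\<Sum>k<n. esc p k)"
  proof -
   have "real n * esc p n = (\<Sum>k<n. esc p n)" by simp
   also have "... <= (\<Sum>k<n. esc p k)" by (intro sum_mono esc_antimono) auto
   finally show ?thesis .
  qed
  moreover have "sqrt (real M) * real l <= sqrt (real n * real l)"
  proof -
   have "sqrt (real M) * real l = sqrt (real M * real l * real l)"
    by (simp add: real_sqrt_mult)
   also have "... <= sqrt (real n * real l)" using Ml by (intro real_sqrt_le_mono mult_right_mono) auto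
   finally show ?thesis .
  qed
  ultimately show "3 * real r + (real M * (\<Sum>k<l. esc p k) - (\<Sum>k<n. esc p k)) + 2 * sqrt (real M) * real l
   <= 3 * real l + real n * real m / real l + real n * (esc p m - esc p n) + 2 * sqrt (real n * real l)"
   by (simp add: algebra_simps)
 qed simp
 finally show ?thesis by (simp add: algebra_simps)
qed

lemma Vpow_deviation_scaled:
 assumes b: "q > 0"
 shows "\<exists>h. h ----> 0 \<and> (\<forall>\<^sub>F n in sequentially. \<forall>K>0.
  wmean n p (%xs. \<bar>Vpow q xs - wmean n p (Vpow q)\<bar>) / (nlog q n) \<le>
  2 / K * (wmean n p (Vpow (q + 1)) / (real n * ln (real n) powr q)) + 2 * K powr q * h n)"
proof -
 \<comment> \<open>With T = K * ln n and the target n * ln n powr (q - 1), errors of size o(n / ln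
   n) are affordable. Blocks of length n / (ln n) ^ 4 make sqrt (n * l) about n / (ln n)^2, and m of
   order n / (ln n) ^ 6 makes n * m / l of the same order.\<close>
 define l where "l n = nat \<lfloor>real n / (ln (real n)) ^ 4\<rfloor>" for n
 define m where "m n = nat \<lfloor>real n / (ln (real n)) ^ 6\<rfloor>" for n
 define h where "h n = 3 / ln (real n) ^ 3 + 4 / ln (real n) + (esc p (m n) * ln (real n) - esc p n * ln (real n))" for n
 have h0: "h ----> 0"
 proof -
  have "(%n. 3 / ln (real n) ^ 3 + 4 / ln (real n)) ----> 0" by real_asymp
  from tendsto_add[OF this tendsto_diff[OF shrunk_time(4) esc_asymp]]
  show ?thesis unfolding h_def m_def by simp
 qed
 have "\<forall>\<^sub>F n in sequentially. real n / (ln (real n)) ^ 4 \<ge> 2" by real_asymp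
 moreover have "\<forall>\<^sub>F n in sequentially. ln (real n) \<ge> 1" by real_asymp
 ultimately have "\<forall>\<^sub>F n in sequentially. \<forall>K>0.
  wmean n p (%xs. \<bar>Vpow q xs - wmean n p (Vpow q)\<bar>) / (nlog q n) \<le>
  2 / K * (wmean n p (Vpow (q + 1)) / (real n * ln (real n) powr q)) + 2 * K powr q * h n"
  using eventually_ge_at_top[of 3]
 proof eventually_elim
  case (elim n)
  define L where "L = ln (real n)"
  have L: "L \<ge> 1" using elim by (simp add: L_def)
  have np: "real n > 0" using elim by simp
  have lub: "real (l n) <= real n / L ^ 4" unfolding l_def L_def using elim by (intro of_nat_floor) auto
  have llb: "real n / (2 * L ^ 4) <= real (l n)"
  proof -
   have "real n / L ^ 4 - 1 <= real (l n)" unfolding l_def L_def by linarith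
   then show ?thesis using elim(1) unfolding L_def[symmetric] by (simp add: field_simps)
  qed
  have mub: "real (m n) <= real n / L ^ 6" unfolding m_def L_def using elim by (intro of_nat_floor) auto
  have lpos: "0 < l n" using llb L np by (metis of_nat_0_less_iff divide_pos_pos less_le_trans mult_pos_pos zero_less_numeral zero_less_one zero_less_power)
  have ln': "l n <= n"
  proof -
   have "real n / L ^ 4 <= real n" using L np by (simp add: divide_le_eq mult_le_cancel_left1)
   then show ?thesis using lub by linarith
  qed
  show ?case
  proof (intro allI impI)
   fix K :: real assume K: "K > 0"
   let ?V = "wmean n p (%xs. \<bar>Vpow q xs - wmean n p (Vpow q)\<bar>)"
   let ?W = "wmean n p (Vpow (q + 1))"
   have "?V <= 2 * (?W / (K * L)) + 2 * (K * L) powr q * (3 * real (l n) + real n * real (m n) / real (l n) + real n * (esc p (m n) - esc p n) + 2 * sqrt (real n * real (l n)))"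
    by (rule Vpow_deviation) (use b K L lpos ln' in auto)
   also have "... <= 2 * (?W / (K * L)) + 2 * (K * L) powr q * (3 * (real n / L ^ 4) + 2 * real n / L ^ 2 + real n * (esc p (m n) - esc p n) + 2 * (real n / L ^ 2))"
   proof (intro add_left_mono mult_left_mono add_mono lub order_refl)
    have "real n * real (m n) / real (l n) <= real n * (real n / L ^ 6) / (real n / (2 * L ^ 4))"
     using mub llb np L by (intro frac_le mult_left_mono) auto
    also have "... = 2 * real n / L ^ 2" using np L by (simp add: field_simps power_numeral_reduce)
    finally show "real n * real (m n) / real (l n) <= 2 * real n / L ^ 2" .
    have "sqrt (real n * real (l n)) <= sqrt ((real n / L ^ 2)\<^sup>2)"
    proof (intro real_sqrt_le_mono)
     have "real n * real (l n) <= real n * (real n / L ^ 4)" using lub np by (intro mult_left_mono) auto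
     also have "... = (real n / L ^ 2)\<^sup>2" by (simp add: power_divide power2_eq_square power_numeral_reduce)
     finally show "real n * real (l n) <= (real n / L ^ 2)\<^sup>2" .
    qed
    then show "sqrt (real n * real (l n)) <= real n / L ^ 2" using L np by simp
   qed auto
   finally have "?V / (real n * L powr (q - 1)) <= (2 * (?W / (K * L)) + 2 * (K * L) powr q * (3 * (real n / L ^ 4) + 2 * real n / L ^ 2 + real n * (esc p (m n) - esc p n) + 2 * (real n / L ^ 2))) / (real n * L powr (q - 1))"
    by (intro divide_right_mono) auto
   also have "... = 2 / K * (?W / (real n * L powr q)) + 2 * K powr q * h n"
   proof -
    have p1: "L powr (q - 1) = L powr q / L" using L by (simp add: powr_diff)
    have p2: "(K * L) powr q = K powr q * L powr q" using L K by (simp add: powr_mult)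
    have p3: "L powr q > 0" using L by simp
    have a: "2 * (?W / (K * L)) / (real n * L powr (q - 1)) = 2 / K * (?W / (real n * L powr q))"
     unfolding p1 using L K np by (simp add: field_simps)
    have b: "2 * (K * L) powr q * (3 * (real n / L ^ 4) + 2 * real n / L ^ 2 + real n * (esc p (m n) - esc p n) + 2 * (real n / L ^ 2)) / (real n * L powr (q - 1)) =
     2 * K powr q * (L * (3 / L ^ 4 + 2 / L ^ 2 + (esc p (m n) - esc p n) + 2 / L ^ 2))"
     unfolding p1 p2 using L np p3 by (simp add: field_simps)
    have c: "L * (3 / L ^ 4 + 2 / L ^ 2 + (esc p (m n) - esc p n) + 2 / L ^ 2) = h n"
     unfolding h_def L_def[symmetric] using L by (simp add: field_simps power_numeral_reduce)
    show ?thesis unfolding add_divide_distrib a b c ..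
   qed
   finally show "?V / (nlog q n) <= 2 / K * (?W / (real n * ln (real n) powr q)) + 2 * K powr q * h n"
    unfolding L_def .
  qed
 qed
 with h0 show ?thesis by blast
qed

theorem Vpow_L1:
 assumes b: "q > 0"
 shows "(%n. wmean n p
  (%xs. \<bar>Vpow q xs / (nlog q n) - Gamma (q + 1) * lam powr (q - 1)\<bar>)) ----> 0"
proof (rule LIMSEQ_I)
 fix \<epsilon> :: real assume e: "\<epsilon> > 0"
 obtain h where h: "h ----> 0" and ev: "\<forall>\<^sub>F n in sequentially. \<forall>K>0.
  wmean n p (%xs. \<bar>Vpow q xs - wmean n p (Vpow q)\<bar>) / (nlog q n) \<le>
  2 / K * (wmean n p (Vpow (q + 1)) / (real n * ln (real n) powr q)) + 2 * K powr q * h n"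
  using Vpow_deviation_scaled[OF b] by blast
 let ?\<kappa> = "Gamma (q + 1) * lam powr (q - 1)"
 let ?c = "%n. real n * ln (real n) powr (q - 1)"
 let ?E = "%n. wmean n p"
 define C where "C = Gamma (q + 1 + 1) * lam powr q"
 have C: "C > 0" unfolding C_def using b lam_pos by (intro mult_pos_pos Gamma_real_pos) auto
 \<comment> \<open>Makes the truncation error 2 * C / K equal to \<epsilon> / 2; K stays fixed while
   n grows, so \<open>K powr q\<close> is harmless in front of \<open>h n\<close>.\<close>
 define K where "K = 4 * C / \<epsilon>"
 have K: "K > 0" using C e by (simp add: K_def)
 have "(%n. 2 / K * (?E n (Vpow (q + 1)) / (real n * ln (real n) powr (q + 1 - 1))) + 2 * K powr q * h n + \<bar>?E n (Vpow q) / ?c n - ?\<kappa>\<bar>)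
  ----> 2 / K * C + 2 * K powr q * 0 + \<bar>?\<kappa> - ?\<kappa>\<bar>"
  using expectation_Vsum_asymp[of "q + 1"] b unfolding C_def
  by (intro tendsto_intros h expectation_Vsum_asymp) auto
 moreover have "2 / K * C + 2 * K powr q * 0 + \<bar>?\<kappa> - ?\<kappa>\<bar> < \<epsilon>"
  using C e by (simp add: K_def)
 ultimately have "\<forall>\<^sub>F n in sequentially. 2 / K * (?E n (Vpow (q + 1)) / (real n * ln (real n) powr (q + 1 - 1))) + 2 * K powr q * h n + \<bar>?E n (Vpow q) / ?c n - ?\<kappa>\<bar> < \<epsilon>"
  by (rule order_tendstoD(2))
 then have "\<forall>\<^sub>F n in sequentially. norm (?E n (%xs. \<bar>Vpow q xs / ?c n - ?\<kappa>\<bar>) - 0) < \<epsilon>"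
  using ev eventually_ge_at_top[of 3]
 proof eventually_elim
  case (elim n)
  have c: "?c n > 0" using elim by simp
  have iV: "integrable (replicate_pmf n p) (Vpow q)" using b by (intro integrable_Vpow) auto
  have "?E n (%xs. \<bar>Vpow q xs / ?c n - ?\<kappa>\<bar>) <= ?E n (%xs. \<bar>Vpow q xs - ?E n (Vpow q)\<bar> / ?c n + \<bar>?E n (Vpow q) / ?c n - ?\<kappa>\<bar>)"
  proof (intro integral_mono)
   fix xs
   have "Vpow q xs / ?c n - ?\<kappa> = (Vpow q xs - ?E n (Vpow q)) / ?c n + (?E n (Vpow q) / ?c n - ?\<kappa>)"
    by (simp add: diff_divide_distrib)
   moreover have "\<bar>(Vpow q xs - ?E n (Vpow q)) / ?c n\<bar> = \<bar>Vpow q xs - ?E n (Vpow q)\<bar> / ?c n"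
    using c by (simp only: abs_divide abs_of_pos)
   ultimately show "\<bar>Vpow q xs / ?c n - ?\<kappa>\<bar> <= \<bar>Vpow q xs - ?E n (Vpow q)\<bar> / ?c n + \<bar>?E n (Vpow q) / ?c n - ?\<kappa>\<bar>"
    by (metis abs_triangle_ineq)
  qed (use iV in \<open>auto intro!: integrable_abs\<close>)
  also have "... = ?E n (%xs. \<bar>Vpow q xs - ?E n (Vpow q)\<bar>) / ?c n + \<bar>?E n (Vpow q) / ?c n - ?\<kappa>\<bar>"
   by (subst Bochner_Integration.integral_add) (use iV in \<open>auto intro!: integrable_abs\<close>)
  also have "... < \<epsilon>" using elim(2)[rule_format, OF K] elim(1) by simp
  finally have "?E n (%xs. \<bar>Vpow q xs / ?c n - ?\<kappa>\<bar>) < \<epsilon>" .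
  moreover have "?E n (%xs. \<bar>Vpow q xs / ?c n - ?\<kappa>\<bar>) \<ge> 0" by (rule Bochner_Integration.integral_nonneg) auto
  ultimately show ?case by simp
 qed
 then show "\<exists>no. \<forall>n\<ge>no. norm (?E n (%xs. \<bar>Vpow q xs / ?c n - ?\<kappa>\<bar>) - 0) < \<epsilon>"
  by (simp add: eventually_sequentially)
qed

end

section \<open>Swapping increments\<close>

definition Wprod :: "(nat => real) => 'a::ab_group_add list => real" where
 "Wprod g xs = (\<Prod>y\<in>set (sites xs). g (cnt xs y))"

lemma Wprod_superset:
 assumes "finite U" "set (sites xs) \<subseteq> U" "g 0 = 1"
 shows "Wprod g xs = (\<Prod>y\<in>U. g (cnt xs y))"
 unfolding Wprod_def
proof (rule prod.mono_neutral_left)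
 show "\<forall>y\<in>U - set (sites xs). g (cnt xs y) = 1"
  using assms(3) cnt_eq_0_iff[of xs] by (metis DiffD2)
qed (use assms in auto)

lemma Wprod_range:
 assumes "\<And>k. 0 <= g k \<and> g k <= 1"
 shows "0 <= Wprod g xs" "Wprod g xs <= 1"
 unfolding Wprod_def using assms by (auto intro!: prod_nonneg prod_le_1)

lemma Wprod_abs:
 assumes "\<And>k. 0 <= g k \<and> g k <= 1"
 shows "\<bar>Wprod g xs\<bar> <= 1"
 using Wprod_range[of g xs, OF assms] by simp

lemma Wprod_le_subset:
 assumes g: "\<And>k. 0 <= g k \<and> g k <= 1" "g 0 = 1" and S: "finite S"
 shows "Wprod g xs <= (\<Prod>y\<in>S. g (cnt xs y))"
proof -
 let ?U = "set (sites xs) \<union> S"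
 have "Wprod g xs = (\<Prod>y\<in>?U. g (cnt xs y))"
  by (rule Wprod_superset) (use g S in auto)
 also have "... = (\<Prod>y\<in>S. g (cnt xs y)) * (\<Prod>y\<in>?U - S. g (cnt xs y))"
  using prod.union_disjoint[of S "?U - S" "%y. g (cnt xs y)"] S by (simp add: Un_commute)
 also have "... <= (\<Prod>y\<in>S. g (cnt xs y)) * 1"
  by (intro mult_left_mono prod_le_1 prod_nonneg) (use g in auto)
 finally show ?thesis by simp
qed

text \<open>Pairing each J with the set obtained by toggling j replaces H by its average over the
  coin j.\<close>

lemma sum_Pow_toggle:
 fixes H :: "'i set => real"
 assumes "finite I" "j \<in> I"
 shows "(\<Sum>J\<in>Pow I. H J) = (\<Sum>J\<in>Pow I. (H (insert j J) + H (J - {j})) / 2)"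
proof -
 have "bij_betw (%J. if j \<in> J then J - {j} else insert j J) (Pow I) (Pow I)"
  by (rule bij_betw_byWitness[where f'="%J. if j \<in> J then J - {j} else insert j J"]) (use assms in auto)
 from sum.reindex_bij_betw[OF this, of H]
 have "(\<Sum>J\<in>Pow I. H (if j \<in> J then J - {j} else insert j J)) = (\<Sum>J\<in>Pow I. H J)" .
 moreover have "(\<Sum>J\<in>Pow I. (H (insert j J) + H (J - {j})) / 2) = (\<Sum>J\<in>Pow I. (H J + H (if j \<in> J then J - {j} else insert j J)) / 2)"
  by (intro sum.cong refl) (auto simp: insert_absorb)
 ultimately show ?thesis
  by (simp add: sum_divide_distrib[symmetric] sum.distrib)
qed

text \<open>Integrating out the coins in \<open>B\<close> one after the other.\<close>
lemma coin_product_bound: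
 fixes h :: "'i => 'i set => real"
 assumes "finite I" "B \<subseteq> I" "0 <= \<rho>"
  and nonneg: "\<And>k J. 0 <= h k J"
  and dep: "\<And>k j J. k \<in> B ==> j \<in> B ==> j \<noteq> k ==> h k (insert j J) = h k (J - {j})"
  and half: "\<And>k J. k \<in> B ==> (h k (insert k J) + h k (J - {k})) / 2 <= \<rho>"
 shows "(\<Sum>J\<in>Pow I. \<Prod>k\<in>B. h k J) <= \<rho> ^ card B * 2 ^ card I"
proof -
 have "finite B" using assms finite_subset by auto
 then show ?thesis using assms(2) dep half
 proof (induction B rule: finite_induct)
  case empty
  then show ?case by (simp add: card_Pow assms(1))
 next
  case (insert j B)
  have same: "h k (insert j J) = h k J" "h k (J - {j}) = h k J" if "k \<in> B" for k J
  proof -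
   have "h k (insert j J) = h k (J - {j})" for J using insert.prems(2)[of k j J] insert.hyps that by auto
   from this[of J] this[of "J - {j}"] this[of "insert j J"]
   show "h k (insert j J) = h k J" "h k (J - {j}) = h k J"
    by (cases "j \<in> J"; simp add: insert_absorb)+
  qed
  have "(\<Sum>J\<in>Pow I. \<Prod>k\<in>insert j B. h k J) = (\<Sum>J\<in>Pow I. h j J * (\<Prod>k\<in>B. h k J))"
   using insert.hyps by simp
  also have "... = (\<Sum>J\<in>Pow I. (h j (insert j J) + h j (J - {j})) / 2 * (\<Prod>k\<in>B. h k J))"
   by (subst sum_Pow_toggle[OF assms(1), of j]) (use insert.prems same in \<open>auto simp: add_divide_distrib distrib_right\<close>)
  also have "... <= (\<Sum>J\<in>Pow I. \<rho> * (\<Prod>k\<in>B. h k J))"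
   by (intro sum_mono mult_right_mono insert.prems prod_nonneg) (use nonneg in auto)
  also have "... = \<rho> * (\<Sum>J\<in>Pow I. \<Prod>k\<in>B. h k J)" by (simp add: sum_distrib_left)
  also have "... <= \<rho> * (\<rho> ^ card B * 2 ^ card I)"
   by (intro mult_left_mono insert.IH) (use insert.prems assms(3) in auto)
  finally show ?case using insert.hyps by simp
 qed
qed

text \<open>Greedy choice: picking s rules out only s, s + v and s - v, hence the factor 3.\<close>

lemma independent_translates:
 fixes U :: "'a::ab_group_add set"
 assumes "finite U"
 shows "\<exists>W\<subseteq>U. card U <= 3 * card W \<and> (\<forall>s\<in>W. \<forall>s'\<in>W. s \<noteq> s' --> s - s' \<noteq> v)"
 using assms
proof (induction "card U" arbitrary: U rule: less_induct)
 case less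
 show ?case
 proof (cases "U = {}")
  case False
  then obtain s where s: "s \<in> U" by auto
  let ?U = "U - {s, s + v, s - v}"
  have "card ?U < card U" using s less.prems by (intro psubset_card_mono) auto
  from less.hyps[OF this] less.prems obtain W where W: "W \<subseteq> ?U" "card ?U <= 3 * card W"
   "\<forall>s\<in>W. \<forall>s'\<in>W. s \<noteq> s' --> s - s' \<noteq> v" by auto
  have fW: "finite W" using W(1) less.prems by (meson finite_Diff finite_subset)
  have "card U <= card ?U + card {s, s + v, s - v}"
   by (metis card_Diff_subset_Int diff_card_le_card_Diff finite.emptyI finite.insertI le_diff_conv)
  also have "card {s, s + v, s - v} <= 3" by (simp add: card_insert_if)
  finally have "card U <= 3 * card W + 3" using W(2) by linarith
  moreover have "s \<notin> W" using W(1) by auto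
  ultimately have "card U <= 3 * card (insert s W)" using fW by simp
  moreover have "\<forall>x\<in>insert s W. \<forall>y\<in>insert s W. x \<noteq> y --> x - y \<noteq> v"
   using W by (auto simp: algebra_simps)
  ultimately show ?thesis using W(1) s by (intro exI[of _ "insert s W"]) auto
 qed simp
qed

fun flat :: "('a \<times> 'a) list => 'a list" where
 "flat [] = []"
| "flat ((x, y) # zs) = x # y # flat zs"

lemma length_flat [simp]: "length (flat zs) = 2 * length zs"
 by (induction zs rule: flat.induct) auto

lemma replicate_pmf_pairs: "replicate_pmf (2 * m) p = map_pmf flat (replicate_pmf m (pair_pmf p p))"
proof (induction m)
 case (Suc m)
 have "replicate_pmf (2 * Suc m) p = do {x \<leftarrow> p; y \<leftarrow> p; xs \<leftarrow> replicate_pmf (2 * m) p; return_pmf (x # y # xs)}"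
  by (simp add: bind_assoc_pmf bind_return_pmf)
 then show ?case
  by (simp add: Suc.IH pair_pmf_def map_bind_pmf bind_map_pmf bind_assoc_pmf bind_return_pmf map_pmf_def[symmetric])
    (simp add: map_pmf_def bind_assoc_pmf bind_return_pmf)
qed simp

text \<open>Exchanging the increments a and b within a pair keeps the positions at even times and
  moves only the intermediate position, between base + a and base + b. The pairs (a, b) and (b, a)
  are equally likely, so the exchange preserves the law.\<close>

locale swap =
 fixes a b :: "'a::ab_group_add"
 assumes ab: "a \<noteq> b"
begin

definition swappable :: "'a \<times> 'a => bool" where
 "swappable z \<longleftrightarrow> z = (a, b) \<or> z = (b, a)"

definition flip :: "bool => 'a \<times> 'a => 'a \<times> 'a" where
 "flip c z = (if c \<and> swappable z then prod.swap z else z)"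

lemma flip_flip [simp]: "flip c (flip c z) = z"
 by (auto simp: flip_def swappable_def)

lemma sum_flip: "fst (flip c z) + snd (flip c z) = fst z + snd z"
 by (auto simp: flip_def add.commute)

lemma map_flip_pair_pmf: "map_pmf (flip c) (pair_pmf p p) = pair_pmf p p"
proof (rule pmf_eqI)
 fix z :: "'a \<times> 'a"
 have inj: "inj (flip c)" by (rule injI) (metis flip_flip)
 have "pmf (map_pmf (flip c) (pair_pmf p p)) (flip c (flip c z)) = pmf (pair_pmf p p) (flip c z)"
  by (rule pmf_map_inj'[OF inj])
 also have "... = pmf (pair_pmf p p) z"
  by (cases z) (auto simp: flip_def pmf_pair mult.commute)
 finally show "pmf (map_pmf (flip c) (pair_pmf p p)) z = pmf (pair_pmf p p) z" by simp
qed

fun flips :: "nat set => ('a \<times> 'a) list => ('a \<times> 'a) list" where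
 "flips J [] = []"
| "flips J (z # zs) = flip (0 \<in> J) z # flips {k. Suc k \<in> J} zs"

lemma length_flips [simp]: "length (flips J zs) = length zs"
 by (induction J zs rule: flips.induct) auto

text \<open>Every flip pattern J preserves the law, hence so does averaging over all patterns with
  the path held fixed. In effect this supplies fair coins independent of each other and of the
  path.\<close>

lemma map_flips_replicate: "map_pmf (flips J) (replicate_pmf m (pair_pmf p p)) = replicate_pmf m (pair_pmf p p)"
proof (induction m arbitrary: J)
 case (Suc m)
 have "map_pmf (flips J) (replicate_pmf (Suc m) (pair_pmf p p)) =
   do {z \<leftarrow> map_pmf (flip (0 \<in> J)) (pair_pmf p p); zs \<leftarrow> map_pmf (flips {k. Suc k \<in> J}) (replicate_pmf m (pair_pmf p p)); return_pmf (z # zs)}"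
  by (simp add: map_bind_pmf bind_map_pmf)
 then show ?case by (simp add: Suc.IH map_flip_pair_pmf)
qed simp

text \<open>The position at even times, which the flips leave alone.\<close>
definition base :: "('a \<times> 'a) list => nat => 'a" where
 "base zs k = sum_list (map (%z. fst z + snd z) (take k zs))"

lemma base_flips: "base (flips J zs) k = base zs k"
proof (induction J zs arbitrary: k rule: flips.induct)
 case (2 J z zs)
 then show ?case by (cases k) (auto simp: base_def sum_flip)
qed simp

lemma nth_flips: "k < length zs ==> flips J zs ! k = flip (k \<in> J) (zs ! k)"
proof (induction J zs arbitrary: k rule: flips.induct)
 case (2 J z zs)
 then show ?case by (cases k) auto
qed simp

lemma cnt_flat:
 "cnt (flat zs) y = (\<Sum>k<length zs. (if base zs k = y then 1 else 0) + (if base zs k + fst (zs ! k) = y then 1 else 0))"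
proof (induction zs arbitrary: y rule: flat.induct)
 case (2 u v zs)
 have "cnt (flat ((u, v) # zs)) y = (if y = 0 then 1 else 0) + (if y = u then 1 else 0) + cnt (flat zs) (y - u - v)"
  by (simp add: cnt_Cons)
 also have "cnt (flat zs) (y - u - v) = (\<Sum>k<length zs. (if base ((u, v) # zs) (Suc k) = y then 1 else 0) + (if base ((u, v) # zs) (Suc k) + fst (((u, v) # zs) ! Suc k) = y then 1 else 0))"
  unfolding 2 by (intro sum.cong refl) (simp add: base_def algebra_simps eq_diff_eq)
 also have "(if y = 0 then 1 else 0) + (if y = u then 1 else 0) + ... =
  (\<Sum>k<Suc (length zs). (if base ((u, v) # zs) k = y then 1 else 0) + (if base ((u, v) # zs) k + fst (((u, v) # zs) ! k) = y then 1 else 0))"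
 proof -
  have "(y = 0) = (0 = y)" "(y = u) = (u = y)" by auto
  then show ?thesis by (subst sum.lessThan_Suc_shift) (simp add: base_def)
 qed
 finally show ?case by simp
qed simp

text \<open>Each block of \<open>B\<close> owns one site whose visit count is changed by exactly one
  by its own coin and by no other coin of \<open>B\<close>. The factors at these sites are therefore
  averaged one coin at a time, each average being at most \<rho>; all other factors are bounded by
  1.\<close>

lemma flips_average:
 assumes g: "\<And>k. 0 <= g k \<and> g k <= 1" "g 0 = 1" and \<rho>: "0 <= \<rho>" "\<And>k. (g k + g (Suc k)) / 2 <= \<rho>"
  and B: "B \<subseteq> {k. k < length zs \<and> swappable (zs ! k)}"
  and sep: "\<And>k j. k \<in> B ==> j \<in> B ==> j \<noteq> k ==> base zs k \<noteq> base zs j \<and> base zs j - base zs k \<noteq> a - b"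
 shows "(\<Sum>J\<in>Pow {..<length zs}. Wprod g (ys @ flat (flips J zs))) <= \<rho> ^ card B * 2 ^ length zs"
proof -
 define s where "s = sum_list ys"
 \<comment> \<open>The intermediate site of block k when its first increment is a; coin k decides
   whether it is hit at that time.\<close>
 define site where "site k = s + base zs k + a" for k
 define h where "h k J = g (cnt (ys @ flat (flips J zs)) (site k))" for k J
 have fB: "finite B" using B by (rule finite_subset) simp
 have inj: "inj_on site B" using sep by (auto simp: inj_on_def site_def)
 have c: "cnt (ys @ flat (flips J zs)) (site k) = cnt ys (site k) +
   (\<Sum>i<length zs. (if base zs i = base zs k + a then 1 else 0) + (if base zs i + fst (flip (i \<in> J) (zs ! i)) = base zs k + a then 1 else 0))" for J k
  unfolding cnt_append cnt_flat by (simp add: base_flips nth_flips site_def s_def[symmetric])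
 have fst_sw: "fst (flip d (zs ! j)) = a \<or> fst (flip d (zs ! j)) = b" if "j \<in> B" for j d
  using B that by (auto simp: flip_def swappable_def)
 \<comment> \<open>Coin j never affects the count at the site of k: the intermediate site of block j
   is base j + a or base j + b, and \<open>sep\<close> excludes that either equals base k +
   a.\<close>
 have term0: "base zs j + fst (flip d (zs ! j)) \<noteq> base zs k + a" if kj: "k \<in> B" "j \<in> B" "j \<noteq> k" for k j d
 proof
  assume eq: "base zs j + fst (flip d (zs ! j)) = base zs k + a"
  then consider "base zs j + a = base zs k + a" | "base zs j + b = base zs k + a"
   using fst_sw[OF kj(2), of d] by metis
  then show False
  proof cases
   case 1 then show ?thesis using sep[OF kj] by simp
  next
   case 2
   then have "base zs j - base zs k = a - b" by (simp add: algebra_simps eq_diff_eq)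
   then show ?thesis using sep[OF kj] by simp
  qed
 qed
 have "(\<Sum>J\<in>Pow {..<length zs}. Wprod g (ys @ flat (flips J zs))) <= (\<Sum>J\<in>Pow {..<length zs}. \<Prod>k\<in>B. h k J)"
 proof (intro sum_mono)
  fix J
  have "Wprod g (ys @ flat (flips J zs)) <= (\<Prod>y\<in>site ` B. g (cnt (ys @ flat (flips J zs)) y))"
   by (rule Wprod_le_subset) (use g fB in auto)
  then show "Wprod g (ys @ flat (flips J zs)) <= (\<Prod>k\<in>B. h k J)"
   by (simp add: prod.reindex[OF inj] h_def)
 qed
 also have "... <= \<rho> ^ card B * 2 ^ card {..<length zs}"
 proof (rule coin_product_bound)
  fix k j J assume kj: "k \<in> B" "j \<in> B" "j \<noteq> k"
  show "h k (insert j J) = h k (J - {j})"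
   unfolding h_def c
  proof (intro arg_cong[where f=g] arg_cong2[where f="(+)"] refl sum.cong)
   fix i
   show "(if base zs i + fst (flip (i \<in> insert j J) (zs ! i)) = base zs k + a then 1 else 0) =
      (if base zs i + fst (flip (i \<in> J - {j}) (zs ! i)) = base zs k + a then 1 else 0 :: nat)"
    by (cases "i = j") (use term0[OF kj] in auto)
  qed
 next
  fix k J assume k: "k \<in> B"
  have kl: "k < length zs" "swappable (zs ! k)" using B k by auto
  \<comment> \<open>All visits to the site except at the intermediate time of block k, so the count
    is R or R + 1 according to coin k.\<close>
  define R where "R = cnt ys (site k) + (\<Sum>i<length zs. (if base zs i = base zs k + a then 1 else 0)) +
   (\<Sum>i\<in>{..<length zs} - {k}. (if base zs i + fst (flip (i \<in> J) (zs ! i)) = base zs k + a then 1 else 0))"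
  have cnt_eq: "cnt (ys @ flat (flips J' zs)) (site k) = R + (if fst (flip (k \<in> J') (zs ! k)) = a then 1 else 0)"
   if "J' = insert k J \<or> J' = J - {k}" for J'
  proof -
   have "(\<Sum>i<length zs. (if base zs i + fst (flip (i \<in> J') (zs ! i)) = base zs k + a then 1 else 0)) =
    (if fst (flip (k \<in> J') (zs ! k)) = a then 1 else 0) +
    (\<Sum>i\<in>{..<length zs} - {k}. (if base zs i + fst (flip (i \<in> J') (zs ! i)) = base zs k + a then 1 else 0 :: nat))"
    by (subst sum.remove[of _ k]) (use kl in auto)
   also have "(\<Sum>i\<in>{..<length zs} - {k}. (if base zs i + fst (flip (i \<in> J') (zs ! i)) = base zs k + a then 1 else 0 :: nat)) =
     (\<Sum>i\<in>{..<length zs} - {k}. (if base zs i + fst (flip (i \<in> J) (zs ! i)) = base zs k + a then 1 else 0))"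
    by (intro sum.cong refl) (use that in auto)
   finally show ?thesis unfolding c sum.distrib R_def by simp
  qed
  have "(h k (insert k J) + h k (J - {k})) / 2 = (g R + g (Suc R)) / 2"
  proof -
   have "h k (insert k J) = g (R + (if fst (flip True (zs ! k)) = a then 1 else 0))"
    "h k (J - {k}) = g (R + (if fst (flip False (zs ! k)) = a then 1 else 0))"
    unfolding h_def using cnt_eq[of "insert k J"] cnt_eq[of "J - {k}"] by simp_all
   moreover have "zs ! k = (a, b) \<or> zs ! k = (b, a)" using kl(2) by (auto simp: swappable_def)
   ultimately show ?thesis using ab ab[symmetric] by (elim disjE) (simp_all add: flip_def swappable_def)
  qed
  then show "(h k (insert k J) + h k (J - {k})) / 2 <= \<rho>" using \<rho>(2)[of R] by simp
 qed (use B \<rho> g in \<open>auto simp: h_def\<close>)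
 finally show ?thesis by simp
qed

definition nswap :: "('a \<times> 'a) list => nat" where
 "nswap zs = length (filter swappable zs)"

text \<open>At most N swappable blocks share a base, since a base is a visited site; thinning to
  bases that do not differ by a - b costs a factor 3.\<close>

lemma separated_blocks:
 assumes N: "\<And>y. cnt (flat zs) y <= N"
 shows "\<exists>B \<subseteq> {k. k < length zs \<and> swappable (zs ! k)}. nswap zs <= 3 * N * card B \<and>
  (\<forall>k\<in>B. \<forall>j\<in>B. j \<noteq> k --> base zs k \<noteq> base zs j \<and> base zs j - base zs k \<noteq> a - b)"
proof -
 define T where "T = {k. k < length zs \<and> swappable (zs ! k)}"
 have fT: "finite T" by (simp add: T_def)
 have nT: "nswap zs = card T" by (simp add: nswap_def T_def length_filter_conv_card)
 obtain W where W: "W \<subseteq> base zs ` T" "card (base zs ` T) <= 3 * card W"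
  "\<forall>s\<in>W. \<forall>s'\<in>W. s \<noteq> s' --> s - s' \<noteq> a - b"
  using independent_translates[of "base zs ` T" "a - b"] fT by auto
 have "card T <= (\<Sum>y\<in>base zs ` T. card {k\<in>T. base zs k = y})"
 proof -
  have "T = (\<Union>y\<in>base zs ` T. {k\<in>T. base zs k = y})" by auto
  then show ?thesis using card_UN_le[of "base zs ` T" "%y. {k\<in>T. base zs k = y}"] fT by simp
 qed
 also have "... <= (\<Sum>y\<in>base zs ` T. N)"
 proof (intro sum_mono)
  fix y
  have "card {k\<in>T. base zs k = y} <= card {k\<in>{..<length zs}. base zs k = y}"
   by (rule card_mono) (auto simp: T_def)
  also have "... = (\<Sum>k<length zs. if base zs k = y then 1 else 0)"
   by (simp add: sum.If_cases Int_def)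
  also have "... <= cnt (flat zs) y" unfolding cnt_flat by (intro sum_mono) auto
  finally show "card {k\<in>T. base zs k = y} <= N" using N[of y] by simp
 qed
 also have "... = N * card (base zs ` T)" by simp
 also have "... <= N * (3 * card W)" using W(2) by (intro mult_left_mono) auto
 finally have cT: "card T <= 3 * N * card W" by simp
 obtain B where B: "B \<subseteq> T" "inj_on (base zs) B" "base zs ` B = W"
  using subset_image_inj[of W "base zs" T] W(1) by auto
 have "card B = card W" using card_image[OF B(2)] B(3) by simp
 moreover have "\<forall>k\<in>B. \<forall>j\<in>B. j \<noteq> k --> base zs k \<noteq> base zs j \<and> base zs j - base zs k \<noteq> a - b"
 proof (intro ballI impI)
  fix k j assume kj: "k \<in> B" "j \<in> B" "j \<noteq> k"
  then have ne: "base zs j \<noteq> base zs k" using B(2) by (auto dest: inj_onD)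
  then show "base zs k \<noteq> base zs j \<and> base zs j - base zs k \<noteq> a - b"
  proof -
   have "base zs j \<in> W" "base zs k \<in> W" using B(3) kj by auto
   then show ?thesis using W(3) ne by (metis (no_types))
  qed
 qed
 ultimately show ?thesis using B(1) cT nT unfolding T_def by (intro exI[of _ B]) auto
qed

text \<open>On the two bad events, too few swappable pairs or a site visited more than N times, the
  trivial bound 1 is used; otherwise at least u separated blocks are averaged. The r initial steps
  are left untouched and accommodate odd lengths.\<close>

lemma expectation_Wprod_le:
 assumes g: "\<And>k. 0 <= g k \<and> g k <= 1" "g 0 = 1" and \<rho>: "0 <= \<rho>" "\<rho> <= 1" "\<And>k. (g k + g (Suc k)) / 2 <= \<rho>"
  and N: "N > 0"
 shows "wmean (r + 2 * m) p (Wprod g) \<le>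
  \<rho> ^ u + wprob m (pair_pmf p p) {zs. nswap zs < 3 * N * u} +
  wprob (2 * m) p {xs. \<exists>y. cnt xs y > N}"
proof -
 let ?Q = "replicate_pmf m (pair_pmf p p)"
 define G where "G zs = \<rho> ^ u + (if nswap zs < 3 * N * u then 1 else 0) + (if \<exists>y. cnt (flat zs) y > N then 1 else 0 :: real)" for zs
 have fixed: "wmean (2 * m) p (%xs. Wprod g (ys @ xs)) <= mean ?Q G" for ys
 proof -
  have iW: "integrable ?Q (%zs. Wprod g (ys @ flat (flips J zs)))" for J
   by (rule integrable_pmf_bounded[where c=1]) (use Wprod_abs[of g, OF g(1)] in auto)
  have iG: "integrable ?Q G"
  proof (rule integrable_pmf_bounded[where c=3])
   show "norm (G zs) <= 3" for zs unfolding G_def using \<rho> power_le_one[of \<rho> u] by auto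
  qed
  have one: "wmean (2 * m) p (%xs. Wprod g (ys @ xs)) =
    mean ?Q (%zs. Wprod g (ys @ flat (flips J zs)))" for J
   by (subst replicate_pmf_pairs, subst (1) map_flips_replicate[of J, symmetric]) simp
  have "2 ^ m * wmean (2 * m) p (%xs. Wprod g (ys @ xs)) =
    (\<Sum>J\<in>Pow {..<m}. wmean (2 * m) p (%xs. Wprod g (ys @ xs)))"
   by (simp add: card_Pow)
  also have "... = (\<Sum>J\<in>Pow {..<m}. mean ?Q (%zs. Wprod g (ys @ flat (flips J zs))))"
   by (intro sum.cong refl one)
  also have "... = mean ?Q (%zs. \<Sum>J\<in>Pow {..<m}. Wprod g (ys @ flat (flips J zs)))"
   by (rule Bochner_Integration.integral_sum[symmetric]) (rule iW)
  also have "... <= mean ?Q (%zs. 2 ^ m * G zs)"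
  proof (rule expectation_pmf_mono)
   fix zs assume "zs \<in> set_pmf ?Q"
   then have l: "length zs = m" by (rule length_replicate_pmf)
   show "(\<Sum>J\<in>Pow {..<m}. Wprod g (ys @ flat (flips J zs))) <= 2 ^ m * G zs"
   proof (cases "nswap zs < 3 * N * u \<or> (\<exists>y. cnt (flat zs) y > N)")
    case True
    have "(\<Sum>J\<in>Pow {..<m}. Wprod g (ys @ flat (flips J zs))) <= (\<Sum>J\<in>Pow {..<m}. 1)"
     by (intro sum_mono Wprod_range(2)[of g, OF g(1)])
    also have "... = 2 ^ m * 1" by (simp add: card_Pow)
    also have "... <= 2 ^ m * G zs"
     by (intro mult_left_mono) (use True \<rho> in \<open>auto simp: G_def\<close>)
    finally show ?thesis .
   next
    case False
    then have "\<And>y. cnt (flat zs) y <= N" by (auto simp: not_less)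
    from separated_blocks[OF this] obtain B where B: "B \<subseteq> {k. k < length zs \<and> swappable (zs ! k)}"
     "nswap zs <= 3 * N * card B"
     "\<forall>k\<in>B. \<forall>j\<in>B. j \<noteq> k --> base zs k \<noteq> base zs j \<and> base zs j - base zs k \<noteq> a - b" by blast
    have "3 * N * u <= nswap zs" using False by auto
    then have "3 * N * u <= 3 * N * card B" using B(2) by (rule order_trans)
    have "(\<Sum>J\<in>Pow {..<m}. Wprod g (ys @ flat (flips J zs))) <= \<rho> ^ card B * 2 ^ m"
     using flips_average[OF g \<rho>(1,3) B(1)] B(3) l by blast
    moreover have "\<rho> ^ card B <= \<rho> ^ u"
    proof -
     have "u <= card B" using \<open>3 * N * u <= 3 * N * card B\<close> N by simp
     then show ?thesis using \<rho> by (intro power_decreasing) auto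
    qed
    then have "\<rho> ^ card B * 2 ^ m <= \<rho> ^ u * 2 ^ m" by (intro mult_right_mono) auto
    ultimately have "(\<Sum>J\<in>Pow {..<m}. Wprod g (ys @ flat (flips J zs))) <= 2 ^ m * \<rho> ^ u"
     by (simp only: mult.commute)
    then show ?thesis using False by (simp add: G_def)
   qed
  qed (use iW iG in auto)
  finally show ?thesis by simp
 qed
 have "wmean (r + 2 * m) p (Wprod g) =
  wmean r p (%ys. wmean (2 * m) p (%xs. Wprod g (ys @ xs)))"
  by (rule expectation_replicate_append[where c=1]) (use Wprod_abs[of g, OF g(1)] in auto)
 also have "... <= wmean r p (%ys. mean ?Q G)"
 proof (rule expectation_pmf_mono)
  show "integrable (replicate_pmf r p) (%ys. wmean (2 * m) p (%xs. Wprod g (ys @ xs)))"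
  proof (rule integrable_pmf_bounded[where c=1])
   fix ys
   have "norm (wmean (2 * m) p (%xs. Wprod g (ys @ xs))) \<le>
    wmean (2 * m) p (%xs. norm (Wprod g (ys @ xs)))" by (rule integral_norm_bound)
   also have "... <= wmean (2 * m) p (%xs. 1)"
    by (rule expectation_pmf_mono)
      (use Wprod_abs[of g, OF g(1)] in \<open>auto intro!: integrable_pmf_bounded[where c=1]\<close>)
   finally show "norm (wmean (2 * m) p (%xs. Wprod g (ys @ xs))) <= 1" by simp
  qed
 qed (use fixed in auto)
 also have "... = mean ?Q G" by simp
 also have "... = \<rho> ^ u + measure_pmf.prob ?Q {zs. nswap zs < 3 * N * u} + measure_pmf.prob ?Q {zs. \<exists>y. cnt (flat zs) y > N}"
 proof -
  have i: "integrable ?Q (%zs. if nswap zs < 3 * N * u then 1 else 0 :: real)"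
   "integrable ?Q (%zs. if \<exists>y. cnt (flat zs) y > N then 1 else 0 :: real)"
   by (auto intro!: integrable_pmf_bounded[where c=1])
  have "mean ?Q G = mean ?Q (%zs. \<rho> ^ u + (if nswap zs < 3 * N * u then 1 else 0)) +
   mean ?Q (%zs. if \<exists>y. cnt (flat zs) y > N then 1 else 0)"
   unfolding G_def by (rule Bochner_Integration.integral_add[OF _ i(2)]) (use i(1) in simp)
  also have "mean ?Q (%zs. \<rho> ^ u + (if nswap zs < 3 * N * u then 1 else 0)) =
   mean ?Q (%_. \<rho> ^ u) + mean ?Q (%zs. if nswap zs < 3 * N * u then 1 else 0)"
   by (rule Bochner_Integration.integral_add[OF _ i(1)]) simp
  finally show ?thesis unfolding prob_eq_expectation by simp
 qed
 also have "measure_pmf.prob ?Q {zs. \<exists>y. cnt (flat zs) y > N} = wprob (2 * m) p {xs. \<exists>y. cnt xs y > N}"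
  unfolding replicate_pmf_pairs by (simp add: vimage_def)
 finally show ?thesis .
qed

end

section \<open>Tail bounds for the number of swappable pairs and for the maximal visit count\<close>

lemma expectation_replicate_prod:
 fixes h :: "'a => real"
 assumes "\<And>x. 0 <= h x \<and> h x <= 1"
 shows "wmean m P (%zs. prod_list (map h zs)) = (mean P h) ^ m"
proof (induction m)
 case (Suc m)
 have pl: "0 <= prod_list (map h zs) \<and> prod_list (map h zs) <= 1" for zs
  using assms by (induction zs) (auto intro!: mult_le_one)
 have "wmean (1 + m) P (%zs. prod_list (map h zs)) =
  wmean 1 P (%xs. wmean m P (%ys. prod_list (map h (xs @ ys))))"
  by (rule expectation_replicate_append[where c=1]) (use pl in \<open>auto simp: abs_le_iff intro: order_trans[of _ 0]\<close>)
 then show ?case unfolding replicate_pmf_1 integral_map_pmf by (simp add: Suc.IH)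
qed simp

context swap begin

text \<open>Exponential Markov inequality: \<theta> is the mean of the weight exp (- 1) on swappable
  pairs and 1 elsewhere, which is below 1 because (a, b) has positive probability.\<close>

lemma nswap_tail:
 assumes "pmf p a > 0" "pmf p b > 0"
 shows "\<exists>\<theta>. 0 < \<theta> \<and> \<theta> < 1 \<and> (\<forall>m v. wprob m (pair_pmf p p) {zs. nswap zs < v} <= exp (real v) * \<theta> ^ m)"
proof -
 define h :: "'a \<times> 'a => real" where "h z = (if swappable z then exp (- 1) else 1)" for z
 define \<theta> where "\<theta> = mean (pair_pmf p p) h"
 have h: "0 <= h z \<and> h z <= 1" for z by (auto simp: h_def)
 have ih: "integrable (pair_pmf p p) h" by (rule integrable_pmf_bounded[where c=1]) (use h in auto)
 have t0: "\<theta> > 0"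
 proof -
  have "exp (- 1) = mean (pair_pmf p p) (%_. exp (- 1 :: real))" by simp
  also have "... <= \<theta>" unfolding \<theta>_def by (rule expectation_pmf_mono) (use ih in \<open>auto simp: h_def\<close>)
  finally show ?thesis by (metis exp_gt_zero less_le_trans)
 qed
 have t1: "\<theta> < 1"
 proof -
  have "\<theta> <= mean (pair_pmf p p) (%z. 1 - (1 - exp (- 1)) * (if z = (a, b) then 1 else 0))"
   unfolding \<theta>_def
  proof (rule expectation_pmf_mono[OF ih])
   show "integrable (pair_pmf p p) (%z. 1 - (1 - exp (- 1)) * (if z = (a, b) then 1 else 0) :: real)"
    by (rule integrable_pmf_bounded[where c=1]) simp
   show "h z <= 1 - (1 - exp (- 1)) * (if z = (a, b) then 1 else 0)" for z
    by (cases "z = (a, b)") (simp_all add: h_def swappable_def)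
  qed
  also have "... = 1 - (1 - exp (- 1)) * measure_pmf.prob (pair_pmf p p) {z. z = (a, b)}"
   unfolding prob_eq_expectation
   by (subst Bochner_Integration.integral_diff) (auto intro!: integrable_pmf_bounded[where c=1])
  also have "measure_pmf.prob (pair_pmf p p) {z. z = (a, b)} = pmf p a * pmf p b"
   by (simp add: measure_pmf_single pmf_pair)
  also have "1 - (1 - exp (- 1)) * (pmf p a * pmf p b) < 1" using assms by simp
  finally show ?thesis .
 qed
 have "wprob m (pair_pmf p p) {zs. nswap zs < v} <= exp (real v) * \<theta> ^ m" for m v
 proof -
  have e: "prod_list (map h zs) = exp (- real (nswap zs))" for zs
  proof (induction zs)
   case (Cons z zs)
   have "exp (- real (nswap (z # zs))) = h z * exp (- real (nswap zs))"
    by (simp add: h_def nswap_def mult_exp_exp)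
   then show ?case by (simp add: Cons.IH)
  qed (simp add: nswap_def)
  have "wprob m (pair_pmf p p) {zs. nswap zs < v} \<le>
   wmean m (pair_pmf p p) (%zs. exp (real v) * prod_list (map h zs))"
   unfolding prob_eq_expectation
  proof (rule expectation_pmf_mono)
   show "(if nswap zs < v then 1 else 0) <= exp (real v) * prod_list (map h zs)" for zs
    unfolding e by (auto simp: exp_add[symmetric])
   have "\<bar>exp (real v) * prod_list (map h zs)\<bar> <= exp (real v)" for zs unfolding e by (auto simp: abs_mult)
   then show "integrable (replicate_pmf m (pair_pmf p p)) (%zs. exp (real v) * prod_list (map h zs))"
    by (intro integrable_pmf_bounded[where c="exp (real v)"]) simp
  qed (auto intro!: integrable_pmf_bounded[where c=1])
  also have "... = exp (real v) * \<theta> ^ m"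
   using expectation_replicate_prod[of h m "pair_pmf p p", OF h] by (simp add: \<theta>_def)
  finally show ?thesis .
 qed
 then show ?thesis using t0 t1 by blast
qed

end

text \<open>A site visited more than N times alone contributes more than \<open>N powr q\<close> to
  the power sum. As q is arbitrary, Markov's inequality makes the maximum smaller than any positive
  power of n.\<close>

lemma (in critical_walk) prob_max_visits:
 assumes q: "q > 0"
 shows "\<exists>C>0. \<forall>n\<ge>2. \<forall>N>0. wprob n p {xs. \<exists>y. real (cnt xs y) > N} <= C * real n * ln (real n) powr q / N powr q"
proof -
 obtain C where C: "C > 0" "\<And>n. n \<ge> 2 ==> wmean n p (Vpow q) <= C * real n * ln (real n) powr q"
  using expectation_Vsum_crude[OF q] by blast
 have "wprob n p {xs. \<exists>y. real (cnt xs y) > N} <= C * real n * ln (real n) powr q / N powr q"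
  if n: "n \<ge> 2" and N: "N > 0" for n N
 proof -
  have "wprob n p {xs. \<exists>y. real (cnt xs y) > N} <= wmean n p (%xs. Vpow q xs / N powr q)"
   unfolding prob_eq_expectation
  proof (rule expectation_pmf_mono)
   fix xs :: "'a list"
   show "(if \<exists>y. real (cnt xs y) > N then 1 else 0) <= Vpow q xs / N powr q"
   proof (cases "\<exists>y. real (cnt xs y) > N")
    case True
    then obtain y where y: "real (cnt xs y) > N" by blast
    then have ys: "y \<in> set (sites xs)" using N by (simp add: cnt_pos_iff[symmetric])
    have "N powr q <= real (cnt xs y) powr q" using y N q by (intro powr_mono2) auto
    also have "... <= Vpow q xs" unfolding Vsum_def by (rule member_le_sum) (use ys in auto)
    finally show ?thesis using True N by simp
   qed (use N in \<open>auto intro!: divide_nonneg_nonneg Vpow_nonneg\<close>)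
  next
   show "integrable (replicate_pmf n p) (%xs. Vpow q xs / N powr q)"
    using integrable_Vpow[of q n p] q by simp
  qed (auto intro!: integrable_pmf_bounded[where c=1])
  also have "... = wmean n p (Vpow q) / N powr q" by simp
  also have "... <= C * real n * ln (real n) powr q / N powr q" by (intro divide_right_mono C n) auto
  finally show ?thesis .
 qed
 then show ?thesis using C(1) by blast
qed

lemma (in critical_walk) prob_max_visits_small:
 assumes e: "e > 0" and \<delta>: "\<delta> > 0" and c: "c > 0"
 shows "(%n. real n powr e * wprob n p {xs. \<exists>y. real (cnt xs y) > c * real n powr \<delta>}) ----> 0"
proof -
 \<comment> \<open>Then n powr e * n / (n powr \<delta>) powr q = 1 / n, which beats the power of
   the logarithm.\<close>
 define q where "q = (e + 2) / \<delta>"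
 have q: "q > 0" unfolding q_def using e \<delta> by (intro divide_pos_pos) auto
 have qd: "\<delta> * q = e + 2" unfolding q_def using \<delta> by simp
 obtain C where C: "C > 0" "\<forall>n\<ge>2. \<forall>N>0. wprob n p {xs. \<exists>y. real (cnt xs y) > N} <= C * real n * ln (real n) powr q / N powr q"
  using prob_max_visits[OF q] by blast
 show ?thesis
 proof (rule tendsto_sandwich)
  show "\<forall>\<^sub>F n in sequentially. 0 <= real n powr e * wprob n p {xs. \<exists>y. real (cnt xs y) > c * real n powr \<delta>}"
   by (intro always_eventually allI) simp
  show "\<forall>\<^sub>F n in sequentially. real n powr e * wprob n p {xs. \<exists>y. real (cnt xs y) > c * real n powr \<delta>} \<le>
   (C / c powr q) * (ln (real n) powr q / real n)"
   using eventually_ge_at_top[of 2]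
  proof eventually_elim
   case (elim n)
   have np: "real n > 0" using elim by simp
   have "wprob n p {xs. \<exists>y. real (cnt xs y) > c * real n powr \<delta>} <= C * real n * ln (real n) powr q / (c * real n powr \<delta>) powr q"
    using C(2) elim c np by auto
   then have "real n powr e * wprob n p {xs. \<exists>y. real (cnt xs y) > c * real n powr \<delta>} <= real n powr e * (C * real n * ln (real n) powr q / (c * real n powr \<delta>) powr q)"
    by (rule mult_left_mono) simp
   also have "(c * real n powr \<delta>) powr q = c powr q * (real n powr e * (real n * real n))"
    using c np by (simp add: powr_mult powr_powr qd powr_add power2_eq_square)
   also have "real n powr e * (C * real n * ln (real n) powr q / (c powr q * (real n powr e * (real n * real n)))) = (C / c powr q) * (ln (real n) powr q / real n)"
    using np c by (simp add: field_simps)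
   finally show ?case .
  qed
  have "(%n. ln (real n) powr q / real n) ----> 0" using q by real_asymp
  from tendsto_mult_left[OF this, of "C / c powr q"]
  show "(%n. (C / c powr q) * (ln (real n) powr q / real n)) ----> 0" by simp
 qed simp
qed

text \<open>With N near n powr (1/8) and u near n powr (3/4), the product N * u is o(n), so too few
  swappable pairs occur with exponentially small probability, while the u averaged factors give
  about exp (- c * n powr (1/4)). The threshold in n is the same for all g.\<close>

lemma (in critical_walk) Wprod_superpoly:
 assumes supp: "a \<noteq> b" "pmf p a > 0" "pmf p b > 0" and c: "0 < c" and e: "e > 0" and \<epsilon>: "\<epsilon> > 0"
 shows "\<forall>\<^sub>F n in sequentially. \<forall>g. (\<forall>k. 0 <= g k \<and> g k <= 1) \<and> g 0 = 1 \<and>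
   (\<forall>k. (g k + g (Suc k)) / 2 <= 1 - c * real n powr (- 1/2)) -->
   real n powr e * wmean n p (Wprod g) <= \<epsilon>"
proof -
 interpret swap a b by unfold_locales (rule supp)
 obtain \<theta> where \<theta>: "0 < \<theta>" "\<theta> < 1" "\<And>m v. wprob m (pair_pmf p p) {zs. nswap zs < v} <= exp (real v) * \<theta> ^ m"
  using nswap_tail[OF supp(2,3)] by blast
 define N where "N n = nat \<lfloor>real n powr (1/8)\<rfloor>" for n
 define u where "u n = nat \<lceil>real n powr (3/4)\<rceil>" for n
 \<comment> \<open>Half of - ln \<theta>, since m is n div 2: then \<theta> ^ m is at most exp (- d
   * (n - 1)).\<close>
 define d where "d = - ln \<theta> / 2"
 have d: "d > 0" unfolding d_def using \<theta> by (simp add: ln_less_zero)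
 define H where "H n = real n powr e * exp (- (c * real n powr (1/4)))
   + real n powr e * exp (3 * real n powr (1/8) * (real n powr (3/4) + 1) - d * (real n - 1))
   + real n powr e * wprob n p {xs. \<exists>y. real (cnt xs y) > 1/2 * real n powr (1/8)}" for n
 have "H ----> 0 + 0 + 0"
  unfolding H_def
 proof (intro tendsto_add)
  show "(%n. real n powr e * exp (- (c * real n powr (1/4)))) ----> 0" using c e by real_asymp
  show "(%n. real n powr e * exp (3 * real n powr (1/8) * (real n powr (3/4) + 1) - d * (real n - 1))) ----> 0"
   using d e by real_asymp
 qed (use prob_max_visits_small[OF e, of "1/8" "1/2"] in simp)
 from order_tendstoD(2)[OF this, of \<epsilon>] have "\<forall>\<^sub>F n in sequentially. H n < \<epsilon>" using \<epsilon> by simp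
 moreover have "\<forall>\<^sub>F n in sequentially. real n powr (1/8) \<ge> 2" by real_asymp
 ultimately show ?thesis using eventually_ge_at_top[of 2]
 proof eventually_elim
  case (elim n)
  show ?case
  proof (intro allI impI, elim conjE)
   fix g :: "nat => real"
   assume g: "\<forall>k. 0 <= g k \<and> g k <= 1" "g 0 = 1" "\<forall>k. (g k + g (Suc k)) / 2 <= 1 - c * real n powr (- 1/2)"
   define \<rho> where "\<rho> = 1 - c * real n powr (- 1/2)"
   define m where "m = n div 2"
   define r where "r = n mod 2"
   have n: "n = r + 2 * m" by (simp add: m_def r_def)
   have np: "real n > 0" using elim by simp
   have "0 <= (g 0 + g (Suc 0)) / 2" using g(1) by (simp add: add_nonneg_nonneg)
   then have \<rho>0: "0 <= \<rho>" unfolding \<rho>_def using g(3) by (meson order_trans)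
   have \<rho>1: "\<rho> <= 1" unfolding \<rho>_def using c by simp
   have N1: "real (N n) <= real n powr (1/8)" unfolding N_def by (intro of_nat_floor) auto
   have N2: "1 / 2 * real n powr (1/8) < real (N n)" unfolding N_def using elim(2) by linarith
   have N0: "N n > 0" unfolding N_def using elim(2) by linarith
   have u1: "real n powr (3/4) <= real (u n)" unfolding u_def by (rule real_nat_ceiling_ge)
   have u2: "real (u n) <= real n powr (3/4) + 1"
    unfolding u_def using powr_ge_zero[of "real n" "3/4"] by linarith
   have "wmean n p (Wprod g) <= \<rho> ^ u n + wprob m (pair_pmf p p) {zs. nswap zs < 3 * N n * u n} +
    wprob (2 * m) p {xs. \<exists>y. cnt xs y > N n}"
    unfolding n by (rule expectation_Wprod_le) (use g \<rho>0 \<rho>1 N0 in \<open>auto simp: \<rho>_def n\<close>)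
   also have "\<rho> ^ u n <= exp (- (c * real n powr (1/4)))"
   proof -
    have "\<rho> ^ u n <= exp (- (c * real n powr (- 1/2))) ^ u n"
     using \<rho>0 exp_ge_add_one_self[of "- (c * real n powr (- 1/2))"] by (intro power_mono) (auto simp: \<rho>_def)
    also have "... = exp (- (c * real n powr (- 1/2) * real (u n)))" by (simp add: exp_of_nat_mult[symmetric] mult.commute)
    also have "... <= exp (- (c * real n powr (1/4)))"
    proof -
     have "c * real n powr (1/4) = c * real n powr (- 1/2) * real n powr (3/4)"
      using np by (simp add: powr_add[symmetric])
     also have "... <= c * real n powr (- 1/2) * real (u n)" using c u1 by (intro mult_left_mono) auto
     finally show ?thesis by simp
    qed
    finally show ?thesis .
   qed
   also have "wprob m (pair_pmf p p) {zs. nswap zs < 3 * N n * u n} <= exp (3 * real n powr (1/8) * (real n powr (3/4) + 1) - d * (real n - 1))"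
   proof -
    have "wprob m (pair_pmf p p) {zs. nswap zs < 3 * N n * u n} <= exp (real (3 * N n * u n)) * \<theta> ^ m" by (rule \<theta>)
    also have "\<theta> ^ m = exp (- (2 * d * real m))"
     using \<theta> by (simp add: d_def exp_of_nat_mult mult.commute)
    also have "exp (real (3 * N n * u n)) * exp (- (2 * d * real m)) = exp (real (3 * N n * u n) - 2 * d * real m)"
     by (simp add: exp_diff exp_minus divide_inverse)
    also have "... <= exp (3 * real n powr (1/8) * (real n powr (3/4) + 1) - d * (real n - 1))"
    proof -
     have "real (3 * N n * u n) <= 3 * real n powr (1/8) * (real n powr (3/4) + 1)"
      unfolding of_nat_mult using N1 u2 by (intro mult_mono) auto
     moreover have "real n - 1 <= 2 * real m" unfolding m_def by linarith
     then have "d * (real n - 1) <= d * (2 * real m)" using d by (intro mult_left_mono) auto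
     ultimately show ?thesis by simp
    qed
    finally show ?thesis .
   qed
   also have "wprob (2 * m) p {xs. \<exists>y. cnt xs y > N n} <= wprob (2 * m + r) p {xs. \<exists>y. real (cnt xs y) > 1/2 * real n powr (1/8)}"
   proof (rule prob_replicate_append_mono)
    fix xs ys :: "'a list" assume "\<exists>y. cnt xs y > N n"
    then obtain y where "cnt xs y > N n" by blast
    then have "real (cnt (xs @ ys) y) > real (N n)" by (simp add: cnt_append)
    then show "\<exists>y. real (cnt (xs @ ys) y) > 1/2 * real n powr (1/8)" using N2 by (intro exI[of _ y]) linarith
   qed
   also have "2 * m + r = n" using n by simp
   finally have "real n powr e * wmean n p (Wprod g) <= H n"
    unfolding H_def distrib_left[symmetric] by (intro mult_left_mono) (auto simp: algebra_simps)
   then show "real n powr e * wmean n p (Wprod g) <= \<epsilon>" using elim(1) by linarith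
  qed
 qed
qed

section \<open>Fourier analysis of the walk\<close>

text \<open>Countability of the index type upgrades measurability in y for each x to joint
  measurability.\<close>

lemma pmf_Fubini:
 fixes f :: "'a::countable => 'b => 'c::{banach, second_countable_topology}"
 assumes "finite_measure \<nu>" "\<And>x. f x \<in> borel_measurable \<nu>" "\<And>x y. norm (f x y) <= c"
 shows "mean P (%x. \<integral>y. f x y \<partial>\<nu>) = (\<integral>y. mean P (%x. f x y) \<partial>\<nu>)"
  and "(%y. mean P (%x. f x y)) \<in> borel_measurable \<nu>"
proof -
 interpret finite_measure \<nu> by fact
 interpret pair_sigma_finite "measure_pmf P" \<nu> ..
 have m: "case_prod f \<in> borel_measurable (measure_pmf P \<Otimes>\<^sub>M \<nu>)"
 proof -
  have "case_prod f \<in> borel_measurable (count_space UNIV \<Otimes>\<^sub>M \<nu>)"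
   by (rule measurable_pair_measure_countable1) (use assms(2) in auto)
  moreover have "sets (measure_pmf P \<Otimes>\<^sub>M \<nu>) = sets (count_space UNIV \<Otimes>\<^sub>M \<nu>)"
   by (intro sets_pair_measure_cong) auto
  ultimately show ?thesis by (metis measurable_cong_sets)
 qed
 interpret F: finite_measure "measure_pmf P \<Otimes>\<^sub>M \<nu>"
  by (rule finite_measure_pair_measure) (use assms in \<open>auto intro: measure_pmf.finite_measure_axioms\<close>)
 have "integrable (measure_pmf P \<Otimes>\<^sub>M \<nu>) (case_prod f)"
  by (rule F.integrable_const_bound[where B=c]) (use m assms in auto)
 from Fubini_integral[OF this]
 show "mean P (%x. \<integral>y. f x y \<partial>\<nu>) = (\<integral>y. mean P (%x. f x y) \<partial>\<nu>)" by simp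
 show "(%y. mean P (%x. f x y)) \<in> borel_measurable \<nu>"
 proof -
  have "(%(y, x). f x y) \<in> borel_measurable (\<nu> \<Otimes>\<^sub>M measure_pmf P)"
   using measurable_compose[OF measurable_pair_swap' m] by (simp add: case_prod_unfold)
  from measure_pmf.borel_measurable_lebesgue_integral[OF this] show ?thesis by simp
 qed
qed

lemma integral_lborel_prod:
 fixes g :: "'b::euclidean_space => real => complex"
 assumes "\<And>b. b \<in> Basis ==> integrable lborel (g b)"
 shows "(\<integral>x. (\<Prod>b\<in>Basis. g b (x \<bullet> b)) \<partial>lborel) = (\<Prod>b\<in>Basis. \<integral>t. g b t \<partial>lborel)"
proof -
 interpret product_sigma_finite "%_::'b. lborel :: real measure" ..
 have [measurable]: "\<And>b. b \<in> Basis ==> g b \<in> borel_measurable borel" using assms by (metis borel_measurable_integrable measurable_lborel2)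
 have "(\<integral>x. (\<Prod>b\<in>Basis. g b (x \<bullet> b)) \<partial>lborel) =
   (\<integral>f. (\<Prod>b\<in>Basis. g b ((\<Sum>b\<in>Basis. f b *\<^sub>R b) \<bullet> b)) \<partial>(\<Pi>\<^sub>M b\<in>Basis. lborel))"
  by (subst lborel_eq, subst integral_distr) (auto intro!: borel_measurable_prod)
 also have "... = (\<integral>f. (\<Prod>b\<in>Basis. g b (f b)) \<partial>(\<Pi>\<^sub>M b\<in>Basis. lborel))"
  by (intro Bochner_Integration.integral_cong refl prod.cong) simp_all
 also have "... = (\<Prod>b\<in>Basis. \<integral>t. g b t \<partial>lborel)"
  by (rule product_integral_prod) (use assms in auto)
 finally show ?thesis .
qed

lemma integral_cis_period:
 fixes k :: int
 shows "(\<integral>t. indicator {-pi..pi} t *\<^sub>R cis (t * of_int k) \<partial>lborel) = (if k = 0 then of_real (2 * pi) else 0)"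
proof (cases "k = 0")
 case False
 have "((%t. cis (t * of_int k)) has_integral (cis (pi * of_int k) / (\<i> * of_int k) - cis (- pi * of_int k) / (\<i> * of_int k))) {-pi..pi}"
 proof (rule fundamental_theorem_of_calculus)
  fix t assume "t \<in> {-pi..pi}"
  have "((%z. exp (\<i> * (z * of_int k)) / (\<i> * of_int k)) has_field_derivative exp (\<i> * (of_real t * of_int k))) (at (of_real t))"
   using False by (auto intro!: derivative_eq_intros simp: field_simps)
  from has_vector_derivative_real_field[OF this, of "{-pi..pi}"]
  have "((%t. exp (\<i> * of_real (t * of_int k)) / (\<i> * of_int k)) has_vector_derivative exp (\<i> * of_real (t * of_int k))) (at t within {-pi..pi})"
   by simp
  then show "((%t. cis (t * of_int k) / (\<i> * of_int k)) has_vector_derivative cis (t * of_int k)) (at t within {-pi..pi})"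
   by (simp add: cis_conv_exp)
 qed simp
 moreover have "cis (pi * of_int k) = cis (- pi * of_int k)"
 proof -
  have "pi * of_int k = - pi * of_int k + 2 * pi * of_int k" by simp
  then have "cis (pi * of_int k) = cis (- pi * of_int k) * cis (2 * pi * of_int k)"
   unfolding cis_mult by simp
  also have "cis (2 * pi * of_int k) = 1" by (intro cis_multiple_2pi) auto
  finally show ?thesis by simp
 qed
 ultimately have hi: "((%t. cis (t * of_int k)) has_integral 0) {-pi..pi}" by simp
 have "set_integrable lborel {-pi..pi} (%t. cis (t * of_int k))"
  by (rule borel_integrable_atLeastAtMost') (auto intro!: continuous_intros)
 from set_borel_integral_eq_integral(2)[OF this] hi False show ?thesis
  by (simp add: set_lebesgue_integral_def integral_unique)
qed (simp add: scaleR_conv_of_real)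

definition ivec :: "int ^ 'd => real ^ 'd" where
 "ivec x = (\<chi> i. of_int (x $ i))"

lemma ivec_add: "ivec (x + y) = ivec x + ivec y"
 by (simp add: ivec_def vec_eq_iff)

lemma ivec_0 [simp]: "ivec 0 = 0"
 by (simp add: ivec_def vec_eq_iff)

definition wchar :: "(int ^ 'd) pmf => real ^ 'd => complex" where
 "wchar p v = mean p (%x. cis (v \<bullet> ivec x))"

lemma norm_wchar_le: "cmod (wchar p v) <= 1"
proof -
 have "cmod (wchar p v) <= mean p (%x. cmod (cis (v \<bullet> ivec x)))"
  unfolding wchar_def by (rule integral_norm_bound)
 then show ?thesis by simp
qed

lemma wchar_0 [simp]: "wchar p 0 = 1"
 by (simp add: wchar_def)

lemma continuous_wchar: "continuous_on UNIV (wchar p)"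
proof (rule continuous_at_imp_continuous_on, rule ballI)
 fix v :: "real ^ 'a"
 show "isCont (wchar p) v"
  unfolding continuous_at_sequentially
 proof safe
  fix X :: "nat => real ^ 'a" assume X: "X ----> v"
  show "(wchar p \<circ> X) ----> wchar p v"
   unfolding wchar_def o_def
   by (rule integral_dominated_convergence[where w="%_. 1"])
     (use X in \<open>auto intro!: tendsto_intros AE_I2 simp: cis_conv_exp\<close>)
 qed
qed

lemma borel_measurable_wchar [measurable]: "wchar p \<in> borel_measurable borel"
 by (rule borel_measurable_continuous_onI[OF continuous_wchar])

lemma expectation_pair_pmf_complex:
 fixes h :: "'a \<times> 'b => complex"
 assumes b: "\<And>z. cmod (h z) <= c"
 shows "mean (pair_pmf P Q) h = mean P (%x. mean Q (%y. h (x, y)))"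
proof -
 have i1: "integrable (pair_pmf P Q) h" by (rule integrable_pmf_bounded[where c=c]) (rule b)
 have i2: "integrable Q (%y. h (x, y))" for x by (rule integrable_pmf_bounded[where c=c]) (rule b)
 have i3: "integrable P (%x. mean Q (%y. h (x, y)))"
 proof (rule integrable_pmf_bounded[where c=c])
  fix x
  have "cmod (mean Q (%y. h (x, y))) <= mean Q (%y. cmod (h (x, y)))"
   by (rule integral_norm_bound)
  also have "... <= mean Q (%y. c)"
   by (rule expectation_pmf_mono) (use b i2 in auto)
  finally show "cmod (mean Q (%y. h (x, y))) <= c" by simp
 qed
 have re: "\<bar>Re (h z)\<bar> <= c" and im: "\<bar>Im (h z)\<bar> <= c" for z
  using b[of z] abs_Re_le_cmod[of "h z"] abs_Im_le_cmod[of "h z"] by linarith+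
 show ?thesis
 proof (rule complex_eqI)
  show "Re (mean (pair_pmf P Q) h) = Re (mean P (%x. mean Q (%y. h (x, y))))"
   using expectation_pair_pmf[of P Q "%z. Re (h z)" c] re i1 i2 i3 by simp
  show "Im (mean (pair_pmf P Q) h) = Im (mean P (%x. mean Q (%y. h (x, y))))"
   using expectation_pair_pmf[of P Q "%z. Im (h z)" c] im i1 i2 i3 by simp
 qed
qed

lemma wchar_power:
 fixes p :: "(int ^ 'd) pmf"
 shows "wmean n p (%xs. cis (v \<bullet> ivec (sum_list xs))) = wchar p v ^ n"
proof (induction n)
 case (Suc n)
 have "replicate_pmf (Suc n) p = map_pmf (%(x, xs). x # xs) (pair_pmf p (replicate_pmf n p))"
  by (simp add: pair_pmf_def map_bind_pmf)
 then have "wmean (Suc n) p (%xs. cis (v \<bullet> ivec (sum_list xs))) =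
  mean (pair_pmf p (replicate_pmf n p)) (%z. cis (v \<bullet> ivec (fst z + sum_list (snd z))))"
  by (simp add: case_prod_unfold)
 also have "... = mean p (%x. wmean n p (%xs. cis (v \<bullet> ivec (x + sum_list xs))))"
  by (subst expectation_pair_pmf_complex[where c=1]) auto
 also have "... = mean p (%x. cis (v \<bullet> ivec x) * wchar p v ^ n)"
  by (simp add: ivec_add inner_add_right cis_mult[symmetric] Suc.IH)
 also have "... = wchar p v ^ Suc n" by (simp add: wchar_def)
 finally show ?case .
qed simp

definition torus :: "(real ^ 'd) set" where
 "torus = cbox (\<chi> i. -pi) (\<chi> i. pi)"

lemma mem_torus: "v \<in> torus \<longleftrightarrow> (\<forall>i. \<bar>v $ i\<bar> <= pi)"
 unfolding torus_def mem_box_cart by (simp add: abs_le_iff) (metis minus_le_iff)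

lemma compact_torus: "compact torus"
 by (simp add: torus_def)

lemma torus_borel [measurable]: "torus \<in> sets borel"
 by (simp add: torus_def)

definition torus_measure :: "(real ^ 'd) measure" where
 "torus_measure = uniform_measure lborel torus"

lemma emeasure_torus: "emeasure lborel (torus :: (real ^ 'd) set) = ennreal ((2 * pi) ^ CARD('d))"
proof -
 have "emeasure lborel (torus :: (real ^ 'd) set) = ennreal (\<Prod>b\<in>(Basis :: (real ^ 'd) set). ((\<chi> i. pi) - (\<chi> i. - pi)) \<bullet> b)"
  unfolding torus_def by (rule emeasure_lborel_cbox) (auto simp: Basis_vec_def inner_axis)
 also have "(\<Prod>b\<in>(Basis :: (real ^ 'd) set). ((\<chi> i. pi) - (\<chi> i. - pi)) \<bullet> b) = (\<Prod>b\<in>(Basis :: (real ^ 'd) set). 2 * pi)"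
  by (intro prod.cong refl) (auto simp: Basis_vec_def inner_axis)
 finally show ?thesis by simp
qed

lemma prob_space_torus: "prob_space (torus_measure :: (real ^ 'd) measure)"
 unfolding torus_measure_def by (rule prob_space_uniform_measure) (auto simp: emeasure_torus)

lemma sets_torus_measure [measurable_cong]: "sets torus_measure = sets borel"
 by (simp add: torus_measure_def)

lemma integral_torus_measure:
 fixes f :: "real ^ 'd => 'b::{banach, second_countable_topology}"
 assumes [measurable]: "f \<in> borel_measurable borel"
 shows "(\<integral>v. f v \<partial>torus_measure) = (\<integral>v. indicator torus v *\<^sub>R f v \<partial>lborel) /\<^sub>R (2 * pi) ^ CARD('d)"
proof -
 let ?c = "(2 * pi) ^ CARD('d)"
 have c: "?c > 0" by simp
 have dm: "(torus_measure :: (real ^ 'd) measure) = density lborel (%v. ennreal (indicator torus v / ?c))"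
  unfolding torus_measure_def uniform_measure_def emeasure_torus
  by (intro density_cong) (auto simp: indicator_def divide_ennreal[symmetric] ennreal_1[symmetric] simp del: ennreal_1)
 have "(\<integral>v. f v \<partial>torus_measure) = (\<integral>v. (indicator torus v / ?c) *\<^sub>R f v \<partial>lborel)"
  unfolding dm by (subst integral_density) auto
 also have "... = (\<integral>v. (indicator torus v *\<^sub>R f v) /\<^sub>R ?c \<partial>lborel)"
  by (intro Bochner_Integration.integral_cong refl) (simp add: divide_inverse mult.commute)
 also have "... = (\<integral>v. indicator torus v *\<^sub>R f v \<partial>lborel) /\<^sub>R ?c"
  by (rule Bochner_Integration.integral_scaleR_right)
 finally show ?thesis .
qed

lemma torus_orthogonality:
 fixes z :: "int ^ 'd"
 shows "(\<integral>v. cis (v \<bullet> ivec z) \<partial>torus_measure) = (if z = 0 then 1 else 0)"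
proof -
 let ?B = "Basis :: (real ^ 'd) set"
 have zb: "\<exists>k::int. ivec z \<bullet> b = of_int k" if "b \<in> ?B" for b
  using that by (auto simp: Basis_vec_def ivec_def inner_axis)
 define k where "k b = \<lfloor>ivec z \<bullet> b\<rfloor>" for b
 have k: "ivec z \<bullet> b = of_int (k b)" if "b \<in> ?B" for b
  using zb[OF that] by (auto simp: k_def)
 have "indicator torus v *\<^sub>R cis (v \<bullet> ivec z) = (\<Prod>b\<in>?B. indicator {-pi..pi} (v \<bullet> b) *\<^sub>R cis ((v \<bullet> b) * of_int (k b)))" for v :: "real ^ 'd"
 proof -
  have "cis (v \<bullet> ivec z) = (\<Prod>b\<in>?B. cis ((v \<bullet> b) * of_int (k b)))"
   by (subst euclidean_inner, simp add: cis_conv_exp exp_sum[symmetric] sum_distrib_left k)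
  moreover have "indicator torus v = (\<Prod>b\<in>?B. indicator {-pi..pi} (v \<bullet> b) :: real)"
  proof -
   have "v \<in> torus \<longleftrightarrow> (\<forall>b\<in>?B. v \<bullet> b \<in> {-pi..pi})"
   proof -
    have "v \<in> torus \<longleftrightarrow> (\<forall>b\<in>?B. \<bar>v \<bullet> b\<bar> <= pi)"
     unfolding mem_torus by (auto simp: Basis_vec_def inner_axis)
    also have "... \<longleftrightarrow> (\<forall>b\<in>?B. v \<bullet> b \<in> {-pi..pi})"
     by (intro ball_cong refl) (simp add: abs_le_iff, metis minus_le_iff)
    finally show ?thesis .
   qed
   then show ?thesis by (auto simp: indicator_def prod_zero_iff)
  qed
  ultimately show ?thesis
   by (simp add: scaleR_conv_of_real prod.distrib)
 qed
 then have "(\<integral>v. indicator torus v *\<^sub>R cis (v \<bullet> ivec z) \<partial>lborel) =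
   (\<Prod>b\<in>?B. \<integral>t. indicator {-pi..pi} t *\<^sub>R cis (t * of_int (k b)) \<partial>lborel)"
 proof (simp only:, intro integral_lborel_prod)
  fix b :: "real ^ 'd"
  have "set_integrable lborel {-pi..pi} (%t. cis (t * of_int (k b)))"
   by (rule borel_integrable_atLeastAtMost') (auto intro!: continuous_intros)
  then show "integrable lborel (%t. indicator {-pi..pi} t *\<^sub>R cis (t * of_int (k b)))"
   by (simp add: set_integrable_def)
 qed
 also have "... = (\<Prod>b\<in>?B. if k b = 0 then of_real (2 * pi) else 0)"
  by (simp only: integral_cis_period)
 also have "... = (if z = 0 then of_real ((2 * pi) ^ CARD('d)) else 0)"
 proof (cases "z = 0")
  case True
  then have "k b = 0" if "b \<in> ?B" for b using k[OF that] by simp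
  then show ?thesis using True by simp
 next
  case False
  then obtain i where i: "z $ i \<noteq> 0" by (auto simp: vec_eq_iff)
  have "axis i 1 \<in> ?B" by (auto simp: Basis_vec_def)
  moreover have "k (axis i 1) \<noteq> 0" using i k[OF \<open>axis i 1 \<in> ?B\<close>] by (auto simp: ivec_def inner_axis)
  ultimately have "(\<Prod>b\<in>?B. if k b = 0 then of_real (2 * pi) else 0 :: complex) = 0"
   by (subst prod_zero_iff) auto
  then show ?thesis using False by simp
 qed
 finally have *: "(\<integral>v. indicator torus v *\<^sub>R cis (v \<bullet> ivec z) \<partial>lborel) = (if z = 0 then of_real ((2 * pi) ^ CARD('d)) else 0)" .
 have [measurable]: "(%v. cis (v \<bullet> ivec z)) \<in> borel_measurable borel"
  by (intro borel_measurable_continuous_onI continuous_intros)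
 show ?thesis
  by (subst integral_torus_measure, measurable, unfold *) (auto simp: scaleR_conv_of_real field_simps)
qed

lemma at0_fourier:
 fixes p :: "(int ^ 'd) pmf"
 shows "of_real (at0 p n) = (\<integral>v. wchar p v ^ n \<partial>torus_measure)"
proof -
 interpret prob_space "torus_measure :: (real ^ 'd) measure" by (rule prob_space_torus)
 have "(\<integral>v. wchar p v ^ n \<partial>torus_measure) = (\<integral>v. wmean n p (%xs. cis (v \<bullet> ivec (sum_list xs))) \<partial>torus_measure)"
  by (simp add: wchar_power)
 also have "... = wmean n p (%xs. \<integral>v. cis (v \<bullet> ivec (sum_list xs)) \<partial>torus_measure)"
  by (rule pmf_Fubini(1)[symmetric, where c=1])
    (auto intro!: borel_measurable_continuous_onI continuous_intros finite_measure_axioms simp: measurable_cong_sets[OF sets_torus_measure refl])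
 also have "... = wmean n p (%xs. of_real (if sum_list xs = 0 then 1 else 0))"
  by (intro Bochner_Integration.integral_cong refl) (simp add: torus_orthogonality)
 also have "... = of_real (at0 p n)"
  unfolding at0_def prob_eq_expectation by (rule integral_complex_of_real)
 finally show ?thesis ..
qed

text \<open>Common form of both walk hypotheses: 1 - \<open>wchar\<close> is equivalent to a gauge q
  near 0, and the sets {q < r} have volume linear in r. Half a planar quadratic form and a * |t| on
  the line are both of this kind; linear volume is exactly what makes the integral of 1 / (e + q)
  diverge logarithmically as e tends to 0.\<close>

locale char_walk =
 fixes p :: "(int ^ 'd) pmf" and q :: "real ^ 'd => real" and c :: real
 assumes c_pos: "c > 0"
  and q_nonneg: "\<And>t. 0 <= q t" and q_0: "q 0 = 0"
  and q_cont: "continuous_on UNIV q"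
  and q_vol: "\<And>r. r > 0 ==> emeasure lborel {t. q t < r} = ennreal (c * r)"
  and q_near: "\<And>\<eta>. \<eta> > 0 ==> \<exists>r>0. \<forall>t. q t < r --> cmod (1 - wchar p t - of_real (q t)) <= \<eta> * q t"
  and q_small: "\<And>e. e > 0 ==> \<exists>r>0. \<forall>t. q t < r --> norm t < e"
begin

lemma q_measurable [measurable]: "q \<in> borel_measurable borel"
 by (rule borel_measurable_continuous_onI[OF q_cont])

text \<open>The volume assumption says that q carries Lebesgue measure to c times Lebesgue measure
  on the half line; integrals of functions of q thereby become one-dimensional.\<close>

lemma distr_q: "distr lborel borel q = density lborel (%r. ennreal c * indicator {0..} r)"
proof (rule measure_eqI_generator_eq[where E="range (%a::real. {..<a})" and \<Omega>=UNIV and A="%n. {..<real n}"])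
 show "Int_stable (range (%a::real. {..<a}))"
 proof -
  have "{..<a} \<inter> {..<b} = {..<min a b}" for a b :: real by auto
  then show ?thesis by (auto simp: Int_stable_def)
 qed
 have eq: "emeasure (distr lborel borel q) {..<a} = ennreal (c * max 0 a)" for a
 proof (cases "a > 0")
  case True
  then show ?thesis using q_vol[of a] by (simp add: emeasure_distr vimage_def)
 next
  case False
  then have "{t. q t < a} = {}" using q_nonneg by (auto simp: not_less intro: order_trans)
  then show ?thesis using False by (simp add: emeasure_distr vimage_def)
 qed
 have eq2: "emeasure (density lborel (%r. ennreal c * indicator {0..} r)) {..<a} = ennreal (c * max 0 a)" for a
 proof -
  have "emeasure (density lborel (%r. ennreal c * indicator {0..} r)) {..<a} = (\<integral>\<^sup>+r. ennreal c * indicator {0..<a} r \<partial>lborel)"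
   by (subst emeasure_density) (auto intro!: nn_integral_cong simp: indicator_def)
  also have "... = ennreal c * emeasure lborel {0..<a}" by (rule nn_integral_cmult_indicator) simp
  also have "... = ennreal (c * max 0 a)"
   using c_pos by (cases "a > 0") (auto simp: ennreal_mult'[symmetric] max_def)
  finally show ?thesis .
 qed
 show "\<And>X. X \<in> range (%a::real. {..<a}) ==> emeasure (distr lborel borel q) X = emeasure (density lborel (%r. ennreal c * indicator {0..} r)) X"
  using eq eq2 by auto
 show "sets (distr lborel borel q) = sigma_sets UNIV (range (%a::real. {..<a}))"
  by (simp add: borel_Iio)
 show "sets (density lborel (%r. ennreal c * indicator {0..} r)) = sigma_sets UNIV (range (%a::real. {..<a}))"
  by (simp add: borel_Iio)
 show "(\<Union>n. {..<real n}) = UNIV" by (auto intro: reals_Archimedean2)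
 show "emeasure (distr lborel borel q) {..<real n} \<noteq> \<infinity>" for n by (simp add: eq)
qed auto

lemma nn_integral_q:
 assumes [measurable]: "h \<in> borel_measurable borel"
 shows "(\<integral>\<^sup>+t. h (q t) \<partial>lborel) = ennreal c * (\<integral>\<^sup>+r. h r * indicator {0..} r \<partial>lborel)"
proof -
 have "(\<integral>\<^sup>+t. h (q t) \<partial>lborel) = (\<integral>\<^sup>+r. h r \<partial>distr lborel borel q)"
  by (simp add: nn_integral_distr)
 also have "... = (\<integral>\<^sup>+r. ennreal c * indicator {0..} r * h r \<partial>lborel)"
  unfolding distr_q by (subst nn_integral_density) auto
 also have "... = (\<integral>\<^sup>+r. ennreal c * (h r * indicator {0..} r) \<partial>lborel)"
  by (simp add: mult_ac)
 also have "... = ennreal c * (\<integral>\<^sup>+r. h r * indicator {0..} r \<partial>lborel)"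
  by (rule nn_integral_cmult) simp
 finally show ?thesis .
qed

lemma nn_integral_exp_q:
 assumes k: "k > 0"
 shows "(\<integral>\<^sup>+t. ennreal (exp (- (k * q t))) \<partial>lborel) = ennreal (c / k)"
proof -
 have "(\<integral>\<^sup>+r. ennreal (exp (- (k * r))) * indicator {0..} r \<partial>lborel) = ennreal (0 - (- exp (- (k * 0)) / k))"
 proof (rule nn_integral_FTC_atLeast)
  show "((%r. - exp (- (k * r)) / k) \<longlongrightarrow> 0) at_top" using k by real_asymp
  show "\<And>x. 0 <= x ==> ((%r. - exp (- (k * r)) / k) has_real_derivative exp (- (k * x))) (at x)"
   using k by (auto intro!: derivative_eq_intros)
 qed auto
 then show ?thesis using c_pos k by (subst nn_integral_q) (auto simp: ennreal_mult'[symmetric])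
qed

lemma nn_integral_inverse_q:
 assumes e: "e > 0" and d: "d > 0"
 shows "(\<integral>\<^sup>+t. ennreal (indicator {t. q t <= d} t / (e + q t)) \<partial>lborel) = ennreal (c * ln ((e + d) / e))"
proof -
 have "(\<integral>\<^sup>+t. ennreal (indicator {t. q t <= d} t / (e + q t)) \<partial>lborel) = (\<integral>\<^sup>+t. (%r. ennreal (indicator {..d} r / (e + r))) (q t) \<partial>lborel)"
  by (intro nn_integral_cong) (auto simp: indicator_def)
 also have "... = ennreal c * (\<integral>\<^sup>+r. ennreal (indicator {..d} r / (e + r)) * indicator {0..} r \<partial>lborel)"
  by (rule nn_integral_q) measurable
 also have "(\<integral>\<^sup>+r. ennreal (indicator {..d} r / (e + r)) * indicator {0..} r \<partial>lborel) = (\<integral>\<^sup>+r. ennreal (1 / (e + r)) * indicator {0..d} r \<partial>lborel)"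
  by (intro nn_integral_cong) (auto simp: indicator_def)
 also have "... = ennreal (ln (e + d) - ln (e + 0))"
  by (rule nn_integral_FTC_Icc) (use e d in \<open>auto intro!: derivative_eq_intros simp: has_real_derivative_iff_has_vector_derivative[symmetric]\<close>)
 also have "ln (e + d) - ln (e + 0) = ln ((e + d) / e)" using e d by (simp add: ln_div)
 finally show ?thesis using c_pos e d by (simp add: ennreal_mult'[symmetric])
qed

lemma wchar_decay: "\<exists>\<rho>>0. \<forall>t. norm t < \<rho> --> cmod (wchar p t) <= exp (- (q t / 2))"
proof -
 obtain r where r: "r > 0" "\<And>t. q t < r ==> cmod (1 - wchar p t - of_real (q t)) <= 1/4 * q t"
  using q_near[of "1/4"] by auto
 have "isCont q 0" using q_cont by (simp add: continuous_on_eq_continuous_at)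
 then have "\<exists>\<rho>>0. \<forall>t. dist t 0 < \<rho> --> dist (q t) (q 0) < min r 1"
  unfolding continuous_at_eps_delta using r(1) by (metis min_less_iff_conj zero_less_one)
 then obtain \<rho> where \<rho>: "\<rho> > 0" "\<And>t. norm t < \<rho> ==> q t < min r 1"
  using q_0 q_nonneg by (auto simp: dist_real_def)
 have "cmod (wchar p t) <= exp (- (q t / 2))" if "norm t < \<rho>" for t
 proof -
  have qq: "q t < r" "q t < 1" using \<rho>(2)[OF that] by auto
  have "cmod (wchar p t) = cmod (of_real (1 - q t) - (1 - wchar p t - of_real (q t)))" by simp
  also have "... <= cmod (of_real (1 - q t)) + cmod (1 - wchar p t - of_real (q t))" by (rule norm_triangle_ineq4)
  also have "... <= (1 - q t) + 1/4 * q t" using r(2)[OF qq(1)] qq(2) by (simp only: norm_of_real)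
  also have "... <= 1 + - (q t / 2)" using q_nonneg[of t] by simp
  also have "... <= exp (- (q t / 2))" by (rule exp_ge_add_one_self)
  finally show ?thesis .
 qed
 then show ?thesis using \<rho>(1) by blast
qed

text \<open>Esseen's concentration inequality: the square of the average of the characters over a small
 ball dominates the indicator of the origin and only involves frequencies near zero.\<close>
lemma at0_bound: "\<exists>C. \<forall>k\<ge>1. at0 p k <= C / real k"
proof -
 obtain \<rho> where \<rho>: "\<rho> > 0" "\<And>t. norm t < \<rho> ==> cmod (wchar p t) <= exp (- (q t / 2))"
  using wchar_decay by blast
 \<comment> \<open>Radius \<rho> / 2, so that differences of two points of the ball stay within the
   radius \<rho> of \<open>wchar_decay\<close>.\<close>
 define B where "B = ball (0 :: real ^ 'd) (\<rho> / 2)"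
 define v where "v = measure lborel B"
 have eB: "emeasure lborel B = ennreal v" unfolding v_def B_def
  by (rule emeasure_eq_ennreal_measure) (metis emeasure_lborel_ball_finite infinity_ennreal_def less_irrefl)
 have v: "v > 0" unfolding v_def B_def using \<rho>(1) by (simp add: content_ball_pos)
 define \<nu> where "\<nu> = uniform_measure lborel B"
 have [measurable_cong]: "sets \<nu> = sets borel" by (simp add: \<nu>_def)
 interpret \<nu>: prob_space \<nu> unfolding \<nu>_def
  by (rule prob_space_uniform_measure) (use eB v in auto)
 have mcis: "(%t. cis (t \<bullet> z)) \<in> borel_measurable borel" for z :: "real ^ 'd"
  by (intro borel_measurable_continuous_onI continuous_intros)
 have mcis' [measurable]: "(%t. cis (t \<bullet> z)) \<in> borel_measurable \<nu>" for z :: "real ^ 'd"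
  using mcis[of z] by simp
 have mm: "(%t'. cis ((t - t') \<bullet> z)) \<in> borel_measurable \<nu>" for z t :: "real ^ 'd"
 proof -
  have "(%t'. cis ((t - t') \<bullet> z)) \<in> borel_measurable borel"
   by (intro borel_measurable_continuous_onI continuous_intros)
  then show ?thesis by simp
 qed
 define J where "J z = (\<integral>t. cis (t \<bullet> ivec z) \<partial>\<nu>)" for z :: "int ^ 'd"
 have J1: "cmod (J z) <= 1" for z
 proof -
  have "cmod (J z) <= (\<integral>t. cmod (cis (t \<bullet> ivec z)) \<partial>\<nu>)" unfolding J_def by (rule integral_norm_bound)
  then show ?thesis by (simp add: \<nu>.prob_space)
 qed
 have J0: "J 0 = 1" by (simp add: J_def \<nu>.prob_space)
 have inB: "AE t in \<nu>. t \<in> B"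
  unfolding \<nu>_def by (rule AE_uniform_measureI) (auto simp: B_def)
 have inner: "cmod (\<integral>t'. wchar p (t - t') ^ k \<partial>\<nu>) <= 2 * c / v / real k" if t: "t \<in> B" and k: "k \<ge> 1" for t k
 proof -
  have [measurable]: "(%t'. wchar p (t - t') ^ k) \<in> borel_measurable borel" by measurable
  have int: "integrable \<nu> (%t'. wchar p (t - t') ^ k)"
   by (rule \<nu>.integrable_const_bound[where B=1]) (auto intro!: AE_I2 power_le_one norm_wchar_le simp: norm_power)
  have "ennreal (cmod (\<integral>t'. wchar p (t - t') ^ k \<partial>\<nu>)) <= (\<integral>\<^sup>+t'. ennreal (cmod (wchar p (t - t') ^ k)) \<partial>\<nu>)"
   by (rule integral_norm_bound_ennreal[OF int])
  also have "... = (\<integral>\<^sup>+t'. ennreal (cmod (wchar p (t - t') ^ k)) * indicator B t' \<partial>lborel) / ennreal v"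
   unfolding \<nu>_def eB[symmetric] by (rule nn_integral_uniform_measure) (auto simp: B_def)
  also have "... <= (\<integral>\<^sup>+t'. ennreal (exp (- (real k / 2 * q (t - t')))) \<partial>lborel) / ennreal v"
  proof (intro divide_right_mono_ennreal nn_integral_mono)
   fix t'
   show "ennreal (cmod (wchar p (t - t') ^ k)) * indicator B t' <= ennreal (exp (- (real k / 2 * q (t - t'))))"
   proof (cases "t' \<in> B")
    case True
    then have "norm (t - t') < \<rho>" using t norm_triangle_ineq4[of t t'] by (simp add: B_def)
    then have "cmod (wchar p (t - t')) ^ k <= exp (- (q (t - t') / 2)) ^ k"
     by (intro power_mono \<rho>(2)) auto
    also have "... = exp (- (real k / 2 * q (t - t')))" by (simp add: exp_of_nat_mult[symmetric])
    finally show ?thesis using True by (simp add: norm_power ennreal_leI)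
   qed simp
  qed
  also have "(\<integral>\<^sup>+t'. ennreal (exp (- (real k / 2 * q (t - t')))) \<partial>lborel) = (\<integral>\<^sup>+t'. ennreal (exp (- (real k / 2 * q t'))) \<partial>lborel)"
  proof -
   have "(lborel :: (real ^ 'd) measure) = distr lborel borel (%x. t - x)"
    using lborel_affine[of "-1" t] by (simp add: density_1)
   then have "(\<integral>\<^sup>+t'. ennreal (exp (- (real k / 2 * q t'))) \<partial>lborel) = (\<integral>\<^sup>+t'. ennreal (exp (- (real k / 2 * q t'))) \<partial>distr lborel borel (%x. t - x))" by simp
   then show ?thesis by (simp add: nn_integral_distr)
  qed
  also have "... = ennreal (c / (real k / 2))" by (rule nn_integral_exp_q) (use k in simp)
  also have "... / ennreal v = ennreal (2 * c / v / real k)"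
   using v c_pos by (simp add: divide_ennreal field_simps)
  finally show ?thesis using v c_pos by (subst (asm) ennreal_le_iff) auto
 qed
 have "at0 p k <= (2 * c / v) / real k" if k: "k \<ge> 1" for k
 proof -
  let ?E = "wmean k p"
  have "of_real (at0 p k) = at0 p k" by simp
  have "at0 p k <= ?E (%xs. (cmod (J (sum_list xs)))\<^sup>2)"
   unfolding at0_def prob_eq_expectation
   by (rule expectation_pmf_mono)
     (use J0 J1 in \<open>auto intro!: integrable_pmf_bounded[where c=1] simp: power_le_one\<close>)
  also have "complex_of_real (?E (%xs. (cmod (J (sum_list xs)))\<^sup>2)) = ?E (%xs. J (sum_list xs) * cnj (J (sum_list xs)))"
   by (subst complex_norm_square[symmetric]) (rule integral_complex_of_real[symmetric])
  then have "?E (%xs. (cmod (J (sum_list xs)))\<^sup>2) = cmod (?E (%xs. J (sum_list xs) * cnj (J (sum_list xs))))"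
   by (metis (no_types, lifting) Bochner_Integration.integral_nonneg abs_of_nonneg norm_of_real zero_le_power2)
  also have "?E (%xs. J (sum_list xs) * cnj (J (sum_list xs))) = ?E (%xs. \<integral>t. cis (t \<bullet> ivec (sum_list xs)) * cnj (J (sum_list xs)) \<partial>\<nu>)"
   unfolding J_def by simp
  also have "... = (\<integral>t. ?E (%xs. cis (t \<bullet> ivec (sum_list xs)) * cnj (J (sum_list xs))) \<partial>\<nu>)"
   by (rule pmf_Fubini(1)[where c=1]) (use J1 in \<open>auto simp: norm_mult intro: \<nu>.finite_measure_axioms\<close>)
  also have "... = (\<integral>t. (\<integral>t'. wchar p (t - t') ^ k \<partial>\<nu>) \<partial>\<nu>)"
  proof (intro Bochner_Integration.integral_cong refl)
   fix t
   have "cis (t \<bullet> ivec z) * cnj (J z) = (\<integral>t'. cis ((t - t') \<bullet> ivec z) \<partial>\<nu>)" for z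
   proof -
    have "cnj (J z) = (\<integral>t'. cis (- (t' \<bullet> ivec z)) \<partial>\<nu>)"
    proof -
     have "integrable \<nu> (%t. cis (t \<bullet> ivec z))"
      by (rule \<nu>.integrable_const_bound[where B=1]) auto
     then have "cnj (J z) = (\<integral>t'. cnj (cis (t' \<bullet> ivec z)) \<partial>\<nu>)" unfolding J_def by simp
     then show ?thesis by (simp add: cis_cnj)
    qed
    then have "cis (t \<bullet> ivec z) * cnj (J z) = (\<integral>t'. cis (t \<bullet> ivec z) * cis (- (t' \<bullet> ivec z)) \<partial>\<nu>)" by simp
    then show ?thesis by (simp add: cis_mult inner_diff_left)
   qed
   then have "?E (%xs. cis (t \<bullet> ivec (sum_list xs)) * cnj (J (sum_list xs))) = ?E (%xs. \<integral>t'. cis ((t - t') \<bullet> ivec (sum_list xs)) \<partial>\<nu>)"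
    by simp
   also have "... = (\<integral>t'. ?E (%xs. cis ((t - t') \<bullet> ivec (sum_list xs))) \<partial>\<nu>)"
    by (rule pmf_Fubini(1)[where c=1]) (use mm in \<open>auto intro: \<nu>.finite_measure_axioms\<close>)
   also have "... = (\<integral>t'. wchar p (t - t') ^ k \<partial>\<nu>)" by (simp add: wchar_power)
   finally show "?E (%xs. cis (t \<bullet> ivec (sum_list xs)) * cnj (J (sum_list xs))) = (\<integral>t'. wchar p (t - t') ^ k \<partial>\<nu>)" .
  qed
  also have "cmod ... <= 2 * c / v / real k"
  proof (cases "integrable \<nu> (%t. \<integral>t'. wchar p (t - t') ^ k \<partial>\<nu>)")
   case True
   have "ennreal (cmod (\<integral>t. (\<integral>t'. wchar p (t - t') ^ k \<partial>\<nu>) \<partial>\<nu>)) <= (\<integral>\<^sup>+t. ennreal (cmod (\<integral>t'. wchar p (t - t') ^ k \<partial>\<nu>)) \<partial>\<nu>)"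
    by (rule integral_norm_bound_ennreal[OF True])
   also have "... <= (\<integral>\<^sup>+t. ennreal (2 * c / v / real k) \<partial>\<nu>)"
    by (rule nn_integral_mono_AE) (use inB in eventually_elim, intro ennreal_leI inner k)
   also have "... = ennreal (2 * c / v / real k)" by (simp add: \<nu>.emeasure_space_1)
   finally show ?thesis using v c_pos by (subst (asm) ennreal_le_iff) auto
  next
   \<comment> \<open>A non-integrable function has Bochner integral 0 by convention, so the bound
     holds trivially.\<close>
   case False
   then show ?thesis using v c_pos by (simp add: not_integrable_integral_eq)
  qed
  finally show ?thesis .
 qed
 then show ?thesis by blast
qed

text \<open>Only the existence of the constant is proved, so it is named by choice.\<close>

sublocale critical_walk p "SOME C. \<forall>k\<ge>1. at0 p k <= C / real k"
 by unfold_locales (use someI_ex[OF at0_bound] in blast)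

end

section \<open>Logarithmic growth of the Green function\<close>

locale lattice_char_walk = char_walk p q c for p :: "(int ^ 'd) pmf" and q c +
 assumes generates: "\<And>H. 0 \<in> H ==> (\<And>u v. u \<in> H ==> v \<in> H ==> u - v \<in> H) ==> set_pmf p \<subseteq> H ==> H = UNIV"
begin

text \<open>A mean equal to 1 forces the character of t to be 1 on the whole support. The points
  where it is 1 form a subgroup, hence the full lattice, and evaluation at unit vectors gives t = 0
  on the torus.\<close>

lemma wchar_eq_1_imp:
 assumes "wchar p t = 1" "t \<in> torus"
 shows "t = 0"
proof -
 let ?H = "{x. cis (t \<bullet> ivec x) = 1}"
 have "mean p (%x. 1 - Re (cis (t \<bullet> ivec x))) = 0"
 proof -
  have i: "integrable p (%x. cis (t \<bullet> ivec x))" by (rule integrable_pmf_bounded[where c=1]) simp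
  have "mean p (%x. Re (cis (t \<bullet> ivec x))) = Re (wchar p t)"
   unfolding wchar_def by (rule integral_Re[OF i])
  moreover have "integrable p (%x. Re (cis (t \<bullet> ivec x)))" using i by (rule integrable_Re)
  ultimately show ?thesis using assms(1) by (subst Bochner_Integration.integral_diff) auto
 qed
 moreover have nn: "AE x in p. 0 <= 1 - Re (cis (t \<bullet> ivec x))" by simp
 moreover have "integrable p (%x. 1 - Re (cis (t \<bullet> ivec x)))"
 proof (rule integrable_pmf_bounded[where c=2])
  fix x
  have "\<bar>cos (t \<bullet> ivec x)\<bar> <= 1" by (rule abs_cos_le_one)
  then show "norm (1 - Re (cis (t \<bullet> ivec x))) <= 2" by (simp add: abs_le_iff)
 qed
 ultimately have "AE x in p. 1 - Re (cis (t \<bullet> ivec x)) = 0"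
  by (subst (asm) integral_nonneg_eq_0_iff_AE) auto
 then have "\<forall>x\<in>set_pmf p. cos (t \<bullet> ivec x) = 1" by (simp add: AE_measure_pmf_iff)
 then have "\<forall>x\<in>set_pmf p. cis (t \<bullet> ivec x) = 1"
  by (metis cis.code cis_zero cos_one_2pi_int cis_multiple_2pi Ints_of_int mult.commute mult.assoc)
 then have sub: "set_pmf p \<subseteq> ?H" by auto
 have "?H = UNIV"
 proof (rule generates[OF _ _ sub])
  show "u - v \<in> ?H" if "u \<in> ?H" "v \<in> ?H" for u v
  proof -
   have "ivec (u - v) = ivec u - ivec v" by (simp add: ivec_def vec_eq_iff)
   then have "cis (t \<bullet> ivec (u - v)) = cis (t \<bullet> ivec u) / cis (t \<bullet> ivec v)"
    by (simp add: inner_diff_right cis_divide)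
   then show ?thesis using that by simp
  qed
 qed simp
 show "t = 0"
 proof (rule vec_eq_iff[THEN iffD2], rule allI)
  fix i
  have "axis i 1 \<in> ?H" using \<open>?H = UNIV\<close> by blast
  moreover have "t \<bullet> ivec (axis i 1) = t $ i"
  proof -
   have "ivec (axis i 1) = axis i 1" by (auto simp: ivec_def axis_def vec_eq_iff)
   then show ?thesis by (simp add: inner_axis)
  qed
  ultimately have "cos (t $ i) = 1" by (simp add: complex_eq_iff)
  moreover have "\<bar>t $ i\<bar> <= pi" using assms(2) by (simp add: mem_torus)
  ultimately show "t $ i = 0 $ i"
   using cos_inj_pi[of "\<bar>t $ i\<bar>" 0] by simp
 qed
qed

text \<open>Compactness in s and t jointly. A zero would force s = 1 and
  \<open>wchar p t = 1\<close>, hence t = 0; points where \<open>wchar\<close> is another number of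
  modulus one, as for periodic walks, stay at positive distance from 1.\<close>

lemma wchar_away:
 assumes "r > 0"
 shows "\<exists>m>0. \<forall>t\<in>torus. \<forall>s\<in>{0..1}. q t \<ge> r --> m <= cmod (1 - of_real s * wchar p t)"
proof -
 let ?K = "{0..1::real} \<times> (torus \<inter> {t. q t \<ge> r})"
 have cl: "closed {t. q t \<ge> r}"
  using continuous_closed_preimage[OF q_cont closed_UNIV, of "{r..}"] by (simp add: vimage_def)
 have cK: "compact ?K" by (intro compact_Times compact_Icc compact_Int_closed compact_torus cl)
 have cont: "continuous_on ?K (%z. cmod (1 - of_real (fst z) * wchar p (snd z)))"
  by (intro continuous_intros continuous_on_compose2[OF continuous_wchar]) auto
 have pos: "cmod (1 - of_real (fst z) * wchar p (snd z)) > 0" if "z \<in> ?K" for z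
 proof -
  have "1 - of_real (fst z) * wchar p (snd z) \<noteq> 0"
  proof
   assume "1 - of_real (fst z) * wchar p (snd z) = 0"
   then have eq: "of_real (fst z) * wchar p (snd z) = 1" by simp
   then have "cmod (of_real (fst z) * wchar p (snd z)) = 1" by simp
   then have "fst z * cmod (wchar p (snd z)) = 1" using that by (auto simp: norm_mult)
   moreover have "fst z * cmod (wchar p (snd z)) <= fst z * 1"
    using that norm_wchar_le by (intro mult_left_mono) auto
   ultimately have "fst z = 1" using that by auto
   then have "wchar p (snd z) = 1" using eq by simp
   then have "snd z = 0" using wchar_eq_1_imp that by auto
   then show False using that assms q_0 by auto
  qed
  then show ?thesis by simp
 qed
 show ?thesis
 proof (cases "?K = {}")
  case True
  then show ?thesis by (intro exI[of _ 1]) auto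
 next
  case False
  from continuous_attains_inf[OF cK False cont] obtain z where z: "z \<in> ?K"
   "\<forall>y\<in>?K. cmod (1 - of_real (fst z) * wchar p (snd z)) <= cmod (1 - of_real (fst y) * wchar p (snd y))" by blast
  show ?thesis
   by (rule exI[of _ "cmod (1 - of_real (fst z) * wchar p (snd z))"]) (use z pos[OF z(1)] in auto)
 qed
qed

text \<open>The damping s < 1 makes the geometric series converge uniformly on the torus, although
  |\<open>wchar\<close>| reaches 1 at the origin.\<close>

lemma green_gen_fourier:
 assumes s: "0 <= s" "s < 1"
 shows "(%k. s ^ k * at0 p k) sums Re (\<integral>t. 1 / (1 - of_real s * wchar p t) \<partial>torus_measure)"
proof -
 interpret T: prob_space "torus_measure :: (real ^ 'd) measure" by (rule prob_space_torus)
 let ?f = "%k t. (of_real s * wchar p t) ^ k"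
 have le: "cmod (?f k t) <= s ^ k" for k t
 proof -
  have "cmod (of_real s * wchar p t) <= s * 1"
   unfolding norm_mult using s norm_wchar_le by (intro mult_mono) auto
  then show ?thesis unfolding norm_power by (intro power_mono) auto
 qed
 have m: "?f k \<in> borel_measurable torus_measure" for k
  unfolding measurable_cong_sets[OF sets_torus_measure refl] by measurable
 have int: "integrable torus_measure (?f k)" for k
  by (rule T.integrable_const_bound[where B="s ^ k"]) (use m le in auto)
 have "(%k. \<integral>t. ?f k t \<partial>torus_measure) sums (\<integral>t. (\<Sum>k. ?f k t) \<partial>torus_measure)"
 proof (rule sums_integral)
  show "integrable torus_measure (?f k)" for k by (rule int)
  show "AE t in torus_measure. summable (%k. norm (?f k t))"
  proof (rule AE_I2)
   fix t
   show "summable (%k. norm (?f k t))"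
    by (rule summable_comparison_test'[where g="%k. s ^ k" and N=0]) (use s le in \<open>auto intro: summable_geometric\<close>)
  qed
  show "summable (%k. \<integral>t. norm (?f k t) \<partial>torus_measure)"
  proof (rule summable_comparison_test'[where g="%k. s ^ k" and N=0])
   fix k :: nat
   have "(\<integral>t. norm (?f k t) \<partial>torus_measure) <= (\<integral>t. s ^ k \<partial>(torus_measure :: (real ^ 'd) measure))"
    by (intro Bochner_Integration.integral_mono integrable_norm int T.integrable_const le)
   then show "norm (\<integral>t. norm (?f k t) \<partial>torus_measure) <= s ^ k" by (simp add: T.prob_space)
  qed (use s in \<open>auto intro: summable_geometric\<close>)
 qed
 moreover have "(\<Sum>k. ?f k t) = 1 / (1 - of_real s * wchar p t)" for t
  by (rule suminf_geometric) (use le[of t 1] s in simp)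
 moreover have "(\<integral>t. ?f k t \<partial>torus_measure) = of_real (s ^ k * at0 p k)" for k
  by (simp add: power_mult_distrib at0_fourier of_real_power)
 ultimately have "(%k. complex_of_real (s ^ k * at0 p k)) sums (\<integral>t. 1 / (1 - of_real s * wchar p t) \<partial>torus_measure)" by simp
 from sums_Re[OF this] show ?thesis by simp
qed

text \<open>Near 0 the integrand is replaced by 1 / (e + q) with e = 1 / n, whose integral is c * ln
  ((e + d) / e), about c * ln n; away from 0 it is bounded by 1 / m.\<close>

lemma green_gen_asymp:
 "(%n. (\<Sum>k. (1 - 1 / real n) ^ k * at0 p k) / ln (real n)) ----> c / (2 * pi) ^ CARD('d)"
proof (rule LIMSEQ_I)
 fix \<epsilon> :: real assume \<epsilon>: "\<epsilon> > 0"
 define K where "K = (2 * pi) ^ CARD('d)"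
 have K: "K > 0" by (simp add: K_def)
 \<comment> \<open>The limiting error is 2 * \<eta> * c / K, which the second bound keeps below
   \<epsilon>; the first one, together with e \<le> 1/4, ensures \<eta> + e \<le> 1/2.\<close>
 define \<eta> where "\<eta> = min (1/4) (\<epsilon> * K / (8 * c))"
 have \<eta>: "\<eta> > 0" "\<eta> <= 1/4" "4 * c * \<eta> <= \<epsilon> * K / 2"
  using \<epsilon> K c_pos by (auto simp: \<eta>_def min_def field_simps)
 obtain r1 where r1: "r1 > 0" "\<And>t. q t < r1 ==> cmod (1 - wchar p t - of_real (q t)) <= \<eta> * q t"
  using q_near[OF \<eta>(1)] by auto
 obtain r2 where r2: "r2 > 0" "\<And>t. q t < r2 ==> norm t < pi"
  using q_small[of pi] by auto
 \<comment> \<open>Below r1 for the approximation by q, below r2 so that {q \<le> d} lies inside the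
   torus.\<close>
 define d where "d = min r1 r2 / 2"
 have d: "d > 0" "d < r1" "d < r2" using r1(1) r2(1) by (auto simp: d_def min_def)
 obtain m where m: "m > 0" "\<And>t s. t \<in> torus ==> s \<in> {0..1} ==> q t \<ge> d ==> m <= cmod (1 - of_real s * wchar p t)"
  using wchar_away[OF d(1)] by auto
 have tor: "t \<in> torus" if "q t <= d" for t
 proof -
  have "norm t < pi" using r2(2)[of t] that d by simp
  then show ?thesis unfolding mem_torus using component_le_norm_cart[of t] by (meson less_imp_le order_trans)
 qed
 have main: "\<bar>K * (\<Sum>k. s ^ k * at0 p k) - c * ln ((e + d) / e)\<bar> <= 2 * (\<eta> + e) * (c * ln ((e + d) / e)) + K / m"
  if s: "e = 1 - s" "0 < e" "e <= 1/4" for s e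
 proof -
  define D where "D t = 1 - of_real s * wchar p t" for t
  define I where "I t = indicator {t. q t <= d} t / (e + q t)" for t
  have s01: "0 <= s" "s < 1" using s by auto
  have Dm [measurable]: "D \<in> borel_measurable borel" unfolding D_def by measurable
  have Im [measurable]: "I \<in> borel_measurable borel" unfolding I_def by measurable
  have I0: "I t \<ge> 0" for t using q_nonneg[of t] s by (simp add: I_def)
  have nnI: "(\<integral>\<^sup>+t. ennreal (I t) \<partial>lborel) = ennreal (c * ln ((e + d) / e))"
   unfolding I_def by (rule nn_integral_inverse_q) (use s d in auto)
  have lnpos: "ln ((e + d) / e) \<ge> 0" using s d by (intro ln_ge_zero) (auto simp: field_simps)
  have intI: "integrable lborel I"
   by (rule integrableI_nonneg) (use I0 nnI in auto)
  have I_val: "(\<integral>t. I t \<partial>lborel) = c * ln ((e + d) / e)"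
   by (rule integral_eq_nn_integral[THEN trans]) (use I0 nnI c_pos lnpos in auto)
  have Dlow: "cmod (D t) \<ge> 1 - s" for t
  proof -
   have "cmod (of_real s * wchar p t) <= s * 1"
    unfolding norm_mult using s01 norm_wchar_le by (intro mult_mono) auto
   then show ?thesis using norm_triangle_ineq2[of 1 "of_real s * wchar p t"] by (simp add: D_def)
  qed
  have pt: "cmod (indicator torus t *\<^sub>R (1 / D t) - of_real (I t)) <= 2 * (\<eta> + e) * I t + indicator torus t / m" for t
  proof (cases "q t <= d")
   case True
   have ne: "D t \<noteq> 0" using Dlow[of t] s01 by auto
   have eq: "e + q t > 0" using s q_nonneg[of t] by simp
   have "cmod (D t - of_real (e + q t)) = cmod (of_real s * (1 - wchar p t - of_real (q t)) - of_real (e * q t))"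
    unfolding D_def s(1) by (simp add: algebra_simps)
   also have "... <= cmod (of_real s * (1 - wchar p t - of_real (q t))) + cmod (of_real (e * q t))"
    by (rule norm_triangle_ineq4)
   also have "... <= 1 * (\<eta> * q t) + e * q t"
   proof (rule add_mono)
    show "cmod (of_real s * (1 - wchar p t - of_real (q t))) <= 1 * (\<eta> * q t)"
     unfolding norm_mult using s01 r1(2)[of t] True d by (intro mult_mono) auto
    show "cmod (of_real (e * q t)) <= e * q t"
     unfolding norm_of_real using s(2) q_nonneg[of t] by simp
   qed
   finally have diff: "cmod (D t - of_real (e + q t)) <= (\<eta> + e) * q t" by (simp add: algebra_simps)
   \<comment> \<open>The relative error is at most one half, so |D| is at least half of e +
     q.\<close>
   have "(\<eta> + e) * q t <= (1/2) * (e + q t)" using \<eta> s q_nonneg[of t] by (intro mult_mono) auto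
   then have half: "(e + q t) / 2 <= cmod (D t)"
    using diff norm_triangle_ineq2[of "of_real (e + q t)" "of_real (e + q t) - D t"] eq
    by (simp add: norm_minus_commute del: of_real_add)
   have "1 / D t - of_real (1 / (e + q t)) = (of_real (e + q t) - D t) / (D t * of_real (e + q t))"
    using ne eq by (simp add: field_simps del: of_real_add)
   then have "cmod (1 / D t - of_real (1 / (e + q t))) = cmod (D t - of_real (e + q t)) / (cmod (D t) * (e + q t))"
    using eq by (simp add: norm_divide norm_mult norm_minus_commute del: of_real_add)
   also have "... <= ((\<eta> + e) * (e + q t)) / ((e + q t) / 2 * (e + q t))"
   proof (rule frac_le)
    show "cmod (D t - of_real (e + q t)) <= (\<eta> + e) * (e + q t)"
     by (rule order_trans[OF diff]) (use \<eta> s in \<open>auto intro!: mult_left_mono\<close>)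
    show "(e + q t) / 2 * (e + q t) <= cmod (D t) * (e + q t)"
     using half eq by (intro mult_right_mono) auto
   qed (use \<eta> s eq in auto)
   also have "... = 2 * (\<eta> + e) * (1 / (e + q t))"
   proof -
    have "(x * a) / (a / 2 * a) = 2 * x * (1 / a)" if "a > 0" for x a :: real using that by simp
    from this[OF eq] show ?thesis .
   qed
   finally have "cmod (1 / D t - of_real (1 / (e + q t))) <= 2 * (\<eta> + e) * (1 / (e + q t)) + 1 / m"
    using m(1) by (smt (verit) divide_pos_pos)
   then show ?thesis using True tor[OF True] by (simp add: I_def)
  next
   case False
   show ?thesis
   proof (cases "t \<in> torus")
    case True
    have "m <= cmod (D t)" unfolding D_def by (rule m(2)) (use True False s01 in auto)
    moreover from this have "cmod (D t) > 0" using m(1) by linarith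
    ultimately have "1 / cmod (D t) <= 1 / m" using m(1) by (intro divide_left_mono mult_pos_pos) auto
    then show ?thesis using False True by (simp add: I_def norm_divide)
   qed (use False in \<open>simp add: I_def\<close>)
  qed
  have intD: "integrable lborel (%t. indicator torus t *\<^sub>R (1 / D t))"
  proof (rule Bochner_Integration.integrable_bound[where f="%t. indicator torus t * (1 / (1 - s))"])
   show "integrable lborel (%t::real ^ 'd. indicator torus t * (1 / (1 - s)))"
    by (intro integrable_mult_left integrable_real_indicator) (auto simp: emeasure_torus)
   show "AE t in lborel. cmod (indicator torus t *\<^sub>R (1 / D t)) <= norm (indicator torus t * (1 / (1 - s)))"
   proof (rule AE_I2)
    fix t
    have "1 / cmod (D t) <= 1 / (1 - s)" using Dlow[of t] s01 by (intro divide_left_mono mult_pos_pos) auto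
    then show "cmod (indicator torus t *\<^sub>R (1 / D t)) <= norm (indicator torus t * (1 / (1 - s)))"
     using s01 by (simp add: norm_divide indicator_def)
   qed
  qed measurable
  have "K * (\<Sum>k. s ^ k * at0 p k) = Re (\<integral>t. indicator torus t *\<^sub>R (1 / D t) \<partial>lborel)"
  proof -
   have "(\<Sum>k. s ^ k * at0 p k) = Re (\<integral>t. 1 / D t \<partial>torus_measure)"
    using green_gen_fourier[OF s01] unfolding D_def by (rule sums_unique[symmetric])
   also have "... = Re (\<integral>t. indicator torus t *\<^sub>R (1 / D t) \<partial>lborel) / K"
    by (subst integral_torus_measure) (auto simp: K_def divide_inverse)
   finally show ?thesis using K by simp
  qed
  also have "... - c * ln ((e + d) / e) = Re (\<integral>t. indicator torus t *\<^sub>R (1 / D t) - of_real (I t) \<partial>lborel)"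
   using intD intI by (subst Bochner_Integration.integral_diff) (auto simp: I_val)
  also have "\<bar>...\<bar> <= cmod (\<integral>t. indicator torus t *\<^sub>R (1 / D t) - of_real (I t) \<partial>lborel)" by (rule abs_Re_le_cmod)
  also have "... <= (\<integral>t. cmod (indicator torus t *\<^sub>R (1 / D t) - of_real (I t)) \<partial>lborel)" by (rule integral_norm_bound)
  also have "... <= (\<integral>t. 2 * (\<eta> + e) * I t + indicator torus t / m \<partial>lborel)"
  proof (rule integral_mono)
   show "integrable lborel (%t. 2 * (\<eta> + e) * I t + indicator torus t / m)"
    using intI by (intro Bochner_Integration.integrable_add integrable_mult_right integrable_divide integrable_real_indicator) (auto simp: emeasure_torus)
  qed (use intD intI pt in auto)
  also have "... = 2 * (\<eta> + e) * (c * ln ((e + d) / e)) + K / m"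
  proof -
   have "measure lborel (torus :: (real ^ 'd) set) = K" unfolding measure_def emeasure_torus K_def by simp
   moreover have "integrable lborel (indicator torus :: real ^ 'd => real)" by (intro integrable_real_indicator) (auto simp: emeasure_torus)
   ultimately show ?thesis using intI by (subst Bochner_Integration.integral_add) (auto simp: I_val)
  qed
  finally show ?thesis .
 qed
 define u where "u n = ln ((1 / real n + d) / (1 / real n)) / ln (real n)" for n
 have u: "u ----> 1" unfolding u_def using d(1) by real_asymp
 have "(%n. (2 * (\<eta> + 1 / real n) * (c * u n) + K / m / ln (real n)) / K + c / K * \<bar>u n - 1\<bar>) ----> (2 * (\<eta> + 0) * (c * 1) + 0) / K + c / K * \<bar>1 - 1\<bar>"
  by (intro tendsto_intros u) (use K m(1) in \<open>simp_all, real_asymp+\<close>)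
 moreover have "(2 * (\<eta> + 0) * (c * 1) + 0) / K + c / K * \<bar>1 - 1\<bar> < \<epsilon>"
 proof -
  have "\<eta> * (c * 8) <= K * \<epsilon>" using \<eta>(3) K c_pos by (simp add: field_simps)
  then have "\<eta> * (c * 2) < K * \<epsilon>" using mult_pos_pos[OF K \<epsilon>] by linarith
  then show ?thesis using K by (simp add: field_simps)
 qed
 ultimately have "\<forall>\<^sub>F n in sequentially. (2 * (\<eta> + 1 / real n) * (c * u n) + K / m / ln (real n)) / K + c / K * \<bar>u n - 1\<bar> < \<epsilon>"
  by (rule order_tendstoD(2))
 then have "\<forall>\<^sub>F n in sequentially. norm ((\<Sum>k. (1 - 1 / real n) ^ k * at0 p k) / ln (real n) - c / K) < \<epsilon>"
  using eventually_ge_at_top[of 4]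
 proof eventually_elim
  case (elim n)
  let ?G = "\<Sum>k. (1 - 1 / real n) ^ k * at0 p k" and ?L = "ln ((1 / real n + d) / (1 / real n))"
  have l: "ln (real n) > 0" using elim by simp
  have "\<bar>K * ?G - c * ?L\<bar> <= 2 * (\<eta> + 1 / real n) * (c * ?L) + K / m"
   by (rule main) (use elim in \<open>auto simp: field_simps\<close>)
  then have "\<bar>K * ?G - c * ?L\<bar> / (K * ln (real n)) <= (2 * (\<eta> + 1 / real n) * (c * ?L) + K / m) / (K * ln (real n))"
   using K l by (intro divide_right_mono) auto
  also have "... = (2 * (\<eta> + 1 / real n) * (c * u n) + K / m / ln (real n)) / K"
   using K l m(1) unfolding u_def by (simp add: field_simps)
  also have "\<bar>K * ?G - c * ?L\<bar> / (K * ln (real n)) = \<bar>?G / ln (real n) - c / K * u n\<bar>"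
  proof -
   have "?G / ln (real n) - c / K * u n = (K * ?G - c * ?L) / (K * ln (real n))"
    using K l unfolding u_def by (simp add: field_simps)
   then show ?thesis using K l by (simp add: abs_mult)
  qed
  finally have 1: "\<bar>?G / ln (real n) - c / K * u n\<bar> <= (2 * (\<eta> + 1 / real n) * (c * u n) + K / m / ln (real n)) / K" .
  have "c / K * u n - c / K = c / K * (u n - 1)" by (simp add: algebra_simps)
  then have "\<bar>c / K * u n - c / K\<bar> = c / K * \<bar>u n - 1\<bar>" using K c_pos by (simp add: abs_mult)
  with 1 elim(1) show ?case by (simp only: real_norm_def)
 qed
 then show "\<exists>no. \<forall>n\<ge>no. norm ((\<Sum>k. (1 - 1 / real n) ^ k * at0 p k) / ln (real n) - c / (2 * pi) ^ CARD('d)) < \<epsilon>"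
  by (simp add: eventually_sequentially K_def)
qed

end

text \<open>Passage from the damped sum to the truncated one. The bound C0 / k on \<open>at0\<close>
  controls both the damped tail beyond n and, through 1 - s ^ k \<le> k / n, the loss up to n. Each
  lies between 0 and C0, and they enter with opposite signs.\<close>

lemma (in critical_walk) green_gen_close:
 assumes n: "n \<ge> 2"
 shows "\<bar>green p n - (\<Sum>k. (1 - 1 / real n) ^ k * at0 p k)\<bar> <= C0"
proof -
 define s where "s = 1 - 1 / real n"
 have s: "0 <= s" "s < 1" using n by (auto simp: s_def field_simps)
 have sm: "summable (%k. s ^ k * at0 p k)"
 proof (rule summable_comparison_test'[where g="%k. s ^ k" and N=0])
  show "norm (s ^ k * at0 p k) <= s ^ k" for k
   using s at0_range[of p k] mult_left_mono[of "at0 p k" 1 "s ^ k"] by (simp add: abs_mult)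
 qed (use s in \<open>auto intro: summable_geometric\<close>)
 define H where "H = (\<Sum>k. s ^ (k + Suc n) * at0 p (k + Suc n))"
 have split: "(\<Sum>k. s ^ k * at0 p k) = H + (\<Sum>k\<le>n. s ^ k * at0 p k)"
  unfolding H_def using suminf_split_initial_segment[OF sm, of "Suc n"] by (simp add: lessThan_Suc_atMost)
 have H0: "0 <= H" unfolding H_def
  by (rule suminf_nonneg[OF summable_ignore_initial_segment[OF sm]]) (use s at0_range in \<open>intro mult_nonneg_nonneg zero_le_power, auto\<close>)
 have H1: "H <= C0"
 proof -
  have "H <= (\<Sum>k. s ^ k * (C0 / real n))"
   unfolding H_def
  proof (rule suminf_le)
   fix k
   have "at0 p (k + Suc n) <= C0 / real (k + Suc n)" by (rule at0_le) simp
   also have "... <= C0 / real n" using n C0_nonneg by (intro divide_left_mono) auto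
   finally have "at0 p (k + Suc n) <= C0 / real n" .
   moreover have "s ^ (k + Suc n) <= s ^ k" using s by (intro power_decreasing) auto
   ultimately show "s ^ (k + Suc n) * at0 p (k + Suc n) <= s ^ k * (C0 / real n)"
    using s at0_range by (intro mult_mono) auto
  qed (use s sm summable_ignore_initial_segment[OF sm, of "Suc n"] in \<open>auto intro!: summable_mult2 summable_geometric\<close>)
  also have "... = 1 / (1 - s) * (C0 / real n)"
   using s suminf_mult2[OF summable_geometric, of s "C0 / real n"] suminf_geometric[of s] by simp
  also have "... = C0" using n by (simp add: s_def)
  finally show ?thesis .
 qed
 have D: "(\<Sum>k\<le>n. at0 p k * (1 - s ^ k)) <= C0" "0 <= (\<Sum>k\<le>n. at0 p k * (1 - s ^ k))"
 proof -
  have "(\<Sum>k\<le>n. at0 p k * (1 - s ^ k)) = (\<Sum>k\<in>{1..n}. at0 p k * (1 - s ^ k))"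
   by (rule sum.mono_neutral_right) (auto simp: not_le)
  also have "... <= (\<Sum>k\<in>{1..n}. C0 / real n)"
  proof (intro sum_mono)
   fix k assume k: "k \<in> {1..n}"
   have "1 + real k * (- (1 / real n)) <= (1 + - (1 / real n)) ^ k"
    by (rule Bernoulli_inequality) (use n in simp)
   then have "1 - s ^ k <= real k / real n" by (simp add: s_def)
   moreover have "at0 p k <= C0 / real k" using k by (intro at0_le) auto
   ultimately have "at0 p k * (1 - s ^ k) <= (C0 / real k) * (real k / real n)"
    using s at0_range C0_nonneg by (intro mult_mono) (auto simp: power_le_one)
   then show "at0 p k * (1 - s ^ k) <= C0 / real n" using k by simp
  qed
  also have "... = C0" using n by simp
  finally show "(\<Sum>k\<le>n. at0 p k * (1 - s ^ k)) <= C0" .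
  show "0 <= (\<Sum>k\<le>n. at0 p k * (1 - s ^ k))"
   using s at0_range by (intro sum_nonneg mult_nonneg_nonneg) (auto simp: power_le_one)
 qed
 have "green p n - (\<Sum>k. s ^ k * at0 p k) = (\<Sum>k\<le>n. at0 p k * (1 - s ^ k)) - H"
  unfolding split green_def by (simp add: algebra_simps sum_subtractf)
 then show ?thesis using D H0 H1 unfolding s_def[symmetric] by linarith
qed

context lattice_char_walk begin

lemma green_log: "(%n. green p n / ln (real n)) ----> c / (2 * pi) ^ CARD('d)"
proof -
 let ?G = "%n. \<Sum>k. (1 - 1 / real n) ^ k * at0 p k"
 let ?C = "SOME C. \<forall>k\<ge>1. at0 p k <= C / real k"
 have "(%n. green p n / ln (real n) - ?G n / ln (real n)) ----> 0"
 proof (rule tendsto_rabs_zero_cancel, rule tendsto_sandwich)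
  show "\<forall>\<^sub>F n in sequentially. 0 <= \<bar>green p n / ln (real n) - ?G n / ln (real n)\<bar>" by simp
  show "\<forall>\<^sub>F n in sequentially. \<bar>green p n / ln (real n) - ?G n / ln (real n)\<bar> <= ?C / ln (real n)"
   using eventually_ge_at_top[of 2]
  proof eventually_elim
   case (elim n)
   have "\<bar>green p n / ln (real n) - ?G n / ln (real n)\<bar> = \<bar>green p n - ?G n\<bar> / ln (real n)"
    using elim by (simp add: diff_divide_distrib[symmetric])
   also have "... <= ?C / ln (real n)"
    using green_gen_close[OF elim] elim by (intro divide_right_mono) auto
   finally show ?case .
  qed
  have "(%n. C / ln (real n)) ----> 0" for C :: real by real_asymp
  then show "(%n. ?C / ln (real n)) ----> 0" .
 qed simp
 from tendsto_add[OF this green_gen_asymp] show ?thesis by simp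
qed

sublocale log_green_walk p "SOME C. \<forall>k\<ge>1. at0 p k <= C / real k" "c / (2 * pi) ^ CARD('d)"
 by unfold_locales (use c_pos green_log in auto)

end

section \<open>Inversion formula for the scenery\<close>

lemma pmf_replicate_pmf: "length xs = n ==> pmf (replicate_pmf n p) xs = (\<Prod>i<n. pmf p (xs ! i))"
proof (induction n arbitrary: xs)
 case (Suc n)
 then obtain x ys where xs: "xs = x # ys" "length ys = n" by (cases xs) auto
 have "replicate_pmf (Suc n) p = map_pmf (%(x, xs). x # xs) (pair_pmf p (replicate_pmf n p))"
  by (simp add: pair_pmf_def map_bind_pmf)
 then have "pmf (replicate_pmf (Suc n) p) (case (x, ys) of (x, xs) => x # xs) = pmf (pair_pmf p (replicate_pmf n p)) (x, ys)"
  by (simp only:) (rule pmf_map_inj', auto simp: inj_def)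
 then have "pmf (replicate_pmf (Suc n) p) xs = pmf p x * pmf (replicate_pmf n p) ys"
  by (simp add: xs pmf_pair)
 also have "... = pmf p (xs ! 0) * (\<Prod>i<n. pmf p (xs ! Suc i))"
  using Suc.IH[OF xs(2)] by (simp add: xs)
 also have "... = (\<Prod>i<Suc n. pmf p (xs ! i))" by (rule prod.lessThan_Suc_shift[symmetric])
 finally show ?case .
qed simp

section \<open>Law of the path and its independence of the scenery\<close>

locale walk_scenery =
 fixes M :: "'w measure" and X :: "nat => 'w => int ^ 'd" and \<xi> :: "int ^ 'd => 'w => real"
 assumes ws: "walk_and_scenery M X \<xi>"
begin

sublocale prob_space M using ws unfolding walk_and_scenery_def by (rule conjunct1)

lemma iid_X: "iid_family M (count_space UNIV) {1..} X"
 using ws unfolding walk_and_scenery_def by (elim conjE)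

lemma iid_\<xi>: "iid_family M borel UNIV \<xi>"
 using ws unfolding walk_and_scenery_def by (elim conjE)

lemma indep_X: "indep_vars (%_. count_space UNIV) X {1..}"
 using iid_X unfolding iid_family_def by (rule conjunct1)

lemma indep_\<xi>: "indep_vars (%_. borel) \<xi> UNIV"
 using iid_\<xi> unfolding iid_family_def by (rule conjunct1)

lemma X_distr:
 assumes "i \<ge> 1" "j \<ge> 1"
 shows "distr M (count_space UNIV) (X i) = distr M (count_space UNIV) (X j)"
proof -
 have "\<forall>i\<in>{1..}. \<forall>j\<in>{1..}. distr M (count_space UNIV) (X i) = distr M (count_space UNIV) (X j)"
  using iid_X unfolding iid_family_def by (rule conjunct2)
 then show ?thesis using assms by (meson atLeast_iff)
qed

lemma \<xi>_distr: "distr M borel (\<xi> y) = distr M borel (\<xi> z)"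
proof -
 have "\<forall>i\<in>UNIV. \<forall>j\<in>UNIV. distr M borel (\<xi> i) = distr M borel (\<xi> j)"
  using iid_\<xi> unfolding iid_family_def by (rule conjunct2)
 then show ?thesis by (meson UNIV_I)
qed

lemma X_measurable [measurable]: "i \<ge> 1 ==> X i \<in> measurable M (count_space UNIV)"
 using indep_X unfolding indep_vars_def by (meson atLeast_iff)

lemma \<xi>_measurable [measurable]: "\<xi> y \<in> borel_measurable M"
 using indep_\<xi> unfolding indep_vars_def by (meson UNIV_I)

text \<open>A law on a countable set is carried by its atoms, so the law of an increment is a
  \<open>pmf\<close> and the estimates for words of i.i.d. increments apply to it.\<close>

definition step :: "(int ^ 'd) pmf" where
 "step = Abs_pmf (distr M (count_space UNIV) (X 1))"

lemma measure_pmf_step: "measure_pmf step = distr M (count_space UNIV) (X 1)"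
 unfolding step_def
proof (rule Abs_pmf_inverse)
 interpret D: prob_space "distr M (count_space UNIV) (X 1)" by (rule prob_space_distr) simp
 have "AE x in distr M (count_space UNIV) (X 1). measure (distr M (count_space UNIV) (X 1)) {x} \<noteq> 0"
  by (rule D.AE_support_countable[THEN iffD2]) auto
 then show "distr M (count_space UNIV) (X 1) \<in> {M. prob_space M \<and> sets M = UNIV \<and> (AE x in M. measure M {x} \<noteq> 0)}"
  using D.prob_space_axioms by (simp only: mem_Collect_eq sets_distr sets_count_space Pow_UNIV simp_thms)
qed

lemma pmf_step: "i \<ge> 1 ==> prob {s \<in> space M. X i s = x} = pmf step x"
proof -
 assume i: "i \<ge> 1"
 have "pmf step x = measure (distr M (count_space UNIV) (X i)) {x}"
  unfolding pmf.rep_eq measure_pmf_step using X_distr[OF i, of 1] by simp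
 also have "... = prob {s \<in> space M. X i s = x}"
  by (subst measure_distr) (use i in \<open>auto intro!: arg_cong[where f=prob]\<close>)
 finally show ?thesis ..
qed

text \<open>Indices are shifted by one because the increments start at \<open>X 1\<close>.\<close>

definition path :: "nat => 'w => (int ^ 'd) list" where
 "path n s = map (%i. X (Suc i) s) [0..<n]"

lemma path_eq_iff: "path n s = xs \<longleftrightarrow> length xs = n \<and> (\<forall>i<n. X (Suc i) s = xs ! i)"
 by (auto simp: path_def list_eq_iff_nth_eq)

lemma path_set [measurable]: "{s \<in> space M. path n s = xs} \<in> sets M"
proof -
 have "{s \<in> space M. length xs = n \<and> (\<forall>i<n. X (Suc i) s = xs ! i)} \<in> sets M" by measurable
 then show ?thesis by (simp add: path_eq_iff)
qed

lemma prob_path: "prob {s \<in> space M. path n s = xs} = pmf (replicate_pmf n step) xs"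
proof (cases "length xs = n")
 case False
 then have "xs \<notin> set_pmf (replicate_pmf n step)" using length_replicate_pmf by blast
 moreover have "{s \<in> space M. path n s = xs} = {}" using False by (auto simp: path_def)
 ultimately show ?thesis by (metis measure_empty pmf_eq_0_set_pmf)
next
 case len: True
 show ?thesis
 proof (cases "n = 0")
  case True
  then have "{s \<in> space M. path n s = xs} = space M" using len by (auto simp: path_def)
  then show ?thesis using True len prob_space by simp
 next
  case False
  have "{s \<in> space M. path n s = xs} = (\<Inter>j\<in>{1..n}. X j -` {xs ! (j - 1)} \<inter> space M)"
  proof (intro set_eqI iffI)
   fix s assume "s \<in> (\<Inter>j\<in>{1..n}. X j -` {xs ! (j - 1)} \<inter> space M)"
   then have *: "\<And>j. j \<in> {1..n} ==> X j s = xs ! (j - 1)" "s \<in> space M" using False by auto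
   then have "X (Suc i) s = xs ! i" if "i < n" for i using that *(1)[of "Suc i"] by auto
   then show "s \<in> {s \<in> space M. path n s = xs}" using len *(2) by (auto simp: path_eq_iff)
  next
   fix s assume "s \<in> {s \<in> space M. path n s = xs}"
   then have *: "s \<in> space M" "\<And>i. i < n ==> X (Suc i) s = xs ! i" by (auto simp: path_eq_iff)
   have "X j s = xs ! (j - 1)" if "j \<in> {1..n}" for j using *(2)[of "j - 1"] that by auto
   then show "s \<in> (\<Inter>j\<in>{1..n}. X j -` {xs ! (j - 1)} \<inter> space M)" using *(1) by auto
  qed
  also have "prob ... = (\<Prod>j\<in>{1..n}. prob (X j -` {xs ! (j - 1)} \<inter> space M))"
   by (rule indep_varsD[OF indep_X]) (use False in auto)
  also have "... = (\<Prod>j\<in>{1..n}. pmf step (xs ! (j - 1)))"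
  proof (intro prod.cong refl)
   fix j assume "j \<in> {1..n}"
   then have "prob {s \<in> space M. X j s = xs ! (j - 1)} = pmf step (xs ! (j - 1))" by (intro pmf_step) auto
   moreover have "X j -` {xs ! (j - 1)} \<inter> space M = {s \<in> space M. X j s = xs ! (j - 1)}" by auto
   ultimately show "prob (X j -` {xs ! (j - 1)} \<inter> space M) = pmf step (xs ! (j - 1))" by simp
  qed
  also have "... = (\<Prod>i<n. pmf step (xs ! i))"
   by (rule prod.reindex_bij_witness[of _ Suc "%j. j - 1"]) auto
  also have "... = pmf (replicate_pmf n step) xs" using len by (simp add: pmf_replicate_pmf)
  finally show ?thesis .
 qed
qed

lemma sum_list_path: "k <= n ==> sum_list (take k (path n s)) = walk X k s"
proof -
 assume k: "k <= n"
 have "take k (path n s) = map (%i. X (Suc i) s) [0..<k]" using k by (simp add: path_def take_map)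
 then have "sum_list (take k (path n s)) = (\<Sum>i<k. X (Suc i) s)" by (simp add: sum_list_distinct_conv_sum_set atLeast0LessThan)
 also have "... = (\<Sum>i=1..k. X i s)" by (rule sum.reindex_bij_witness[of _ "%j. j - 1" Suc]) auto
 finally show ?thesis by (simp add: walk_def)
qed

definition path_sum :: "(int ^ 'd) list => 'w => real" where
 "path_sum xs s = (\<Sum>k<length xs. \<xi> (sites xs ! k) s)"

lemma path_sum_measurable [measurable]: "path_sum xs \<in> borel_measurable M"
 unfolding path_sum_def[abs_def] by measurable

lemma rwrs_eq_path_sum: "rwrs X \<xi> n s = path_sum (path n s) s"
proof -
 have l: "length (path n s) = n" by (simp add: path_def)
 have "sites (path n s) ! k = walk X k s" if "k < n" for k
  using that l sum_list_path[of k n s] by (simp add: sites_nth)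
 then show ?thesis unfolding rwrs_def path_sum_def l by (intro sum.cong refl) simp
qed

text \<open>The independence hypothesis concerns the sigma-algebras of the two whole families; both
  events are preimages of measurable sets of the product spaces that depend on finitely many
  coordinates.\<close>

lemma prob_path_and_scenery:
 assumes B: "B \<in> sets borel"
 shows "prob {s \<in> space M. path n s = xs \<and> path_sum xs s \<in> B} =
  pmf (replicate_pmf n step) xs * prob {s \<in> space M. path_sum xs s \<in> B}"
proof (cases "length xs = n")
 case False
 then have "xs \<notin> set_pmf (replicate_pmf n step)" using length_replicate_pmf by blast
 moreover have "{s \<in> space M. path n s = xs \<and> path_sum xs s \<in> B} = {}" using False by (auto simp: path_def)
 ultimately show ?thesis by (metis measure_empty mult_zero_left pmf_eq_0_set_pmf)
next
 case len: True
 let ?PX = "\<Pi>\<^sub>M k\<in>{1::nat..}. count_space (UNIV :: (int ^ 'd) set)"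
 let ?P\<xi> = "\<Pi>\<^sub>M y\<in>(UNIV :: (int ^ 'd) set). (borel :: real measure)"
 let ?A = "{f \<in> space ?PX. \<forall>i\<in>{..<n}. f (Suc i) = xs ! i}"
 let ?B = "{g \<in> space ?P\<xi>. (\<Sum>k<length xs. g (sites xs ! k)) \<in> B}"
 have ind: "indep_set
    (sets (vimage_algebra (space M) (%s. \<lambda>k\<in>{1..}. X k s) ?PX))
    (sets (vimage_algebra (space M) (%s y. \<xi> y s) ?P\<xi>))"
  using ws unfolding walk_and_scenery_def by (elim conjE)
 have A: "?A \<in> sets ?PX"
 proof -
  have [measurable]: "(%f. f (Suc i)) \<in> measurable ?PX (count_space UNIV)" for i
   by (rule measurable_component_singleton) simp
  show ?thesis by measurable
 qed
 have Bs: "?B \<in> sets ?P\<xi>"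
 proof -
  have [measurable]: "(%g. g y) \<in> borel_measurable ?P\<xi>" for y
   by (rule measurable_component_singleton) simp
  show ?thesis using B by measurable
 qed
 have 1: "(%s. \<lambda>k\<in>{1..}. X k s) -` ?A \<inter> space M = {s \<in> space M. path n s = xs}"
  using len by (auto simp: path_eq_iff space_PiM)
 have 2: "(%s y. \<xi> y s) -` ?B \<inter> space M = {s \<in> space M. path_sum xs s \<in> B}"
  by (auto simp: path_sum_def space_PiM)
 have "prob ({s \<in> space M. path n s = xs} \<inter> {s \<in> space M. path_sum xs s \<in> B}) =
  prob {s \<in> space M. path n s = xs} * prob {s \<in> space M. path_sum xs s \<in> B}"
  by (rule indep_setD[OF ind]) (subst 1[symmetric] 2[symmetric], rule in_vimage_algebra, fact A Bs)+
 moreover have "{s \<in> space M. path n s = xs} \<inter> {s \<in> space M. path_sum xs s \<in> B} = {s \<in> space M. path n s = xs \<and> path_sum xs s \<in> B}" by auto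
 ultimately show ?thesis by (simp add: prob_path)
qed

lemma rwrs_set: "B \<in> sets borel ==> {s \<in> space M. rwrs X \<xi> n s \<in> B} = (\<Union>xs. {s \<in> space M. path n s = xs \<and> path_sum xs s \<in> B})"
 by (auto simp: rwrs_eq_path_sum)

lemma path_event:
 assumes B: "B \<in> sets borel"
 shows "{s \<in> space M. path n s = xs \<and> path_sum xs s \<in> B} \<in> sets M"
proof -
 have "{s \<in> space M. path n s = xs \<and> path_sum xs s \<in> B} = {s \<in> space M. path n s = xs} \<inter> (path_sum xs -` B \<inter> space M)" by auto
 then show ?thesis using B by (simp add: measurable_sets[OF path_sum_measurable] sets.Int)
qed

lemma rwrs_event: "B \<in> sets borel ==> {s \<in> space M. rwrs X \<xi> n s \<in> B} \<in> sets M"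
 unfolding rwrs_set by (rule sets.countable_UN) (auto simp: path_event)

text \<open>Conditioning on the path: there are countably many paths, and given one of them the
  scenery keeps its law.\<close>

lemma prob_rwrs:
 assumes B: "B \<in> sets borel"
 shows "prob {s \<in> space M. rwrs X \<xi> n s \<in> B} =
  wmean n step (%xs. prob {s \<in> space M. path_sum xs s \<in> B})"
proof -
 let ?S = "%xs. {s \<in> space M. path n s = xs \<and> path_sum xs s \<in> B}"
 have S: "?S xs \<in> sets M" for xs by (rule path_event[OF B])
 have "emeasure M {s \<in> space M. rwrs X \<xi> n s \<in> B} = emeasure M (\<Union>xs. ?S xs)" by (simp only: rwrs_set[OF B])
 also have "... = (\<integral>\<^sup>+xs. emeasure M (?S xs) \<partial>count_space UNIV)"
  by (rule emeasure_UN_countable) (use S in \<open>auto simp: disjoint_family_on_def\<close>)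
 also have "... = (\<integral>\<^sup>+xs. ennreal (pmf (replicate_pmf n step) xs) * ennreal (prob {s \<in> space M. path_sum xs s \<in> B}) \<partial>count_space UNIV)"
  by (intro nn_integral_cong) (simp add: emeasure_eq_measure prob_path_and_scenery[OF B] ennreal_mult)
 also have "... = (\<integral>\<^sup>+xs. ennreal (prob {s \<in> space M. path_sum xs s \<in> B}) \<partial>replicate_pmf n step)"
  by (rule nn_integral_measure_pmf[symmetric])
 also have "... = ennreal (wmean n step (%xs. prob {s \<in> space M. path_sum xs s \<in> B}))"
  by (rule nn_integral_eq_integral) (auto intro!: integrable_pmf_bounded[where c=1])
 finally show ?thesis
  by (simp add: emeasure_eq_measure Bochner_Integration.integral_nonneg)
qed

text \<open>The conditional characteristic function of Z given the path, by independence of the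
  scenery over distinct sites.\<close>

definition Cprod :: "(int ^ 'd) list => real => complex" where
 "Cprod xs t = (\<Prod>y\<in>set (sites xs). char (distr M borel (\<xi> 0)) (t * real (cnt xs y)))"

lemma path_sum_alt: "path_sum xs s = (\<Sum>y\<in>set (sites xs). real (cnt xs y) * \<xi> y s)"
proof -
 have "path_sum xs s = (\<Sum>y\<in>(!) (sites xs) ` {..<length xs}. \<Sum>k | k \<in> {..<length xs} \<and> sites xs ! k = y. \<xi> (sites xs ! k) s)"
  unfolding path_sum_def by (rule sum.image_gen) simp
 also have "(!) (sites xs) ` {..<length xs} = set (sites xs)" by (auto simp: set_conv_nth)
 also have "(\<Sum>y\<in>set (sites xs). \<Sum>k | k \<in> {..<length xs} \<and> sites xs ! k = y. \<xi> (sites xs ! k) s) =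
  (\<Sum>y\<in>set (sites xs). real (cnt xs y) * \<xi> y s)"
 proof (intro sum.cong refl)
  fix y
  have "(\<Sum>k | k \<in> {..<length xs} \<and> sites xs ! k = y. \<xi> (sites xs ! k) s) = (\<Sum>k | k \<in> {..<length xs} \<and> sites xs ! k = y. \<xi> y s)"
   by (intro sum.cong) auto
  also have "... = real (cnt xs y) * \<xi> y s"
   unfolding cnt_def count_list_eq_length_filter length_filter_conv_card by (simp add: eq_commute[of y])
  finally show "(\<Sum>k | k \<in> {..<length xs} \<and> sites xs ! k = y. \<xi> (sites xs ! k) s) = real (cnt xs y) * \<xi> y s" .
 qed
 finally show ?thesis .
qed

lemma char_path_sum: "char (distr M borel (path_sum xs)) t = Cprod xs t"
proof -
 have ind: "indep_vars (%_. borel) (%y s. real (cnt xs y) * \<xi> y s) (set (sites xs))"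
 proof -
  have "indep_vars (%_. borel) (%y. (%v. real (cnt xs y) * v) \<circ> \<xi> y) (set (sites xs))"
   by (rule indep_vars_compose[OF indep_vars_subset[OF indep_\<xi>]]) auto
  then show ?thesis by (simp add: o_def)
 qed
 have "char (distr M borel (path_sum xs)) t = char (distr M borel (%s. \<Sum>y\<in>set (sites xs). real (cnt xs y) * \<xi> y s)) t"
  by (simp add: path_sum_alt[abs_def])
 also have "... = (\<Prod>y\<in>set (sites xs). char (distr M borel (%s. real (cnt xs y) * \<xi> y s)) t)"
  by (rule char_distr_sum[OF ind])
 also have "... = Cprod xs t"
  unfolding Cprod_def
 proof (intro prod.cong refl)
  fix y
  have "char (distr M borel (%s. real (cnt xs y) * \<xi> y s)) t = char (distr M borel (\<xi> y)) (t * real (cnt xs y))"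
   unfolding char_def by (subst (1 2) integral_distr) (auto simp: mult_ac)
  then show "char (distr M borel (%s. real (cnt xs y) * \<xi> y s)) t = char (distr M borel (\<xi> 0)) (t * real (cnt xs y))"
   by (simp add: \<xi>_distr[of y 0])
 qed
 finally show ?thesis .
qed

text \<open>All sites share one law and there are countably many of them.\<close>

lemma AE_\<xi>_transfer:
 assumes "AE s in M. \<xi> 0 s \<in> S" "S \<in> sets borel"
 shows "AE s in M. \<forall>y. \<xi> y s \<in> S"
proof -
 have "AE s in M. \<xi> y s \<in> S" for y
 proof -
  have "AE x in distr M borel (\<xi> 0). x \<in> S" using assms by (subst AE_distr_iff) auto
  then have "AE x in distr M borel (\<xi> y). x \<in> S" by (subst \<xi>_distr[of y 0])
  then show ?thesis using assms by (subst (asm) AE_distr_iff) auto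
 qed
 then show ?thesis by (subst AE_all_countable) blast
qed

text \<open>Equality case of |E w| \<le> 1: multiplied by the conjugate of its mean, the unit vector
  has real part at most 1 and mean 1, hence equals 1 almost surely.\<close>

lemma char_modulus_one_imp:
 assumes "cmod (char (distr M borel (\<xi> 0)) u) = 1"
 shows "AE s in M. iexp (u * \<xi> 0 s) = char (distr M borel (\<xi> 0)) u"
proof -
 let ?c = "char (distr M borel (\<xi> 0)) u"
 have c: "?c = (\<integral>s. iexp (u * \<xi> 0 s) \<partial>M)" unfolding char_def by (subst integral_distr) auto
 have i: "integrable M (%s. cnj ?c * iexp (u * \<xi> 0 s))"
  by (rule integrable_const_bound[where B=1]) (auto simp: norm_mult assms)
 have r: "Re (cnj ?c * iexp (u * \<xi> 0 s)) <= 1" for s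
  using complex_Re_le_cmod[of "cnj ?c * iexp (u * \<xi> 0 s)"] by (simp only: norm_mult complex_mod_cnj assms norm_exp_i_times mult_1)
 have "(\<integral>s. cnj ?c * iexp (u * \<xi> 0 s) \<partial>M) = cnj ?c * ?c" unfolding c by simp
 also have "... = 1" using assms complex_norm_square[of ?c] by (simp add: mult.commute)
 finally have one: "(\<integral>s. cnj ?c * iexp (u * \<xi> 0 s) \<partial>M) = 1" .
 have "(\<integral>s. 1 - Re (cnj ?c * iexp (u * \<xi> 0 s)) \<partial>M) = 1 - Re (\<integral>s. cnj ?c * iexp (u * \<xi> 0 s) \<partial>M)"
  using i by (subst Bochner_Integration.integral_diff) (auto simp: prob_space simp del: times_complex.simps complex_cnj)
 then have "(\<integral>s. 1 - Re (cnj ?c * iexp (u * \<xi> 0 s)) \<partial>M) = 0" unfolding one by simp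
 then have "AE s in M. 1 - Re (cnj ?c * iexp (u * \<xi> 0 s)) = 0"
  using i r by (subst (asm) integral_nonneg_eq_0_iff_AE) (auto simp del: times_complex.simps)
 then show ?thesis
 proof eventually_elim
  case (elim s)
  let ?w = "cnj ?c * iexp (u * \<xi> 0 s)"
  have n: "cmod ?w = 1" by (simp only: norm_mult complex_mod_cnj assms norm_exp_i_times mult_1)
  have "Re ?w = 1" using elim by simp
  then have "Im ?w = 0" using n cmod_power2[of ?w] by (simp del: times_complex.simps)
  then have w: "?w = 1" using \<open>Re ?w = 1\<close> by (simp add: complex_eq_iff)
  have "?c * cnj ?c = 1" using assms complex_norm_square[of ?c] by simp
  moreover have "?c * ?w = (?c * cnj ?c) * iexp (u * \<xi> 0 s)" by (simp only: mult.assoc)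
  ultimately show ?case using w by (simp only: mult_1 mult_1_right)
 qed
qed

text \<open>As the modulus is 1 at 2 * pi / d, the value of exp (2 * pi * i * \<xi> / d) is almost
  surely constant, so the integer values of the scenery agree modulo d. The residue r is read off at
  one sample point.\<close>

lemma lattice_offset:
 assumes int: "AE s in M. \<xi> 0 s \<in> \<int>" and d: "d \<ge> 1"
  and one: "cmod (char (distr M borel (\<xi> 0)) (2 * pi / real d)) = 1"
 obtains r :: int where "AE s in M. \<forall>y. \<xi> y s - of_int r \<in> multiples d"
proof -
 let ?c = "char (distr M borel (\<xi> 0)) (2 * pi / real d)"
 have ae: "AE s in M. iexp (2 * pi / real d * \<xi> 0 s) = ?c \<and> \<xi> 0 s \<in> \<int>"
  using char_modulus_one_imp[OF one] int by eventually_elim auto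
 obtain s0 where w0: "iexp (2 * pi / real d * \<xi> 0 s0) = ?c" "\<xi> 0 s0 \<in> \<int>"
  using eventually_happens[OF ae] by (auto simp: trivial_limit_def AE_iff_null_sets prob_space ae_filter_eq_bot_iff emeasure_space_1)
 then obtain r where r: "\<xi> 0 s0 = of_int r" by (auto elim: Ints_cases)
 have "AE s in M. \<xi> 0 s \<in> {x. x - of_int r \<in> multiples d}"
  using ae
 proof eventually_elim
  case (elim s)
  then obtain k where k: "\<xi> 0 s = of_int k" by (auto elim: Ints_cases)
  have "iexp (2 * pi / real d * of_int k) = iexp (2 * pi / real d * of_int r)" using elim w0 k r by simp
  then obtain n :: int where "2 * pi / real d * of_int k = 2 * pi / real d * of_int r + 2 * pi * of_int n"
   unfolding exp_eq by (auto simp: complex_eq_iff)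
  then have "2 * pi * of_int k = 2 * pi * (of_int r + real d * of_int n)" using d by (simp add: field_simps)
  then have "of_int k - of_int r = real d * of_int n" by simp
  then show ?case using k by (auto simp: multiples_def)
 qed
 moreover have "{x. x - of_int r \<in> multiples d} \<in> sets borel"
 proof -
  have "{x. x - of_int r \<in> multiples d} = (%x. x + of_int r) ` multiples d" by (auto simp: image_iff) (metis diff_add_cancel)
  then have "countable {x. x - of_int r \<in> multiples d}" by (simp add: multiples_def)
  then show ?thesis by (rule sets.countable[rotated]) simp
 qed
 ultimately have "AE s in M. \<forall>y. \<xi> y s \<in> {x. x - of_int r \<in> multiples d}" by (rule AE_\<xi>_transfer)
 then show ?thesis using that by simp
qed

end

text \<open>For integer W the integral of exp (i * t * W) over one period is 2 * pi times the
  indicator of W = 0.\<close>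

lemma (in prob_space) prob_0_integer_valued:
 assumes [measurable]: "W \<in> borel_measurable M" and int: "AE s in M. W s \<in> \<int>"
 shows "complex_of_real (prob {s \<in> space M. W s = 0}) = (\<integral>t. indicator {-pi..pi} t *\<^sub>R char (distr M borel W) t \<partial>lborel) / (2 * pi)"
proof -
 define \<nu> where "\<nu> = restrict_space lborel {-pi..pi}"
 interpret \<nu>: finite_measure \<nu> unfolding \<nu>_def by (rule finite_measureI) (simp add: emeasure_restrict_space)
 interpret P: pair_sigma_finite M \<nu> ..
 interpret PF: finite_measure "M \<Otimes>\<^sub>M \<nu>" by (intro finite_measure_pair_measure finite_measure_axioms \<nu>.finite_measure_axioms)
 have "(\<integral>t. char (distr M borel W) t \<partial>\<nu>) = (\<integral>t. (\<integral>s. iexp (t * W s) \<partial>M) \<partial>\<nu>)"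
  unfolding char_def by (intro Bochner_Integration.integral_cong refl, subst integral_distr) auto
 also have "... = (\<integral>s. (\<integral>t. iexp (t * W s) \<partial>\<nu>) \<partial>M)"
 proof (rule P.Fubini_integral)
  have [measurable]: "(%t. t) \<in> borel_measurable \<nu>" unfolding \<nu>_def by (intro measurable_restrict_space1) simp
  have "case_prod (%s t. iexp (t * W s)) \<in> borel_measurable (M \<Otimes>\<^sub>M \<nu>)" by measurable
  then show "integrable (M \<Otimes>\<^sub>M \<nu>) (case_prod (%s t. iexp (t * W s)))"
   by (intro PF.integrable_const_bound[where B=1]) (auto simp: case_prod_unfold)
 qed
 also have "... = (\<integral>s. of_real (2 * pi * indicator {s \<in> space M. W s = 0} s) \<partial>M)"
 proof (rule integral_cong_AE)
  show "AE s in M. (\<integral>t. iexp (t * W s) \<partial>\<nu>) = of_real (2 * pi * indicator {s \<in> space M. W s = 0} s)"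
   using int AE_space
  proof eventually_elim
   case (elim s)
   then obtain k where k: "W s = of_int k" by (auto elim: Ints_cases)
   have "(\<integral>t. iexp (t * W s) \<partial>\<nu>) = (\<integral>t. indicator {-pi..pi} t *\<^sub>R cis (t * of_int k) \<partial>lborel)"
    unfolding \<nu>_def by (subst integral_restrict_space) (auto simp: k cis_conv_exp)
   then show ?case unfolding integral_cis_period using elim k by (auto simp: indicator_def)
  qed
  have [measurable]: "(%t. t) \<in> borel_measurable \<nu>" unfolding \<nu>_def by (intro measurable_restrict_space1) simp
  have "(%(s, t). iexp (t * W s)) \<in> borel_measurable (M \<Otimes>\<^sub>M \<nu>)" by measurable
  then show "(%s. \<integral>t. iexp (t * W s) \<partial>\<nu>) \<in> borel_measurable M"
   by (rule \<nu>.borel_measurable_lebesgue_integral)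
 qed measurable
 also have "... = of_real (\<integral>s. 2 * pi * indicator {s \<in> space M. W s = 0} s \<partial>M)"
  by (rule integral_complex_of_real)
 also have "... = 2 * pi * of_real (prob {s \<in> space M. W s = 0})" by simp
 finally have "(\<integral>t. char (distr M borel W) t \<partial>\<nu>) = 2 * pi * of_real (prob {s \<in> space M. W s = 0})" .
 moreover have "(\<integral>t. char (distr M borel W) t \<partial>\<nu>) = (\<integral>t. indicator {-pi..pi} t *\<^sub>R char (distr M borel W) t \<partial>lborel)"
  unfolding \<nu>_def by (subst integral_restrict_space) auto
 ultimately show ?thesis by simp
qed

context walk_scenery begin

lemma continuous_char_\<xi>: "continuous_on UNIV (char (distr M borel (\<xi> 0)))"
proof -
 interpret D: real_distribution "distr M borel (\<xi> 0)" by (rule real_distribution_distr) simp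
 show ?thesis using D.isCont_char by (simp add: continuous_on_eq_continuous_at)
qed

lemma norm_char_\<xi>_le: "cmod (char (distr M borel (\<xi> 0)) t) <= 1"
proof -
 interpret D: real_distribution "distr M borel (\<xi> 0)" by (rule real_distribution_distr) simp
 show ?thesis by (rule D.cmod_char_le_1)
qed

lemma continuous_Cprod: "continuous_on UNIV (Cprod xs)"
 unfolding Cprod_def[abs_def]
 by (intro continuous_on_prod continuous_on_compose2[OF continuous_char_\<xi>] continuous_intros) auto

lemma norm_Cprod_le: "cmod (Cprod xs t) <= 1"
 unfolding Cprod_def prod_norm[symmetric]
 by (intro prod_le_1) (auto simp: norm_char_\<xi>_le)

text \<open>Dividing \<open>Z - j\<close> by \<open>d\<close> keeps it integer valued, which turns the full period into a single
 fundamental domain of the modulus of the characteristic function.\<close>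
lemma rwrs_inversion:
 assumes off: "AE s in M. \<forall>y. \<xi> y s - of_int r \<in> multiples d" and d: "d \<ge> 1"
  and j: "of_int (int n * r - j) \<in> multiples d"
 shows "complex_of_real (prob {s \<in> space M. rwrs X \<xi> n s = of_int j}) =
  (\<integral>t. indicator {-pi..pi} t *\<^sub>R (iexp (- (t * of_int j / real d)) *
    wmean n step (%xs. Cprod xs (t / real d))) \<partial>lborel) / (2 * pi)"
proof -
 define W where "W xs s = (path_sum xs s - of_int j) / real d" for xs s
 have Wm [measurable]: "W xs \<in> borel_measurable M" for xs unfolding W_def[abs_def] by measurable
 have mult: "\<exists>k::int. x = real d * of_int k" if "x \<in> multiples d" for x using that by (auto simp: multiples_def)
 obtain k0 where k0: "of_int (int n * r - j) = real d * of_int k0" using mult[OF j] by blast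
 \<comment> \<open>Each of the n scenery values is r modulo d, so the path sum is n * r modulo d,
   which by hypothesis is the residue of j.\<close>
 have Wint: "AE s in M. W xs s \<in> \<int>" if l: "length xs = n" for xs
  using off
 proof eventually_elim
  case (elim s)
  have "\<forall>y. \<exists>k::int. \<xi> y s - of_int r = real d * of_int k" using elim mult by blast
  then obtain k where k: "\<And>y. \<xi> y s - of_int r = real d * of_int (k y)" by metis
  have "path_sum xs s = (\<Sum>i<n. of_int r + real d * of_int (k (sites xs ! i)))"
   unfolding path_sum_def l by (intro sum.cong refl) (use k in \<open>simp add: algebra_simps\<close>)
  also have "... = real n * of_int r + real d * of_int (\<Sum>i<n. k (sites xs ! i))"
   by (simp add: sum.distrib sum_distrib_left)
  finally have "path_sum xs s - of_int j = real d * of_int (k0 + (\<Sum>i<n. k (sites xs ! i)))"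
   using k0 by (simp add: algebra_simps)
  then have "W xs s = of_int (k0 + (\<Sum>i<n. k (sites xs ! i)))" using d by (simp add: W_def)
  then show ?case by (simp only: Ints_of_int)
 qed
 have charW: "char (distr M borel (W xs)) t = iexp (- (t * of_int j / real d)) * Cprod xs (t / real d)" for xs t
 proof -
  have "char (distr M borel (W xs)) t = (\<integral>s. iexp (- (t * of_int j / real d)) * iexp (t / real d * path_sum xs s) \<partial>M)"
   unfolding char_def W_def by (subst integral_distr) (auto simp: exp_add[symmetric] algebra_simps diff_divide_distrib)
  also have "... = iexp (- (t * of_int j / real d)) * (\<integral>s. iexp (t / real d * path_sum xs s) \<partial>M)" by simp
  also have "(\<integral>s. iexp (t / real d * path_sum xs s) \<partial>M) = Cprod xs (t / real d)"
   unfolding char_path_sum[symmetric] char_def by (subst integral_distr) auto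
  finally show ?thesis .
 qed
 define \<nu> where "\<nu> = restrict_space lborel {-pi..pi}"
 interpret \<nu>: finite_measure \<nu> unfolding \<nu>_def by (rule finite_measureI) (simp add: emeasure_restrict_space)
 define H where "H xs t = iexp (- (t * of_int j / real d)) * Cprod xs (t / real d)" for xs t
 have Hc: "continuous_on UNIV (H xs)" for xs
  unfolding H_def[abs_def] by (intro continuous_intros continuous_on_compose2[OF continuous_Cprod]) (use d in auto)
 have Hm: "H xs \<in> borel_measurable \<nu>" for xs
  unfolding \<nu>_def by (intro measurable_restrict_space1) (simp add: borel_measurable_continuous_onI[OF Hc])
 have Hn: "cmod (H xs t) <= 1" for xs t unfolding H_def using norm_Cprod_le by (simp add: norm_mult)
 have "complex_of_real (prob {s \<in> space M. rwrs X \<xi> n s = of_int j}) =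
  wmean n step (%xs. complex_of_real (prob {s \<in> space M. path_sum xs s = of_int j}))"
  using prob_rwrs[of "{of_int j}" n] by (simp add: integral_complex_of_real)
 also have "... = wmean n step (%xs. (\<integral>t. H xs t \<partial>\<nu>) / (2 * pi))"
 proof (rule integral_cong_AE)
  show "AE xs in replicate_pmf n step. complex_of_real (prob {s \<in> space M. path_sum xs s = of_int j}) = (\<integral>t. H xs t \<partial>\<nu>) / (2 * pi)"
  proof (subst AE_measure_pmf_iff, rule ballI)
   fix xs assume "xs \<in> set_pmf (replicate_pmf n step)"
   then have l: "length xs = n" by (rule length_replicate_pmf)
   have "{s \<in> space M. path_sum xs s = of_int j} = {s \<in> space M. W xs s = 0}" using d by (auto simp: W_def)
   then have "complex_of_real (prob {s \<in> space M. path_sum xs s = of_int j}) = (\<integral>t. indicator {-pi..pi} t *\<^sub>R H xs t \<partial>lborel) / (2 * pi)"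
    using prob_0_integer_valued[OF Wm Wint[OF l]] unfolding charW H_def by simp
   then show "complex_of_real (prob {s \<in> space M. path_sum xs s = of_int j}) = (\<integral>t. H xs t \<partial>\<nu>) / (2 * pi)"
    unfolding \<nu>_def by (subst integral_restrict_space) auto
  qed
 qed auto
 also have "... = wmean n step (%xs. \<integral>t. H xs t \<partial>\<nu>) / (2 * pi)" by simp
 also have "wmean n step (%xs. \<integral>t. H xs t \<partial>\<nu>) = (\<integral>t. wmean n step (%xs. H xs t) \<partial>\<nu>)"
  by (rule pmf_Fubini(1)[where c=1]) (use Hm Hn in \<open>auto intro: \<nu>.finite_measure_axioms\<close>)
 also have "... = (\<integral>t. iexp (- (t * of_int j / real d)) * wmean n step (%xs. Cprod xs (t / real d)) \<partial>\<nu>)"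
  unfolding H_def by simp
 also have "... = (\<integral>t. indicator {-pi..pi} t *\<^sub>R (iexp (- (t * of_int j / real d)) * wmean n step (%xs. Cprod xs (t / real d))) \<partial>lborel)"
  unfolding \<nu>_def by (subst integral_restrict_space) auto
 finally show ?thesis .
qed

lemma rwrs_zero:
 assumes off: "AE s in M. \<forall>y. \<xi> y s - of_int r \<in> multiples d" and j: "of_int (int n * r - j) \<notin> multiples d"
 shows "prob {s \<in> space M. rwrs X \<xi> n s = of_int j} = 0"
proof -
 have "AE s in M. rwrs X \<xi> n s \<noteq> of_int j"
  using off
 proof eventually_elim
  case (elim s)
  have "\<forall>y. \<exists>k::int. \<xi> y s - of_int r = real d * of_int k" using elim by (auto simp: multiples_def)
  then obtain k where k: "\<And>y. \<xi> y s - of_int r = real d * of_int (k y)" by metis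
  have "rwrs X \<xi> n s = (\<Sum>i<n. of_int r + real d * of_int (k (walk X i s)))"
   unfolding rwrs_def by (intro sum.cong refl) (use k in \<open>simp add: algebra_simps\<close>)
  also have "... = real n * of_int r + real d * of_int (\<Sum>i<n. k (walk X i s))"
   by (simp add: sum.distrib sum_distrib_left)
  finally have eq: "rwrs X \<xi> n s = real n * of_int r + real d * of_int (\<Sum>i<n. k (walk X i s))" .
  show ?case
  proof
   assume "rwrs X \<xi> n s = of_int j"
   then have "of_int (int n * r - j) = real d * of_int (- (\<Sum>i<n. k (walk X i s)))" using eq by simp
   then show False using j unfolding multiples_def by blast
  qed
 qed
 moreover have "{s \<in> space M. rwrs X \<xi> n s = of_int j} \<in> sets M"
  using rwrs_event[of "{of_int j}" n] by simp
 ultimately show ?thesis by (subst prob_eq_0) auto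
qed

end

section \<open>Characteristic functions near the origin\<close>

text \<open>Minus the exponent of the stable characteristic function. Its homogeneity
  \<open>psi_scale\<close> is what turns visit counts into the power sum V.\<close>

definition psi :: "real => real => real => real => complex" where
 "psi q A1 A2 u = of_real (\<bar>u\<bar> powr q) * (of_real A1 + \<i> * of_real A2 * of_real (sgn u))"

lemma psi_0 [simp]: "psi q A1 A2 0 = 0"
 by (simp add: psi_def)

lemma psi_minus: "psi q A1 A2 (- u) = cnj (psi q A1 A2 u)"
 by (simp add: psi_def)

lemma Re_psi: "Re (psi q A1 A2 u) = A1 * \<bar>u\<bar> powr q"
 by (simp add: psi_def)

lemma psi_scale: "c \<ge> 0 ==> psi q A1 A2 (u * c) = of_real (c powr q) * psi q A1 A2 u"
 by (cases "c = 0") (auto simp: psi_def abs_mult powr_mult sgn_mult)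

lemma psi_pos: "u > 0 ==> psi q A1 A2 u = of_real (u powr q) * (of_real A1 + \<i> * of_real A2)"
 by (simp add: psi_def)

lemma norm_iexp_diff_le: "cmod (iexp x - iexp y) <= min 2 \<bar>x - y\<bar>"
proof -
 have "iexp x - iexp y = iexp y * (iexp (x - y) - 1)"
  by (simp add: exp_diff field_simps)
 then have "cmod (iexp x - iexp y) = cmod (iexp (x - y) - 1)" by (simp add: norm_mult)
 moreover have "cmod (iexp (x - y) - 1) <= \<bar>x - y\<bar>" using iexp_approx1[of "x - y" 0] by simp
 moreover have "cmod (iexp (x - y) - 1) <= 2" using norm_triangle_ineq4[of "iexp (x - y)" 1] by simp
 ultimately show ?thesis by simp
qed

text \<open>Skorohod coupling: for t in [0, 1] the difference of the exponentials is at most the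
  minimum of 2 and |Yn - Y|, a bound free of t.\<close>

lemma weak_conv_char_uniform:
 fixes \<mu> :: "nat => real measure" and M :: "real measure"
 assumes "\<And>n. real_distribution (\<mu> n)" "real_distribution M" "weak_conv_m \<mu> M" and e: "\<epsilon> > 0"
 shows "\<forall>\<^sub>F n in sequentially. \<forall>t\<in>{0..1}. cmod (char (\<mu> n) t - char M t) <= \<epsilon>"
proof -
 obtain \<Omega> :: "real measure" and Yn Y where Om: "prob_space \<Omega>"
  and Yn: "\<And>n. Yn n \<in> measurable \<Omega> borel" "\<And>n. distr \<Omega> borel (Yn n) = \<mu> n"
  and Y: "Y \<in> measurable \<Omega> lborel" "distr \<Omega> borel Y = M"
  and lim: "\<And>x. x \<in> space \<Omega> ==> (%n. Yn n x) ----> Y x"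
  using Skorohod[OF assms(1-3)] by blast
 interpret prob_space \<Omega> by fact
 have [measurable]: "\<And>n. Yn n \<in> borel_measurable \<Omega>" "Y \<in> borel_measurable \<Omega>"
  using Yn Y by auto
 have "(%n. \<integral>x. min 2 \<bar>Yn n x - Y x\<bar> \<partial>\<Omega>) ----> (\<integral>x. 0 \<partial>\<Omega>)"
 proof (rule integral_dominated_convergence[where w="%_. 2"])
  show "AE x in \<Omega>. (%n. min 2 \<bar>Yn n x - Y x\<bar>) ----> 0"
  proof (rule AE_I2)
   fix x assume "x \<in> space \<Omega>"
   from tendsto_diff[OF lim[OF this] tendsto_const, of "Y x"]
   have "(%n. min 2 \<bar>Yn n x - Y x\<bar>) ----> min 2 \<bar>Y x - Y x\<bar>" by (intro tendsto_intros lim \<open>x \<in> space \<Omega>\<close>)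
   then show "(%n. min 2 \<bar>Yn n x - Y x\<bar>) ----> 0" by simp
  qed
 qed auto
 from order_tendstoD(2)[OF this, of \<epsilon>] have "\<forall>\<^sub>F n in sequentially. (\<integral>x. min 2 \<bar>Yn n x - Y x\<bar> \<partial>\<Omega>) < \<epsilon>" using e by simp
 then show ?thesis
 proof eventually_elim
  case (elim n)
  show ?case
  proof
   fix t :: real assume t: "t \<in> {0..1}"
   have i: "integrable \<Omega> (%x. iexp (t * Yn n x))" "integrable \<Omega> (%x. iexp (t * Y x))"
    by (intro integrable_const_bound[where B=1], auto)+
   have "char (\<mu> n) t - char M t = (\<integral>x. iexp (t * Yn n x) - iexp (t * Y x) \<partial>\<Omega>)"
    unfolding char_def Yn(2)[symmetric] Y(2)[symmetric]
    by (subst Bochner_Integration.integral_diff[OF i]) (simp add: integral_distr)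
   also have "cmod ... <= (\<integral>x. cmod (iexp (t * Yn n x) - iexp (t * Y x)) \<partial>\<Omega>)" by (rule integral_norm_bound)
   also have "... <= (\<integral>x. min 2 \<bar>Yn n x - Y x\<bar> \<partial>\<Omega>)"
   proof (rule integral_mono)
    show "integrable \<Omega> (%x. cmod (iexp (t * Yn n x) - iexp (t * Y x)))" using i by (intro integrable_norm Bochner_Integration.integrable_diff)
    show "integrable \<Omega> (%x. min 2 \<bar>Yn n x - Y x\<bar>)" by (rule integrable_const_bound[where B=2]) auto
    fix x
    have "cmod (iexp (t * Yn n x) - iexp (t * Y x)) <= min 2 \<bar>t * Yn n x - t * Y x\<bar>" by (rule norm_iexp_diff_le)
    also have "\<bar>t * Yn n x - t * Y x\<bar> = t * \<bar>Yn n x - Y x\<bar>" using t by (simp add: right_diff_distrib[symmetric] abs_mult)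
    also have "min 2 (t * \<bar>Yn n x - Y x\<bar>) <= min 2 \<bar>Yn n x - Y x\<bar>"
     using t mult_right_mono[of t 1 "\<bar>Yn n x - Y x\<bar>"] by auto
    finally show "cmod (iexp (t * Yn n x) - iexp (t * Y x)) <= min 2 \<bar>Yn n x - Y x\<bar>" .
   qed
   finally show "cmod (char (\<mu> n) t - char M t) <= \<epsilon>" using elim by simp
  qed
 qed
qed

text \<open>Serves the continuity argument below: if |z| \<le> 1/2, then exp z can be close to 1
  only when z is close to 0.\<close>

lemma norm_exp_minus_1_ge:
 fixes z :: complex
 assumes "cmod z <= 1/2"
 shows "cmod z / 2 <= cmod (exp z - 1)"
proof -
 have "cmod (exp z - (\<Sum>k\<le>2. z ^ k / fact k)) <= exp \<bar>Re z\<bar> * cmod z ^ Suc 2 / fact 2"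
  by (rule Taylor_exp)
 also have "exp \<bar>Re z\<bar> <= 2"
 proof -
  have "\<bar>Re z\<bar> <= 1/2" using assms abs_Re_le_cmod[of z] by linarith
  then have "exp \<bar>Re z\<bar> <= exp (1/2)" by simp
  then show ?thesis using exp_half_le2 by linarith
 qed
 finally have t: "cmod (exp z - (\<Sum>k\<le>2. z ^ k / fact k)) <= cmod z ^ 3"
  by (simp add: divide_right_mono mult_right_mono)
 have sum: "(\<Sum>k\<le>2. z ^ k / fact k) = 1 + z + z\<^sup>2 / 2"
  by (simp add: numeral_2_eq_2)
 have "cmod z ^ 3 <= cmod z / 4"
  using mult_mono[OF mult_mono[OF assms assms] order_refl, of "cmod z"] by (simp add: power3_eq_cube)
 moreover have "cmod (z\<^sup>2 / 2) <= cmod z / 4"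
  using mult_right_mono[OF assms, of "cmod z"] by (simp add: norm_divide norm_mult power2_eq_square)
 moreover have "z = (exp z - 1) - (exp z - (1 + z + z\<^sup>2 / 2)) - z\<^sup>2 / 2" by simp
 then have "cmod z <= cmod (exp z - 1) + cmod (exp z - (1 + z + z\<^sup>2 / 2)) + cmod (z\<^sup>2 / 2)"
  using norm_triangle_ineq4[of "(exp z - 1) - (exp z - (1 + z + z\<^sup>2 / 2))" "z\<^sup>2 / 2"]
   norm_triangle_ineq4[of "exp z - 1" "exp z - (1 + z + z\<^sup>2 / 2)"] by simp
 ultimately show ?thesis using t unfolding sum by linarith
qed

text \<open>Continuity of \<open>g\<close> rules out the other branches of the logarithm.\<close>
lemma small_log_on_path:
 fixes g :: "real => complex"
 assumes cont: "continuous_on {0..1} g" and g0: "g 0 = 0"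
  and e: "\<epsilon> < 1/8" "\<And>s. s \<in> {0..1} ==> cmod (exp (g s) - 1) <= \<epsilon>" and s: "s \<in> {0..1}"
 shows "cmod (g s) <= 2 * \<epsilon>"
proof (rule ccontr)
 assume "\<not> cmod (g s) <= 2 * \<epsilon>"
 then have big: "cmod (g s) > 2 * \<epsilon>" by simp
 have e0: "\<epsilon> \<ge> 0" using e(2)[OF s] norm_ge_zero order_trans by blast
 define y where "y = min (cmod (g s)) (1/2)"
 have y: "2 * \<epsilon> < y" "y <= 1/2" "0 <= y" "y <= cmod (g s)" using big e e0 by (auto simp: y_def)
 have "continuous_on {0..s} (%s. cmod (g s))"
  by (intro continuous_on_norm continuous_on_subset[OF cont]) (use s in auto)
 from IVT'[of "%s. cmod (g s)" 0 y s, OF _ _ _ this] obtain x where x: "0 <= x" "x <= s" "cmod (g x) = y"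
  using y s g0 by auto
 have "y / 2 <= cmod (exp (g x) - 1)" using norm_exp_minus_1_ge[of "g x"] x y by simp
 also have "... <= \<epsilon>" using e(2)[of x] x s by auto
 finally show False using y by simp
qed

text \<open>Given u, take n near u powr (- q) and h = n powr (- 1 / q), so that u = h * t with t in
  (0, 1]. Along s in [0, 1] the function g s = n * Ln (\<phi> (h * s)) + \<psi> s is continuous,
  vanishes at 0, and has exponential near 1 by uniform convergence, so it is small; at s = t
  homogeneity makes it n times the difference to be estimated.\<close>

lemma log_char_asymp_pos:
 fixes \<phi> :: "real => complex"
 assumes \<phi>: "continuous_on UNIV \<phi>" "\<phi> 0 = 1"
  and N: "real_distribution N" "\<And>u. char N u = exp (- psi q A1 A2 u)"
  and \<nu>: "\<And>n. real_distribution (\<nu> n)" "\<And>n t. char (\<nu> n) t = \<phi> (real n powr (- 1 / q) * t) ^ n"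
  and wc: "weak_conv_m \<nu> N" and b: "q > 0" and A1: "A1 > 0" and \<eta>: "\<eta> > 0"
 shows "\<exists>\<delta>>0. \<forall>u. 0 < u \<and> u < \<delta> --> (\<exists>z. \<phi> u = exp z \<and> cmod (z + psi q A1 A2 u) <= \<eta> * u powr q)"
proof -
 let ?\<psi> = "psi q A1 A2"
 \<comment> \<open>The bound 2 * \<epsilon> on |g t| becomes 4 * \<epsilon> * u powr q after
   division by n, since n * u powr q \<ge> 1/2; the value 1/16 keeps \<epsilon> below the 1/8 of
   \<open>small_log_on_path\<close>.\<close>
 define \<epsilon> where "\<epsilon> = min (1/16) (\<eta> / 4)"
 have \<epsilon>: "\<epsilon> > 0" "\<epsilon> < 1/8" "4 * \<epsilon> <= \<eta>" using \<eta> by (auto simp: \<epsilon>_def)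
 \<comment> \<open>Bounds |exp (\<psi> s)| on [0, 1], the factor gained when the difference of the
   two characteristic functions is turned into a quotient.\<close>
 define K where "K = exp A1"
 have K: "K > 0" by (simp add: K_def)
 have "\<forall>\<^sub>F n in sequentially. \<forall>t\<in>{0..1}. cmod (char (\<nu> n) t - char N t) <= \<epsilon> / K"
  using weak_conv_char_uniform[OF \<nu>(1) N(1) wc, of "\<epsilon> / K"] \<epsilon> K by simp
 then obtain n0 where n0: "\<And>n t. n \<ge> n0 ==> t \<in> {0..1} ==> cmod (char (\<nu> n) t - char N t) <= \<epsilon> / K"
  unfolding eventually_sequentially by blast
 have "\<exists>\<delta>>0. \<forall>x. dist x 0 < \<delta> --> dist (\<phi> x) (\<phi> 0) < 1"
  using \<phi>(1) unfolding continuous_on_iff by (metis UNIV_I zero_less_one)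
 then obtain \<delta>0 where \<delta>0: "\<delta>0 > 0" "\<And>x. \<bar>x\<bar> < \<delta>0 ==> cmod (\<phi> x - 1) < 1"
  using \<phi>(2) by (auto simp: dist_norm)
 have notneg: "\<phi> x \<notin> \<real>\<^sub>\<le>\<^sub>0" "\<phi> x \<noteq> 0" if "\<bar>x\<bar> < \<delta>0" for x
 proof -
  have "\<bar>Re (\<phi> x - 1)\<bar> < 1" using \<delta>0(2)[OF that] abs_Re_le_cmod[of "\<phi> x - 1"] by linarith
  then have "Re (\<phi> x) > 0" by simp
  then show "\<phi> x \<notin> \<real>\<^sub>\<le>\<^sub>0" "\<phi> x \<noteq> 0" by (auto simp: complex_nonpos_Reals_iff)
 qed
 define L where "L x = Ln (\<phi> x)" for x
 \<comment> \<open>The first bound gives h < \<delta>0, as h \<le> 2 powr (1 / q) * u; the second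
   makes n positive and at least n0.\<close>
 define \<delta> where "\<delta> = min (\<delta>0 / 2 powr (1 / q)) ((1 / real (n0 + 2)) powr (1 / q))"
 have \<delta>le: "\<delta> <= \<delta>0"
 proof -
  have "1 <= 2 powr (1 / q)" using b by (simp add: ge_one_powr_ge_zero)
  then have "\<delta>0 / 2 powr (1 / q) <= \<delta>0" using \<delta>0(1) by (simp add: divide_le_eq mult_le_cancel_left1)
  then show ?thesis by (simp add: \<delta>_def)
 qed
 have \<delta>: "\<delta> > 0" using \<delta>0(1) by (simp add: \<delta>_def)
 have "\<exists>z. \<phi> u = exp z \<and> cmod (z + ?\<psi> u) <= \<eta> * u powr q" if u: "0 < u" "u < \<delta>" for u
 proof -
  define n where "n = nat \<lfloor>u powr (- q)\<rfloor>"
  have ub: "u powr q < 1 / real (n0 + 2)"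
  proof -
   have "u < (1 / real (n0 + 2)) powr (1 / q)" using u by (simp add: \<delta>_def)
   then have "u powr q < ((1 / real (n0 + 2)) powr (1 / q)) powr q" using u b by (intro powr_less_mono2) auto
   then show ?thesis using b by (simp add: powr_powr)
  qed
  have up: "u powr q > 0" using u by simp
  have inv: "u powr (- q) = 1 / u powr q" by (simp add: powr_minus divide_inverse)
  have nle: "real n <= 1 / u powr q" unfolding n_def inv by (intro of_nat_floor) simp
  have ngt: "1 / u powr q < real n + 1" unfolding n_def inv by linarith
  have "real (n0 + 2) < 1 / u powr q" using ub up by (simp add: field_simps)
  then have nn0: "n \<ge> n0" "n \<ge> 1" using ngt by linarith+
  have nu: "real n * u powr q <= 1" "1 / 2 <= real n * u powr q"
  proof -
   show "real n * u powr q <= 1" using nle up by (simp add: field_simps)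
   have "1 < (real n + 1) * u powr q" using ngt up by (simp add: field_simps)
   also have "... <= (2 * real n) * u powr q" using nn0 up by (intro mult_right_mono) auto
   finally show "1 / 2 <= real n * u powr q" by simp
  qed
  define h where "h = real n powr (- 1 / q)"
  have h0: "0 < h" using nn0 by (simp add: h_def)
  have hb: "h powr q = 1 / real n"
   unfolding h_def powr_powr using nn0 b by (simp add: powr_minus divide_inverse)
  define t where "t = u / h"
  have t0: "0 < t" using u h0 by (simp add: t_def)
  have tb: "t powr q = real n * u powr q" using u h0 hb nn0 by (simp add: t_def powr_divide)
  have t1: "t <= 1"
  proof (rule ccontr)
   assume "\<not> t <= 1"
   then have "1 powr q < t powr q" using b by (intro powr_less_mono2) auto
   then show False using nu tb by simp
  qed
  have hd: "h < \<delta>0"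
  proof -
   have "h = (h powr q) powr (1 / q)" using h0 b by (simp add: powr_powr)
   also have "... <= (2 * u powr q) powr (1 / q)"
    unfolding hb using nu(2) nn0 b by (intro powr_mono2) (auto simp: field_simps)
   also have "... = 2 powr (1 / q) * u" using u b by (simp add: powr_mult powr_powr)
   also have "... < \<delta>0" using u by (simp add: \<delta>_def field_simps)
   finally show ?thesis .
  qed
  define g where "g s = of_nat n * L (h * s) + ?\<psi> s" for s
  have hs: "\<bar>h * s\<bar> < \<delta>0" if "s \<in> {0..1}" for s
  proof -
   have "h * s <= h * 1" using that h0 by (intro mult_left_mono) auto
   moreover have "0 <= h * s" using that h0 by simp
   ultimately show ?thesis using hd by linarith
  qed
  have cg: "continuous_on {0..1} g"
  proof -
   have c1: "continuous_on {0..1} (%s. L (h * s))"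
    unfolding L_def using notneg hs
    by (intro continuous_on_Ln continuous_on_compose2[OF \<phi>(1)] continuous_intros) auto
   have "continuous_on {0..1} (%s. of_real (s powr q) * (of_real A1 + \<i> * of_real A2))"
    using b by (intro continuous_intros continuous_on_powr') auto
   then have "continuous_on {0..1} ?\<psi>"
    by (rule continuous_on_cong[THEN iffD1, rotated 2]) (auto simp: psi_def sgn_if)
   then show ?thesis unfolding g_def using c1 by (intro continuous_intros)
  qed
  have g0: "g 0 = 0" by (simp add: g_def L_def \<phi>(2))
  have ge: "cmod (exp (g s) - 1) <= \<epsilon>" if s: "s \<in> {0..1}" for s
  proof -
   have "exp (of_nat n * L (h * s)) = \<phi> (h * s) ^ n"
    using notneg(2)[OF hs[OF s]] by (simp add: exp_of_nat_mult L_def)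
   also have "... = char (\<nu> n) s" by (simp add: \<nu>(2) h_def)
   finally have "exp (g s) - 1 = (char (\<nu> n) s - char N s) * exp (?\<psi> s)"
    by (simp add: g_def exp_add N(2) left_diff_distrib exp_minus field_simps)
   then have "cmod (exp (g s) - 1) = cmod (char (\<nu> n) s - char N s) * exp (Re (?\<psi> s))" by (simp add: norm_mult)
   also have "... <= \<epsilon> / K * K"
   proof (rule mult_mono)
    show "cmod (char (\<nu> n) s - char N s) <= \<epsilon> / K" by (rule n0) (use nn0 s in auto)
    have "s powr q <= 1" using s b powr_mono2[of q s 1] by auto
    then show "exp (Re (?\<psi> s)) <= K" using A1 s by (simp add: Re_psi K_def)
   qed (use \<epsilon> K in auto)
   finally show ?thesis using K by simp
  qed
  have "cmod (g t) <= 2 * \<epsilon>" by (rule small_log_on_path[OF cg g0 \<epsilon>(2) ge]) (use t0 t1 in auto)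
  moreover have "g t = of_nat n * (L u + ?\<psi> u)"
   using h0 t0 u by (simp add: g_def t_def[symmetric] psi_pos tb distrib_left mult.assoc) (simp add: t_def)
  ultimately have "real n * cmod (L u + ?\<psi> u) <= 2 * \<epsilon>" by (simp add: norm_mult)
  also have "2 * \<epsilon> <= 4 * \<epsilon> * (real n * u powr q)" using nu(2) \<epsilon>(1) mult_left_mono[of "1/2" "real n * u powr q" "4 * \<epsilon>"] by simp
  also have "... <= \<eta> * (real n * u powr q)" using \<epsilon>(3) by (intro mult_right_mono) auto
  finally have "real n * cmod (L u + ?\<psi> u) <= real n * (\<eta> * u powr q)" by (simp add: mult_ac)
  then have "cmod (L u + ?\<psi> u) <= \<eta> * u powr q" using nn0 by simp
  moreover have "\<phi> u = exp (L u)" unfolding L_def using notneg(2)[of u] u \<delta>le by simp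
  ultimately show ?thesis by blast
 qed
 then show ?thesis using \<delta> by blast
qed

lemma log_char_asymp:
 fixes \<phi> :: "real => complex"
 assumes \<phi>: "continuous_on UNIV \<phi>" "\<phi> 0 = 1" "\<And>u. \<phi> (- u) = cnj (\<phi> u)"
  and N: "real_distribution N" "\<And>u. char N u = exp (- psi q A1 A2 u)"
  and \<nu>: "\<And>n. real_distribution (\<nu> n)" "\<And>n t. char (\<nu> n) t = \<phi> (real n powr (- 1 / q) * t) ^ n"
  and wc: "weak_conv_m \<nu> N" and b: "q > 0" and A1: "A1 > 0" and \<eta>: "\<eta> > 0"
 shows "\<exists>\<delta>>0. \<forall>u. \<bar>u\<bar> < \<delta> --> (\<exists>z. \<phi> u = exp z \<and> cmod (z + psi q A1 A2 u) <= \<eta> * \<bar>u\<bar> powr q)"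
proof -
 obtain \<delta> where \<delta>: "\<delta> > 0" "\<And>u. 0 < u ==> u < \<delta> ==> \<exists>z. \<phi> u = exp z \<and> cmod (z + psi q A1 A2 u) <= \<eta> * u powr q"
  using log_char_asymp_pos[OF \<phi>(1,2) N \<nu> wc b A1 \<eta>] by blast
 have "\<exists>z. \<phi> u = exp z \<and> cmod (z + psi q A1 A2 u) <= \<eta> * \<bar>u\<bar> powr q" if u: "\<bar>u\<bar> < \<delta>" for u
 proof -
  consider "u = 0" | "u > 0" | "u < 0" by linarith
  then show ?thesis
  proof cases
   case 1
   then show ?thesis using \<phi>(2) by (intro exI[of _ 0]) auto
  next
   case 2
   then show ?thesis using \<delta>(2)[of u] u by auto
  next
   case 3
   then obtain z where z: "\<phi> (- u) = exp z" "cmod (z + psi q A1 A2 (- u)) <= \<eta> * \<bar>u\<bar> powr q"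
    using \<delta>(2)[of "- u"] u by auto
   have "\<phi> u = exp (cnj z)" using z(1) \<phi>(3)[of "- u"] by (simp add: exp_cnj)
   moreover have "cnj z + psi q A1 A2 u = cnj (z + psi q A1 A2 (- u))" by (simp add: psi_minus)
   then have "cmod (cnj z + psi q A1 A2 u) <= \<eta> * \<bar>u\<bar> powr q" using z(2) by (simp only: complex_mod_cnj)
   ultimately show ?thesis by blast
  qed
 qed
 then show ?thesis using \<delta>(1) by blast
qed

text \<open>Near 0 the expansion with error A1 / 2 leaves half of the decay. On the compact
  remainder up to r the modulus is at most some m < 1, which is absorbed into c because |u| powr q
  \<le> r powr q there.\<close>

lemma char_decay:
 fixes \<phi> :: "real => complex"
 assumes cont: "continuous_on UNIV \<phi>" and le1: "\<And>u. cmod (\<phi> u) <= 1"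
  and near: "\<delta> > 0" "\<And>u. \<bar>u\<bar> < \<delta> ==> \<exists>z. \<phi> u = exp z \<and> cmod (z + psi q A1 A2 u) <= A1 / 2 * \<bar>u\<bar> powr q"
  and r: "r > 0" "\<And>u. \<bar>u\<bar> <= r ==> cmod (\<phi> u) = 1 ==> u = 0" and b: "q > 0" and A1: "A1 > 0"
 shows "\<exists>c>0. \<forall>u. \<bar>u\<bar> <= r --> cmod (\<phi> u) <= exp (- (c * \<bar>u\<bar> powr q))"
proof -
 have small: "cmod (\<phi> u) <= exp (- (A1 / 2 * \<bar>u\<bar> powr q))" if u: "\<bar>u\<bar> < \<delta>" for u
 proof -
  obtain z where z: "\<phi> u = exp z" "cmod (z + psi q A1 A2 u) <= A1 / 2 * \<bar>u\<bar> powr q" using near(2)[OF u] by blast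
  have "Re (z + psi q A1 A2 u) <= A1 / 2 * \<bar>u\<bar> powr q" using complex_Re_le_cmod z(2) by (rule order_trans)
  then have "Re z <= - (A1 / 2 * \<bar>u\<bar> powr q)" by (simp add: Re_psi)
  then show ?thesis using z(1) by simp
 qed
 let ?K = "{u. \<bar>u\<bar> <= r \<and> \<delta> <= \<bar>u\<bar>}"
 have cK: "compact ?K"
 proof -
  have "?K = {-r..r} \<inter> ({..- \<delta>} \<union> {\<delta>..})" using near(1) by auto
  then show ?thesis by (auto intro!: compact_Int_closed closed_Un)
 qed
 show ?thesis
 proof (cases "?K = {}")
  case True
  have "cmod (\<phi> u) <= exp (- (A1 / 2 * \<bar>u\<bar> powr q))" if "\<bar>u\<bar> <= r" for u
   by (rule small) (use True that in force)
  then show ?thesis using A1 by (intro exI[of _ "A1 / 2"]) auto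
 next
  case False
  have "continuous_on ?K (%u. cmod (\<phi> u))" by (intro continuous_on_norm continuous_on_subset[OF cont]) auto
  from continuous_attains_sup[OF cK False this] obtain v where v: "v \<in> ?K" "\<And>u. u \<in> ?K ==> cmod (\<phi> u) <= cmod (\<phi> v)" by blast
  define m where "m = max (1/2) (cmod (\<phi> v))"
  have "cmod (\<phi> v) \<noteq> 1" using r(2)[of v] v(1) near(1) by auto
  then have m: "0 < m" "m < 1" using le1[of v] by (auto simp: m_def)
  define c where "c = min (A1 / 2) (- ln m / r powr q)"
  have c: "c > 0" using A1 m r by (simp add: c_def ln_less_zero divide_neg_pos)
  have "cmod (\<phi> u) <= exp (- (c * \<bar>u\<bar> powr q))" if u: "\<bar>u\<bar> <= r" for u
  proof (cases "\<bar>u\<bar> < \<delta>")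
   case True
   have "c * \<bar>u\<bar> powr q <= A1 / 2 * \<bar>u\<bar> powr q" by (rule mult_right_mono) (simp_all only: c_def min.cobounded1 powr_ge_zero)
   then show ?thesis using small[OF True] by (smt (verit) exp_le_cancel_iff)
  next
   case False
   then have "cmod (\<phi> u) <= m" using v(2)[of u] u by (auto simp: m_def)
   also have "m = exp (ln m)" using m by simp
   also have "... <= exp (- (c * \<bar>u\<bar> powr q))"
   proof -
    have "c * \<bar>u\<bar> powr q <= (- ln m / r powr q) * r powr q"
     using u b c by (intro mult_mono powr_mono2) (auto simp: c_def)
    also have "... = - ln m" using r by simp
    finally show ?thesis by simp
   qed
   finally show ?thesis .
  qed
  then show ?thesis using c by blast
 qed
qed

section \<open>Planar and Cauchy walks\<close>

text \<open>A deterministic step would give |\<open>wchar\<close>| = 1 everywhere, against the decay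
  near 0. The two points feed the exchange of increments.\<close>

lemma (in char_walk) two_support_points: "\<exists>a b. a \<noteq> b \<and> pmf p a > 0 \<and> pmf p b > 0"
proof (rule ccontr)
 assume no: "\<nexists>a b. a \<noteq> b \<and> pmf p a > 0 \<and> pmf p b > 0"
 obtain a where a: "a \<in> set_pmf p" using set_pmf_not_empty by fast
 have "b = a" if "b \<in> set_pmf p" for b using no a that by (auto simp: set_pmf_iff pmf_positive_iff)
 then have cis: "wchar p t = cis (t \<bullet> ivec a)" for t
 proof -
  have "set_pmf p \<subseteq> {a}" using \<open>\<And>b. b \<in> set_pmf p ==> b = a\<close> by blast
  then have "p = return_pmf a" by (simp only: set_pmf_subset_singleton)
  then show ?thesis by (simp add: wchar_def)
 qed
 obtain \<rho> where \<rho>: "\<rho> > 0" "\<And>t. norm t < \<rho> ==> cmod (wchar p t) <= exp (- (q t / 2))"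
  using wchar_decay by blast
 obtain i :: 'd where True by simp
 define t :: "real ^ 'd" where "t = (\<rho> / 2) *\<^sub>R axis i 1"
 have n: "norm t = \<rho> / 2" using \<rho>(1) by (simp add: t_def norm_axis_1)
 then have "1 <= exp (- (q t / 2))" using \<rho>(2)[of t] \<rho>(1) cis[of t] by simp
 then have "q t = 0" using q_nonneg[of t] by simp
 moreover obtain r where "r > 0" "\<And>t. q t < r ==> norm t < \<rho> / 2" using q_small[of "\<rho> / 2"] \<rho>(1) by auto
 ultimately show False using n by force
qed

lemma cis_taylor2: "cmod (cis y - (1 + \<i> * of_real y - of_real (y\<^sup>2) / 2)) <= min (y\<^sup>2) (\<bar>y\<bar> ^ 3)"
proof -
 have s: "(\<Sum>k\<le>2. (\<i> * complex_of_real y) ^ k / fact k) = 1 + \<i> * of_real y - of_real (y\<^sup>2) / 2"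
  by (simp add: numeral_2_eq_2 power_mult_distrib)
 have "cmod (cis y - (1 + \<i> * of_real y - of_real (y\<^sup>2) / 2)) <= \<bar>y\<bar> ^ 3 / 6"
  using iexp_approx1[of y 2] unfolding s by (simp add: cis_conv_exp eval_nat_numeral)
 moreover have "\<bar>y\<bar> ^ 3 / 6 <= \<bar>y\<bar> ^ 3" by simp
 moreover have "cmod (cis y - (1 + \<i> * of_real y - of_real (y\<^sup>2) / 2)) <= y\<^sup>2"
  using iexp_approx2[of y 2] unfolding s by (simp add: cis_conv_exp eval_nat_numeral)
 ultimately show ?thesis by linarith
qed

lemma det_two_points:
 fixes A :: "real ^ 'd ^ 'd"
 assumes "UNIV = {i, j}" "i \<noteq> j"
 shows "det A = A $ i $ i * A $ j $ j - A $ i $ j * A $ j $ i"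
proof -
 have f: "finite {j}" "i \<notin> {j}" using assms by auto
 show ?thesis
  unfolding det_def assms(1) sum_over_permutations_insert[OF f] permutes_sing
  using assms(2) by (simp add: sign_swap_id sign_id swap_id_eq)
qed

lemma prod_Basis_vec: "(\<Prod>b\<in>(Basis :: (real ^ 'n) set). f b) = (\<Prod>k\<in>UNIV. f (axis k 1))"
proof -
 have b: "(Basis :: (real ^ 'n) set) = (%k. axis k 1) ` UNIV" by (auto simp: Basis_vec_def)
 have i: "inj (%k. axis k (1 :: real) :: real ^ 'n)" by (auto simp: inj_def axis_eq_axis)
 show ?thesis unfolding b prod.reindex[OF i] by (simp add: o_def)
qed

text \<open>Only the cardinality of the index type is known; naming its two elements carries the
  area computation to the concrete plane \<open>real ^ 2\<close>.\<close>

lemma distr_lborel_two_coordinates: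
 fixes i j :: "'d::finite"
 assumes ij: "UNIV = {i, j}" "i \<noteq> j"
 shows "distr lborel borel (%t. vector [t $ i, t $ j] :: real ^ 2) = lborel"
proof (rule lborel_eqI[symmetric])
 define T :: "real ^ 'd => real ^ 2" where "T t = vector [t $ i, t $ j]" for t
 have linT: "linear T" by (rule linearI) (auto simp: T_def vec_eq_iff forall_2)
 then have Tm: "T \<in> borel_measurable borel"
  by (intro borel_measurable_continuous_onI linear_continuous_on linear_conv_bounded_linear[THEN iffD1])
 define S :: "real ^ 2 => real ^ 'd" where "S v = (\<chi> k. v $ (if k = i then 1 else 2))" for v
 fix l u :: "real ^ 2" assume le: "\<And>b. b \<in> Basis ==> l \<bullet> b <= u \<bullet> b"
 have le2: "l $ k <= u $ k" for k using le[of "axis k 1"] by (simp add: inner_axis)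
 have box: "T -` box l u = box (S l) (S u)"
 proof (intro set_eqI)
  fix t :: "real ^ 'd"
  have "t \<in> box (S l) (S u) \<longleftrightarrow> (\<forall>k\<in>{i, j}. S l $ k < t $ k \<and> t $ k < S u $ k)"
   unfolding mem_box_cart ij(1)[symmetric] by simp
  then show "t \<in> T -` box l u \<longleftrightarrow> t \<in> box (S l) (S u)"
   using ij(2) by (auto simp: mem_box_cart forall_2 T_def S_def)
 qed
 have "emeasure (distr lborel borel T) (box l u) = emeasure lborel (box (S l) (S u))"
  using Tm by (subst emeasure_distr) (auto simp: box)
 also have "... = (\<Prod>b\<in>Basis. (S u - S l) \<bullet> b)"
  by (rule emeasure_lborel_box) (use le2 in \<open>auto simp: Basis_vec_def inner_axis S_def\<close>)
 also have "(\<Prod>b\<in>Basis. (S u - S l) \<bullet> b) = (\<Prod>b\<in>Basis. (u - l) \<bullet> b)"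
  unfolding prod_Basis_vec ij(1) UNIV_2 using ij(2) by (simp add: inner_axis S_def)
 finally show "emeasure (distr lborel borel (%t. vector [t $ i, t $ j])) (box l u) = (\<Prod>b\<in>Basis. (u - l) \<bullet> b)"
  unfolding T_def .
qed simp

locale planar_law =
 fixes p :: "(int ^ 'd) pmf"
 assumes card2: "CARD('d) = 2"
  and sq: "\<And>i. integrable p (%x. (of_int (x $ i) :: real)\<^sup>2)"
  and mean0: "\<And>i. mean p (%x. of_int (x $ i) :: real) = 0"
begin

definition cov :: "real ^ 'd ^ 'd" where
 "cov = (\<chi> i j. mean p (%x. of_int (x $ i) * of_int (x $ j)))"

lemma integrable_coord_mult: "integrable p (%x. of_int (x $ i) * of_int (x $ j) :: real)"
proof (rule Bochner_Integration.integrable_bound)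
 show "integrable p (%x. (of_int (x $ i) :: real)\<^sup>2 + (of_int (x $ j))\<^sup>2)" by (intro Bochner_Integration.integrable_add sq)
 have "\<bar>u * v\<bar> <= u\<^sup>2 + v\<^sup>2" for u v :: real
 proof -
  have "0 <= (\<bar>u\<bar> - \<bar>v\<bar>)\<^sup>2" by simp
  then have "2 * (\<bar>u\<bar> * \<bar>v\<bar>) <= u\<^sup>2 + v\<^sup>2" by (simp add: power2_diff)
  then show ?thesis unfolding abs_mult by (smt (verit) mult_nonneg_nonneg abs_ge_zero)
 qed
 then show "AE x in p. norm (of_int (x $ i) * of_int (x $ j) :: real) <= norm ((of_int (x $ i) :: real)\<^sup>2 + (of_int (x $ j))\<^sup>2)"
  by (intro AE_I2) (simp only: real_norm_def abs_of_nonneg sum_power2_ge_zero)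
qed simp

lemma integrable_coord: "integrable p (%x. of_int (x $ i) :: real)"
 by (rule measure_pmf.square_integrable_imp_integrable) (use sq in auto)

lemma inner_ivec: "t \<bullet> ivec x = (\<Sum>i\<in>UNIV. t $ i * of_int (x $ i))"
 by (simp add: inner_vec_def ivec_def)

lemma integrable_inner_sq: "integrable p (%x. (t \<bullet> ivec x)\<^sup>2)"
 unfolding inner_ivec power2_eq_square sum_product
proof (intro Bochner_Integration.integrable_sum)
 fix i j
 have "integrable p (%x. (t $ i * t $ j) * (of_int (x $ i) * of_int (x $ j)))"
  by (intro integrable_mult_right integrable_coord_mult)
 then show "integrable p (%x. t $ i * of_int (x $ i) * (t $ j * of_int (x $ j)))" by (simp add: mult_ac)
qed

lemma cov_form: "t \<bullet> (cov *v t) = mean p (%x. (t \<bullet> ivec x)\<^sup>2)"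
proof -
 have "mean p (%x. (t \<bullet> ivec x)\<^sup>2) =
  (\<Sum>i\<in>UNIV. \<Sum>j\<in>UNIV. mean p (%x. (t $ i * t $ j) * (of_int (x $ i) * of_int (x $ j))))"
  unfolding inner_ivec power2_eq_square sum_product
  by (subst Bochner_Integration.integral_sum, (intro Bochner_Integration.integrable_sum)?, (subst Bochner_Integration.integral_sum)?)
    (use integrable_mult_right[OF integrable_coord_mult, of "t $ _ * t $ _"] in \<open>auto simp: mult_ac intro!: sum.cong Bochner_Integration.integral_cong\<close>)
 also have "... = (\<Sum>i\<in>UNIV. \<Sum>j\<in>UNIV. t $ i * (cov $ i $ j * t $ j))"
  by (intro sum.cong refl) (simp add: cov_def)
 also have "... = t \<bullet> (cov *v t)"
  by (simp add: inner_vec_def matrix_vector_mult_def sum_distrib_left)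
 finally show ?thesis ..
qed

text \<open>If the form vanishes at t, then t is orthogonal to every step of the support, hence lies
  in the kernel of the covariance.\<close>

lemma cov_pos:
 assumes "invertible cov" "t \<noteq> 0"
 shows "t \<bullet> (cov *v t) > 0"
proof -
 have nn: "t \<bullet> (cov *v t) \<ge> 0" unfolding cov_form by (rule Bochner_Integration.integral_nonneg) simp
 moreover have "t \<bullet> (cov *v t) \<noteq> 0"
 proof
  assume "t \<bullet> (cov *v t) = 0"
  then have "AE x in p. (t \<bullet> ivec x)\<^sup>2 = 0"
   unfolding cov_form by (subst (asm) integral_nonneg_eq_0_iff_AE[OF integrable_inner_sq]) auto
  then have z: "\<And>x. x \<in> set_pmf p ==> t \<bullet> ivec x = 0" by (simp add: AE_measure_pmf_iff)
  have "cov *v t = 0"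
  proof (subst vec_eq_iff, rule allI)
   fix i
   have "(cov *v t) $ i = (\<Sum>j\<in>UNIV. mean p (%x. of_int (x $ i) * of_int (x $ j) * t $ j))"
    by (simp add: matrix_vector_mult_def cov_def)
   also have "... = mean p (%x. \<Sum>j\<in>UNIV. of_int (x $ i) * of_int (x $ j) * t $ j)"
    by (rule Bochner_Integration.integral_sum[symmetric]) (intro integrable_mult_left integrable_coord_mult)
   also have "... = mean p (%x. 0)"
   proof (rule expectation_pmf_cong)
    fix x assume "x \<in> set_pmf p"
    have "(\<Sum>j\<in>UNIV. of_int (x $ i) * of_int (x $ j) * t $ j) = of_int (x $ i) * (t \<bullet> ivec x)"
     unfolding inner_ivec sum_distrib_left by (intro sum.cong refl) simp
    then show "(\<Sum>j\<in>UNIV. of_int (x $ i) * of_int (x $ j) * t $ j) = 0" using z[OF \<open>x \<in> set_pmf p\<close>] by simp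
   qed
   finally show "(cov *v t) $ i = 0 $ i" by simp
  qed
  then have "t = 0" using assms(1) by (metis inj_matrix_vector_mult injD matrix_vector_mult_0_right)
  then show False using assms(2) by simp
 qed
 ultimately show ?thesis by simp
qed

text \<open>The gauge is half the covariance form, written as half the squared norm of L applied to
  the two coordinates, with L the Cholesky factor. The set {q < r} is the preimage under L of a disc
  of radius sqrt (2 * r), of area 2 * pi * r / det L, and det L = sqrt (det cov). Dividing c = 2 *
  pi / det L by the square of 2 * pi gives 1 / (pi * A) with A = 2 * sqrt (det cov).\<close>

lemma char_walk_planar:
 assumes inv: "invertible cov"
 shows "\<exists>q c. char_walk p q c \<and> c / (2 * pi) ^ CARD('d) = 1 / (pi * (2 * sqrt (det cov)))"
proof -
 obtain i j :: 'd where ij: "UNIV = {i, j}" "i \<noteq> j" using card2 by (meson card_2_iff)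
 define a b d where "a = cov $ i $ i" and "b = cov $ i $ j" and "d = cov $ j $ j"
 have sym: "cov $ j $ i = b" by (simp add: b_def cov_def mult.commute)
 have form: "t \<bullet> (cov *v t) = a * (t $ i)\<^sup>2 + 2 * b * t $ i * t $ j + d * (t $ j)\<^sup>2" for t
  unfolding inner_vec_def matrix_vector_mult_def ij(1) using ij(2) sym
  by (simp add: a_def[symmetric] b_def[symmetric] d_def[symmetric] power2_eq_square algebra_simps)
 have a: "a > 0"
 proof -
  have "axis i (1::real) \<noteq> 0" by (simp add: axis_eq_0_iff)
  from cov_pos[OF inv this] show ?thesis using ij(2) unfolding form by (simp add: axis_def)
 qed
 \<comment> \<open>The minimiser of the form among vectors with j-th coordinate 1. The minimum d -
   b^2 / a is the Schur complement, whose root enters the Cholesky factor.\<close>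
 define t0 :: "real ^ 'd" where "t0 = (\<chi> k. if k = i then - b / a else 1)"
 have "t0 $ j \<noteq> 0" using ij(2) by (simp add: t0_def)
 then have "t0 \<noteq> 0" by auto
 from cov_pos[OF inv this] have "a * (b / a)\<^sup>2 - 2 * b * (b / a) + d > 0" unfolding form using ij(2) by (simp add: t0_def)
 then have e: "d - b\<^sup>2 / a > 0" using a by (simp add: power2_eq_square field_simps)
 define L :: "real ^ 2 ^ 2" where "L = vector [vector [sqrt a, b / sqrt a], vector [0, sqrt (d - b\<^sup>2 / a)]]"
 have detL: "det L = sqrt (det cov)"
 proof -
  have "det cov = a * d - b * b"
   using det_two_points[OF ij, of cov] sym by (simp add: a_def b_def d_def)
  also have "... = a * (d - b\<^sup>2 / a)" using a by (simp add: power2_eq_square field_simps)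
  finally show ?thesis unfolding det_2 L_def by (simp add: real_sqrt_mult)
 qed
 have dL0: "det L > 0" unfolding det_2 L_def using a e by simp
 then have invL: "invertible L" by (simp add: invertible_det_nz)
 define T :: "real ^ 'd => real ^ 2" where "T t = vector [t $ i, t $ j]" for t
 have T_nth [simp]: "T t $ 1 = t $ i" "T t $ 2 = t $ j" for t by (simp_all add: T_def)
 have linT: "linear T" by (rule linearI) (auto simp: vec_eq_iff forall_2)
 have T_eq_0: "T t = 0 ==> t = 0" for t
 proof (subst vec_eq_iff, rule allI)
  fix k assume T0: "T t = 0"
  have "t $ i = 0" "t $ j = 0" using T0 T_nth[of t] by (metis zero_index)+
  moreover have "k = i \<or> k = j" using ij(1) by auto
  ultimately show "t $ k = 0 $ k" by auto
 qed
 define B where "B t = L *v T t" for t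
 have linB: "linear B" unfolding B_def
  using linear_compose[OF linT matrix_vector_mul_linear[of L]] by (simp add: o_def)
 have LL: "(L *v v) \<bullet> (L *v v) = a * (v $ 1)\<^sup>2 + 2 * b * v $ 1 * v $ 2 + d * (v $ 2)\<^sup>2" for v
 proof -
  have s: "sqrt a * sqrt a = a" "sqrt (d - b\<^sup>2 / a) * sqrt (d - b\<^sup>2 / a) = d - b\<^sup>2 / a" using a e by auto
  have s2: "b / sqrt a * (b / sqrt a) = b\<^sup>2 / a" "sqrt a * (b / sqrt a) = b" using a by (auto simp: power2_eq_square)
  have "(L *v v) \<bullet> (L *v v) = (sqrt a * v $ 1 + b / sqrt a * v $ 2)\<^sup>2 + (sqrt (d - b\<^sup>2 / a) * v $ 2)\<^sup>2"
   unfolding inner_vec_def matrix_vector_mult_def L_def by (simp add: sum_2 power2_eq_square)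
  also have "... = (sqrt a * sqrt a) * (v $ 1)\<^sup>2 + 2 * (sqrt a * (b / sqrt a)) * v $ 1 * v $ 2
   + (b / sqrt a * (b / sqrt a) + sqrt (d - b\<^sup>2 / a) * sqrt (d - b\<^sup>2 / a)) * (v $ 2)\<^sup>2"
   by (simp only: power2_eq_square) algebra
  finally show ?thesis unfolding s s2 by simp
 qed
 define q where "q t = (norm (B t))\<^sup>2 / 2" for t
 define c where "c = 2 * pi / det L"
 have q_form: "q t = mean p (%x. (t \<bullet> ivec x)\<^sup>2) / 2" for t
  unfolding cov_form[symmetric] form q_def B_def power2_norm_eq_inner LL by simp
 have injB: "inj B"
 proof -
  have "t = 0" if "B t = 0" for t
  proof (rule T_eq_0)
   show "T t = 0" using that invL unfolding B_def by (metis inj_matrix_vector_mult injD matrix_vector_mult_0_right)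
  qed
  then show ?thesis using linear_injective_0[OF linB] by blast
 qed
 obtain K where K: "K > 0" "\<And>t. K * norm t <= norm (B t)"
  using linear_inj_bounded_below_pos[OF linB injB] by blast
 have q_low: "K\<^sup>2 / 2 * (norm t)\<^sup>2 <= q t" for t
  using power_mono[OF K(2)[of t], of 2] K(1) by (simp add: q_def power_mult_distrib)
 have small: "\<exists>r>0. \<forall>t. q t < r --> norm t < e" if e: "e > 0" for e
 proof (intro exI conjI allI impI)
  show "K\<^sup>2 / 2 * e\<^sup>2 > 0" using K e by simp
  fix t assume "q t < K\<^sup>2 / 2 * e\<^sup>2"
  then have "K\<^sup>2 / 2 * (norm t)\<^sup>2 < K\<^sup>2 / 2 * e\<^sup>2" using q_low[of t] by simp
  then have "(norm t)\<^sup>2 < e\<^sup>2" using K by simp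
  then show "norm t < e" using e by (simp add: power2_less_imp_less)
 qed
 have vol: "emeasure lborel {t. q t < r} = ennreal (c * r)" if r: "r > 0" for r
 proof -
  define E where "E = {v :: real ^ 2. (norm (L *v v))\<^sup>2 / 2 < r}"
  have Em [measurable]: "E \<in> sets borel"
   unfolding E_def by (intro borel_open open_Collect_less continuous_intros linear_continuous_on_compose[OF _ matrix_vector_mul_linear, of UNIV "%x. x", simplified]) simp_all
  have Tm: "T \<in> borel_measurable borel" by (intro borel_measurable_continuous_onI linear_continuous_on linear_conv_bounded_linear[THEN iffD1] linT)
  obtain Li where LiL: "Li ** L = mat 1" "L ** Li = mat 1" using invL unfolding invertible_def by blast
  have "E = (*v) Li ` ball 0 (sqrt (2 * r))"
  proof safe
   fix v assume "v \<in> E"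
   then have "(norm (L *v v))\<^sup>2 < 2 * r" by (simp add: E_def)
   then have "norm (L *v v) < sqrt (2 * r)" by (rule real_less_rsqrt)
   moreover have "v = Li *v (L *v v)" by (simp add: matrix_vector_mul_assoc LiL)
   ultimately show "v \<in> (*v) Li ` ball 0 (sqrt (2 * r))" by (intro image_eqI) auto
  next
   fix v :: "real ^ 2" assume "v \<in> ball 0 (sqrt (2 * r))"
   then have "norm v < sqrt (2 * r)" by simp
   then have "(norm v)\<^sup>2 < (sqrt (2 * r))\<^sup>2" by (intro power_strict_mono) auto
   moreover have "L *v (Li *v v) = v" by (simp add: matrix_vector_mul_assoc LiL)
   ultimately show "Li *v v \<in> E" using r by (simp add: E_def)
  qed
  moreover have "measure lebesgue ((*v) Li ` ball 0 (sqrt (2 * r))) = \<bar>det Li\<bar> * measure lebesgue (ball (0 :: real ^ 2) (sqrt (2 * r)))"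
   using measure_linear_image[of "(*v) Li" "ball 0 (sqrt (2 * r))"] by (simp add: matrix_vector_mul_linear lmeasurable_ball)
  moreover have "measure lebesgue (ball (0 :: real ^ 2) (sqrt (2 * r))) = pi * (2 * r)"
   using content_ball[of "sqrt (2 * r)" "0 :: real ^ 2"] r by (simp add: unit_ball_vol_2)
  moreover have "\<bar>det Li\<bar> = 1 / det L"
  proof -
   have "det Li * det L = 1" using LiL(1) by (metis det_I det_mul)
   then have "det Li = 1 / det L" using dL0 by (simp add: field_simps)
   then show ?thesis using dL0 by simp
  qed
  moreover have "(*v) Li ` ball 0 (sqrt (2 * r)) \<in> lmeasurable"
   by (rule measurable_linear_image) (auto simp: matrix_vector_mul_linear lmeasurable_ball)
  ultimately have "E \<in> lmeasurable" "measure lebesgue E = c * r"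
   by (simp_all add: c_def)
  then have "emeasure lebesgue E = ennreal (c * r)" by (simp add: emeasure_eq_measure2)
  then have "emeasure lborel E = ennreal (c * r)" using Em by simp
  also have "emeasure lborel E = emeasure (distr lborel borel T) E"
   unfolding T_def by (simp only: distr_lborel_two_coordinates[OF ij])
  also have "... = emeasure lborel (T -` E)" using Tm by (subst emeasure_distr) auto
  also have "T -` E = {t. q t < r}" by (auto simp: E_def q_def B_def)
  finally show ?thesis .
 qed
 have near: "\<exists>r>0. \<forall>t. q t < r --> cmod (1 - wchar p t - of_real (q t)) <= \<eta> * q t" if \<eta>: "\<eta> > 0" for \<eta>
 proof -
  define nx where "nx x = norm (ivec x :: real ^ 'd)" for x
  \<comment> \<open>Only second moments are available, so the third-order Taylor bound is cut off by
    the second-order one. With s a bound for the norm of t, g s tends to 0 with s by dominated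
    convergence.\<close>
  define g where "g s = mean p (%x. min ((nx x)\<^sup>2) (s * nx x ^ 3))" for s
  have nx2: "integrable p (%x. (nx x)\<^sup>2)"
  proof -
   have "(nx x)\<^sup>2 = (\<Sum>i\<in>UNIV. (of_int (x $ i) :: real)\<^sup>2)" for x
    unfolding nx_def power2_norm_eq_inner inner_vec_def by (simp add: ivec_def power2_eq_square)
   then show ?thesis by (simp add: sq)
  qed
  have nx0: "nx x \<ge> 0" for x by (simp add: nx_def)
  have "(%n. g (1 / real (Suc n))) ----> mean p (%x. 0)"
   unfolding g_def
  proof (rule integral_dominated_convergence[OF _ _ nx2])
   show "AE x in p. (%n. min ((nx x)\<^sup>2) (1 / real (Suc n) * nx x ^ 3)) ----> 0"
   proof (rule AE_I2)
    fix x
    have "(%n. min ((nx x)\<^sup>2) (1 / real (Suc n) * nx x ^ 3)) ----> min ((nx x)\<^sup>2) (0 * nx x ^ 3)"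
     by (intro tendsto_intros LIMSEQ_Suc[OF lim_1_over_n])
    then show "(%n. min ((nx x)\<^sup>2) (1 / real (Suc n) * nx x ^ 3)) ----> 0" by simp
   qed
   show "AE x in p. norm (min ((nx x)\<^sup>2) (1 / real (Suc n) * nx x ^ 3)) <= (nx x)\<^sup>2" for n
    by (intro AE_I2) (use nx0 in \<open>auto simp: min_def\<close>)
  qed auto
  moreover have eta2: "0 < \<eta> * (K\<^sup>2 / 2)" using \<eta> K by simp
  ultimately have "\<forall>\<^sub>F n in sequentially. g (1 / real (Suc n)) < \<eta> * (K\<^sup>2 / 2)"
   using order_tendstoD(2) by fastforce
  then obtain n where n: "g (1 / real (Suc n)) < \<eta> * (K\<^sup>2 / 2)" by (auto simp: eventually_sequentially)
  define s0 where "s0 = 1 / real (Suc n)"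
  have s0: "s0 > 0" "g s0 < \<eta> * (K\<^sup>2 / 2)" using n by (auto simp: s0_def)
  obtain r where r: "r > 0" "\<And>t. q t < r ==> norm t < s0" using small[OF s0(1)] by auto
  have "cmod (1 - wchar p t - of_real (q t)) <= \<eta> * q t" if "q t < r" for t
  proof -
   have ns: "norm t < s0" using r(2) that by auto
   define Y where "Y x = t \<bullet> ivec x" for x
   have iY2: "integrable p (%x. (Y x)\<^sup>2)" unfolding Y_def by (rule integrable_inner_sq)
   have iY: "integrable p Y" unfolding Y_def inner_ivec by (intro Bochner_Integration.integrable_sum integrable_mult_right integrable_coord)
   have EY: "mean p Y = 0"
    unfolding Y_def inner_ivec by (subst Bochner_Integration.integral_sum) (auto intro!: integrable_mult_right integrable_coord simp: mean0)
   have icis: "integrable p (%x. cis (Y x))" by (rule integrable_pmf_bounded[where c=1]) simp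
   have ipoly: "integrable p (%x. 1 + \<i> * of_real (Y x) - of_real ((Y x)\<^sup>2) / 2)"
    by (intro Bochner_Integration.integrable_add Bochner_Integration.integrable_diff integrable_mult_right integrable_divide integrable_of_real iY iY2) simp
   have "mean p (%x. 1 + \<i> * of_real (Y x) - of_real ((Y x)\<^sup>2) / 2) = 1 - of_real (q t)"
   proof -
    have i1: "integrable p (%x. \<i> * complex_of_real (Y x))" by (intro integrable_mult_right integrable_of_real iY)
    have i2: "integrable p (%x. complex_of_real ((Y x)\<^sup>2) / 2)" by (intro integrable_divide integrable_of_real iY2)
    have "mean p (%x. 1 + \<i> * of_real (Y x) - of_real ((Y x)\<^sup>2) / 2) =
     mean p (%x. 1 + \<i> * of_real (Y x)) - mean p (%x. complex_of_real ((Y x)\<^sup>2) / 2)"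
     by (rule Bochner_Integration.integral_diff) (use i1 i2 in auto)
    also have "mean p (%x. 1 + \<i> * complex_of_real (Y x)) = 1 + mean p (%x. \<i> * complex_of_real (Y x))"
     by (subst Bochner_Integration.integral_add) (use i1 in auto)
    also have "mean p (%x. \<i> * complex_of_real (Y x)) = \<i> * of_real (mean p Y)"
     by (simp only: integral_mult_right_zero integral_complex_of_real)
    also have "mean p (%x. complex_of_real ((Y x)\<^sup>2) / 2) = of_real (q t)"
     unfolding q_form Y_def[symmetric] by (simp only: integral_divide_zero integral_complex_of_real) simp
    finally show ?thesis by (simp add: EY)
   qed
   then have "1 - wchar p t - of_real (q t) = - (mean p (%x. cis (Y x) - (1 + \<i> * of_real (Y x) - of_real ((Y x)\<^sup>2) / 2)))"
    by (subst Bochner_Integration.integral_diff[OF icis ipoly]) (simp add: wchar_def Y_def)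
   then have "cmod (1 - wchar p t - of_real (q t)) <= mean p (%x. cmod (cis (Y x) - (1 + \<i> * of_real (Y x) - of_real ((Y x)\<^sup>2) / 2)))"
    by (simp only: norm_minus_cancel) (rule integral_norm_bound)
   also have "... <= mean p (%x. (norm t)\<^sup>2 * min ((nx x)\<^sup>2) (s0 * nx x ^ 3))"
   proof (rule expectation_pmf_mono)
    show "integrable p (%x. cmod (cis (Y x) - (1 + \<i> * of_real (Y x) - of_real ((Y x)\<^sup>2) / 2)))"
     by (intro integrable_norm Bochner_Integration.integrable_diff icis ipoly)
    show "integrable p (%x. (norm t)\<^sup>2 * min ((nx x)\<^sup>2) (s0 * nx x ^ 3))"
     by (intro integrable_mult_right Bochner_Integration.integrable_bound[OF nx2]) (use nx0 s0 in \<open>auto simp: min_def\<close>)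
    fix x
    have Yb: "\<bar>Y x\<bar> <= norm t * nx x" unfolding Y_def nx_def by (rule Cauchy_Schwarz_ineq2)
    have "\<bar>Y x\<bar>\<^sup>2 <= (norm t * nx x)\<^sup>2" by (rule power_mono[OF Yb]) simp
    then have 1: "(Y x)\<^sup>2 <= (norm t)\<^sup>2 * (nx x)\<^sup>2" by (simp add: power_mult_distrib)
    have "\<bar>Y x\<bar> ^ 3 <= (norm t * nx x) ^ 3" by (rule power_mono[OF Yb]) simp
    also have "... = (norm t)\<^sup>2 * (norm t * nx x ^ 3)" by (simp add: power2_eq_square power3_eq_cube)
    also have "... <= (norm t)\<^sup>2 * (s0 * nx x ^ 3)" using ns nx0[of x] by (intro mult_left_mono mult_right_mono) auto
    finally have 2: "\<bar>Y x\<bar> ^ 3 <= (norm t)\<^sup>2 * (s0 * nx x ^ 3)" .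
    show "cmod (cis (Y x) - (1 + \<i> * of_real (Y x) - of_real ((Y x)\<^sup>2) / 2)) <= (norm t)\<^sup>2 * min ((nx x)\<^sup>2) (s0 * nx x ^ 3)"
    proof -
     note c = cis_taylor2[of "Y x", unfolded min.bounded_iff]
     show ?thesis
     proof (cases "(nx x)\<^sup>2 <= s0 * nx x ^ 3")
      case True
      show ?thesis unfolding min_absorb1[OF True] by (rule order_trans[OF conjunct1[OF c] 1])
     next
      case False
      then have le: "s0 * nx x ^ 3 <= (nx x)\<^sup>2" by simp
      show ?thesis unfolding min_absorb2[OF le] by (rule order_trans[OF conjunct2[OF c] 2])
     qed
    qed
   qed
   also have "... = (norm t)\<^sup>2 * g s0" by (simp add: g_def)
   also have "... <= (norm t)\<^sup>2 * (\<eta> * (K\<^sup>2 / 2))" using s0(2) by (intro mult_left_mono) auto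
   also have "... = \<eta> * (K\<^sup>2 / 2 * (norm t)\<^sup>2)" by simp
   also have "... <= \<eta> * q t" using q_low \<eta> by (intro mult_left_mono) auto
   finally show ?thesis .
  qed
  then show ?thesis using r(1) by blast
 qed
 have "char_walk p q c"
 proof
  show "continuous_on UNIV q" unfolding q_def
   by (intro continuous_intros linear_continuous_on_compose[OF _ linB, of UNIV "%x. x", simplified]) simp_all
 qed (use vol near small dL0 in \<open>auto simp: q_def c_def linear_0[OF linB]\<close>)
 moreover have "c / (2 * pi) ^ CARD('d) = 1 / (pi * (2 * sqrt (det cov)))"
  unfolding c_def detL card2 using dL0 by (simp add: power2_eq_square)
 ultimately show ?thesis by blast
qed

end

section \<open>From the hypotheses on the walk to the Fourier conditions\<close>

context walk_scenery begin

lemma distr_path: "distr M (count_space UNIV) (path n) = measure_pmf (replicate_pmf n step)"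
proof (rule measure_eqI_countable)
 have m: "path n \<in> measurable M (count_space UNIV)"
 proof (rule measurable_count_space_eq_countable[THEN iffD2], safe)
  fix xs
  have "path n -` {xs} \<inter> space M = {\<omega> \<in> space M. path n \<omega> = xs}" by auto
  then show "path n -` {xs} \<inter> space M \<in> sets M" by simp
 qed auto
 fix xs :: "(int ^ 'd) list"
 have "emeasure (distr M (count_space UNIV) (path n)) {xs} = emeasure M {\<omega> \<in> space M. path n \<omega> = xs}"
  using m by (subst emeasure_distr) (auto intro!: arg_cong[where f="emeasure M"])
 then show "emeasure (distr M (count_space UNIV) (path n)) {xs} = emeasure (measure_pmf (replicate_pmf n step)) {xs}"
  by (simp add: emeasure_eq_measure prob_path emeasure_pmf_single)
qed auto

lemma path_measurable: "path n \<in> measurable M (count_space UNIV)"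
proof (rule measurable_count_space_eq_countable[THEN iffD2], safe)
 fix xs
 have "path n -` {xs} \<inter> space M = {\<omega> \<in> space M. path n \<omega> = xs}" by auto
 then show "path n -` {xs} \<inter> space M \<in> sets M" by simp
qed auto

lemma integral_path:
 fixes F :: "(int ^ 'd) list => 'b::{banach, second_countable_topology}"
 shows "(\<integral>\<omega>. F (path n \<omega>) \<partial>M) = wmean n step F"
 unfolding distr_path[symmetric] by (rule integral_distr[symmetric]) (use path_measurable in auto)

lemma integral_step:
 fixes F :: "int ^ 'd => 'b::{banach, second_countable_topology}"
 shows "(\<integral>\<omega>. F (X 1 \<omega>) \<partial>M) = mean step F" "integrable M (%\<omega>. F (X 1 \<omega>)) \<longleftrightarrow> integrable step F"
 unfolding measure_pmf_step by (simp_all add: integral_distr integrable_distr_eq)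

lemma planar_char_walk:
 assumes "planar_walk_assumption M X A"
 shows "\<exists>q c. char_walk step q c \<and> c / (2 * pi) ^ CARD('d) = 1 / (pi * A)"
proof -
 have c2: "CARD('d) = 2" and sq: "\<And>i. integrable M (%\<omega>. (of_int (X 1 \<omega> $ i) :: real)\<^sup>2)"
  and m0: "\<And>i. (\<integral>\<omega>. (of_int (X 1 \<omega> $ i) :: real) \<partial>M) = 0"
  and inv: "invertible (covariance_matrix M (X 1))" and A: "A = 2 * sqrt (det (covariance_matrix M (X 1)))"
  using assms unfolding planar_walk_assumption_def by auto
 interpret L: planar_law step
 proof
  show "CARD('d) = 2" by (rule c2)
  show "integrable step (%x. (of_int (x $ i) :: real)\<^sup>2)" for i
   using sq[of i] integral_step(2)[of "%x. (of_int (x $ i) :: real)\<^sup>2"] by simp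
  show "mean step (%x. of_int (x $ i) :: real) = 0" for i
   using m0[of i] integral_step(1)[of "%x. of_int (x $ i) :: real"] by simp
 qed
 have cov: "covariance_matrix M (X 1) = L.cov"
  unfolding covariance_matrix_def L.cov_def m0 using integral_step(1)[of "%x. of_int (x $ _) * of_int (x $ _) :: real"] by simp
 show ?thesis using L.char_walk_planar[OF inv[unfolded cov]] unfolding A cov by simp
qed

text \<open>Convergence of S_n / n to the Cauchy law is a stable limit of index 1 with A2 = 0, so
  \<open>log_char_asymp\<close> gives \<open>wchar\<close> = exp (- a * |w| + o(|w|)). The gauge is
  a * |w|, and {q < r} is an interval of length 2 * r / a, whence c = 2 / a.\<close>

lemma cauchy_char_walk:
 assumes "cauchy_walk_assumption M X a"
 shows "\<exists>q c. char_walk step q c \<and> c / (2 * pi) ^ CARD('d) = 1 / (pi * a)"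
proof -
 obtain L where c1: "CARD('d) = 1" and a: "a > 0" and L: "real_distribution L" "\<And>t. char L t = complex_of_real (exp (- a * \<bar>t\<bar>))"
  and wc: "\<And>i. weak_conv_m (%n. distr M borel (%\<omega>. of_int (walk X n \<omega> $ i) / real n)) L"
  using assms unfolding cauchy_walk_assumption_def by blast
 obtain i :: 'd where U: "UNIV = {i}" using c1 by (metis card_1_singletonE)
 define f where "f t = wchar step (t *\<^sub>R axis i 1)" for t
 have vec: "w = (w $ i) *\<^sub>R axis i 1" for w :: "real ^ 'd"
  unfolding vec_eq_iff by (metis U UNIV_I axis_nth mult.right_neutral real_scaleR_def singletonD vector_scaleR_component)
 have nrm: "norm w = \<bar>w $ i\<bar>" for w :: "real ^ 'd"
  by (subst vec) (simp add: norm_axis_1)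
 have inn: "(t *\<^sub>R axis i 1) \<bullet> ivec x = t * of_int (x $ i)" for t and x :: "int ^ 'd"
  by (simp add: inner_axis' ivec_def)
 have fc: "continuous_on UNIV f" unfolding f_def
  by (intro continuous_on_compose2[OF continuous_wchar] continuous_intros) auto
 have f0: "f 0 = 1" by (simp add: f_def)
 have fm: "f (- u) = cnj (f u)" for u
 proof -
  have "integrable step (%x. cis (u * of_int (x $ i)))" by (rule integrable_pmf_bounded[where c=1]) simp
  then have "cnj (f u) = mean step (%x. cnj (cis (u * of_int (x $ i))))"
   unfolding f_def wchar_def inn by simp
  then show ?thesis unfolding f_def wchar_def inn by (simp add: cis_cnj)
 qed
 define \<nu> where "\<nu> n = distr M borel (%\<omega>. of_int (walk X n \<omega> $ i) / real n)" for n
 have walk: "walk X n \<omega> = sum_list (path n \<omega>)" for n \<omega>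
  using sum_list_path[of n n \<omega>] by (simp add: path_def)
 have wm: "(%\<omega>. of_int (walk X n \<omega> $ i) / real n) \<in> borel_measurable M" for n
  unfolding walk by (rule measurable_compose[OF path_measurable]) simp
 have \<nu>d: "real_distribution (\<nu> n)" for n unfolding \<nu>_def by (rule real_distribution_distr) (rule wm)
 have \<nu>c: "char (\<nu> n) t = f (real n powr (- 1 / 1) * t) ^ n" for n t
 proof -
  have "char (\<nu> n) t = (\<integral>\<omega>. iexp (t * (of_int (sum_list (path n \<omega>) $ i) / real n)) \<partial>M)"
   unfolding char_def \<nu>_def by (subst integral_distr) (use wm in \<open>auto simp: walk\<close>)
  also have "... = wmean n step (%xs. iexp (t * (of_int (sum_list xs $ i) / real n)))"
   by (rule integral_path)
  also have "... = wmean n step (%xs. cis (((t / real n) *\<^sub>R axis i 1) \<bullet> ivec (sum_list xs)))"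
   unfolding inn by (simp add: cis_conv_exp)
  also have "... = f (t / real n) ^ n" unfolding wchar_power f_def ..
  finally show ?thesis by (cases "n = 0") (simp_all add: powr_minus divide_inverse mult.commute)
 qed
 have charL: "char L u = exp (- psi 1 a 0 u)" for u
  unfolding L(2) psi_def by (simp add: exp_of_real[symmetric] mult.commute del: exp_of_real)
 define q where "q w = a * norm w" for w :: "real ^ 'd"
 have near: "\<exists>r>0. \<forall>w. q w < r --> cmod (1 - wchar step w - of_real (q w)) <= \<eta> * q w" if \<eta>: "\<eta> > 0" for \<eta>
 proof -
  \<comment> \<open>One half of the allowed error goes to the logarithm, the other to the quadratic
    remainder of the exponential.\<close>
  define \<eta>' where "\<eta>' = min 1 (\<eta> * a / 2)"
  have e': "\<eta>' > 0" "\<eta>' <= 1" "\<eta>' <= \<eta> * a / 2" using \<eta> a by (auto simp: \<eta>'_def)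
  have "\<exists>\<delta>>0. \<forall>u. \<bar>u\<bar> < \<delta> --> (\<exists>z. f u = exp z \<and> cmod (z + psi 1 a 0 u) <= \<eta>' * \<bar>u\<bar> powr 1)"
  proof (rule log_char_asymp[where \<nu>=\<nu> and N=L])
   show "continuous_on UNIV f" by (rule fc)
   show "f 0 = 1" by (rule f0)
   show "f (- u) = cnj (f u)" for u by (rule fm)
   show "real_distribution L" by (rule L)
   show "char L u = exp (- psi 1 a 0 u)" for u by (rule charL)
   show "real_distribution (\<nu> n)" for n by (rule \<nu>d)
   show "char (\<nu> n) t = f (real n powr (- 1 / 1) * t) ^ n" for n t by (rule \<nu>c)
   show "weak_conv_m \<nu> L" unfolding \<nu>_def by (rule wc)
  qed (use a e' in auto)
  then obtain \<delta> where \<delta>: "\<delta> > 0" "\<And>u. \<bar>u\<bar> < \<delta> ==> \<exists>z. f u = exp z \<and> cmod (z + psi 1 a 0 u) <= \<eta>' * \<bar>u\<bar> powr 1"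
   by blast
  define K where "K = a + 1"
  have K: "K > 0" using a by (simp add: K_def)
  \<comment> \<open>In turn: validity of the expansion, |z| \<le> 1, and 3 * K^2 * |u| \<le> \<eta>
    * a / 2.\<close>
  define s where "s = min \<delta> (min (1 / K) (\<eta> * a / (8 * K\<^sup>2)))"
  have s: "s > 0" using \<delta> K \<eta> a by (simp add: s_def)
  show ?thesis
  proof (intro exI conjI allI impI)
   show "a * s > 0" using a s by simp
   fix w assume "q w < a * s"
   then have "norm w < s" using a by (simp add: q_def)
   define u where "u = w $ i"
   have u: "\<bar>u\<bar> < s" "norm w = \<bar>u\<bar>" using \<open>norm w < s\<close> nrm by (auto simp: u_def)
   have wf: "wchar step w = f u" unfolding f_def u_def using vec[of w] by simp
   obtain z where z: "f u = exp z" "cmod (z + of_real (a * \<bar>u\<bar>)) <= \<eta>' * \<bar>u\<bar>"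
    using \<delta>(2)[of u] u(1) by (auto simp: s_def psi_def mult.commute)
   have zK: "cmod z <= K * \<bar>u\<bar>"
   proof -
    have "cmod z <= cmod (z + of_real (a * \<bar>u\<bar>)) + cmod (of_real (a * \<bar>u\<bar>))"
     using norm_triangle_ineq4[of "z + of_real (a * \<bar>u\<bar>)" "of_real (a * \<bar>u\<bar>)"] by simp
    also have "... <= 1 * \<bar>u\<bar> + a * \<bar>u\<bar>"
     using z(2) mult_right_mono[OF e'(2), of "\<bar>u\<bar>"] a by (simp add: norm_mult)
    finally show ?thesis by (simp add: K_def algebra_simps)
   qed
   have z1: "cmod z <= 1"
   proof -
    have "K * \<bar>u\<bar> <= K * (1 / K)" using u(1) K by (intro mult_left_mono) (auto simp: s_def)
    then show ?thesis using zK K by simp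
   qed
   have "cmod (exp z - (\<Sum>k\<le>1. z ^ k / fact k)) <= exp \<bar>Re z\<bar> * cmod z ^ Suc 1 / fact 1"
    by (rule Taylor_exp)
   then have "cmod (exp z - 1 - z) <= exp \<bar>Re z\<bar> * (cmod z)\<^sup>2"
    by (simp add: power2_eq_square algebra_simps)
   also have "... <= 3 * (K * \<bar>u\<bar>)\<^sup>2"
   proof (rule mult_mono)
    have "\<bar>Re z\<bar> <= 1" using abs_Re_le_cmod[of z] z1 by linarith
    then have "exp \<bar>Re z\<bar> <= exp 1" by simp
    then show "exp \<bar>Re z\<bar> <= 3" using exp_le by linarith
    show "(cmod z)\<^sup>2 <= (K * \<bar>u\<bar>)\<^sup>2" by (rule power_mono[OF zK]) simp
   qed auto
   also have "... = (3 * K\<^sup>2 * \<bar>u\<bar>) * \<bar>u\<bar>" by (simp add: power2_eq_square)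
   also have "... <= (\<eta> * a / 2) * \<bar>u\<bar>"
   proof (rule mult_right_mono)
    have "3 * K\<^sup>2 * \<bar>u\<bar> <= 3 * K\<^sup>2 * (\<eta> * a / (8 * K\<^sup>2))" using u(1) by (intro mult_left_mono) (auto simp: s_def)
    also have "... = 3 / 8 * (\<eta> * a)" using K by simp
    also have "... <= \<eta> * a / 2" using \<eta> a by simp
    finally show "3 * K\<^sup>2 * \<bar>u\<bar> <= \<eta> * a / 2" .
   qed simp
   finally have t: "cmod (exp z - 1 - z) <= \<eta> * a / 2 * \<bar>u\<bar>" .
   have "1 - wchar step w - of_real (q w) = - ((exp z - 1 - z) + (z + of_real (a * \<bar>u\<bar>)))"
    unfolding wf z(1) q_def u(2) by simp
   then have "cmod (1 - wchar step w - of_real (q w)) <= cmod (exp z - 1 - z) + cmod (z + of_real (a * \<bar>u\<bar>))"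
    by (simp only: norm_minus_cancel) (rule norm_triangle_ineq)
   also have "... <= \<eta> * a / 2 * \<bar>u\<bar> + \<eta> * a / 2 * \<bar>u\<bar>"
    using t z(2) mult_right_mono[OF e'(3), of "\<bar>u\<bar>"] by simp
   also have "... = \<eta> * q w" by (simp add: q_def u(2))
   finally show "cmod (1 - wchar step w - of_real (q w)) <= \<eta> * q w" .
  qed
 qed
 have "char_walk step q (2 / a)"
 proof
  show "continuous_on UNIV q" unfolding q_def by (intro continuous_intros)
  show "emeasure lborel {w. q w < r} = ennreal (2 / a * r)" if r: "r > 0" for r
  proof -
   have "{w. q w < r} = ball 0 (r / a)" using a by (auto simp: q_def field_simps)
   moreover have "emeasure lborel (ball (0 :: real ^ 'd) (r / a)) = ennreal (measure lborel (ball (0 :: real ^ 'd) (r / a)))"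
    by (rule emeasure_eq_ennreal_measure) (metis emeasure_lborel_ball_finite infinity_ennreal_def less_irrefl)
   moreover have "measure lborel (ball (0 :: real ^ 'd) (r / a)) = 2 / a * r"
    using content_ball[of "r / a" "0 :: real ^ 'd"] r a c1 by (simp add: unit_ball_vol_1)
   ultimately show ?thesis by simp
  qed
  show "\<exists>r>0. \<forall>w. q w < r --> norm w < e" if "e > 0" for e
   by (rule exI[of _ "a * e"]) (use a that in \<open>auto simp: q_def\<close>)
 qed (use near a in \<open>auto simp: q_def\<close>)
 moreover have "2 / a / (2 * pi) ^ CARD('d) = 1 / (pi * a)" using c1 a by simp
 ultimately show ?thesis by blast
qed

lemma lattice_walk:
 assumes cw: "char_walk step q c" and gen: "generates_lattice M (X 1)"
 shows "lattice_char_walk step q c"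
proof -
 interpret char_walk step q c by fact
 show ?thesis
 proof
  fix H :: "(int ^ 'd) set"
  assume H: "0 \<in> H" "\<And>u v. u \<in> H ==> v \<in> H ==> u - v \<in> H" "set_pmf step \<subseteq> H"
  have "AE x in measure_pmf step. x \<in> H" using H(3) by (auto simp: AE_measure_pmf_iff)
  then have "AE \<omega> in M. X 1 \<omega> \<in> H"
   unfolding measure_pmf_step by (subst (asm) AE_distr_iff) auto
  then show "H = UNIV" using gen H(1,2) unfolding generates_lattice_def by blast
 qed
qed

end

section \<open>Convergence of the mean characteristic function\<close>

lemma exp_minus_le_powr:
 fixes x q :: real
 assumes "x > 0" "q > 0"
 shows "exp (- x) <= (q / x) powr q"
proof -
 have "x / q <= exp (x / q)" using exp_ge_add_one_self[of "x / q"] by linarith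
 then have "(x / q) powr q <= exp (x / q) powr q" using assms by (intro powr_mono2) auto
 also have "... = exp x" using assms by (simp add: powr_def)
 finally have *: "(x / q) powr q <= exp x" .
 have "exp (- x) = inverse (exp x)" by (simp add: exp_minus)
 also have "... <= inverse ((x / q) powr q)" using assms * by (intro le_imp_inverse_le) auto
 also have "... = (q / x) powr q" using assms by (simp add: powr_divide field_simps)
 finally show ?thesis .
qed

text \<open>As x powr (2 / \<beta>) * exp (- x) is bounded, this exponential has an integrable
  majorant that depends on a only through a powr (- 2 / \<beta>). With a proportional to the random
  V / b powr \<beta>, this is the origin of the inverse moment.\<close>

lemma exp_powr_decay:
 fixes a \<beta> u :: real
 assumes a: "a > 0" and b: "\<beta> > 0"
 shows "exp (- (a * \<bar>u\<bar> powr \<beta>)) <= (1 + (2 / (\<beta> * a)) powr (2 / \<beta>)) * inverse (1 + u\<^sup>2)"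
proof -
 define E where "E = exp (- (a * \<bar>u\<bar> powr \<beta>))"
 define K where "K = (2 / (\<beta> * a)) powr (2 / \<beta>)"
 have E1: "E <= 1" unfolding E_def using a by simp
 have "E * u\<^sup>2 <= K"
 proof (cases "u = 0")
  case False
  have "E <= (2 / \<beta> / (a * \<bar>u\<bar> powr \<beta>)) powr (2 / \<beta>)" unfolding E_def
   using False a b by (intro exp_minus_le_powr) auto
  also have "... = K / (\<bar>u\<bar> powr \<beta>) powr (2 / \<beta>)"
   unfolding K_def using False a b by (subst powr_divide[symmetric]) (auto simp: field_simps)
  also have "(\<bar>u\<bar> powr \<beta>) powr (2 / \<beta>) = u\<^sup>2" using b False by (simp add: powr_powr powr_numeral)
  finally show ?thesis using False by (simp add: field_simps)
 qed (simp add: K_def)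
 then have "E * (1 + u\<^sup>2) <= 1 + K" using E1 by (simp add: algebra_simps)
 moreover have "0 < 1 + u\<^sup>2" by (smt (verit) zero_le_power2)
 ultimately show ?thesis unfolding E_def[symmetric] K_def[symmetric]
  by (simp add: field_simps)
qed

text \<open>On the closed left half-plane, which is convex, the derivative of exp has modulus at
  most 1.\<close>

lemma norm_exp_diff_le:
 fixes z w :: complex
 assumes "Re z <= 0" "Re w <= 0"
 shows "cmod (exp z - exp w) <= cmod (z - w)"
proof -
 have "cmod (exp z - exp w) <= 1 * cmod (z - w)"
 proof (rule field_differentiable_bound[where S="{z. Re z <= 0}" and f'=exp])
  show "convex {z. Re z <= 0}" by (rule convex_halfspace_Re_le)
 qed (use assms in \<open>auto intro!: derivative_eq_intros\<close>)
 then show ?thesis by simp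
qed

lemma integrable_inverse_1_plus_square_lborel: "integrable lborel (%x::real. inverse (1 + x\<^sup>2))"
 using integrable_inverse_1_plus_square by (simp add: set_integrable_def)

section \<open>Pointwise Fourier inversion of a continuous density\<close>

lemma tendsto_density_interval:
 fixes C :: "real => real"
 assumes \<mu>: "\<mu> = density lborel (%x. ennreal (C x))" "finite_measure \<mu>" and C: "continuous_on UNIV C" "\<And>x. C x \<ge> 0"
 shows "(%n. measure \<mu> {a<..a + 1 / real (Suc n)} * real (Suc n)) ----> C a"
proof (rule LIMSEQ_I)
 fix e :: real assume e: "e > 0"
 interpret finite_measure \<mu> by fact
 have [measurable]: "C \<in> borel_measurable borel" using C by (simp add: borel_measurable_continuous_onI)
 obtain \<delta> where \<delta>: "\<delta> > 0" "\<And>y. \<bar>y - a\<bar> < \<delta> ==> \<bar>C y - C a\<bar> < e / 2"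
  using C(1) e unfolding continuous_on_iff dist_real_def by (metis UNIV_I half_gt_zero)
 obtain n0 where n0: "1 / real (Suc n0) < \<delta>" using \<delta>(1) nat_approx_posE by metis
 have "norm (measure \<mu> {a<..a + 1 / real (Suc n)} * real (Suc n) - C a) < e" if n: "n \<ge> n0" for n
 proof -
  define h where "h = 1 / real (Suc n)"
  have "h <= 1 / real (Suc n0)" unfolding h_def using n by (intro frac_le) auto
  then have h: "h > 0" "h < \<delta>" using n0 by (auto simp: h_def)
  have near: "C a - e / 2 <= C y \<and> C y <= C a + e / 2" if "y \<in> {a<..a+h}" for y
   using \<delta>(2)[of y] that h by (auto simp: abs_if split: if_splits)
  have em: "emeasure \<mu> {a<..a+h} = (\<integral>\<^sup>+y. ennreal (C y) * indicator {a<..a+h} y \<partial>lborel)"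
   unfolding \<mu>(1) by (rule emeasure_density) auto
  have le: "emeasure lborel {a<..a+h} = ennreal h" using h by simp
  have "emeasure \<mu> {a<..a+h} <= (\<integral>\<^sup>+y. ennreal (C a + e / 2) * indicator {a<..a+h} y \<partial>lborel)"
   unfolding em by (intro nn_integral_mono) (auto simp: indicator_def intro!: ennreal_leI conjunct2[OF near])
  also have "... = ennreal (C a + e / 2) * ennreal h" by (subst nn_integral_cmult_indicator) (simp_all add: le)
  also have "... = ennreal ((C a + e / 2) * h)" using C(2)[of a] e h by (subst ennreal_mult) auto
  finally have up: "measure \<mu> {a<..a+h} <= (C a + e / 2) * h"
   unfolding emeasure_eq_measure using C(2)[of a] e h by (subst (asm) ennreal_le_iff) auto
  have "ennreal ((C a - e / 2) * h) = ennreal (C a - e / 2) * ennreal h" using h by (subst ennreal_mult'') auto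
  also have "... = (\<integral>\<^sup>+y. ennreal (C a - e / 2) * indicator {a<..a+h} y \<partial>lborel)"
   by (subst nn_integral_cmult_indicator) (simp_all add: le)
  also have "... <= emeasure \<mu> {a<..a+h}"
   unfolding em by (intro nn_integral_mono) (auto simp: indicator_def intro!: ennreal_leI conjunct1[OF near])
  finally have lo: "(C a - e / 2) * h <= measure \<mu> {a<..a+h}"
   unfolding emeasure_eq_measure by (subst (asm) ennreal_le_iff) auto
  have "(C a - e / 2) <= measure \<mu> {a<..a+h} / h" "measure \<mu> {a<..a+h} / h <= C a + e / 2"
   using up lo h by (simp_all add: field_simps)
  moreover have "measure \<mu> {a<..a+h} / h = measure \<mu> {a<..a+h} * real (Suc n)" by (simp add: h_def)
  ultimately show ?thesis using e unfolding h_def[symmetric] by (simp add: abs_if)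
 qed
 then show "\<exists>no. \<forall>n\<ge>no. norm (measure \<mu> {a<..a + 1 / real (Suc n)} * real (Suc n) - C a) < e" by blast
qed

text \<open>Levy's inversion on the interval from a to a + h, where integrability of the
  characteristic function removes the truncation of the integral. Dividing by h and letting h tend
  to 0 identifies the continuous density at every point, not merely almost everywhere.\<close>

lemma char_inversion_density:
 fixes C :: "real => real"
 assumes \<mu>: "\<mu> = density lborel (%x. ennreal (C x))" "real_distribution \<mu>"
  and C: "continuous_on UNIV C" "\<And>x. C x \<ge> 0" and int: "integrable lborel (char \<mu>)"
 shows "complex_of_real (C a) = (\<integral>t. iexp (- (t * a)) * char \<mu> t \<partial>lborel) / (2 * pi)"
proof -
 interpret \<mu>: real_distribution \<mu> by fact
 have [measurable]: "C \<in> borel_measurable borel" using C by (simp add: borel_measurable_continuous_onI)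
 have [measurable]: "char \<mu> \<in> borel_measurable lborel" using int by auto
 have atom: "measure \<mu> {x} = 0" for x
 proof -
  have "emeasure \<mu> {x} = 0"
   unfolding \<mu>(1) by (subst emeasure_density) (auto simp: nn_integral_0_iff_AE intro!: AE_I'[of "{x}"] split: split_indicator)
  then show ?thesis by (simp add: measure_def)
 qed
 define F where "F b t = (iexp (-(t * a)) - iexp (-(t * b))) / (\<i> * t) * char \<mu> t" for b t :: real
 have [measurable]: "F b \<in> borel_measurable lborel" for b unfolding F_def[abs_def] by measurable
 have Fb: "cmod (F b t) <= (b - a) * cmod (char \<mu> t)" if "a <= b" for b t
 proof (cases "t = 0")
  case False
  have "cmod ((iexp (-(t * a)) - iexp (-(t * b))) / (\<i> * t)) = cmod ((iexp (t * (- a)) - iexp (t * (- b))) / (\<i> * t))" by simp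
  also have "... <= - a - (- b)" using that False by (intro Levy_Inversion_aux2) auto
  finally show ?thesis unfolding F_def norm_mult by (intro mult_right_mono) auto
 qed (use that in \<open>simp add: F_def\<close>)
 have intF: "integrable lborel (F b)" if "a <= b" for b
  by (rule Bochner_Integration.integrable_bound[where f="%t. (b - a) * cmod (char \<mu> t)"])
    (use that Fb[OF that] int in \<open>auto simp: abs_mult\<close>)
 have inv: "complex_of_real (measure \<mu> {a<..b}) = (\<integral>t. F b t \<partial>lborel) / (2 * pi)" if ab: "a <= b" for b
 proof (rule LIMSEQ_unique)
  show "(%T::nat. 1 / (2 * pi) * (CLBINT t=-T..T. (iexp (-(t * a)) - iexp (-(t * b))) / (\<i> * t) * char \<mu> t)) ----> of_real (measure \<mu> {a<..b})"
   by (rule \<mu>.Levy_Inversion[OF ab atom atom])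
  have eq: "(CLBINT t=-(real T)..T. F b t) = (\<integral>t. indicator {-real T<..<real T} t *\<^sub>R F b t \<partial>lborel)" for T :: nat
   by (simp add: interval_lebesgue_integral_def set_lebesgue_integral_def)
  have "(%T::nat. \<integral>t. indicator {-real T<..<real T} t *\<^sub>R F b t \<partial>lborel) ----> (\<integral>t. F b t \<partial>lborel)"
  proof (rule integral_dominated_convergence[where w="%t. cmod (F b t)"])
   show "AE t in lborel. (%T::nat. indicator {-real T<..<real T} t *\<^sub>R F b t) ----> F b t"
   proof (rule AE_I2)
    fix t :: real
    obtain T0 where T0: "\<bar>t\<bar> < real T0" using reals_Archimedean2 by blast
    have "\<forall>\<^sub>F T in sequentially. indicator {-real T<..<real T} t *\<^sub>R F b t = F b t"
     using eventually_ge_at_top[of T0]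
    proof eventually_elim
     case (elim T)
     then have "\<bar>t\<bar> < real T" using T0 by linarith
     then show ?case by (auto simp: indicator_def abs_less_iff)
    qed
    then show "(%T::nat. indicator {-real T<..<real T} t *\<^sub>R F b t) ----> F b t" by (rule tendsto_eventually)
   qed
  qed (use intF[OF ab] in \<open>auto simp: indicator_def\<close>)
  then show "(%T::nat. 1 / (2 * pi) * (CLBINT t=-T..T. (iexp (-(t * a)) - iexp (-(t * b))) / (\<i> * t) * char \<mu> t)) ----> (\<integral>t. F b t \<partial>lborel) / (2 * pi)"
   unfolding F_def[symmetric] eq[symmetric] by (auto intro!: tendsto_eq_intros)
 qed
 have fin: "finite_measure \<mu>" by (rule \<mu>.finite_measure_axioms)
 define h where "h n = 1 / real (Suc n)" for n
 have h: "h n > 0" for n by (simp add: h_def)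
 have "(%n. complex_of_real (measure \<mu> {a<..a + 1 / real (Suc n)} * real (Suc n))) ----> of_real (C a)"
  by (intro tendsto_of_real tendsto_density_interval[OF \<mu>(1) fin C])
 moreover have "complex_of_real (measure \<mu> {a<..a + 1 / real (Suc n)} * real (Suc n)) =
  (\<integral>t. F (a + h n) t * real (Suc n) \<partial>lborel) / (2 * pi)" for n
  using inv[of "a + h n"] h[of n] by (simp add: h_def)
 ultimately have l1: "(%n. (\<integral>t. F (a + h n) t * real (Suc n) \<partial>lborel) / (2 * pi)) ----> of_real (C a)" by simp
 have "(%n. \<integral>t. F (a + h n) t * real (Suc n) \<partial>lborel) ----> (\<integral>t. iexp (- (t * a)) * char \<mu> t \<partial>lborel)"
 proof (rule integral_dominated_convergence[where w="%t. cmod (char \<mu> t)"])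
  show "AE t in lborel. (%n. F (a + h n) t * real (Suc n)) ----> iexp (- (t * a)) * char \<mu> t"
  \<comment> \<open>At t = 0 the quotient in \<open>F\<close> is 0 by the convention on division by
    0, so this null set is excluded.\<close>
  proof (rule AE_I'[of "{0}"])
   have "(%n. F (a + h n) t * real (Suc n)) ----> iexp (- (t * a)) * char \<mu> t" if t: "t \<noteq> 0" for t
   proof -
    have bnd: "norm (F (a + h n) t * real (Suc n) - iexp (- (t * a)) * char \<mu> t) <= cmod (char \<mu> t) * (\<bar>t\<bar> * h n / 2)" for n
    proof -
     have e: "iexp (- (t * (a + h n))) = iexp (- (t * a)) * iexp (- (t * h n))"
      by (simp add: exp_add[symmetric] algebra_simps)
     have "F (a + h n) t * real (Suc n) - iexp (- (t * a)) * char \<mu> t =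
      - (iexp (- (t * a)) * char \<mu> t) * ((iexp (- (t * h n)) - (1 + \<i> * of_real (- (t * h n)))) / (\<i> * of_real (t * h n)))"
     proof -
      have alg: "(E - E * G) / (\<i> * T) * c * (1 / H) - E * c = - (E * c) * ((G - (1 + \<i> * - (T * H))) / (\<i> * (T * H)))"
       if "T \<noteq> 0" "H \<noteq> 0" for E G c T H :: complex using that by (simp add: field_simps)
      have "complex_of_real (real (Suc n)) = 1 / of_real (h n)" by (simp add: h_def)
      then show ?thesis unfolding F_def e
       using alg[of "of_real t" "of_real (h n)" "iexp (- (t * a))" "iexp (- (t * h n))" "char \<mu> t"] t h[of n] by simp
     qed
     also have "norm ... = cmod (char \<mu> t) * (cmod (iexp (- (t * h n)) - (1 + \<i> * of_real (- (t * h n)))) / \<bar>t * h n\<bar>)"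
      by (simp only: norm_mult norm_minus_cancel norm_divide norm_exp_i_times norm_of_real norm_ii mult_1)
     also have "... <= cmod (char \<mu> t) * (((- (t * h n))\<^sup>2 / 2) / \<bar>t * h n\<bar>)"
      using iexp_approx1[of "- (t * h n)" 1] by (intro mult_left_mono divide_right_mono) (auto simp: eval_nat_numeral)
     also have "((- (t * h n))\<^sup>2 / 2) / \<bar>t * h n\<bar> = \<bar>t\<bar> * h n / 2"
     proof -
      have "\<bar>t * h n\<bar> = \<bar>t\<bar> * h n" "(- (t * h n))\<^sup>2 = (\<bar>t\<bar> * h n)\<^sup>2"
       using h[of n] by (simp_all add: abs_mult power_mult_distrib)
      moreover have "(x\<^sup>2 / 2) / x = x / 2" if "x > 0" for x :: real using that by (simp add: power2_eq_square)
      ultimately show ?thesis using h[of n] t by simp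
     qed
     finally show ?thesis .
    qed
    have lim: "(%n. cmod (char \<mu> t) * (\<bar>t\<bar> * h n / 2)) ----> 0"
     unfolding h_def by real_asymp
    show ?thesis by (rule LIM_zero_cancel, rule Lim_null_comparison[OF always_eventually lim]) (intro allI bnd)
   qed
   then show "{t \<in> space lborel. \<not> (%n. F (a + h n) t * real (Suc n)) ----> iexp (- (t * a)) * char \<mu> t} \<subseteq> {0}" by auto
  qed auto
  show "AE t in lborel. norm (F (a + h n) t * real (Suc n)) <= cmod (char \<mu> t)" for n
  proof (rule AE_I2)
   fix t
   have "cmod (F (a + h n) t) <= h n * cmod (char \<mu> t)" using Fb[of "a + h n" t] h[of n] by simp
   then have "cmod (F (a + h n) t) * real (Suc n) <= h n * cmod (char \<mu> t) * real (Suc n)" by (intro mult_right_mono) auto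
   also have "... = cmod (char \<mu> t)" by (simp add: h_def)
   finally show "norm (F (a + h n) t * real (Suc n)) <= cmod (char \<mu> t)" by (simp add: norm_mult del: of_nat_Suc)
  qed
 qed (use int in auto)
 then have "(%n. (\<integral>t. F (a + h n) t * real (Suc n) \<partial>lborel) / (2 * pi)) ----> (\<integral>t. iexp (- (t * a)) * char \<mu> t \<partial>lborel) / (2 * pi)"
  by (intro tendsto_intros) auto
 from LIMSEQ_unique[OF l1 this] show ?thesis .
qed

lemma Vpow_ge_1: "xs \<noteq> [] ==> q \<ge> 0 ==> Vpow q xs \<ge> 1"
proof -
 assume xs: "xs \<noteq> []" and q: "q \<ge> 0"
 then have "sites xs \<noteq> []" by simp
 then obtain y where y: "y \<in> set (sites xs)" by (meson last_in_set)
 have "1 <= real (cnt xs y)" using y cnt_pos_iff[of xs y] by simp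
 then have "1 <= real (cnt xs y) powr q" using q by (intro ge_one_powr_ge_zero) auto
 also have "... <= Vpow q xs" unfolding Vsum_def by (rule member_le_sum) (use y in auto)
 finally show ?thesis .
qed

text \<open>\<open>r\<close> is half a period of |\<phi>|, the range on which
  \<open>\<phi>_decay\<close> holds; \<open>\<kappa>\<close> is the limit of V / b powr q;
  \<open>K\<close> bounds the mean of the power 2 / q of b powr q / V, that is of 1 / W^2;
  \<open>a\<close> and \<open>b\<close> are the increments to be exchanged.\<close>

locale local_limit_walk = critical_walk p C0 for p :: "'a::{ab_group_add,countable} pmf" and C0 +
 fixes \<phi> :: "real => complex" and q A1 A2 \<kappa> r c K :: real and a b :: 'a
 assumes q: "0 < q" "q <= 2" and A1: "0 < A1" and \<kappa>: "0 < \<kappa>" and r: "0 < r" and c: "0 < c"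
  and \<phi>_cont: "continuous_on UNIV \<phi>" and \<phi>_0: "\<phi> 0 = 1" and \<phi>_le: "\<And>u. cmod (\<phi> u) <= 1"
  and \<phi>_log: "\<And>\<eta>. \<eta> > 0 ==> \<exists>\<delta>>0. \<forall>u. \<bar>u\<bar> < \<delta> --> (\<exists>z. \<phi> u = exp z \<and> cmod (z + psi q A1 A2 u) <= \<eta> * \<bar>u\<bar> powr q)"
  and \<phi>_decay: "\<And>u. \<bar>u\<bar> <= r ==> cmod (\<phi> u) <= exp (- (c * \<bar>u\<bar> powr q))"
  and \<phi>_periodic: "\<And>u. cmod (\<phi> (u + 2 * r)) = cmod (\<phi> u)"
  and two_points: "a \<noteq> b" "pmf p a > 0" "pmf p b > 0"
  and Vpow_limit: "(%n. wmean n p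
    (%xs. \<bar>Vpow q xs / (nlog q n) - \<kappa>\<bar>)) ----> 0"
  and Vpow_moment: "\<forall>\<^sub>F n in sequentially. wmean n p
    (%xs. (nlog q n / Vpow q xs) powr (2 / q)) <= K"
begin

abbreviation EE :: "nat => ('a list => real) => real" where
 "EE n \<equiv> wmean n p"

definition charprod :: "'a list => real => complex" where
 "charprod xs t = (\<Prod>y\<in>set (sites xs). \<phi> (t * real (cnt xs y)))"

definition limit_char :: "real => complex" where
 "limit_char u = exp (- (of_real \<kappa> * psi q A1 A2 u))"

text \<open>On this event |t| \<le> n powr (- 1/4) keeps every t * N y within half a period; it
  fails with probability below every negative power of n.\<close>

definition spread :: "nat => 'a list => bool" where
 "spread n xs \<longleftrightarrow> (\<forall>y. real (cnt xs y) <= r * real n powr (1/4))"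

lemma rwrs_scale_powr: "n \<ge> 2 ==> rwrs_scale q n powr q = real n * ln (real n) powr (q - 1)"
 using q by (simp add: rwrs_scale_def powr_mult powr_powr)

lemma rwrs_scale_pos: "n \<ge> 2 ==> rwrs_scale q n > 0"
 by (simp add: rwrs_scale_def)

lemma norm_charprod_le: "cmod (charprod xs t) <= 1"
 unfolding charprod_def prod_norm[symmetric] by (rule prod_le_1) (use \<phi>_le in auto)

lemma continuous_charprod: "continuous_on UNIV (charprod xs)"
 unfolding charprod_def[abs_def]
 by (intro continuous_on_prod continuous_on_compose2[OF \<phi>_cont] continuous_intros) auto

lemma norm_limit_char: "cmod (limit_char u) = exp (- (\<kappa> * A1 * \<bar>u\<bar> powr q))"
 by (simp add: limit_char_def norm_exp_eq_Re Re_psi)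

lemma norm_limit_char_le: "cmod (limit_char u) <= 1"
 using \<kappa> A1 by (simp add: norm_limit_char)

lemma continuous_limit_char: "continuous_on UNIV limit_char"
proof -
 have *: "continuous_on S (%u. of_real (\<bar>u\<bar> powr q) * w)" for S and w :: complex
  using q by (intro continuous_intros continuous_on_powr') auto
 have "continuous_on {0..} (psi q A1 A2)"
  by (rule continuous_on_cong[THEN iffD1, rotated 2, OF *[of _ "of_real A1 + \<i> * of_real A2"]]) (auto simp: psi_def sgn_if)
 moreover have "continuous_on {..0} (psi q A1 A2)"
  by (rule continuous_on_cong[THEN iffD1, rotated 2, OF *[of _ "of_real A1 - \<i> * of_real A2"]]) (auto simp: psi_def sgn_if)
 ultimately have "continuous_on ({0..} \<union> {..0}) (psi q A1 A2)" by (intro continuous_on_closed_Un) auto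
 moreover have "{0..} \<union> {..0} = (UNIV :: real set)" by auto
 ultimately show ?thesis unfolding limit_char_def[abs_def] by (auto intro!: continuous_intros)
qed

lemma charprod_bound:
 assumes "\<And>y. \<bar>t\<bar> * real (cnt xs y) <= r"
 shows "cmod (charprod xs t) <= exp (- (c * \<bar>t\<bar> powr q * Vpow q xs))"
proof -
 have "cmod (charprod xs t) <= (\<Prod>y\<in>set (sites xs). exp (- (c * \<bar>t * real (cnt xs y)\<bar> powr q)))"
  unfolding charprod_def prod_norm[symmetric]
  by (intro prod_mono conjI norm_ge_zero \<phi>_decay) (use assms in \<open>simp add: abs_mult\<close>)
 also have "... = exp (\<Sum>y\<in>set (sites xs). - (c * \<bar>t * real (cnt xs y)\<bar> powr q))" by (simp add: exp_sum)
 also have "(\<Sum>y\<in>set (sites xs). - (c * \<bar>t * real (cnt xs y)\<bar> powr q)) = - (c * \<bar>t\<bar> powr q * Vpow q xs)"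
  unfolding Vsum_def by (simp add: abs_mult powr_mult sum_negf sum_distrib_left mult.assoc)
 finally show ?thesis .
qed

text \<open>By homogeneity the logarithms of the factors sum to - w * \<psi> u up to \<eta> * |u|
  powr q * w. Both exponents lie in the left half-plane, where exp is 1-Lipschitz, so it suffices to
  compare them.\<close>

lemma charprod_limit_diff:
 assumes \<delta>: "\<And>v. \<bar>v\<bar> < \<delta> ==> \<exists>z. \<phi> v = exp z \<and> cmod (z + psi q A1 A2 v) <= \<eta> * \<bar>v\<bar> powr q"
  and \<eta>: "\<eta> \<ge> 0" and n: "n \<ge> 2" and small: "\<And>y. \<bar>u\<bar> / rwrs_scale q n * real (cnt xs y) < \<delta>"
 defines "w \<equiv> Vpow q xs / (nlog q n)"
 shows "cmod (charprod xs (u / rwrs_scale q n) - limit_char u) \<le>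
  (cmod (psi q A1 A2 u) + \<eta> * \<bar>u\<bar> powr q) * \<bar>w - \<kappa>\<bar> + \<eta> * \<bar>u\<bar> powr q * \<kappa>"
proof -
 define B where "B = rwrs_scale q n"
 have B: "B > 0" unfolding B_def by (rule rwrs_scale_pos[OF n])
 have Bb: "B powr q = real n * ln (real n) powr (q - 1)" unfolding B_def by (rule rwrs_scale_powr[OF n])
 have "\<forall>y. \<exists>z. \<phi> (u / B * real (cnt xs y)) = exp z \<and>
   cmod (z + psi q A1 A2 (u / B * real (cnt xs y))) <= \<eta> * \<bar>u / B * real (cnt xs y)\<bar> powr q"
  using small B unfolding B_def[symmetric] by (intro allI \<delta>) (simp add: abs_mult)
 then obtain z where z: "\<And>y. \<phi> (u / B * real (cnt xs y)) = exp (z y)"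
   "\<And>y. cmod (z y + psi q A1 A2 (u / B * real (cnt xs y))) <= \<eta> * \<bar>u / B * real (cnt xs y)\<bar> powr q" by metis
 define Z where "Z = (\<Sum>y\<in>set (sites xs). z y)"
 have Rez: "Re (z y) <= 0" for y using \<phi>_le[of "u / B * real (cnt xs y)"] unfolding z(1) by (simp add: norm_exp_eq_Re)
 have 1: "charprod xs (u / B) = exp Z" unfolding charprod_def Z_def z(1) by (simp add: exp_sum)
 have sc: "psi q A1 A2 (u / B * real (cnt xs y)) = of_real (real (cnt xs y) powr q / B powr q) * psi q A1 A2 u" for y
 proof -
  have "psi q A1 A2 (u / B * real (cnt xs y)) = psi q A1 A2 (u * (real (cnt xs y) / B))" by simp
  also have "... = of_real ((real (cnt xs y) / B) powr q) * psi q A1 A2 u" using B by (intro psi_scale) auto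
  finally show ?thesis using B by (simp add: powr_divide)
 qed
 have ab: "\<bar>u / B * real (cnt xs y)\<bar> powr q = \<bar>u\<bar> powr q * (real (cnt xs y) powr q / B powr q)" for y
  using B by (simp add: abs_mult powr_mult powr_divide)
 have w: "w = (\<Sum>y\<in>set (sites xs). real (cnt xs y) powr q / B powr q)"
  unfolding w_def Vsum_def Bb by (simp add: sum_divide_distrib)
 have w0: "w \<ge> 0" unfolding w by (intro sum_nonneg) auto
 have 2: "cmod (Z + of_real w * psi q A1 A2 u) <= \<eta> * \<bar>u\<bar> powr q * w"
 proof -
  have "Z + of_real w * psi q A1 A2 u = (\<Sum>y\<in>set (sites xs). z y + psi q A1 A2 (u / B * real (cnt xs y)))"
   unfolding Z_def w sc by (simp add: sum.distrib sum_distrib_right)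
  also have "cmod ... <= (\<Sum>y\<in>set (sites xs). \<eta> * (\<bar>u\<bar> powr q * (real (cnt xs y) powr q / B powr q)))"
   using z(2) unfolding ab by (intro sum_norm_le) auto
  also have "... = \<eta> * \<bar>u\<bar> powr q * w" unfolding w by (simp add: sum_distrib_left mult_ac)
  finally show ?thesis .
 qed
 have "cmod (exp Z - limit_char u) <= cmod (Z - - (of_real \<kappa> * psi q A1 A2 u))"
  unfolding limit_char_def
  by (rule norm_exp_diff_le) (use \<kappa> A1 in \<open>auto simp: Z_def Re_psi intro!: sum_nonpos Rez\<close>)
 also have "Z - - (of_real \<kappa> * psi q A1 A2 u) = (Z + of_real w * psi q A1 A2 u) - of_real (w - \<kappa>) * psi q A1 A2 u"
  by (simp add: algebra_simps)
 also have "cmod ... <= \<eta> * \<bar>u\<bar> powr q * w + \<bar>w - \<kappa>\<bar> * cmod (psi q A1 A2 u)"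
  using norm_triangle_ineq4[of "Z + of_real w * psi q A1 A2 u" "of_real (w - \<kappa>) * psi q A1 A2 u"] 2
  by (simp only: norm_mult norm_of_real)
 finally have 3: "cmod (exp Z - limit_char u) <= \<eta> * \<bar>u\<bar> powr q * w + \<bar>w - \<kappa>\<bar> * cmod (psi q A1 A2 u)" .
 have eta: "0 <= \<eta> * \<bar>u\<bar> powr q" using \<eta> by simp
 have "\<eta> * \<bar>u\<bar> powr q * w <= \<eta> * \<bar>u\<bar> powr q * (\<bar>w - \<kappa>\<bar> + \<kappa>)" using eta by (intro mult_left_mono) auto
 then show ?thesis using 3 unfolding 1[symmetric] B_def by (simp add: algebra_simps)
qed

lemma integrable_charprod_diff: "integrable (replicate_pmf n p) (%xs. cmod (charprod xs t - limit_char u))"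
proof (rule integrable_pmf_bounded[where c=2])
 fix xs
 show "norm (cmod (charprod xs t - limit_char u)) <= 2"
  using norm_triangle_ineq4[of "charprod xs t" "limit_char u"] norm_charprod_le[of xs t] norm_limit_char_le[of u] by simp
qed

lemma prob_not_spread: "e > 0 ==> (%n. real n powr e * wprob n p {xs. \<not> spread n xs}) ----> 0"
 using prob_max_visits_small[of e "1/4" r] r by (simp add: spread_def not_le)

end

lemma powr_times_ln_powr_tendsto_0:
 fixes s t :: real
 assumes "s < 0"
 shows "(%n. real n powr s * ln (real n) powr t) ----> 0"
 using assms by real_asymp

context local_limit_walk begin

lemma quarter_power_over_scale: "(%n. real n powr (1/4) / rwrs_scale q n) ----> 0"
proof -
 \<comment> \<open>From q \<le> 2: up to logarithms the scale is at least of order sqrt n, far above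
   n powr (1/4).\<close>
 have "1 / 4 - 1 / q < 0" using q by (simp add: field_simps)
 from powr_times_ln_powr_tendsto_0[OF this, of "- ((q - 1) / q)"]
 show ?thesis
 proof (rule Lim_transform_eventually)
  show "\<forall>\<^sub>F n in sequentially. real n powr (1 / 4 - 1 / q) * ln (real n) powr - ((q - 1) / q) = real n powr (1/4) / rwrs_scale q n"
   using eventually_ge_at_top[of 2]
  proof eventually_elim
   case (elim n)
   show ?case unfolding rwrs_scale_def
    by (simp only: powr_diff powr_minus_divide times_divide_times_eq mult_1_right)
  qed
 qed
qed

lemma scale_times_power: "(%n. rwrs_scale q n * real n powr (- (1 / q + 2))) ----> 0"
proof -
 have "- 2 < (0 :: real)" by simp
 from powr_times_ln_powr_tendsto_0[OF this, of "(q - 1) / q"]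
 show ?thesis
 proof (rule Lim_transform_eventually)
  show "\<forall>\<^sub>F n in sequentially. real n powr - 2 * ln (real n) powr ((q - 1) / q) = rwrs_scale q n * real n powr (- (1 / q + 2))"
   using eventually_ge_at_top[of 2]
  proof eventually_elim
   case (elim n)
   have "real n powr (1 / q) * real n powr (- (1 / q + 2)) = real n powr (- 2)"
    unfolding powr_add[symmetric] by simp
   then show ?case unfolding rwrs_scale_def by (metis mult.assoc mult.commute)
  qed
 qed
qed

abbreviation dev :: "nat => real => real" where
 "dev n u \<equiv> EE n (%xs. cmod (charprod xs (u / rwrs_scale q n) - limit_char u))"

lemma dev_nonneg: "0 <= dev n u"
 by (rule Bochner_Integration.integral_nonneg) simp

lemma charprod_diff_le_2: "cmod (charprod xs t - limit_char u) <= 2"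
 using norm_triangle_ineq4[of "charprod xs t" "limit_char u"] norm_charprod_le[of xs t] norm_limit_char_le[of u] by linarith

text \<open>Pointwise in u: for spread paths the counts are negligible against the scale, so the
  expansion of \<phi> at 0 applies to all factors; w converges in mean, and paths that are not
  spread are rare.\<close>

lemma dev_tendsto_0: "(%n. dev n u) ----> 0"
proof (rule LIMSEQ_I)
 fix \<epsilon> :: real assume \<epsilon>: "\<epsilon> > 0"
 define U where "U = \<bar>u\<bar> powr q"
 have U0: "U \<ge> 0" by (simp add: U_def)
 \<comment> \<open>Keeps \<eta> * U * \<kappa>, the one term that does not tend to 0, below
   \<epsilon>; the summand 1 covers u = 0.\<close>
 define \<eta> where "\<eta> = \<epsilon> / (2 * (\<kappa> * U + 1))"
 have pos: "\<kappa> * U + 1 > 0" using \<kappa> U0 by (simp add: add_nonneg_pos)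
 have \<eta>: "\<eta> > 0" using \<epsilon> pos by (simp add: \<eta>_def)
 have \<eta>U: "\<eta> * U * \<kappa> < \<epsilon>"
 proof -
  have "\<eta> * U * \<kappa> <= \<eta> * (\<kappa> * U + 1)" using \<eta> by (simp add: algebra_simps)
  also have "... = \<epsilon> / 2"
  proof -
   have "\<epsilon> / (2 * D) * D = \<epsilon> / 2" if "D > 0" for D :: real using that by simp
   from this[OF pos] show ?thesis unfolding \<eta>_def .
  qed
  finally show ?thesis using \<epsilon> by simp
 qed
 obtain \<delta> where \<delta>: "\<delta> > 0" "\<And>v. \<bar>v\<bar> < \<delta> ==> \<exists>z. \<phi> v = exp z \<and> cmod (z + psi q A1 A2 v) <= \<eta> * \<bar>v\<bar> powr q"
  using \<phi>_log[OF \<eta>] by blast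
 define P where "P = cmod (psi q A1 A2 u) + \<eta> * U"
 define w where "w n xs = Vpow q xs / (nlog q n)" for n and xs :: "'a list"
 have iw: "integrable (replicate_pmf n p) (%xs. \<bar>w n xs - \<kappa>\<bar>)" for n
  unfolding w_def using q by (intro integrable_abs Bochner_Integration.integrable_diff integrable_divide integrable_Vpow) auto
 have "(%n. \<bar>u\<bar> * (r * (real n powr (1/4) / rwrs_scale q n))) ----> \<bar>u\<bar> * (r * 0)"
  by (intro tendsto_intros quarter_power_over_scale)
 then have ev1: "\<forall>\<^sub>F n in sequentially. \<bar>u\<bar> * (r * (real n powr (1/4) / rwrs_scale q n)) < \<delta>"
  using \<delta>(1) by (simp add: order_tendstoD(2))
 have p0: "(%n. wprob n p {xs. \<not> spread n xs}) ----> 0"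
 proof -
  have up: "\<forall>\<^sub>F n in sequentially. wprob n p {xs. \<not> spread n xs} <= real n powr 1 * wprob n p {xs. \<not> spread n xs}"
   using eventually_ge_at_top[of 1] by eventually_elim (simp add: mult_le_cancel_right1)
  have lim: "(%n. real n powr 1 * wprob n p {xs. \<not> spread n xs}) ----> 0"
   by (rule prob_not_spread) simp
  show ?thesis by (rule tendsto_sandwich[OF _ up tendsto_const lim]) simp
 qed
 have "(%n. P * EE n (%xs. \<bar>w n xs - \<kappa>\<bar>) + \<eta> * U * \<kappa> + 2 * wprob n p {xs. \<not> spread n xs}) ----> P * 0 + \<eta> * U * \<kappa> + 2 * 0"
  unfolding w_def by (intro tendsto_intros Vpow_limit p0)
 then have ev2: "\<forall>\<^sub>F n in sequentially. P * EE n (%xs. \<bar>w n xs - \<kappa>\<bar>) + \<eta> * U * \<kappa> + 2 * wprob n p {xs. \<not> spread n xs} < \<epsilon>"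
  using \<eta>U by (simp add: order_tendstoD(2))
 have "\<forall>\<^sub>F n in sequentially. dev n u < \<epsilon>"
  using ev1 ev2 eventually_ge_at_top[of 2]
 proof eventually_elim
  case (elim n)
  have n: "n \<ge> 2" by (rule elim(3))
  define B where "B = rwrs_scale q n"
  have B: "B > 0" unfolding B_def by (rule rwrs_scale_pos[OF n])
  have P0: "P \<ge> 0" using \<eta> U0 by (simp add: P_def)
  have "dev n u <= EE n (%xs. P * \<bar>w n xs - \<kappa>\<bar> + \<eta> * U * \<kappa> + 2 * (if \<not> spread n xs then 1 else 0))"
  proof (rule expectation_pmf_mono)
   show "integrable (replicate_pmf n p) (%xs. P * \<bar>w n xs - \<kappa>\<bar> + \<eta> * U * \<kappa> + 2 * (if \<not> spread n xs then 1 else 0))"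
   proof -
    have "integrable (replicate_pmf n p) (%xs. if \<not> spread n xs then 1 else 0 :: real)" by (intro integrable_pmf_bounded[where c=1]) auto
    then show ?thesis using iw[of n] by simp
   qed
   fix xs
   show "cmod (charprod xs (u / rwrs_scale q n) - limit_char u) <= P * \<bar>w n xs - \<kappa>\<bar> + \<eta> * U * \<kappa> + 2 * (if \<not> spread n xs then 1 else 0)"
   proof (cases "spread n xs")
    case True
    have "\<bar>u\<bar> / rwrs_scale q n * real (cnt xs y) < \<delta>" for y
    proof -
     have "\<bar>u\<bar> / B * real (cnt xs y) <= \<bar>u\<bar> / B * (r * real n powr (1/4))"
      using True B unfolding spread_def by (intro mult_left_mono) auto
     also have "... = \<bar>u\<bar> * (r * (real n powr (1/4) / B))" by simp
     also have "... < \<delta>" using elim(1) unfolding B_def .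
     finally show ?thesis unfolding B_def .
    qed
    from charprod_limit_diff[OF \<delta>(2) _ n this] \<eta> True
    show ?thesis unfolding P_def U_def w_def by (simp add: algebra_simps)
   next
    case False
    have "0 <= P * \<bar>w n xs - \<kappa>\<bar> + \<eta> * U * \<kappa>" using P0 \<eta> U0 \<kappa> by simp
    then show ?thesis using charprod_diff_le_2[of xs "u / rwrs_scale q n" u] False by simp
   qed
  qed (rule integrable_charprod_diff)
  also have "... = P * EE n (%xs. \<bar>w n xs - \<kappa>\<bar>) + \<eta> * U * \<kappa> + 2 * wprob n p {xs. \<not> spread n xs}"
  proof -
   have i2: "integrable (replicate_pmf n p) (%xs. if \<not> spread n xs then 1 else 0 :: real)" by (intro integrable_pmf_bounded[where c=1]) auto
   show ?thesis unfolding prob_eq_expectation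
    using iw[of n] i2 by (subst Bochner_Integration.integral_add | simp)+
  qed
  finally show ?case using elim(2) by simp
 qed
 then show "\<exists>no. \<forall>n\<ge>no. norm (dev n u - 0) < \<epsilon>"
  using dev_nonneg by (simp add: eventually_sequentially)
qed

section \<open>Frequencies away from the origin, and domination near it\<close>

lemma cmod_periodic: "cmod (\<phi> (u + of_int k * (2 * r))) = cmod (\<phi> u)"
proof (induction k rule: int_induct[where k=0])
 case (step1 i)
 then show ?case using \<phi>_periodic[of "u + of_int i * (2 * r)"] by (simp add: algebra_simps)
next
 case (step2 i)
 then show ?case using \<phi>_periodic[of "u + of_int (i - 1) * (2 * r)"] by (simp add: algebra_simps)
qed simp

text \<open>Reduce v modulo the period to v0 in [- r, r). If |v0| < |t| / 2, then v0 + t, brought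
  back by at most one period, has modulus at least |t| / 2, as |t| \<le> r. So one of the two points
  is away from the maxima of |\<phi>|.\<close>

lemma consecutive_values:
 assumes t: "\<bar>t\<bar> <= r"
 shows "cmod (\<phi> v) <= exp (- (c * (\<bar>t\<bar> / 2) powr q)) \<or> cmod (\<phi> (v + t)) <= exp (- (c * (\<bar>t\<bar> / 2) powr q))"
proof -
 define k where "k = \<lfloor>(v + r) / (2 * r)\<rfloor>"
 define v0 where "v0 = v - of_int k * (2 * r)"
 have "of_int k <= (v + r) / (2 * r)" "(v + r) / (2 * r) < of_int k + 1" unfolding k_def by linarith+
 then have "of_int k * (2 * r) <= v + r" "v + r < (of_int k + 1) * (2 * r)" using r by (simp_all add: field_simps)
 then have v0: "- r <= v0" "v0 < r" unfolding v0_def by (simp_all add: algebra_simps)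
 have e1: "cmod (\<phi> v) = cmod (\<phi> v0)" using cmod_periodic[of v0 k] by (simp add: v0_def)
 have e2: "cmod (\<phi> (v + t)) = cmod (\<phi> (v0 + t + of_int l * (2 * r)))" for l
 proof -
  have vt: "v + t = (v0 + t + of_int l * (2 * r)) + of_int (k - l) * (2 * r)" by (simp add: v0_def algebra_simps)
  show ?thesis unfolding vt by (rule cmod_periodic)
 qed
 have bnd: "cmod (\<phi> x) <= exp (- (c * (\<bar>t\<bar> / 2) powr q))" if "\<bar>x\<bar> <= r" "\<bar>t\<bar> / 2 <= \<bar>x\<bar>" for x
 proof -
  have "(\<bar>t\<bar> / 2) powr q <= \<bar>x\<bar> powr q" using that q by (intro powr_mono2) auto
  then have "exp (- (c * \<bar>x\<bar> powr q)) <= exp (- (c * (\<bar>t\<bar> / 2) powr q))" using c by simp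
  then show ?thesis using \<phi>_decay[OF that(1)] by linarith
 qed
 consider "\<bar>t\<bar> / 2 <= \<bar>v0\<bar>" | "\<bar>v0\<bar> < \<bar>t\<bar> / 2" "\<bar>v0 + t\<bar> <= r" | "\<bar>v0\<bar> < \<bar>t\<bar> / 2" "v0 + t > r" | "\<bar>v0\<bar> < \<bar>t\<bar> / 2" "v0 + t < - r"
  by linarith
 then show ?thesis
 proof cases
  case 1
  then show ?thesis unfolding e1 using v0 by (intro disjI1 bnd) auto
 next
  case 2
  then show ?thesis unfolding e2[of 0] by (intro disjI2 bnd) (auto simp: abs_if split: if_splits)
 next
  case 3
  then show ?thesis unfolding e2[of "- 1"] using t r by (intro disjI2 bnd) (auto simp: abs_if split: if_splits)
 next
  case 4
  then show ?thesis unfolding e2[of 1] using t r by (intro disjI2 bnd) (auto simp: abs_if split: if_splits)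
 qed
qed

lemma norm_charprod_eq_Wprod: "cmod (charprod xs t) = Wprod (%k. cmod (\<phi> (t * real k))) xs"
 by (simp add: charprod_def Wprod_def prod_norm)

text \<open>Two consecutive values of the weight average to at most 1 - c' * n powr (- 1/2), because
  |t| powr q is at least n powr (- q / 4) and q \<le> 2; the swapping estimate then applies
  uniformly in t.\<close>

lemma charprod_far:
 assumes e: "e > 0"
 shows "\<forall>\<^sub>F n in sequentially. \<forall>t. real n powr (- (1/4)) <= \<bar>t\<bar> \<and> \<bar>t\<bar> <= r --> EE n (%xs. cmod (charprod xs t)) <= real n powr (- e)"
proof -
 \<comment> \<open>Of the 16, a factor 4 comes from 2 powr q \<le> 4, a factor 2 from exp (- y)
   \<le> 1 - y / 2, and a factor 2 from averaging with the trivial bound 1. The minimum with 1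
   ensures y \<le> 1.\<close>
 define c' where "c' = min 1 c / 16"
 have c': "c' > 0" using c by (simp add: c'_def)
 show ?thesis
  using Wprod_superpoly[OF two_points c' e zero_less_one] eventually_ge_at_top[of 1]
 proof eventually_elim
  case (elim n)
  show ?case
  proof (intro allI impI)
   fix t assume t: "real n powr (- (1/4)) <= \<bar>t\<bar> \<and> \<bar>t\<bar> <= r"
   define g where "g k = cmod (\<phi> (t * real k))" for k
   define y where "y = min 1 c / 4 * real n powr (- 1 / 2)"
   have n1: "real n powr (- 1 / 2) <= 1" using elim(2) powr_mono[of "- 1 / 2" 0 "real n"] by simp
   have "min 1 c / 4 * real n powr (- 1 / 2) <= 1 / 4 * 1" using n1 c by (intro mult_mono) auto
   then have y: "0 <= y" "y <= 1" using c by (auto simp: y_def)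
   have yx: "y <= c * (\<bar>t\<bar> / 2) powr q"
   proof -
    have "real n powr (- 1 / 2) <= real n powr (- (1/4) * q)" using elim(2) q by (intro powr_mono) auto
    also have "... = (real n powr (- (1/4))) powr q" by (simp only: powr_powr)
    also have "... <= \<bar>t\<bar> powr q" using t q by (intro powr_mono2) auto
    finally have 1: "real n powr (- 1 / 2) <= \<bar>t\<bar> powr q" .
    have "(2::real) powr q <= 2 powr 2" using q by (intro powr_mono) auto
    then have 2: "1 / 4 <= 1 / (2::real) powr q" by (simp add: field_simps)
    have "y <= c * (1 / 4) * \<bar>t\<bar> powr q" unfolding y_def using 1 c by (intro mult_mono) auto
    also have "... <= c * (1 / 2 powr q) * \<bar>t\<bar> powr q" using 2 c by (intro mult_right_mono mult_left_mono) auto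
    also have "... = c * (\<bar>t\<bar> / 2) powr q" by (simp add: powr_divide)
    finally show ?thesis .
   qed
   have ey: "exp (- y) <= 1 - y / 2"
   proof -
    have "1 <= (1 - y / 2) * (1 + y)" using y mult_nonneg_nonneg[of y "1 - y"] by (simp add: algebra_simps)
    also have "... <= (1 - y / 2) * exp y" using y exp_ge_add_one_self[of y] by (intro mult_left_mono) auto
    finally show ?thesis by (simp add: exp_minus field_simps)
   qed
   have half: "(g k + g (Suc k)) / 2 <= 1 - c' * real n powr (- 1 / 2)" for k
   proof -
    have "exp (- (c * (\<bar>t\<bar> / 2) powr q)) <= 1 - y / 2" using yx ey by (smt (verit) exp_le_cancel_iff)
    moreover have "t * real (Suc k) = t * real k + t" by (simp add: algebra_simps)
    ultimately have "g k <= 1 - y / 2 \<or> g (Suc k) <= 1 - y / 2"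
     using consecutive_values[of t "t * real k"] t unfolding g_def by force
    moreover have "g k <= 1" "g (Suc k) <= 1" unfolding g_def by (rule \<phi>_le)+
    ultimately have "(g k + g (Suc k)) / 2 <= 1 - y / 4"
    proof -
     assume a: "g k <= 1 - y / 2 \<or> g (Suc k) <= 1 - y / 2" "g k <= 1" "g (Suc k) <= 1"
     have "g k + g (Suc k) <= 2 - y / 2" using a by auto
     then show ?thesis by (simp add: field_simps)
    qed
    then show ?thesis by (simp add: c'_def y_def)
   qed
   have "(\<forall>k. 0 <= g k \<and> g k <= 1) \<and> g 0 = 1 \<and> (\<forall>k. (g k + g (Suc k)) / 2 <= 1 - c' * real n powr (- 1 / 2))"
    using half \<phi>_le \<phi>_0 by (simp add: g_def)
   then have "real n powr e * EE n (Wprod g) <= 1" using elim(1) by blast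
   then have "EE n (Wprod g) <= real n powr (- e)" using elim(2) by (simp add: powr_minus field_simps)
   then show "EE n (%xs. cmod (charprod xs t)) <= real n powr (- e)"
    unfolding norm_charprod_eq_Wprod g_def .
  qed
 qed
qed

lemma integrable_moment:
 assumes "n \<ge> 2"
 shows "integrable (replicate_pmf n p) (%xs. (nlog q n / Vpow q xs) powr (2 / q))"
proof (rule integrable_pmf_bounded[where c="(nlog q n) powr (2 / q)"])
 fix xs assume "xs \<in> set_pmf (replicate_pmf n p)"
 then have "length xs = n" by (rule length_replicate_pmf)
 then have "xs \<noteq> []" using assms by auto
 then have V: "Vpow q xs \<ge> 1" using q by (intro Vpow_ge_1) auto
 have "nlog q n / Vpow q xs <= nlog q n / 1"
  using V by (intro divide_left_mono) auto
 then have "(nlog q n / Vpow q xs) powr (2 / q) <= (nlog q n) powr (2 / q)"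
  using V q by (intro powr_mono2) auto
 then show "norm ((nlog q n / Vpow q xs) powr (2 / q)) <= (nlog q n) powr (2 / q)"
  by simp
qed

text \<open>Each spread path has the majorant of \<open>exp_powr_decay\<close> with a = c * V / b
  powr q; after averaging, the inverse moment makes it uniform in n.\<close>

lemma charprod_near:
 assumes n: "n \<ge> 2" and t: "\<bar>u\<bar> / rwrs_scale q n <= real n powr (- (1/4))"
  and mom: "EE n (%xs. (nlog q n / Vpow q xs) powr (2 / q)) <= K"
 shows "EE n (%xs. cmod (charprod xs (u / rwrs_scale q n))) \<le>
  (1 + (2 / (q * c)) powr (2 / q) * K) * inverse (1 + u\<^sup>2) + wprob n p {xs. \<not> spread n xs}"
proof -
 define B where "B = rwrs_scale q n"
 have B: "B > 0" unfolding B_def by (rule rwrs_scale_pos[OF n])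
 have Bb: "B powr q = real n * ln (real n) powr (q - 1)" unfolding B_def by (rule rwrs_scale_powr[OF n])
 define m where "m xs = (B powr q / Vpow q xs) powr (2 / q)" for xs :: "'a list"
 have im: "integrable (replicate_pmf n p) m" unfolding m_def Bb by (rule integrable_moment[OF n])
 have Em: "EE n m <= K" using mom unfolding m_def Bb .
 define J where "J = (2 / (q * c)) powr (2 / q)"
 have J0: "J \<ge> 0" by (simp add: J_def)
 define v where "v = inverse (1 + u\<^sup>2)"
 have v0: "v \<ge> 0" by (simp add: v_def add_nonneg_nonneg)
 have isp: "integrable (replicate_pmf n p) (%xs. if \<not> spread n xs then 1 else 0 :: real)" by (intro integrable_pmf_bounded[where c=1]) auto
 have "EE n (%xs. cmod (charprod xs (u / B))) <= EE n (%xs. (1 + J * m xs) * v + (if \<not> spread n xs then 1 else 0))"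
 proof (rule expectation_pmf_mono)
  show "integrable (replicate_pmf n p) (%xs. cmod (charprod xs (u / B)))"
   by (rule integrable_pmf_bounded[where c=1]) (use norm_charprod_le in auto)
  show "integrable (replicate_pmf n p) (%xs. (1 + J * m xs) * v + (if \<not> spread n xs then 1 else 0))"
   using isp im by (intro Bochner_Integration.integrable_add integrable_mult_left integrable_mult_right) auto
  fix xs assume "xs \<in> set_pmf (replicate_pmf n p)"
  then have "length xs = n" by (rule length_replicate_pmf)
  then have "xs \<noteq> []" using n by auto
  then have V: "Vpow q xs \<ge> 1" using q by (intro Vpow_ge_1) auto
  show "cmod (charprod xs (u / B)) <= (1 + J * m xs) * v + (if \<not> spread n xs then 1 else 0)"
  proof (cases "spread n xs")
   case True
   have "\<bar>u / B\<bar> * real (cnt xs y) <= r" for y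
   proof -
    have "\<bar>u / B\<bar> * real (cnt xs y) <= real n powr (- (1/4)) * (r * real n powr (1/4))"
     using True t B unfolding spread_def B_def[symmetric] by (intro mult_mono) auto
    also have "... = r * (real n powr (- (1/4)) * real n powr (1/4))" by simp
    also have "... = r" unfolding powr_add[symmetric] using n by simp
    finally show ?thesis .
   qed
   from charprod_bound[OF this]
   have "cmod (charprod xs (u / B)) <= exp (- (c * \<bar>u / B\<bar> powr q * Vpow q xs))" .
   also have "c * \<bar>u / B\<bar> powr q * Vpow q xs = (c * (Vpow q xs / B powr q)) * \<bar>u\<bar> powr q"
    using B by (simp add: powr_divide abs_divide)
   also have "exp (- ((c * (Vpow q xs / B powr q)) * \<bar>u\<bar> powr q)) \<le>
     (1 + (2 / (q * (c * (Vpow q xs / B powr q)))) powr (2 / q)) * inverse (1 + u\<^sup>2)"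
    using c V B q by (intro exp_powr_decay) auto
   also have "(2 / (q * (c * (Vpow q xs / B powr q)))) powr (2 / q) = J * m xs"
   proof -
    have "2 / (q * (c * (Vpow q xs / B powr q))) = (2 / (q * c)) * (B powr q / Vpow q xs)" by simp
    then show ?thesis unfolding J_def m_def using c q V by (simp only:) (subst powr_mult, auto)
   qed
   finally show ?thesis using True by (simp add: v_def)
  next
   case False
   have "0 <= (1 + J * m xs) * v" using J0 v0 by (simp add: m_def)
   then show ?thesis using False norm_charprod_le[of xs "u / B"] by simp
  qed
 qed
 also have "... = (1 + J * EE n m) * v + wprob n p {xs. \<not> spread n xs}"
  unfolding prob_eq_expectation using im isp by simp
 also have "... <= (1 + J * K) * v + wprob n p {xs. \<not> spread n xs}"
  using Em J0 v0 by (intro add_right_mono mult_right_mono add_left_mono mult_left_mono) auto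
 finally show ?thesis unfolding B_def J_def v_def .
qed

text \<open>One summand for the product at low frequencies, one for the limit;
  \<open>max K 0\<close> keeps it nonnegative for every K.\<close>

definition envelope :: real where
 "envelope = (1 + (2 / (q * c)) powr (2 / q) * max K 0) + (1 + (2 / (q * (\<kappa> * A1))) powr (2 / q))"

lemma dev_dominated:
 "\<forall>\<^sub>F n in sequentially. \<forall>u. \<bar>u\<bar> <= r * rwrs_scale q n -->
   dev n u <= envelope * inverse (1 + u\<^sup>2) + real n powr (- (1 / q + 2))"
proof -
 \<comment> \<open>The remainder n powr (- e) is later integrated over a window of length
   proportional to the scale, n powr (1 / q) up to logarithms; the extra 2 makes the product
   vanish.\<close>
 define e where "e = 1 / q + 2"
 have e: "e > 0" using q by (simp add: e_def add_pos_pos)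
 have "\<forall>\<^sub>F n in sequentially. real n powr e * wprob n p {xs. \<not> spread n xs} < 1"
  using prob_not_spread[OF e] by (simp add: order_tendstoD(2))
 with charprod_far[OF e] Vpow_moment eventually_ge_at_top[of 2] show ?thesis
  unfolding e_def[symmetric]
 proof eventually_elim
  case (elim n)
  define B where "B = rwrs_scale q n"
  have B: "B > 0" unfolding B_def by (rule rwrs_scale_pos[OF elim(3)])
  have ps: "wprob n p {xs. \<not> spread n xs} <= real n powr (- e)"
   using elim(3,4) by (simp add: powr_minus field_simps)
  show ?case
  proof (intro allI impI)
   fix u assume u: "\<bar>u\<bar> <= r * rwrs_scale q n"
   define v where "v = inverse (1 + u\<^sup>2)"
   have v0: "v \<ge> 0" by (simp add: v_def add_nonneg_nonneg)
   have lim: "cmod (limit_char u) <= (1 + (2 / (q * (\<kappa> * A1))) powr (2 / q)) * v"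
    unfolding norm_limit_char v_def using \<kappa> A1 q by (intro exp_powr_decay) auto
   have ch: "EE n (%xs. cmod (charprod xs (u / B))) <= (1 + (2 / (q * c)) powr (2 / q) * max K 0) * v + real n powr (- e)"
   proof (cases "\<bar>u\<bar> / B <= real n powr (- (1/4))")
    case True
    have "EE n (%xs. cmod (charprod xs (u / B))) \<le>
     (1 + (2 / (q * c)) powr (2 / q) * K) * v + wprob n p {xs. \<not> spread n xs}"
     using charprod_near[OF elim(3) True[unfolded B_def] elim(2)] unfolding B_def v_def .
    also have "... <= (1 + (2 / (q * c)) powr (2 / q) * max K 0) * v + real n powr (- e)"
     using ps v0 by (intro add_mono mult_right_mono mult_left_mono) auto
    finally show ?thesis .
   next
    case False
    have "\<bar>u / B\<bar> <= r" using u B by (simp add: B_def[symmetric] field_simps)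
    then have "EE n (%xs. cmod (charprod xs (u / B))) <= real n powr (- e)"
     using elim(1) False B by (simp add: abs_divide)
    moreover have "0 <= (1 + (2 / (q * c)) powr (2 / q) * max K 0) * v" using v0 by simp
    ultimately show ?thesis by linarith
   qed
   have "dev n u <= EE n (%xs. cmod (charprod xs (u / B)) + cmod (limit_char u))"
    unfolding B_def[symmetric]
   proof (rule expectation_pmf_mono)
    show "integrable (replicate_pmf n p) (%xs. cmod (charprod xs (u / B)) + cmod (limit_char u))"
    proof (rule integrable_pmf_bounded[where c=2])
     fix xs
     show "norm (cmod (charprod xs (u / B)) + cmod (limit_char u)) <= 2"
      using norm_charprod_le[of xs "u / B"] norm_limit_char_le[of u] by simp
    qed
   qed (simp_all add: norm_triangle_ineq4 integrable_charprod_diff)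
   also have "... = EE n (%xs. cmod (charprod xs (u / B))) + cmod (limit_char u)"
    by (subst Bochner_Integration.integral_add) (auto intro!: integrable_pmf_bounded[where c=1] norm_charprod_le)
   also have "... <= envelope * v + real n powr (- e)"
    using ch lim unfolding envelope_def by (simp add: distrib_right)
   finally show "dev n u <= envelope * inverse (1 + u\<^sup>2) + real n powr (- e)" unfolding v_def .
  qed
 qed
qed

lemma dev_measurable: "(%u. dev n u) \<in> borel_measurable borel"
proof -
 \<comment> \<open>\<open>pmf_Fubini\<close> asks for a finite measure; this one is chosen for its
   Borel sigma-algebra.\<close>
 have fin: "finite_measure (return borel (0::real))" by (rule prob_space.axioms(1)[OF prob_space_return]) simp
 have "(%u. dev n u) \<in> borel_measurable (return borel (0::real))"
 proof (rule pmf_Fubini(2)[OF fin, where c=2])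
  fix xs
  show "(%u. cmod (charprod xs (u / rwrs_scale q n) - limit_char u)) \<in> borel_measurable (return borel (0::real))"
  proof -
   have "continuous_on UNIV (%u. charprod xs (u / rwrs_scale q n))"
    unfolding divide_inverse by (intro continuous_on_compose2[OF continuous_charprod] continuous_intros) auto
   then have "continuous_on UNIV (%u. cmod (charprod xs (u / rwrs_scale q n) - limit_char u))"
    by (intro continuous_intros continuous_limit_char)
   then have "(%u. cmod (charprod xs (u / rwrs_scale q n) - limit_char u)) \<in> borel_measurable borel"
    by (rule borel_measurable_continuous_onI)
   then show ?thesis by (simp cong: measurable_cong_sets)
  qed
 qed (use charprod_diff_le_2 in auto)
 then show ?thesis by simp
qed

theorem dev_integral_tendsto_0:
 "(%n. \<integral>u. indicator {- (r * rwrs_scale q n)..r * rwrs_scale q n} u * dev n u \<partial>lborel) ----> 0"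
proof -
 define B where "B n = r * rwrs_scale q n" for n
 define I where "I n u = (indicator {- B n..B n} u :: real)" for n u
 define \<epsilon> where "\<epsilon> n = real n powr (- (1 / q + 2))" for n :: nat
 \<comment> \<open>The part of \<open>dev\<close> on the window that exceeds the remainder
   \<epsilon> n. It has a fixed integrable majorant, whereas the remainder is controlled only
   through its integral over the growing window.\<close>
 define h where "h n u = max 0 (I n u * dev n u - I n u * \<epsilon> n)" for n u
 have [measurable]: "(%u. dev n u) \<in> borel_measurable borel" for n by (rule dev_measurable)
 have [measurable]: "I n \<in> borel_measurable borel" for n unfolding I_def[abs_def] by measurable
 have \<epsilon>0: "\<epsilon> n \<ge> 0" for n by (simp add: \<epsilon>_def)
 have hm: "h n \<in> borel_measurable lborel" for n unfolding h_def[abs_def] by measurable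
 have I: "I n u = 0 \<or> I n u = 1" for n u by (simp add: I_def indicator_def)
 have iI: "integrable lborel (I n)" for n unfolding I_def[abs_def] by (intro integrable_real_indicator) (auto simp: emeasure_lborel_Icc_eq)
 have dev2: "dev n u <= 2" for n u
 proof -
  have "dev n u <= EE n (%_. 2)" by (rule expectation_pmf_mono[OF integrable_charprod_diff]) (use charprod_diff_le_2 in auto)
  then show ?thesis by simp
 qed
 have iId: "integrable lborel (%u. I n u * dev n u)" for n
 proof (rule Bochner_Integration.integrable_bound[where f="%u. 2 * I n u"])
  show "AE u in lborel. norm (I n u * dev n u) <= norm (2 * I n u)"
  proof (rule AE_I2)
   fix u
   show "norm (I n u * dev n u) <= norm (2 * I n u)"
    using dev2[of n u] dev_nonneg[of n u] I[of n u] by (elim disjE) simp_all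
  qed
 qed (use iI in auto)
 obtain n0 where n0: "\<And>n u. n \<ge> n0 ==> \<bar>u\<bar> <= B n ==> dev n u <= envelope * inverse (1 + u\<^sup>2) + \<epsilon> n"
  using dev_dominated unfolding eventually_sequentially B_def \<epsilon>_def by blast
 have env0: "0 <= envelope * inverse (1 + u\<^sup>2)" for u :: real
  unfolding envelope_def by (intro mult_nonneg_nonneg add_nonneg_nonneg) (auto simp: add_nonneg_nonneg)
 have h0: "0 <= h n u" for n u by (simp add: h_def)
 have hle: "h n u <= envelope * inverse (1 + u\<^sup>2)" if "n \<ge> n0" for n u
  using n0[OF that, of u] env0[of u] by (auto simp: h_def I_def indicator_def abs_le_iff)
 have hdev: "h n u <= dev n u" for n u
  using I[of n u] dev_nonneg[of n u] \<epsilon>0[of n] by (auto simp: h_def)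
 \<comment> \<open>Domination holds from n0 on, hence the shift.\<close>
 have "(%n. \<integral>u. h (n + n0) u \<partial>lborel) ----> (\<integral>u. 0 \<partial>(lborel :: real measure))"
 proof (rule integral_dominated_convergence[where w="%u. envelope * inverse (1 + u\<^sup>2)"])
  show "integrable lborel (%u::real. envelope * inverse (1 + u\<^sup>2))"
   by (intro integrable_mult_right integrable_inverse_1_plus_square_lborel)
  show "AE u in lborel. (%n. h (n + n0) u) ----> 0"
  proof (rule AE_I2)
   fix u
   have "(%n. h n u) ----> 0"
    by (rule tendsto_sandwich[OF _ _ tendsto_const dev_tendsto_0[of u]]) (use h0 hdev in auto)
   then show "(%n. h (n + n0) u) ----> 0" by (rule LIMSEQ_ignore_initial_segment)
  qed
  show "AE u in lborel. norm (h (n + n0) u) <= envelope * inverse (1 + u\<^sup>2)" for n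
   using hle[of "n + n0"] h0 by (intro AE_I2) simp
 qed (use hm in auto)
 then have lim: "(%n. \<integral>u. h n u \<partial>lborel) ----> 0" by (simp add: LIMSEQ_offset)
 have ih: "integrable lborel (h n)" for n
 proof (rule Bochner_Integration.integrable_bound[OF iId])
  show "AE u in lborel. norm (h n u) <= norm (I n u * dev n u)"
   using I[of n] dev_nonneg[of n] \<epsilon>0[of n] by (intro AE_I2) (auto simp: h_def I_def indicator_def)
 qed (rule hm)
 have le: "(\<integral>u. I n u * dev n u \<partial>lborel) <= (\<integral>u. h n u + \<epsilon> n * I n u \<partial>lborel)" for n
  by (rule integral_mono) (use iId ih iI in \<open>auto simp: h_def mult.commute\<close>)
 have eq: "(\<integral>u. h n u + \<epsilon> n * I n u \<partial>lborel) = (\<integral>u. h n u \<partial>lborel) + \<epsilon> n * (\<integral>u. I n u \<partial>lborel)" for n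
  using ih iI by simp
 have len: "(\<integral>u. I n u \<partial>lborel) = 2 * B n" if "n \<ge> 2" for n
 proof -
  have "B n \<ge> 0" using r rwrs_scale_pos[OF that] by (simp add: B_def)
  then show ?thesis unfolding I_def[abs_def] by simp
 qed
 have up: "\<forall>\<^sub>F n in sequentially. (\<integral>u. I n u * dev n u \<partial>lborel) <= (\<integral>u. h n u \<partial>lborel) + 2 * r * (rwrs_scale q n * \<epsilon> n)"
  using eventually_ge_at_top[of 2]
 proof eventually_elim
  case (elim n)
  have "\<epsilon> n * (2 * B n) = 2 * r * (rwrs_scale q n * \<epsilon> n)" by (simp add: B_def)
  then show ?case using le[of n] unfolding eq[of n] len[OF elim] by linarith
 qed
 have "(%n. (\<integral>u. h n u \<partial>lborel) + 2 * r * (rwrs_scale q n * \<epsilon> n)) ----> 0 + 2 * r * 0"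
  unfolding \<epsilon>_def by (intro tendsto_intros lim scale_times_power)
 then have lim2: "(%n. (\<integral>u. h n u \<partial>lborel) + 2 * r * (rwrs_scale q n * \<epsilon> n)) ----> 0" by simp
 have lo: "\<forall>\<^sub>F n in sequentially. 0 <= (\<integral>u. I n u * dev n u \<partial>lborel)"
  using dev_nonneg by (intro always_eventually allI Bochner_Integration.integral_nonneg) (simp add: I_def)
 show ?thesis using tendsto_sandwich[OF lo up tendsto_const lim2] unfolding I_def B_def .
qed

end

section \<open>Inverse moments of the power sums\<close>

lemma interpolate_first_power:
 fixes x T s q :: real
 assumes "x > 0" "T > 0" "s <= 1" "1 <= q"
 shows "x <= T powr (1 - s) * x powr s + T powr (1 - q) * x powr q"
proof (cases "x <= T")
 case True
 have "x = x powr (1 - s) * x powr s" using assms by (simp add: powr_add[symmetric])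
 also have "... <= T powr (1 - s) * x powr s" using True assms by (intro mult_right_mono powr_mono2) auto
 finally show ?thesis by (smt (verit) mult_nonneg_nonneg powr_ge_zero)
next
 case False
 have "x = x powr (1 - q) * x powr q" using assms by (simp add: powr_add[symmetric])
 also have "... <= T powr (1 - q) * x powr q" using False assms by (intro mult_right_mono powr_mono2') auto
 finally show ?thesis by (smt (verit) mult_nonneg_nonneg powr_ge_zero)
qed

text \<open>The visit counts sum to the length; their first power is interpolated between the powers
  s and q, split at T. As T is free, this bounds one power sum from below in terms of the
  other.\<close>

lemma length_le_Vpow:
 assumes "T > 0" "s <= 1" "1 <= q"
 shows "real (length xs) <= T powr (1 - s) * Vpow s xs + T powr (1 - q) * Vpow q xs"
proof -
 have "real (length xs) = (\<Sum>y\<in>set (sites xs). real (cnt xs y))" by (simp flip: sum_cnt of_nat_sum)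
 also have "... <= (\<Sum>y\<in>set (sites xs). T powr (1 - s) * real (cnt xs y) powr s + T powr (1 - q) * real (cnt xs y) powr q)"
  by (intro sum_mono interpolate_first_power) (use assms cnt_pos_iff in auto)
 also have "... = T powr (1 - s) * Vpow s xs + T powr (1 - q) * Vpow q xs"
  by (simp add: Vsum_def sum.distrib sum_distrib_left)
 finally show ?thesis .
qed

lemma Vpow_0: "Vpow 0 xs = range_card xs"
 unfolding Vsum_def range_card_def using cnt_pos_iff by (subst sum.cong[OF refl, of _ _ "%_. 1"]) auto

lemma Vpow_1: "Vpow 1 xs = real (length xs)"
 unfolding Vsum_def by (simp flip: sum_cnt of_nat_sum)

lemma powr_le_1_plus: "0 <= x ==> 0 <= a ==> a <= 1 ==> x powr a <= 1 + (x::real)"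
 by (smt (verit) one_le_numeral powr_le_one_le powr_mono powr_one powr_le1 powr_mono2 powr_one_eq_one)

context log_green_walk begin

text \<open>Interpolation between the range R (power 0) and \<beta>. With T = n / (2 * R) the range
  accounts for half of n, so V is at least of order n * (n / R) powr (\<beta> - 1). The resulting
  exponent (\<beta> - 1) * 2 / \<beta> of R * ln n / n is at most 1 as \<beta> \<le> 2, so the mean
  range suffices.\<close>

lemma Vpow_inverse_bound_gt_1:
 assumes b: "1 < \<beta>" "\<beta> <= 2" and xs: "length xs = n" and n: "n \<ge> 2"
 shows "(nlog \<beta> n / Vpow \<beta> xs) powr (2 / \<beta>) \<le>
  2 powr (2 / \<beta>) * (1 + 2 * (range_card xs * ln (real n) / real n))"
proof -
 define L where "L = ln (real n)"
 have L: "L > 0" using n by (simp add: L_def)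
 have ne: "xs \<noteq> []" using xs n by auto
 define R where "R = range_card xs"
 have R: "R \<ge> 1" unfolding R_def Vpow_0[symmetric] using ne by (intro Vpow_ge_1) auto
 have V: "Vpow \<beta> xs \<ge> 1" using ne b by (intro Vpow_ge_1) auto
 define T where "T = real n / (2 * R)"
 have T: "T > 0" using R n by (simp add: T_def)
 have "real n <= T * R + T powr (1 - \<beta>) * Vpow \<beta> xs"
  using length_le_Vpow[of T 0 \<beta> xs] T b unfolding xs Vpow_0 R_def by simp
 moreover have "T * R = real n / 2" using R by (simp add: T_def)
 ultimately have "real n <= 2 * T powr (1 - \<beta>) * Vpow \<beta> xs" by simp
 then have "real n / Vpow \<beta> xs <= 2 * T powr (1 - \<beta>)" using V by (simp add: divide_le_eq)
 then have "real n / Vpow \<beta> xs * L powr (\<beta> - 1) <= 2 * T powr (1 - \<beta>) * L powr (\<beta> - 1)" by (intro mult_right_mono) auto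
 also have "T powr (1 - \<beta>) = (1 / T) powr (\<beta> - 1)"
  using powr_minus[of T "\<beta> - 1"] T by (simp add: powr_divide inverse_eq_divide)
 also have "2 * (1 / T) powr (\<beta> - 1) * L powr (\<beta> - 1) = 2 * (2 * (R * L / real n)) powr (\<beta> - 1)"
  using T L R by (simp add: powr_mult[symmetric] T_def mult.assoc)
 finally have "real n * L powr (\<beta> - 1) / Vpow \<beta> xs <= 2 * (2 * (R * L / real n)) powr (\<beta> - 1)" by simp
 then have "(real n * L powr (\<beta> - 1) / Vpow \<beta> xs) powr (2 / \<beta>) <= (2 * (2 * (R * L / real n)) powr (\<beta> - 1)) powr (2 / \<beta>)"
  using V b by (intro powr_mono2) auto
 also have "... = 2 powr (2 / \<beta>) * (2 * (R * L / real n)) powr ((\<beta> - 1) * (2 / \<beta>))"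
  by (simp only: powr_mult powr_powr)
 also have "... <= 2 powr (2 / \<beta>) * (1 + 2 * (R * L / real n))"
  using b R L by (intro mult_left_mono powr_le_1_plus) (auto simp: field_simps)
 finally show ?thesis unfolding L_def R_def .
qed

text \<open>Interpolation between \<beta> and an exponent q above 1, with T such that the q-term
  accounts for half of n. The value of q is the one that makes the inverse power linear in
  \<open>Vpow q\<close>, whose mean is known.\<close>

lemma Vpow_inverse_bound_lt_1:
 assumes b: "0 < \<beta>" "\<beta> < 1" and xs: "length xs = n" and n: "n \<ge> 2"
 defines "q \<equiv> 1 + 2 * (1 - \<beta>) / \<beta>"
 shows "(nlog \<beta> n / Vpow \<beta> xs) powr (2 / \<beta>) \<le>
  2 powr (2 / \<beta>) * (2 * (Vpow q xs / (nlog q n)))"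
proof -
 define L where "L = ln (real n)"
 have L: "L > 0" using n by (simp add: L_def)
 have ne: "xs \<noteq> []" using xs n by auto
 have q: "q > 1" using b by (simp add: q_def)
 have V: "Vpow \<beta> xs \<ge> 1" "Vpow q xs \<ge> 1" using ne b q by (auto intro!: Vpow_ge_1)
 define T where "T = (2 * Vpow q xs / real n) powr (1 / (q - 1))"
 have base: "2 * Vpow q xs / real n > 0" using V n by simp
 have T: "T > 0" using base unfolding T_def by (simp only: powr_gt_zero)
 have Tq: "T powr (q - 1) = 2 * Vpow q xs / real n"
  unfolding T_def powr_powr using base q Vpow_nonneg[of q xs] by simp
 have "T powr (1 - q) = inverse (T powr (q - 1))" using powr_minus[of T "q - 1"] by simp
 then have "T powr (1 - q) * Vpow q xs = real n / 2" unfolding Tq using V n by (simp add: field_simps)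
 moreover have "real n <= T powr (1 - \<beta>) * Vpow \<beta> xs + T powr (1 - q) * Vpow q xs"
  using length_le_Vpow[of T \<beta> q xs] T b q unfolding xs by simp
 ultimately have "real n <= 2 * T powr (1 - \<beta>) * Vpow \<beta> xs" by simp
 then have "real n / Vpow \<beta> xs <= 2 * T powr (1 - \<beta>)" using V by (simp add: divide_le_eq)
 then have "real n / Vpow \<beta> xs * L powr (\<beta> - 1) <= 2 * T powr (1 - \<beta>) * L powr (\<beta> - 1)" by (intro mult_right_mono) auto
 also have "L powr (\<beta> - 1) = (1 / L) powr (1 - \<beta>)"
  using powr_minus[of L "1 - \<beta>"] L by (simp add: powr_divide inverse_eq_divide)
 also have "2 * T powr (1 - \<beta>) * (1 / L) powr (1 - \<beta>) = 2 * (T / L) powr (1 - \<beta>)"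
  using T L by (simp add: powr_divide)
 finally have "real n * L powr (\<beta> - 1) / Vpow \<beta> xs <= 2 * (T / L) powr (1 - \<beta>)"
  using L powr_minus[of L "1 - \<beta>"] by (simp add: powr_divide inverse_eq_divide mult.commute)
 then have "(real n * L powr (\<beta> - 1) / Vpow \<beta> xs) powr (2 / \<beta>) <= (2 * (T / L) powr (1 - \<beta>)) powr (2 / \<beta>)"
  using V b by (intro powr_mono2) auto
 also have "... = 2 powr (2 / \<beta>) * (T / L) powr ((1 - \<beta>) * (2 / \<beta>))"
  by (simp only: powr_mult powr_powr)
 also have "(1 - \<beta>) * (2 / \<beta>) = q - 1" by (simp add: q_def)
 also have "(T / L) powr (q - 1) = 2 * (Vpow q xs / (real n * L powr (q - 1)))"
  using T L by (simp add: powr_divide Tq)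
 finally show ?thesis unfolding L_def .
qed

theorem Vpow_inverse_moment:
 assumes b: "0 < \<beta>" "\<beta> <= 2" "\<beta> \<noteq> 1"
 shows "\<exists>K. \<forall>\<^sub>F n in sequentially. wmean n p
    (%xs. (nlog \<beta> n / Vpow \<beta> xs) powr (2 / \<beta>)) <= K"
proof (cases "\<beta> < 1")
 case True
 define q where "q = 1 + 2 * (1 - \<beta>) / \<beta>"
 have q: "q > 0" using b True by (simp add: q_def add_pos_nonneg)
 define l where "l = 2 powr (2 / \<beta>) * (2 * (Gamma (q + 1) * lam powr (q - 1)))"
 have "(%n. 2 powr (2 / \<beta>) * (2 * (wmean n p (Vpow q) / (nlog q n)))) ----> l"
  unfolding l_def by (intro tendsto_intros expectation_Vsum_asymp q)
 then have "\<forall>\<^sub>F n in sequentially. 2 powr (2 / \<beta>) * (2 * (wmean n p (Vpow q) / (nlog q n))) < l + 1"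
  by (rule order_tendstoD(2)) simp
 then have "\<forall>\<^sub>F n in sequentially. wmean n p
    (%xs. (nlog \<beta> n / Vpow \<beta> xs) powr (2 / \<beta>)) <= l + 1"
  using eventually_ge_at_top[of 2]
 proof eventually_elim
  case (elim n)
  have i: "integrable (replicate_pmf n p) (%xs. 2 powr (2 / \<beta>) * (2 * (Vpow q xs / (nlog q n))))"
   using q by (intro integrable_mult_right integrable_divide integrable_Vpow) auto
  have "wmean n p (%xs. (nlog \<beta> n / Vpow \<beta> xs) powr (2 / \<beta>)) \<le>
   wmean n p (%xs. 2 powr (2 / \<beta>) * (2 * (Vpow q xs / (nlog q n))))"
  proof (rule integral_mono_AE')
   show "AE xs in replicate_pmf n p. (nlog \<beta> n / Vpow \<beta> xs) powr (2 / \<beta>) \<le>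
    2 powr (2 / \<beta>) * (2 * (Vpow q xs / (nlog q n)))"
    using Vpow_inverse_bound_lt_1[OF b(1) True length_replicate_pmf elim(2)] unfolding q_def
    by (auto simp: AE_measure_pmf_iff)
   show "AE xs in replicate_pmf n p. 0 <= 2 powr (2 / \<beta>) * (2 * (Vpow q xs / (nlog q n)))"
    by (intro AE_I2 mult_nonneg_nonneg divide_nonneg_nonneg Vpow_nonneg) auto
  qed (rule i)
  also have "... = 2 powr (2 / \<beta>) * (2 * (wmean n p (Vpow q) / (nlog q n)))"
   by simp
  finally show ?case using elim(1) by linarith
 qed
 then show ?thesis by blast
next
 case False
 then have b1: "1 < \<beta>" using b by simp
 define l where "l = 2 powr (2 / \<beta>) * (1 + 2 * (1 / lam))"
 have "(%n. 2 powr (2 / \<beta>) * (1 + 2 * ((\<Sum>k<n. esc p k) * ln (real n) / real n))) ----> l"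
  unfolding l_def by (intro tendsto_intros sum_esc_asymp)
 then have "\<forall>\<^sub>F n in sequentially. 2 powr (2 / \<beta>) * (1 + 2 * ((\<Sum>k<n. esc p k) * ln (real n) / real n)) < l + 1"
  by (rule order_tendstoD(2)) simp
 then have "\<forall>\<^sub>F n in sequentially. wmean n p
    (%xs. (nlog \<beta> n / Vpow \<beta> xs) powr (2 / \<beta>)) <= l + 1"
  using eventually_ge_at_top[of 2]
 proof eventually_elim
  case (elim n)
  have ir: "integrable (replicate_pmf n p) range_card"
   by (rule integrable_replicateI[where c="real n"]) (metis range_card_nonneg range_card_le abs_of_nonneg real_norm_def)
  have i: "integrable (replicate_pmf n p) (%xs. 2 powr (2 / \<beta>) * (1 + 2 * (range_card xs * ln (real n) / real n)))"
   using ir by (intro integrable_mult_right Bochner_Integration.integrable_add integrable_divide integrable_mult_left) auto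
  have "wmean n p (%xs. (nlog \<beta> n / Vpow \<beta> xs) powr (2 / \<beta>)) \<le>
   wmean n p (%xs. 2 powr (2 / \<beta>) * (1 + 2 * (range_card xs * ln (real n) / real n)))"
  proof (rule integral_mono_AE')
   show "AE xs in replicate_pmf n p. (nlog \<beta> n / Vpow \<beta> xs) powr (2 / \<beta>) \<le>
    2 powr (2 / \<beta>) * (1 + 2 * (range_card xs * ln (real n) / real n))"
    using Vpow_inverse_bound_gt_1[OF b1 b(2) length_replicate_pmf elim(2)]
    by (auto simp: AE_measure_pmf_iff)
   show "AE xs in replicate_pmf n p. 0 <= 2 powr (2 / \<beta>) * (1 + 2 * (range_card xs * ln (real n) / real n))"
    using elim(2) by (intro AE_I2 mult_nonneg_nonneg add_nonneg_nonneg divide_nonneg_nonneg range_card_nonneg) auto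
  qed (rule i)
  also have "... = 2 powr (2 / \<beta>) * (1 + 2 * ((\<Sum>k<n. esc p k) * ln (real n) / real n))"
   using ir by (simp add: expectation_range_card)
  finally show ?case using elim(1) by linarith
 qed
 then show ?thesis by blast
qed

end

lemma char_normalized_sum:
 fixes c t :: real and n :: nat
 assumes \<mu>: "real_distribution \<mu>"
 defines "\<nu> \<equiv> distr (\<Pi>\<^sub>M k\<in>{..<n}. \<mu>) borel (%x. c * (\<Sum>k<n. x k))"
 shows "real_distribution \<nu>" "char \<nu> t = char \<mu> (c * t) ^ n"
proof -
 interpret \<mu>: real_distribution \<mu> by fact
 interpret P: product_prob_space "%_::nat. \<mu>" "{..<n}" by unfold_locales
 have m [measurable]: "(%x. c * (\<Sum>k<n. x k)) \<in> borel_measurable (\<Pi>\<^sub>M k\<in>{..<n}. \<mu>)"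
  by (intro borel_measurable_times borel_measurable_const borel_measurable_sum) (simp cong: measurable_cong_sets)
 show "real_distribution \<nu>" unfolding \<nu>_def by (rule P.P.real_distribution_distr) (rule m)
 have "char \<nu> t = (\<integral>x. (\<Prod>k<n. iexp (c * t * x k)) \<partial>(\<Pi>\<^sub>M k\<in>{..<n}. \<mu>))"
  unfolding char_def \<nu>_def
  by (subst integral_distr) (auto intro!: Bochner_Integration.integral_cong simp: exp_sum[symmetric] sum_distrib_left mult_ac)
 also have "... = (\<Prod>k<n. \<integral>x. iexp (c * t * x) \<partial>\<mu>)"
  by (rule P.product_integral_prod) (auto intro!: \<mu>.integrable_iexp)
 finally show "char \<nu> t = char \<mu> (c * t) ^ n" by (simp add: char_def)
qed

lemma real_distribution_density:
 assumes "distributed N lborel f C'" "real_distribution N"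
 shows "real_distribution (density lborel C')"
proof -
 interpret N: real_distribution N by fact
 have "density lborel C' = distr N lborel f" "f \<in> measurable N lborel" using assms(1) by (auto simp: distributed_def)
 moreover from this(2) have "prob_space (distr N lborel f)" by (rule N.prob_space_distr)
 ultimately have "prob_space (density lborel C')" by simp
 then show ?thesis by (intro real_distribution.intro real_distribution_axioms.intro) auto
qed

context walk_scenery begin

abbreviation \<phi> :: "real => complex" where
 "\<phi> \<equiv> char (distr M borel (\<xi> 0))"

text \<open>Where |\<phi> v| = 1, the variable exp (i * v * \<xi>) is almost surely constant, so the
  shift by v multiplies \<phi> by a number of modulus one.\<close>

lemma norm_char_\<xi>_periodic:
 assumes "cmod (\<phi> v) = 1"
 shows "cmod (\<phi> (u + v)) = cmod (\<phi> u)"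
proof -
 have "\<phi> (u + v) = (\<integral>\<omega>. iexp ((u + v) * \<xi> 0 \<omega>) \<partial>M)"
  unfolding char_def by (subst integral_distr) auto
 also have "... = (\<integral>\<omega>. iexp (u * \<xi> 0 \<omega>) * \<phi> v \<partial>M)"
 proof (rule integral_cong_AE)
  show "AE \<omega> in M. iexp ((u + v) * \<xi> 0 \<omega>) = iexp (u * \<xi> 0 \<omega>) * \<phi> v"
   using char_modulus_one_imp[OF assms]
  proof eventually_elim
   case (elim \<omega>)
   show ?case unfolding elim[symmetric] by (simp add: exp_add[symmetric] algebra_simps)
  qed
 qed measurable
 also have "... = \<phi> u * \<phi> v"
  unfolding char_def by (subst integral_distr) auto
 finally show ?thesis using assms by (simp add: norm_mult)
qed

lemma char_\<xi>_minus: "\<phi> (- u) = cnj (\<phi> u)"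
proof -
 have "cnj (\<phi> u) = (\<integral>x. cnj (iexp (u * x)) \<partial>distr M borel (\<xi> 0))"
  unfolding char_def by (rule Bochner_Integration.integral_cnj[symmetric])
 also have "... = \<phi> (- u)"
  unfolding char_def by (intro Bochner_Integration.integral_cong) (simp_all add: exp_cnj)
 finally show ?thesis ..
qed

lemma real_distribution_\<xi>: "real_distribution (distr M borel (\<xi> 0))"
 by (rule real_distribution_distr) simp

text \<open>Both kinds of walk give the Green constant lam = 1 / (pi * A), so that Gamma (\<beta> +
  1) * lam powr (\<beta> - 1) is the \<kappa> of the statement. The half period pi / d comes from
  the description of the points where |\<phi>| = 1.\<close>

lemma ex_local_limit_walk:
 assumes walk: "planar_walk_assumption M X A \<or> cauchy_walk_assumption M X A"
  and gen: "\<beta> \<noteq> 1 ==> generates_lattice M (X 1)"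
  and stable: "strictly_stable_law \<beta> A1 A2 N"
  and nda: "normal_domain_of_attraction \<beta> (distr M borel (\<xi> 0)) N"
  and d: "d \<ge> 1" and lat: "{u. cmod (\<phi> u) = 1} = range (%k::int. 2 * pi / real d * of_int k)"
 shows "\<exists>C0 c K a b. local_limit_walk step C0 \<phi> \<beta> A1 A2 (Gamma (\<beta> + 1) / (pi * A) powr (\<beta> - 1)) (pi / real d) c K a b"
proof -
 have \<beta>: "0 < \<beta>" "\<beta> <= 2" and A1: "A1 > 0" and N: "real_distribution N"
  and cN: "\<And>u. char N u = exp (- psi \<beta> A1 A2 u)"
  using stable unfolding strictly_stable_law_def psi_def by auto
 define \<nu> where "\<nu> n = distr (\<Pi>\<^sub>M k\<in>{..<n}. distr M borel (\<xi> 0)) borel (%x. real n powr (- 1 / \<beta>) * (\<Sum>k<n. x k))" for n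
 have log: "\<exists>\<delta>>0. \<forall>u. \<bar>u\<bar> < \<delta> --> (\<exists>z. \<phi> u = exp z \<and> cmod (z + psi \<beta> A1 A2 u) <= \<eta> * \<bar>u\<bar> powr \<beta>)" if "\<eta> > 0" for \<eta>
 proof (rule log_char_asymp[where \<nu>=\<nu> and N=N])
  show "continuous_on UNIV \<phi>" by (rule continuous_char_\<xi>)
  show "\<phi> 0 = 1" using real_distribution.char_zero[OF real_distribution_\<xi>] .
  show "\<phi> (- u) = cnj (\<phi> u)" for u by (rule char_\<xi>_minus)
  show "real_distribution (\<nu> n)" for n unfolding \<nu>_def by (rule char_normalized_sum(1)[OF real_distribution_\<xi>])
  show "char (\<nu> n) t = \<phi> (real n powr (- 1 / \<beta>) * t) ^ n" for n t
   unfolding \<nu>_def by (rule char_normalized_sum(2)[OF real_distribution_\<xi>])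
  show "weak_conv_m \<nu> N" using nda unfolding normal_domain_of_attraction_def \<nu>_def .
 qed (use N cN \<beta> A1 that in auto)
 have one: "cmod (\<phi> u) = 1 \<longleftrightarrow> (\<exists>k::int. u = 2 * pi / real d * of_int k)" for u using lat by blast
 have per: "cmod (\<phi> (u + 2 * (pi / real d))) = cmod (\<phi> u)" for u
 proof -
  have "2 * (pi / real d) = 2 * pi / real d * of_int 1" by simp
  then have "cmod (\<phi> (2 * (pi / real d))) = 1" using one by blast
  then show ?thesis by (rule norm_char_\<xi>_periodic)
 qed
 obtain \<delta> where \<delta>: "\<delta> > 0" "\<And>u. \<bar>u\<bar> < \<delta> ==> \<exists>z. \<phi> u = exp z \<and> cmod (z + psi \<beta> A1 A2 u) <= A1 / 2 * \<bar>u\<bar> powr \<beta>"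
  using log[of "A1 / 2"] A1 by auto
 have only0: "u = 0" if u: "\<bar>u\<bar> <= pi / real d" "cmod (\<phi> u) = 1" for u
 proof -
  obtain k :: int where k: "u = 2 * pi / real d * of_int k" using u(2) one by blast
  have "2 * pi / real d * \<bar>of_int k\<bar> <= pi / real d" using u(1) d unfolding k by (simp add: abs_mult)
  then have "2 * \<bar>of_int k :: real\<bar> <= 1" using d by (simp add: field_simps)
  then have "k = 0" by linarith
  then show ?thesis using k by simp
 qed
 have dpos: "pi / real d > 0" using d by simp
 obtain c where c: "c > 0" "\<And>u. \<bar>u\<bar> <= pi / real d ==> cmod (\<phi> u) <= exp (- (c * \<bar>u\<bar> powr \<beta>))"
  using char_decay[OF continuous_char_\<xi> norm_char_\<xi>_le \<delta> dpos only0 \<beta>(1) A1] by blast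
 obtain q c' where cw: "char_walk step q c'" and c': "c' / (2 * pi) ^ CARD('d) = 1 / (pi * A)"
  using walk planar_char_walk cauchy_char_walk by blast
 interpret W: char_walk step q c' by (rule cw)
 have A: "A > 0"
 proof -
  have "1 / (pi * A) > 0" using W.c_pos unfolding c'[symmetric] by simp
  then show ?thesis by (simp add: zero_less_mult_iff)
 qed
 define \<kappa> where "\<kappa> = Gamma (\<beta> + 1) / (pi * A) powr (\<beta> - 1)"
 have \<kappa>: "\<kappa> > 0" unfolding \<kappa>_def using \<beta> A by (intro divide_pos_pos Gamma_real_pos) auto
 obtain a b where ab: "a \<noteq> b" "pmf step a > 0" "pmf step b > 0" using W.two_support_points by blast
 have lim: "(%n. wmean n step
    (%xs. \<bar>Vpow \<beta> xs / (nlog \<beta> n) - \<kappa>\<bar>)) ----> 0 \<and>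
   (\<exists>K. \<forall>\<^sub>F n in sequentially. wmean n step
    (%xs. (nlog \<beta> n / Vpow \<beta> xs) powr (2 / \<beta>)) <= K)"
 proof (cases "\<beta> = 1")
  case False
  interpret L: lattice_char_walk step q c' by (rule lattice_walk[OF cw gen[OF False]])
  have "Gamma (\<beta> + 1) * (c' / (2 * pi) ^ CARD('d)) powr (\<beta> - 1) = \<kappa>"
   unfolding c' \<kappa>_def using A by (simp add: powr_divide)
  then show ?thesis using L.Vpow_L1[OF \<beta>(1)] L.Vpow_inverse_moment[OF \<beta> False] by simp
 next
  case True
  \<comment> \<open>For \<beta> = 1 the power sum is the length of the path, so the normalised sum
    equals its limit Gamma 2 = 1 on every path.\<close>
  have \<kappa>1: "\<kappa> = 1" unfolding \<kappa>_def True using A Gamma_fact[of 1, where 'a=real] by simp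
  have V: "Vpow 1 xs / (real n * ln (real n) powr 0) = 1" "real n * ln (real n) powr 0 / Vpow 1 xs = 1"
   if "xs \<in> set_pmf (replicate_pmf n step)" "n \<ge> 2" for n xs
  proof -
   have v: "Vpow 1 xs = real n" using Vpow_1[of xs] length_replicate_pmf[OF that(1)] by simp
   show "Vpow 1 xs / (real n * ln (real n) powr 0) = 1" "real n * ln (real n) powr 0 / Vpow 1 xs = 1"
    unfolding v using that(2) by simp_all
  qed
  have "\<forall>\<^sub>F n in sequentially. 0 = wmean n step
    (%xs. \<bar>Vpow \<beta> xs / (nlog \<beta> n) - \<kappa>\<bar>)"
   using eventually_ge_at_top[of 2]
  proof eventually_elim
   case (elim n)
   have "wmean n step (%xs. \<bar>Vpow \<beta> xs / (nlog \<beta> n) - \<kappa>\<bar>)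
    = wmean n step (%xs. 0)"
    by (rule expectation_pmf_cong) (simp only: True \<kappa>1 V[OF _ elim] diff_self abs_zero)
   then show ?case by simp
  qed
  then have "(%n. wmean n step
    (%xs. \<bar>Vpow \<beta> xs / (nlog \<beta> n) - \<kappa>\<bar>)) ----> 0"
   by (rule Lim_transform_eventually[OF tendsto_const])
  moreover have "\<forall>\<^sub>F n in sequentially. wmean n step
    (%xs. (nlog \<beta> n / Vpow \<beta> xs) powr (2 / \<beta>)) <= 1"
   using eventually_ge_at_top[of 2]
  proof eventually_elim
   case (elim n)
   have "wmean n step (%xs. (nlog \<beta> n / Vpow \<beta> xs) powr (2 / \<beta>))
    = wmean n step (%xs. 1)"
    by (rule expectation_pmf_cong) (simp only: True V[OF _ elim] diff_self powr_one_eq_one)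
   then show ?case by simp
  qed
  ultimately show ?thesis by blast
 qed
 then obtain K where K: "\<forall>\<^sub>F n in sequentially. wmean n step
    (%xs. (nlog \<beta> n / Vpow \<beta> xs) powr (2 / \<beta>)) <= K" by blast
 have "local_limit_walk step (SOME C. \<forall>k\<ge>1. at0 step k <= C / real k) \<phi> \<beta> A1 A2 \<kappa> (pi / real d) c K a b"
 proof (intro local_limit_walk.intro local_limit_walk_axioms.intro)
  show "critical_walk step (SOME C. \<forall>k\<ge>1. at0 step k <= C / real k)" by (rule W.critical_walk_axioms)
  show "\<phi> 0 = 1" using real_distribution.char_zero[OF real_distribution_\<xi>] .
  show "\<exists>\<delta>>0. \<forall>u. \<bar>u\<bar> < \<delta> --> (\<exists>z. \<phi> u = exp z \<and> cmod (z + psi \<beta> A1 A2 u) <= \<eta> * \<bar>u\<bar> powr \<beta>)" if "\<eta> > 0" for \<eta>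
   by (rule log[OF that])
 qed (use \<beta> A1 \<kappa> dpos c ab lim K per continuous_char_\<xi> norm_char_\<xi>_le in \<open>simp_all\<close>)
 then show ?thesis unfolding \<kappa>_def by blast
qed

end

section \<open>The local limit theorem\<close>

context local_limit_walk begin

text \<open>Free of x, which is where uniformity comes from. The first integral compares the
  characteristic functions on the window; the second collects the limit outside the window and the
  effect of rounding b * x to an integer.\<close>

definition char_error :: "nat => real" where
 "char_error n = (\<integral>u. indicator {- (r * rwrs_scale q n)..r * rwrs_scale q n} u * dev n u \<partial>lborel) +
   (\<integral>u. ((1 - indicator {- (r * rwrs_scale q n)..r * rwrs_scale q n} u) + min 2 (\<bar>u\<bar> / rwrs_scale q n)) * cmod (limit_char u) \<partial>lborel)"

lemma limit_char_measurable [measurable]: "limit_char \<in> borel_measurable borel"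
 by (rule borel_measurable_continuous_onI[OF continuous_limit_char])

lemma integrable_limit_char: "integrable lborel limit_char"
proof (rule Bochner_Integration.integrable_bound)
 show "integrable lborel (%u::real. (1 + (2 / (q * (\<kappa> * A1))) powr (2 / q)) * inverse (1 + u\<^sup>2))"
  by (intro integrable_mult_right integrable_inverse_1_plus_square_lborel)
 show "limit_char \<in> borel_measurable lborel" by simp
 show "AE u in lborel. norm (limit_char u) <= norm ((1 + (2 / (q * (\<kappa> * A1))) powr (2 / q)) * inverse (1 + u\<^sup>2))"
 proof (rule AE_I2)
  fix u
  have "cmod (limit_char u) <= (1 + (2 / (q * (\<kappa> * A1))) powr (2 / q)) * inverse (1 + u\<^sup>2)"
   unfolding norm_limit_char using \<kappa> A1 q by (intro exp_powr_decay) auto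
  then show "norm (limit_char u) <= norm ((1 + (2 / (q * (\<kappa> * A1))) powr (2 / q)) * inverse (1 + u\<^sup>2))"
   by (simp only: real_norm_def)
 qed
qed

lemma inverse_scale_tendsto_0: "(%n. 1 / rwrs_scale q n) ----> 0"
proof -
 have up: "\<forall>\<^sub>F n in sequentially. 1 / rwrs_scale q n <= real n powr (1/4) / rwrs_scale q n"
  using eventually_ge_at_top[of 2]
 proof eventually_elim
  case (elim n)
  have "1 <= real n powr (1/4)" using elim by (intro ge_one_powr_ge_zero) auto
  then show ?case using rwrs_scale_pos[OF elim] by (intro divide_right_mono) auto
 qed
 have lo: "\<forall>\<^sub>F n in sequentially. 0 <= 1 / rwrs_scale q n"
  by (simp add: rwrs_scale_def)
 show ?thesis by (rule tendsto_sandwich[OF lo up tendsto_const quarter_power_over_scale])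
qed

lemma tail_weight_bounds:
 "0 <= (1 - indicator S u) + min 2 (\<bar>u\<bar> / rwrs_scale q n)" "(1 - indicator S u) + min 2 (\<bar>u\<bar> / rwrs_scale q n) <= (3 :: real)"
 by (auto simp: indicator_def rwrs_scale_def)

lemma tail_le: "norm (((1 - indicator S u) + min 2 (\<bar>u\<bar> / rwrs_scale q n)) * cmod z) <= 3 * cmod z"
proof -
 have "\<bar>(1 - indicator S u) + min 2 (\<bar>u\<bar> / rwrs_scale q n)\<bar> <= (3 :: real)"
  using tail_weight_bounds[of S u n] by linarith
 then show ?thesis unfolding real_norm_def abs_mult abs_norm_cancel by (rule mult_right_mono) simp
qed

lemma integrable_tail:
 "integrable lborel (%u. ((1 - indicator {- (r * rwrs_scale q n)..r * rwrs_scale q n} u) + min 2 (\<bar>u\<bar> / rwrs_scale q n)) * cmod (limit_char u))"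
proof (rule Bochner_Integration.integrable_bound)
 show "integrable lborel (%u. 3 * cmod (limit_char u))" using integrable_limit_char by simp
 show "AE u in lborel. norm (((1 - indicator {- (r * rwrs_scale q n)..r * rwrs_scale q n} u) + min 2 (\<bar>u\<bar> / rwrs_scale q n)) * cmod (limit_char u)) <= norm (3 * cmod (limit_char u))"
 proof (rule AE_I2)
  fix u
  show "norm (((1 - indicator {- (r * rwrs_scale q n)..r * rwrs_scale q n} u) + min 2 (\<bar>u\<bar> / rwrs_scale q n)) * cmod (limit_char u)) <= norm (3 * cmod (limit_char u))"
   by (rule order_trans[OF tail_le]) simp
 qed
qed measurable

lemma char_error_tendsto_0: "char_error ----> 0"
proof -
 let ?w = "%n u. (1 - indicator {- (r * rwrs_scale q n)..r * rwrs_scale q n} u) + min 2 (\<bar>u\<bar> / rwrs_scale q n) :: real"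
 have "(%n. \<integral>u. ?w n u * cmod (limit_char u) \<partial>lborel) ----> (\<integral>u. 0 \<partial>(lborel :: real measure))"
 proof (rule integral_dominated_convergence[where w="%u. 3 * cmod (limit_char u)"])
  show "integrable lborel (%u. 3 * cmod (limit_char u))" using integrable_limit_char by simp
  show "AE u in lborel. norm (?w n u * cmod (limit_char u)) <= 3 * cmod (limit_char u)" for n
   by (intro AE_I2 tail_le)
  show "AE u in lborel. (%n. ?w n u * cmod (limit_char u)) ----> 0"
  proof (rule AE_I2)
   fix u
   have l1: "(%n. \<bar>u\<bar> * (1 / rwrs_scale q n)) ----> 0" by (rule tendsto_mult_right_zero[OF inverse_scale_tendsto_0])
   have "\<forall>\<^sub>F n in sequentially. \<bar>u\<bar> * (1 / rwrs_scale q n) < min r 2"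
    by (rule order_tendstoD(2)[OF l1]) (use r in simp)
   then have "\<forall>\<^sub>F n in sequentially. \<bar>u\<bar> * (1 / rwrs_scale q n) * cmod (limit_char u) = ?w n u * cmod (limit_char u)"
    using eventually_ge_at_top[of 2]
   proof eventually_elim
    case (elim n)
    have "\<bar>u\<bar> / rwrs_scale q n < r" "\<bar>u\<bar> / rwrs_scale q n < 2" using elim(1) by simp_all
    moreover from this(1) have "\<bar>u\<bar> <= r * rwrs_scale q n" using rwrs_scale_pos[OF elim(2)] by (simp add: field_simps)
    ultimately show ?case by (simp add: indicator_def abs_le_iff)
   qed
   moreover have "(%n. \<bar>u\<bar> * (1 / rwrs_scale q n) * cmod (limit_char u)) ----> \<bar>u\<bar> * 0 * cmod (limit_char u)"
    by (intro tendsto_intros inverse_scale_tendsto_0)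
   ultimately show "(%n. ?w n u * cmod (limit_char u)) ----> 0"
    by (simp add: Lim_transform_eventually)
  qed
 qed auto
 then have "(%n. (\<integral>u. indicator {- (r * rwrs_scale q n)..r * rwrs_scale q n} u * dev n u \<partial>lborel) +
   (\<integral>u. ?w n u * cmod (limit_char u) \<partial>lborel)) ----> 0 + 0"
  by (intro tendsto_add dev_integral_tendsto_0) simp
 then show ?thesis unfolding char_error_def[abs_def] by simp
qed

lemma mean_charprod_measurable: "(%u. wmean n p (%xs. charprod xs (u / b'))) \<in> borel_measurable borel"
proof -
 have fin: "finite_measure (return borel (0::real))" by (rule prob_space.axioms(1)[OF prob_space_return]) simp
 have "(%u. wmean n p (%xs. charprod xs (u / b'))) \<in> borel_measurable (return borel (0::real))"
 proof (rule pmf_Fubini(2)[OF fin, where c=1])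
  fix xs
  have "continuous_on UNIV (%u. charprod xs (u / b'))"
   unfolding divide_inverse by (intro continuous_on_compose2[OF continuous_charprod] continuous_intros) auto
  then have "(%u. charprod xs (u / b')) \<in> borel_measurable borel" by (rule borel_measurable_continuous_onI)
  then show "(%u. charprod xs (u / b')) \<in> borel_measurable (return borel (0::real))" by (simp cong: measurable_cong_sets)
 qed (use norm_charprod_le in auto)
 then show ?thesis by (simp cong: measurable_cong_sets)
qed

text \<open>Inside the window the difference splits into the deviation of the mean product and the
  shift of the exponential from x to y, at most |u| / b; outside it only the limit remains.\<close>

lemma fourier_difference_le:
 assumes n: "n \<ge> 2" and yx: "\<bar>y - x\<bar> <= 1 / rwrs_scale q n"
 shows "cmod ((\<integral>u. indicator {- (r * rwrs_scale q n)..r * rwrs_scale q n} u *\<^sub>R (iexp (- (u * y)) *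
   wmean n p (%xs. charprod xs (u / rwrs_scale q n))) \<partial>lborel) -
  (\<integral>u. iexp (- (u * x)) * limit_char u \<partial>lborel)) <= char_error n"
proof -
 define B where "B = rwrs_scale q n"
 have B: "B > 0" unfolding B_def by (rule rwrs_scale_pos[OF n])
 define S where "S = {- (r * B)..r * B}"
 define m where "m u = wmean n p (%xs. charprod xs (u / B))" for u
 have [measurable]: "m \<in> borel_measurable borel" unfolding m_def[abs_def] by (rule mean_charprod_measurable)
 have [measurable]: "(%u. dev n u) \<in> borel_measurable borel" by (rule dev_measurable)
 have iS: "integrable lborel (indicator S :: real => real)"
  unfolding S_def by (intro integrable_real_indicator) (auto simp: emeasure_lborel_Icc_eq)
 have ich: "integrable (replicate_pmf n p) (%xs. charprod xs t)" for t
  by (rule integrable_pmf_bounded[where c=1]) (rule norm_charprod_le)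
 have md: "cmod (m u - limit_char u) <= dev n u" for u
 proof -
  have "m u - limit_char u = wmean n p (%xs. charprod xs (u / B) - limit_char u)"
   unfolding m_def by (subst Bochner_Integration.integral_diff) (use ich in auto)
  then show ?thesis unfolding B_def by (simp only:) (rule integral_norm_bound)
 qed
 have m1: "cmod (m u) <= 1" for u
 proof -
  have "cmod (m u) <= EE n (%xs. cmod (charprod xs (u / B)))" unfolding m_def by (rule integral_norm_bound)
  also have "... <= EE n (%_. 1)"
   by (rule expectation_pmf_mono) (use ich norm_charprod_le in auto)
  finally show ?thesis by simp
 qed
 have i1: "integrable lborel (%u. indicator S u *\<^sub>R (iexp (- (u * y)) * m u))"
 proof (rule Bochner_Integration.integrable_bound[OF iS])
  show "AE u in lborel. norm (indicator S u *\<^sub>R (iexp (- (u * y)) * m u)) <= norm (indicator S u :: real)"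
   using m1 by (intro AE_I2) (simp add: norm_mult indicator_def)
 qed (simp add: S_def)
 have i2: "integrable lborel (%u. iexp (- (u * x)) * limit_char u)"
 proof (rule Bochner_Integration.integrable_bound[OF integrable_limit_char])
  show "AE u in lborel. norm (iexp (- (u * x)) * limit_char u) <= norm (limit_char u)"
   by (intro AE_I2) (simp add: norm_mult)
 qed simp
 let ?w = "%u. (1 - indicator S u) + min 2 (\<bar>u\<bar> / B) :: real"
 have i3: "integrable lborel (%u. ?w u * cmod (limit_char u))" unfolding S_def B_def by (rule integrable_tail)
 have i4: "integrable lborel (%u. indicator S u * dev n u)"
 proof (rule Bochner_Integration.integrable_bound[where f="%u. indicator S u * 2"])
  show "AE u in lborel. norm (indicator S u * dev n u) <= norm (indicator S u * (2::real))"
  proof (rule AE_I2)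
   fix u
   have "dev n u <= EE n (%_. 2)" by (rule expectation_pmf_mono[OF integrable_charprod_diff]) (use charprod_diff_le_2 in auto)
   then show "norm (indicator S u * dev n u) <= norm (indicator S u * (2::real))"
    using dev_nonneg[of n u] by (simp add: indicator_def)
  qed
 qed (use iS in \<open>auto simp: S_def\<close>)
 have pt: "cmod (indicator S u *\<^sub>R (iexp (- (u * y)) * m u) - iexp (- (u * x)) * limit_char u) <= indicator S u * dev n u + ?w u * cmod (limit_char u)" for u
 proof (cases "u \<in> S")
  case True
  have "\<bar>- (u * y) - - (u * x)\<bar> = \<bar>u\<bar> * \<bar>y - x\<bar>"
   by (simp add: abs_mult[symmetric] right_diff_distrib abs_minus_commute)
  also have "... <= \<bar>u\<bar> * (1 / B)" using yx unfolding B_def by (intro mult_left_mono) auto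
  finally have "min 2 \<bar>- (u * y) - - (u * x)\<bar> <= min 2 (\<bar>u\<bar> / B)" by simp
  then have e: "cmod (iexp (- (u * y)) - iexp (- (u * x))) <= min 2 (\<bar>u\<bar> / B)"
   using norm_iexp_diff_le[of "- (u * y)" "- (u * x)"] by linarith
  have "iexp (- (u * y)) * m u - iexp (- (u * x)) * limit_char u =
   iexp (- (u * y)) * (m u - limit_char u) + (iexp (- (u * y)) - iexp (- (u * x))) * limit_char u"
   by (simp add: algebra_simps)
  also have "cmod ... <= cmod (iexp (- (u * y)) * (m u - limit_char u)) + cmod ((iexp (- (u * y)) - iexp (- (u * x))) * limit_char u)"
   by (rule norm_triangle_ineq)
  also have "... = cmod (m u - limit_char u) + cmod (iexp (- (u * y)) - iexp (- (u * x))) * cmod (limit_char u)"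
   by (simp only: norm_mult norm_exp_i_times mult_1)
  also have "... <= dev n u + min 2 (\<bar>u\<bar> / B) * cmod (limit_char u)"
   by (intro add_mono md mult_right_mono e) simp
  finally show ?thesis using True by simp
 next
  case False
  have "cmod (limit_char u) <= (1 + min 2 (\<bar>u\<bar> / B)) * cmod (limit_char u)" using B by (simp add: distrib_right)
  then show ?thesis using False by (simp add: norm_mult)
 qed
 have "cmod ((\<integral>u. indicator S u *\<^sub>R (iexp (- (u * y)) * m u) \<partial>lborel) - (\<integral>u. iexp (- (u * x)) * limit_char u \<partial>lborel)) =
  cmod (\<integral>u. indicator S u *\<^sub>R (iexp (- (u * y)) * m u) - iexp (- (u * x)) * limit_char u \<partial>lborel)"
  using i1 i2 by (subst Bochner_Integration.integral_diff) auto
 also have "... <= (\<integral>u. cmod (indicator S u *\<^sub>R (iexp (- (u * y)) * m u) - iexp (- (u * x)) * limit_char u) \<partial>lborel)"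
  by (rule integral_norm_bound)
 also have "... <= (\<integral>u. indicator S u * dev n u + ?w u * cmod (limit_char u) \<partial>lborel)"
  by (rule integral_mono[OF integrable_norm[OF Bochner_Integration.integrable_diff[OF i1 i2]] Bochner_Integration.integrable_add[OF i4 i3] pt])
 also have "... = char_error n"
  unfolding char_error_def S_def B_def by (rule Bochner_Integration.integral_add[OF i4[unfolded S_def B_def] i3[unfolded S_def B_def]])
 finally show ?thesis unfolding S_def m_def B_def .
qed

text \<open>By homogeneity, multiplying a variable of law N by \<kappa> powr (1 / q) yields the
  characteristic function exp (- \<kappa> * \<psi>), which is \<open>limit_char\<close> and is
  integrable.\<close>

lemma density_fourier:
 fixes C :: "real => real"
 assumes N: "real_distribution N" "\<And>u. char N u = exp (- psi q A1 A2 u)"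
  and C: "continuous_on UNIV C" "\<And>x. 0 <= C x"
  and dist: "distributed N lborel (%y. \<kappa> powr (1 / q) * y) (%x. ennreal (C x))"
 shows "complex_of_real (C x) = (\<integral>u. iexp (- (u * x)) * limit_char u \<partial>lborel) / (2 * pi)"
proof -
 interpret N: real_distribution N by fact
 define s where "s = \<kappa> powr (1 / q)"
 have s: "s > 0" "s powr q = \<kappa>" using \<kappa> q by (auto simp: s_def powr_powr)
 define \<mu> where "\<mu> = density lborel (%x. ennreal (C x))"
 have \<mu>d: "\<mu> = distr N lborel (%y. s * y)" using dist unfolding \<mu>_def s_def by (simp add: distributed_def)
 have ch: "char \<mu> = limit_char"
 proof
  fix t
  have "char \<mu> t = (\<integral>y. iexp (t * (s * y)) \<partial>N)" unfolding char_def \<mu>d by (subst integral_distr) auto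
  also have "... = char N (t * s)" by (simp add: char_def mult_ac)
  also have "... = limit_char t" unfolding N(2) limit_char_def using s by (subst psi_scale) auto
  finally show "char \<mu> t = limit_char t" .
 qed
 have rd: "real_distribution \<mu>" unfolding \<mu>_def by (rule real_distribution_density[OF dist N(1)])
 show ?thesis
  using char_inversion_density[OF \<mu>_def rd C, of x] integrable_limit_char unfolding ch by simp
qed

end

context walk_scenery begin

text \<open>Substitution t = d * u / B in the inversion formula. The period becomes the window of
  half-length pi / d * B, and the Jacobian d / B is the source of the factor d0 in the
  theorem.\<close>

lemma scaled_inversion:
 assumes off: "AE \<omega> in M. \<forall>y. \<xi> y \<omega> - of_int r \<in> multiples d" and d: "d \<ge> 1"
  and j: "of_int (int n * r - j) \<in> multiples d" and B: "B > 0"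
 shows "complex_of_real (B * prob {\<omega> \<in> space M. rwrs X \<xi> n \<omega> = of_int j}) = real d / (2 * pi) *
  (\<integral>u. indicator {- (pi / real d * B)..pi / real d * B} u *\<^sub>R (iexp (- (u * (of_int j / B))) *
    wmean n step (%xs. Cprod xs (u / B))) \<partial>lborel)"
proof -
 define f where "f t = indicator {-pi..pi} t *\<^sub>R (iexp (- (t * of_int j / real d)) *
    wmean n step (%xs. Cprod xs (t / real d)))" for t
 have dB: "real d / B > 0" using d B by simp
 have "(\<integral>t. f t \<partial>lborel) = \<bar>real d / B\<bar> *\<^sub>R (\<integral>u. f (0 + real d / B * u) \<partial>lborel)"
  by (rule lborel_integral_real_affine) (use d B in auto)
 also have "(%u. f (0 + real d / B * u)) = (%u. indicator {- (pi / real d * B)..pi / real d * B} u *\<^sub>R (iexp (- (u * (of_int j / B))) *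
    wmean n step (%xs. Cprod xs (u / B))))"
 proof
  fix u
  have "(0 + real d / B * u \<in> {-pi..pi}) = (u \<in> {- (pi / real d * B)..pi / real d * B})"
   using d B by (auto simp: field_simps)
  then have i: "(indicator {-pi..pi} (0 + real d / B * u) :: real) = indicator {- (pi / real d * B)..pi / real d * B} u"
   by (simp add: indicator_def)
  have a: "(0 + real d / B * u) * of_int j / real d = u * (of_int j / B)" "(0 + real d / B * u) / real d = u / B"
   using d B by (auto simp: field_simps)
  show "f (0 + real d / B * u) = indicator {- (pi / real d * B)..pi / real d * B} u *\<^sub>R (iexp (- (u * (of_int j / B))) *
    wmean n step (%xs. Cprod xs (u / B)))"
   unfolding f_def i a ..
 qed
 finally show ?thesis
  using rwrs_inversion[OF off d j] B dB unfolding f_def[symmetric]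
  by (simp add: scaleR_conv_of_real field_simps)
qed

text \<open>The scaled probability and d times the density are Fourier integrals with the same
  prefactor d / (2 * pi), so they differ by at most that prefactor times \<open>char_error\<close>,
  for all admissible x at once.\<close>

lemma local_limit_uniform:
 fixes C :: "real => real"
 assumes loc: "local_limit_walk step C0 \<phi> q A1 A2 \<kappa> (pi / real d) c K a b"
  and N: "real_distribution N" "\<And>u. char N u = exp (- psi q A1 A2 u)"
  and C: "continuous_on UNIV C" "\<And>x. 0 <= C x"
  and dist: "distributed N lborel (%y. \<kappa> powr (1 / q) * y) (%x. ennreal (C x))"
  and off: "AE \<omega> in M. \<forall>y. \<xi> y \<omega> - of_int r \<in> multiples d" and d: "d \<ge> 1" and \<epsilon>: "\<epsilon> > 0"
 shows "\<exists>n0\<ge>2. \<forall>n\<ge>n0. \<forall>x. of_int (int n * r - \<lfloor>rwrs_scale q n * x\<rfloor>) \<in> multiples d -->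
  \<bar>prob {\<omega> \<in> space M. rwrs X \<xi> n \<omega> = of_int \<lfloor>rwrs_scale q n * x\<rfloor>} - real d * (C x / rwrs_scale q n)\<bar> <= \<epsilon> / rwrs_scale q n"
proof -
 interpret L: local_limit_walk step C0 \<phi> q A1 A2 \<kappa> "pi / real d" c K a b by fact
 have Cp: "Cprod xs t = L.charprod xs t" for xs t by (simp add: Cprod_def L.charprod_def)
 have "\<forall>\<^sub>F n in sequentially. real d / (2 * pi) * L.char_error n < \<epsilon>"
  by (rule order_tendstoD(2)[OF tendsto_mult_right_zero[OF L.char_error_tendsto_0] \<epsilon>])
 then obtain n0 where n0: "\<And>n. n \<ge> n0 ==> real d / (2 * pi) * L.char_error n < \<epsilon>"
  by (auto simp: eventually_sequentially)
 show ?thesis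
 proof (intro exI[of _ "max 2 n0"] conjI allI impI)
  fix n x assume n: "max 2 n0 <= n" and j: "of_int (int n * r - \<lfloor>rwrs_scale q n * x\<rfloor>) \<in> multiples d"
  define B where "B = rwrs_scale q n"
  have n2: "n \<ge> 2" using n by simp
  have B: "B > 0" unfolding B_def by (rule L.rwrs_scale_pos[OF n2])
  define J where "J = \<lfloor>B * x\<rfloor>"
  define P where "P = prob {\<omega> \<in> space M. rwrs X \<xi> n \<omega> = of_int J}"
  have "\<bar>of_int J - B * x\<bar> <= 1" unfolding J_def by linarith
  moreover have "\<bar>of_int J / B - x\<bar> = \<bar>of_int J - B * x\<bar> / B"
  proof -
   have "of_int J / B - x = (of_int J - B * x) / B" using B by (simp add: field_simps)
   then show ?thesis using B by simp
  qed
  ultimately have yx: "\<bar>of_int J / B - x\<bar> <= 1 / B" using B by (simp add: divide_right_mono)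
  let ?I = "\<integral>u. indicator {- (pi / real d * B)..pi / real d * B} u *\<^sub>R (iexp (- (u * (of_int J / B))) *
    wmean n step (%xs. L.charprod xs (u / B))) \<partial>lborel"
  let ?F = "\<integral>u. iexp (- (u * x)) * L.limit_char u \<partial>lborel"
  have "complex_of_real (B * P) = real d / (2 * pi) * ?I"
   using scaled_inversion[OF off d _ B, of n J] j unfolding P_def J_def B_def Cp by simp
  moreover have "complex_of_real (real d * C x) = real d / (2 * pi) * ?F"
   using L.density_fourier[OF N C dist, of x] by simp
  ultimately have "complex_of_real (B * P - real d * C x) = of_real (real d / (2 * pi)) * (?I - ?F)"
   by (simp add: right_diff_distrib)
  then have "cmod (complex_of_real (B * P - real d * C x)) = real d / (2 * pi) * cmod (?I - ?F)"
   by (simp only: norm_mult norm_of_real) simp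
  then have "\<bar>B * P - real d * C x\<bar> = real d / (2 * pi) * cmod (?I - ?F)" by (simp only: norm_of_real)
  also have "... <= real d / (2 * pi) * L.char_error n"
   using L.fourier_difference_le[OF n2 yx[unfolded B_def]] unfolding B_def by (intro mult_left_mono) auto
  also have "... <= \<epsilon>" using n0[of n] n by simp
  finally have "\<bar>B * P - real d * C x\<bar> / B <= \<epsilon> / B" using B by (intro divide_right_mono) auto
  moreover have "\<bar>P - real d * (C x / B)\<bar> = \<bar>B * P - real d * C x\<bar> / B"
  proof -
   have "P - real d * (C x / B) = (B * P - real d * C x) / B" using B by (simp add: field_simps)
   then show ?thesis using B by simp
  qed
  ultimately show "\<bar>prob {\<omega> \<in> space M. rwrs X \<xi> n \<omega> = of_int \<lfloor>rwrs_scale q n * x\<rfloor>} - real d * (C x / rwrs_scale q n)\<bar> <= \<epsilon> / rwrs_scale q n"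
   unfolding P_def J_def B_def by simp
 qed simp
qed

text \<open>A scenery value x is r modulo d, so n * x and n * r are congruent: the random condition
  of the theorem amounts to a deterministic one on j.\<close>

lemma multiples_shift:
 assumes "x - of_int r \<in> multiples d"
 shows "real n * x - of_int j \<in> multiples d \<longleftrightarrow> of_int (int n * r - j) \<in> multiples d"
proof -
 obtain k :: int where "x - of_int r = real d * of_int k" using assms unfolding multiples_def by blast
 then have k: "x = of_int r + real d * of_int k" by simp
 have e: "real n * x - of_int j = of_int (int n * r - j) + real d * of_int (int n * k)" unfolding k by (simp add: algebra_simps)
 show ?thesis
 proof
  assume "real n * x - of_int j \<in> multiples d"
  then obtain l :: int where "real n * x - of_int j = real d * of_int l" unfolding multiples_def by blast
  then have "of_int (int n * r - j) = real d * of_int (l - int n * k)" using e by (simp add: algebra_simps)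
  then show "of_int (int n * r - j) \<in> multiples d" unfolding multiples_def by blast
 next
  assume "of_int (int n * r - j) \<in> multiples d"
  then obtain l :: int where "of_int (int n * r - j) = real d * of_int l" unfolding multiples_def by blast
  then have "real n * x - of_int j = real d * of_int (l + int n * k)" unfolding e by (simp add: algebra_simps)
  then show "real n * x - of_int j \<in> multiples d" unfolding multiples_def by blast
 qed
qed

lemma prob_multiples_1_imp:
 assumes off: "AE \<omega> in M. \<forall>y. \<xi> y \<omega> - of_int r \<in> multiples d"
 shows "prob {\<omega> \<in> space M. real n * \<xi> 0 \<omega> - of_int j \<in> multiples d} = 1 ==> of_int (int n * r - j) \<in> multiples d"
  and "prob {\<omega> \<in> space M. real n * \<xi> 0 \<omega> - of_int j \<notin> multiples d} = 1 ==> of_int (int n * r - j) \<notin> multiples d"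
proof -
 have [measurable]: "multiples d \<in> sets borel"
  by (rule sets.countable[rotated]) (simp_all add: multiples_def)
 have iff: "AE \<omega> in M. real n * \<xi> 0 \<omega> - of_int j \<in> multiples d \<longleftrightarrow> of_int (int n * r - j) \<in> multiples d"
  using off by eventually_elim (rule multiples_shift, blast)
 have ex: "Q" if "AE \<omega> in M. Q" for Q using that by simp
 show "of_int (int n * r - j) \<in> multiples d" if "prob {\<omega> \<in> space M. real n * \<xi> 0 \<omega> - of_int j \<in> multiples d} = 1"
 proof -
  have "AE \<omega> in M. real n * \<xi> 0 \<omega> - of_int j \<in> multiples d" using that
   by (subst (asm) prob_Collect_eq_1) auto
  from this iff have "AE \<omega> in M. of_int (int n * r - j) \<in> multiples d"
   by eventually_elim blast
  then show ?thesis by (rule ex)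
 qed
 show "of_int (int n * r - j) \<notin> multiples d" if "prob {\<omega> \<in> space M. real n * \<xi> 0 \<omega> - of_int j \<notin> multiples d} = 1"
 proof -
  have "AE \<omega> in M. real n * \<xi> 0 \<omega> - of_int j \<notin> multiples d" using that
   by (subst (asm) prob_Collect_eq_1) auto
  from this iff have "AE \<omega> in M. of_int (int n * r - j) \<notin> multiples d"
   by eventually_elim blast
  then show ?thesis by (rule ex)
 qed
qed

end

theorem theorem2:
  fixes M :: "'w measure"
    and X :: "nat \<Rightarrow> 'w \<Rightarrow> int ^ 'd"
    and \<xi> :: "int ^ 'd \<Rightarrow> 'w \<Rightarrow> real"
    and A \<beta> A1 A2 :: real
    and N :: "real measure"
    and d0 :: nat
    and C :: "real \<Rightarrow> real"
  assumes "walk_and_scenery M X \<xi>"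
    and "planar_walk_assumption M X A \<or> cauchy_walk_assumption M X A"
    and "\<beta> \<noteq> 1 \<Longrightarrow> generates_lattice M (X 1)"
    and "strictly_stable_law \<beta> A1 A2 N"
    and "normal_domain_of_attraction \<beta> (distr M borel (\<xi> 0)) N"
    and "\<beta> = 1 \<Longrightarrow> bounded_truncated_means M (\<xi> 0)"
    and "AE \<omega> in M. \<xi> 0 \<omega> \<in> \<int>"
    and "d0 \<ge> 1"
    and "{u. cmod (char (distr M borel (\<xi> 0)) u) = 1} =
           range (\<lambda>k::int. 2 * pi / real d0 * of_int k)"
    and "continuous_on UNIV C" and "\<And>x. 0 \<le> C x"
    and "distributed N lborel
           (\<lambda>y. (Gamma (\<beta> + 1) / (pi * A) powr (\<beta> - 1)) powr (1 / \<beta>) * y)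
           (\<lambda>x. ennreal (C x))"
  shows "(\<forall>n\<ge>2. \<forall>x::real.
            \<P>(\<omega> in M. real n * \<xi> 0 \<omega> - of_int \<lfloor>rwrs_scale \<beta> n * x\<rfloor> \<notin> multiples d0) = 1 \<longrightarrow>
            \<P>(\<omega> in M. rwrs X \<xi> n \<omega> = of_int \<lfloor>rwrs_scale \<beta> n * x\<rfloor>) = 0) \<and>
         (\<forall>\<epsilon>>0. \<exists>n0\<ge>2. \<forall>n\<ge>n0. \<forall>x::real.
            \<P>(\<omega> in M. real n * \<xi> 0 \<omega> - of_int \<lfloor>rwrs_scale \<beta> n * x\<rfloor> \<in> multiples d0) = 1 \<longrightarrow>
            \<bar>\<P>(\<omega> in M. rwrs X \<xi> n \<omega> = of_int \<lfloor>rwrs_scale \<beta> n * x\<rfloor>)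
               - real d0 * (C x / (real n powr (1 / \<beta>) * ln (real n) powr ((\<beta> - 1) / \<beta>)))\<bar>
            \<le> \<epsilon> * (real n powr (- 1 / \<beta>) * ln (real n) powr (- (\<beta> - 1) / \<beta>)))"
proof -
 interpret prob_space M using assms(1) by (simp add: walk_and_scenery_def)
 interpret walk_scenery M X \<xi> by unfold_locales (rule assms(1))
 have "2 * pi / real d0 \<in> {u. cmod (\<phi> u) = 1}"
  unfolding assms(9) by (rule range_eqI[of _ _ 1]) simp
 then have one: "cmod (\<phi> (2 * pi / real d0)) = 1" by simp
 obtain r where off: "AE \<omega> in M. \<forall>y. \<xi> y \<omega> - of_int r \<in> multiples d0"
  using lattice_offset[OF assms(7,8) one] by blast
 have N: "real_distribution N" "\<And>u. char N u = exp (- psi \<beta> A1 A2 u)"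
  using assms(4) unfolding strictly_stable_law_def psi_def by auto
 obtain C0 c K a b where
  loc: "local_limit_walk step C0 \<phi> \<beta> A1 A2 (Gamma (\<beta> + 1) / (pi * A) powr (\<beta> - 1)) (pi / real d0) c K a b"
  using ex_local_limit_walk[OF assms(2-5,8,9)] by blast
 have inv: "e / rwrs_scale \<beta> n = e * (real n powr (- 1 / \<beta>) * ln (real n) powr (- (\<beta> - 1) / \<beta>))" for e n
 proof -
  have "- 1 / \<beta> = - (1 / \<beta>)" "- (\<beta> - 1) / \<beta> = - ((\<beta> - 1) / \<beta>)" by (simp_all only: minus_divide_left)
  then show ?thesis unfolding rwrs_scale_def by (simp only: powr_minus_divide times_divide_times_eq times_divide_eq_right mult_1_right divide_divide_eq_left)
 qed
 show ?thesis
 proof (intro conjI allI impI)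
  fix n :: nat and x :: real
  assume "\<P>(\<omega> in M. real n * \<xi> 0 \<omega> - of_int \<lfloor>rwrs_scale \<beta> n * x\<rfloor> \<notin> multiples d0) = 1"
  from prob_multiples_1_imp(2)[OF off this]
  show "\<P>(\<omega> in M. rwrs X \<xi> n \<omega> = of_int \<lfloor>rwrs_scale \<beta> n * x\<rfloor>) = 0" by (rule rwrs_zero[OF off])
 next
  fix \<epsilon> :: real assume "\<epsilon> > 0"
  from local_limit_uniform[OF loc N assms(10-12) off assms(8) this] obtain n0 where n0: "n0 \<ge> 2"
   "\<And>n x. n \<ge> n0 \<Longrightarrow> of_int (int n * r - \<lfloor>rwrs_scale \<beta> n * x\<rfloor>) \<in> multiples d0 \<Longrightarrow>
    \<bar>prob {\<omega> \<in> space M. rwrs X \<xi> n \<omega> = of_int \<lfloor>rwrs_scale \<beta> n * x\<rfloor>} - real d0 * (C x / rwrs_scale \<beta> n)\<bar> \<le> \<epsilon> / rwrs_scale \<beta> n"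
   by blast
  show "\<exists>n0\<ge>2. \<forall>n\<ge>n0. \<forall>x::real.
      \<P>(\<omega> in M. real n * \<xi> 0 \<omega> - of_int \<lfloor>rwrs_scale \<beta> n * x\<rfloor> \<in> multiples d0) = 1 \<longrightarrow>
      \<bar>\<P>(\<omega> in M. rwrs X \<xi> n \<omega> = of_int \<lfloor>rwrs_scale \<beta> n * x\<rfloor>)
        - real d0 * (C x / (real n powr (1 / \<beta>) * ln (real n) powr ((\<beta> - 1) / \<beta>)))\<bar>
      \<le> \<epsilon> * (real n powr (- 1 / \<beta>) * ln (real n) powr (- (\<beta> - 1) / \<beta>))"
  proof (intro exI[of _ n0] conjI allI impI)
   fix n x assume n: "n0 \<le> n" and "\<P>(\<omega> in M. real n * \<xi> 0 \<omega> - of_int \<lfloor>rwrs_scale \<beta> n * x\<rfloor> \<in> multiples d0) = 1"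
   from n0(2)[OF n prob_multiples_1_imp(1)[OF off this(2)]]
   show "\<bar>\<P>(\<omega> in M. rwrs X \<xi> n \<omega> = of_int \<lfloor>rwrs_scale \<beta> n * x\<rfloor>)
        - real d0 * (C x / (real n powr (1 / \<beta>) * ln (real n) powr ((\<beta> - 1) / \<beta>)))\<bar>
      \<le> \<epsilon> * (real n powr (- 1 / \<beta>) * ln (real n) powr (- (\<beta> - 1) / \<beta>))"
    unfolding inv[of \<epsilon> n, symmetric] rwrs_scale_def[symmetric] .
  qed (rule n0(1))
 qed
qed

end
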